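(* Let $\Omega\subset\mathbb R^n$ be a bounded domain, $n,N\ge 1$, $1<p<\infty$, and let $\mathbf F\colon W^{1,p}_0(\Omega;\mathbb R^N)\to \mathbb R\cup\{+\infty\}$ with $\mathbf F(0)<\infty$. Assume that $\mathbf F$ is coercive and lower semicontinuous on $W_0^{1,p}(\Omega;\mathbb R^N)$ and convex on $L^2(\Omega;\mathbb R^N)\cap W_0^{1,p}(\Omega;\mathbb R^N)$. Then for each $u_0\in\overline{D(\mathbf F)}$ there exists a unique function $u\in C^0([0,\infty);L^2(\Omega;\mathbb R^N))$ with $$u'\in L^{\infty}(\delta,\infty;L^2(\Omega;\mathbb R^N))\quad\text{for all }\delta>0$$ and $u(t)\in D(\mathcal F)$ for all $t>0$ that solves the Cauchy problem $$u'(t)\in-\mathcal F(u(t))\ \text{ for a.e. } t>0,\qquad u(0)=u_0.$$ Moreover, the solution $u$ satisfies the following properties: (i) $\mathbf F(u)\in L^1(0,T)$ for all $T>0$. (ii) $t\mapsto\mathbf F(u(t))$, $(0,\infty)\to\mathbb R$, is nonincreasing. (iii) $\|u'\|_{L^\infty(\delta,\infty;L^2(\Omega;\mathbb R^N))}\le\|A^0(u(\delta))\|_{L^2(\Omega)}$ for all $\delta>0$, where for each $w\in D(\mathcal F)$, $A^0(w)\in\mathcal F(w)$ is the unique minimizer of $\|z\|_{L^2(\Omega)}$ over the closed and convex subset $\mathcal F(w)$ of $L^2(\Omega;\mathbb R^N)$. (iv) $-u'(t)=A^0(u(t))$ for a.e. $t>0$. (v) If $u_0\in D(\mathbf F)$,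 then $u'\in L^2(0,T;L^2(\Omega;\mathbb R^N))$ and $\mathbf F(u)\in W^{1,1}(0,T)$ for all $T>0$. (vi) If $u_0\in D(\mathcal F)$, then $u'\in L^\infty(0,\infty;L^2(\Omega;\mathbb R^N))$.
   Context: Notation: $D(\mathbf F)=\{u\in L^2(\Omega;\mathbb R^N)\cap W_0^{1,p}(\Omega;\mathbb R^N):\mathbf F(u)<\infty\}$. For $u\in D(\mathbf F)$, the $L^2$-subdifferential set of $\mathbf F$ at $u$ is $$\mathcal F(u)=\{v\in L^2(\Omega;\mathbb R^N):\ \mathbf F(w)\ge\mathbf F(u)+(v,w-u)_{L^2}\ \ \forall\,w\in D(\mathbf F)\},$$ and $D(\mathcal F)=\{u\in D(\mathbf F):\mathcal F(u)\ne\emptyset\}$. The closure $\overline{S}$ of a set $S$ is taken in the Hilbert space $L^2(\Omega;\mathbb R^N)$. Coercive means $\mathbf F(u)\to\infty$ as $\|u\|_{W^{1,p}_0(\Omega;\mathbb R^N)}\to\infty$. Lower semicontinuity on $W_0^{1,p}$ is with respect to norm convergence. $u'$ is the (weak) time derivative of the $L^2(\Omega;\mathbb R^N)$-valued function $u$. *)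

theory Defs
  imports "HOL-Probability.Essential_Supremum"
begin

section \<open>The Hilbert space of square integrable functions\<close>

definition square_integrable :: "('a::euclidean_space \<Rightarrow> 'b::euclidean_space) \<Rightarrow> bool" where
  "square_integrable f \<longleftrightarrow>
     f \<in> borel_measurable lebesgue \<and> integrable lebesgue (\<lambda>x. (norm (f x))\<^sup>2)"

definition L2_rel :: "('a::euclidean_space \<Rightarrow> 'b::euclidean_space) \<Rightarrow> ('a \<Rightarrow> 'b) \<Rightarrow> bool" where
  "L2_rel f g \<longleftrightarrow>
     square_integrable f \<and> square_integrable g \<and> (AE x in lebesgue. f x = g x)"

lemma square_integrable_zero: "square_integrable (\<lambda>x. 0)"
  by (simp add: square_integrable_def)

lemma square_integrable_measurable [measurable_dest]:
  "square_integrable f \<Longrightarrow> f \<in> borel_measurable lebesgue"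
  by (simp add: square_integrable_def)

lemma square_integrable_add:
  assumes "square_integrable f" "square_integrable g"
  shows "square_integrable (\<lambda>x. f x + g x)"
proof -
  have [measurable]: "f \<in> borel_measurable lebesgue" "g \<in> borel_measurable lebesgue"
    using assms by (auto simp: square_integrable_def)
  have le: "(norm (f x + g x))\<^sup>2 \<le> 2 * (norm (f x))\<^sup>2 + 2 * (norm (g x))\<^sup>2" for x
  proof -
    have "(norm (f x + g x))\<^sup>2 \<le> (norm (f x) + norm (g x))\<^sup>2"
      by (intro power_mono norm_triangle_ineq) auto
    also have "\<dots> \<le> 2 * (norm (f x))\<^sup>2 + 2 * (norm (g x))\<^sup>2"
      using sum_squares_bound[of "norm (f x)" "norm (g x)"] by (simp add: power2_sum)
    finally show ?thesis .
  qed
  have "integrable lebesgue (\<lambda>x. 2 * (norm (f x))\<^sup>2 + 2 * (norm (g x))\<^sup>2)"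
    using assms by (auto simp: square_integrable_def)
  then have "integrable lebesgue (\<lambda>x. (norm (f x + g x))\<^sup>2)"
    by (rule Bochner_Integration.integrable_bound) (use le in \<open>auto intro!: AE_I2\<close>)
  then show ?thesis
    by (simp add: square_integrable_def)
qed

lemma square_integrable_scaleR:
  assumes "square_integrable f" shows "square_integrable (\<lambda>x. c *\<^sub>R f x)"
  using assms by (auto simp: square_integrable_def power_mult_distrib)

lemma integrable_inner_square_integrable:
  assumes "square_integrable f" "square_integrable g"
  shows "integrable lebesgue (\<lambda>x. f x \<bullet> g x)"
proof -
  have [measurable]: "f \<in> borel_measurable lebesgue" "g \<in> borel_measurable lebesgue"
    using assms by (auto simp: square_integrable_def)
  have le: "norm (f x \<bullet> g x) \<le> (norm (f x))\<^sup>2 + (norm (g x))\<^sup>2" for x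
  proof -
    have "norm (f x \<bullet> g x) \<le> norm (f x) * norm (g x)"
      by (simp add: Cauchy_Schwarz_ineq2)
    also have "\<dots> \<le> (norm (f x))\<^sup>2 + (norm (g x))\<^sup>2"
      using sum_squares_bound[of "norm (f x)" "norm (g x)"]
        mult_nonneg_nonneg[OF norm_ge_zero[of "f x"] norm_ge_zero[of "g x"]] by linarith
    finally show ?thesis .
  qed
  have "integrable lebesgue (\<lambda>x. (norm (f x))\<^sup>2 + (norm (g x))\<^sup>2)"
    using assms by (auto simp: square_integrable_def)
  then show ?thesis
    by (rule Bochner_Integration.integrable_bound) (use le in \<open>auto intro!: AE_I2\<close>)
qed

text \<open>
  Elements of \<open>('a, 'b) L2\<close> are the classes, modulo equality almost everywhere, of Lebesgue measurable
  square integrable functions on the whole of \<open>'a\<close>.  The class \<open>second_countable_topology\<close> is needed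
  in order to use the Bochner integral of the library for functions with values in \<open>L2\<close>.
\<close>

quotient_type (overloaded) ('a, 'b) L2 = "'a::euclidean_space \<Rightarrow> 'b::euclidean_space" / partial: L2_rel
proof (rule part_equivpI)
  show "\<exists>f. L2_rel f f"
    using square_integrable_zero by (auto simp: L2_rel_def)
  show "symp L2_rel"
    by (auto simp: symp_def L2_rel_def)
  show "transp L2_rel"
    by (auto simp: transp_def L2_rel_def)
qed

lemma square_integrable_rep [simp]: "square_integrable (rep_L2 u)"
  using Quotient3_rep_reflp[OF Quotient3_L2, of u] by (simp add: L2_rel_def)

lemma rep_L2_measurable [measurable]: "rep_L2 u \<in> borel_measurable lebesgue"
  using square_integrable_rep[of u] by (simp add: square_integrable_def)

lemma rep_abs_L2:
  assumes "square_integrable f" shows "AE x in lebesgue. rep_L2 (abs_L2 f) x = f x"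
  using Quotient3_rel_abs[OF Quotient3_L2] assms
    Quotient3_rep_abs[OF Quotient3_L2, of f] by (auto simp: L2_rel_def)

instantiation L2 :: (euclidean_space, euclidean_space) real_inner
begin

lift_definition zero_L2 :: "('a, 'b) L2" is "\<lambda>x. 0"
  by (simp add: L2_rel_def square_integrable_zero)

lift_definition plus_L2 :: "('a, 'b) L2 \<Rightarrow> ('a, 'b) L2 \<Rightarrow> ('a, 'b) L2" is "\<lambda>f g x. f x + g x"
  by (auto simp: L2_rel_def square_integrable_add)

lift_definition scaleR_L2 :: "real \<Rightarrow> ('a, 'b) L2 \<Rightarrow> ('a, 'b) L2" is "\<lambda>c f x. c *\<^sub>R f x"
  by (auto simp: L2_rel_def square_integrable_scaleR)

lift_definition uminus_L2 :: "('a, 'b) L2 \<Rightarrow> ('a, 'b) L2" is "\<lambda>f x. - f x"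
  by (auto simp: L2_rel_def square_integrable_def)

lift_definition minus_L2 :: "('a, 'b) L2 \<Rightarrow> ('a, 'b) L2 \<Rightarrow> ('a, 'b) L2" is "\<lambda>f g x. f x - g x"
proof -
  fix f f' g g' :: "'a \<Rightarrow> 'b"
  assume "L2_rel f f'" "L2_rel g g'"
  then show "L2_rel (\<lambda>x. f x - g x) (\<lambda>x. f' x - g' x)"
    using square_integrable_add[of f "\<lambda>x. - 1 *\<^sub>R g x"] square_integrable_add[of f' "\<lambda>x. - 1 *\<^sub>R g' x"]
      square_integrable_scaleR[of g "-1"] square_integrable_scaleR[of g' "-1"]
    by (auto simp: L2_rel_def)
qed

lift_definition inner_L2 :: "('a, 'b) L2 \<Rightarrow> ('a, 'b) L2 \<Rightarrow> real"
  is "\<lambda>f g. LINT x|lebesgue. f x \<bullet> g x"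
  by (intro integral_cong_AE) (auto simp: L2_rel_def square_integrable_def)

definition norm_L2 :: "('a, 'b) L2 \<Rightarrow> real" where "norm_L2 u = sqrt (u \<bullet> u)"
definition sgn_L2 :: "('a, 'b) L2 \<Rightarrow> ('a, 'b) L2" where "sgn_L2 u = scaleR (inverse (norm u)) u"
definition dist_L2 :: "('a, 'b) L2 \<Rightarrow> ('a, 'b) L2 \<Rightarrow> real" where "dist_L2 u v = norm (u - v)"
definition uniformity_L2 :: "(('a, 'b) L2 \<times> ('a, 'b) L2) filter" where
  "uniformity_L2 = (INF e\<in>{0<..}. principal {(u, v). dist u v < e})"
definition open_L2 :: "('a, 'b) L2 set \<Rightarrow> bool" where
  "open_L2 S = (\<forall>u\<in>S. \<forall>\<^sub>F (u', v) in uniformity. u' = u \<longrightarrow> v \<in> S)"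

instance
proof
  fix u v w :: "('a, 'b) L2" and c d :: real
  note sq = L2_rel_def square_integrable_add square_integrable_scaleR square_integrable_zero
  show "u + v + w = u + (v + w)" by transfer (auto simp: sq algebra_simps)
  show "u + v = v + u" by transfer (auto simp: sq algebra_simps)
  show "0 + u = u" by transfer (auto simp: sq)
  show "- u + u = 0" by transfer (auto simp: sq)
  show "u - v = u + - v"
    by transfer (auto simp: sq square_integrable_add[of _ "\<lambda>x. - 1 *\<^sub>R _ x", simplified]
        square_integrable_scaleR[of _ "-1", simplified])
  show "c *\<^sub>R (u + v) = c *\<^sub>R u + c *\<^sub>R v" by transfer (auto simp: sq algebra_simps)
  show "(c + d) *\<^sub>R u = c *\<^sub>R u + d *\<^sub>R u" by transfer (auto simp: sq algebra_simps)
  show "c *\<^sub>R d *\<^sub>R u = (c * d) *\<^sub>R u" by transfer (auto simp: sq)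
  show "1 *\<^sub>R u = u" by transfer (auto simp: sq)
  show "u \<bullet> v = v \<bullet> u" by transfer (simp add: inner_commute)
  show "(u + v) \<bullet> w = u \<bullet> w + v \<bullet> w"
    by transfer (simp add: inner_add_left L2_rel_def integrable_inner_square_integrable)
  show "(c *\<^sub>R u) \<bullet> v = c * (u \<bullet> v)" by transfer simp
  show "0 \<le> u \<bullet> u" by transfer simp
  show "u \<bullet> u = 0 \<longleftrightarrow> u = 0"
  proof transfer
    fix f :: "'a \<Rightarrow> 'b" assume f: "L2_rel f f"
    then have "integrable lebesgue (\<lambda>x. f x \<bullet> f x)"
      by (simp add: L2_rel_def integrable_inner_square_integrable)
    then have "(LINT x|lebesgue. f x \<bullet> f x) = 0 \<longleftrightarrow> (AE x in lebesgue. f x \<bullet> f x = 0)"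
      by (intro integral_nonneg_eq_0_iff_AE) auto
    then show "(LINT x|lebesgue. f x \<bullet> f x) = 0 \<longleftrightarrow> L2_rel f (\<lambda>x. 0)"
      using f by (simp add: sq)
  qed
  show "norm u = sqrt (u \<bullet> u)" by (rule norm_L2_def)
  show "sgn u = scaleR (inverse (norm u)) u" by (rule sgn_L2_def)
  show "dist u v = norm (u - v)" by (rule dist_L2_def)
  show "(uniformity :: (('a, 'b) L2 \<times> ('a, 'b) L2) filter) =
      (INF e\<in>{0<..}. principal {(u, v). dist u v < e})"
    by (rule uniformity_L2_def)
  fix S :: "('a, 'b) L2 set"
  show "open S = (\<forall>u\<in>S. \<forall>\<^sub>F (u', v) in uniformity. u' = u \<longrightarrow> v \<in> S)"
    by (rule open_L2_def)
qed

end

lemma inner_L2_rep: "u \<bullet> v = (LINT x|lebesgue. rep_L2 u x \<bullet> rep_L2 v x)"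
  by (simp add: inner_L2.rep_eq)

lemma norm_L2_rep: "(norm u)\<^sup>2 = (LINT x|lebesgue. (norm (rep_L2 u x))\<^sup>2)"
  by (simp add: power2_norm_eq_inner inner_L2_rep)

lemma abs_rep_L2 [simp]: "abs_L2 (rep_L2 u) = u"
  by (rule Quotient3_abs_rep[OF Quotient3_L2])

lemma abs_L2_eqI:
  "square_integrable f \<Longrightarrow> square_integrable g \<Longrightarrow> AE x in lebesgue. f x = g x \<Longrightarrow> abs_L2 f = abs_L2 g"
  using Quotient3_rel_abs[OF Quotient3_L2, of f g] by (auto simp: L2_rel_def)

lemma rep_diff_L2: "AE x in lebesgue. rep_L2 (u - v) x = rep_L2 u x - rep_L2 v x"
proof -
  have "u - v = abs_L2 (\<lambda>x. rep_L2 u x - rep_L2 v x)"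
    by (simp add: minus_L2_def)
  moreover have "square_integrable (\<lambda>x. rep_L2 u x - rep_L2 v x)"
    using square_integrable_add[of "rep_L2 u" "\<lambda>x. - 1 *\<^sub>R rep_L2 v x"]
      square_integrable_scaleR[of "rep_L2 v" "-1"] by simp
  ultimately show ?thesis
    using rep_abs_L2 by metis
qed

lemma nn_integral_diff_L2:
  "(\<integral>\<^sup>+x. ennreal ((norm (rep_L2 u x - rep_L2 v x))\<^sup>2) \<partial>lebesgue) = ennreal ((norm (u - v))\<^sup>2)"
proof -
  have "(\<integral>\<^sup>+x. ennreal ((norm (rep_L2 u x - rep_L2 v x))\<^sup>2) \<partial>lebesgue) =
      (\<integral>\<^sup>+x. ennreal ((norm (rep_L2 (u - v) x))\<^sup>2) \<partial>lebesgue)"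
    by (rule nn_integral_cong_AE) (use rep_diff_L2[of u v] in auto)
  also have "\<dots> = ennreal (LINT x|lebesgue. (norm (rep_L2 (u - v) x))\<^sup>2)"
    using square_integrable_rep[of "u - v"]
    by (intro nn_integral_eq_integral) (auto simp: square_integrable_def)
  finally show ?thesis
    by (simp add: norm_L2_rep)
qed

lemma summable_increments_convergent:
  fixes s :: "nat \<Rightarrow> 'b::euclidean_space"
  assumes "(\<Sum>k. ennreal (2^k * (norm (s (Suc k) - s k))\<^sup>2)) < \<infinity>"
  shows "convergent s"
proof -
  let ?d = "\<lambda>k. norm (s (Suc k) - s k)"
  have "summable (\<lambda>k. 2^k * (?d k)\<^sup>2)"
    using assms by (intro summable_suminf_not_top) auto
  then have "Bseq (\<lambda>k. 2^k * (?d k)\<^sup>2)"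
    by (intro convergent_imp_Bseq summable_LIMSEQ_zero[THEN convergentI])
  then obtain C where C: "0 < C" "\<And>k. norm (2^k * (?d k)\<^sup>2) \<le> C"
    by (auto simp: Bseq_def)
  have le: "norm (?d k) \<le> sqrt C * (1 / sqrt 2)^k" for k
  proof -
    have "sqrt (2^k) * ?d k = sqrt (2^k * (?d k)\<^sup>2)"
      by (simp add: real_sqrt_mult)
    also have "\<dots> \<le> sqrt C"
      using C(2)[of k] by simp
    finally show ?thesis
      by (simp add: power_divide field_simps real_sqrt_power)
  qed
  have "summable (\<lambda>k. sqrt C * (1 / sqrt 2)^k)"
    by (intro summable_mult summable_geometric) simp
  then have "summable (\<lambda>k. s (Suc k) - s k)"
    by (rule summable_norm_cancel[OF summable_comparison_test'])
       (use le in auto)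
  then have "convergent (\<lambda>n. \<Sum>k<n. s (Suc k) - s k)"
    by (simp add: summable_iff_convergent)
  then have "convergent (\<lambda>n. s n - s 0)"
    by (simp add: sum_lessThan_telescope)
  then have "convergent (\<lambda>n. (s n - s 0) + s 0)"
    by (intro convergent_add convergent_const)
  then show ?thesis by simp
qed

instance L2 :: (euclidean_space, euclidean_space) complete_space
proof
  fix X :: "nat \<Rightarrow> ('a, 'b) L2" assume "Cauchy X"
  then have "\<forall>k. \<exists>M. \<forall>m\<ge>M. \<forall>n\<ge>M. norm (X m - X n) < (1/2)^k"
    by (auto simp: Cauchy_iff)
  then obtain N where N: "\<And>k m n. m \<ge> N k \<Longrightarrow> n \<ge> N k \<Longrightarrow> norm (X m - X n) < (1/2)^k"
    by metis
  have N2: "(norm (X m - X n))\<^sup>2 \<le> (1/4)^k" if "m \<ge> N k" "n \<ge> N k" for k m n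
  proof -
    have "(norm (X m - X n))\<^sup>2 \<le> ((1/2)^k)\<^sup>2"
      using N[OF that] by (intro power_mono) auto
    also have "\<dots> = (1/4)^k"
      by (simp add: power_mult[symmetric] mult.commute[of k 2]) (simp add: power_mult power2_eq_square)
    finally show ?thesis .
  qed
  define r where "r k = (\<Sum>i\<le>k. N i)" for k
  have rN: "N k \<le> r j" if "k \<le> j" for k j
    unfolding r_def using that by (intro member_le_sum) auto
  define f where "f k = rep_L2 (X (r k))" for k
  have [measurable]: "f k \<in> borel_measurable lebesgue" for k
    by (simp add: f_def)
  define g where "g x = lim (\<lambda>k. f k x)" for x
  have [measurable]: "g \<in> borel_measurable lebesgue"
    unfolding g_def by (intro borel_measurable_lim_metric) auto
  have "(\<integral>\<^sup>+x. (\<Sum>k. ennreal (2^k * (norm (f (Suc k) x - f k x))\<^sup>2)) \<partial>lebesgue) =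
      (\<Sum>k. \<integral>\<^sup>+x. ennreal (2^k * (norm (f (Suc k) x - f k x))\<^sup>2) \<partial>lebesgue)"
    by (intro nn_integral_suminf) auto
  also have "\<dots> = (\<Sum>k. ennreal (2^k) * ennreal ((norm (X (r (Suc k)) - X (r k)))\<^sup>2))"
    by (simp add: ennreal_mult nn_integral_cmult nn_integral_diff_L2[symmetric] f_def)
  also have "\<dots> \<le> (\<Sum>k. ennreal ((1/2)^k))"
  proof (intro suminf_le)
    fix k
    have "(2::real)^k * (norm (X (r (Suc k)) - X (r k)))\<^sup>2 \<le> 2^k * (1/4)^k"
      by (intro mult_left_mono N2 rN) auto
    also have "\<dots> = (1/2)^k"
      by (simp add: power_mult_distrib[symmetric])
    finally show "ennreal (2^k) * ennreal ((norm (X (r (Suc k)) - X (r k)))\<^sup>2) \<le> ennreal ((1/2)^k)"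
      by (simp add: ennreal_mult[symmetric] ennreal_leI)
  qed auto
  also have "\<dots> = ennreal (\<Sum>k. (1/2)^k)"
    by (intro suminf_ennreal2) auto
  also have "\<dots> < \<infinity>" by simp
  finally have "(\<integral>\<^sup>+x. (\<Sum>k. ennreal (2^k * (norm (f (Suc k) x - f k x))\<^sup>2)) \<partial>lebesgue) \<noteq> \<infinity>"
    by simp
  then have "AE x in lebesgue. (\<Sum>k. ennreal (2^k * (norm (f (Suc k) x - f k x))\<^sup>2)) \<noteq> \<infinity>"
    by (intro nn_integral_PInf_AE) auto
  then have lim: "AE x in lebesgue. (\<lambda>k. f k x) \<longlonglongrightarrow> g x"
  proof eventually_elim
    case (elim x)
    then have "convergent (\<lambda>k. f k x)"
      by (intro summable_increments_convergent) (simp add: less_top)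
    then show ?case
      by (simp add: g_def convergent_LIMSEQ_iff)
  qed
  have bound: "(\<integral>\<^sup>+x. ennreal ((norm (g x - rep_L2 (X n) x))\<^sup>2) \<partial>lebesgue) \<le> ennreal ((1/4)^k)"
    if n: "n \<ge> N k" for n k
  proof -
    have "(\<integral>\<^sup>+x. ennreal ((norm (g x - rep_L2 (X n) x))\<^sup>2) \<partial>lebesgue) =
        (\<integral>\<^sup>+x. liminf (\<lambda>j. ennreal ((norm (f j x - rep_L2 (X n) x))\<^sup>2)) \<partial>lebesgue)"
    proof (intro nn_integral_cong_AE)
      show "AE x in lebesgue. ennreal ((norm (g x - rep_L2 (X n) x))\<^sup>2) =
          liminf (\<lambda>j. ennreal ((norm (f j x - rep_L2 (X n) x))\<^sup>2))"
        using lim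
      proof eventually_elim
        case (elim x)
        then have "(\<lambda>j. ennreal ((norm (f j x - rep_L2 (X n) x))\<^sup>2)) \<longlonglongrightarrow>
            ennreal ((norm (g x - rep_L2 (X n) x))\<^sup>2)"
          by (intro tendsto_intros)
        then show ?case
          by (intro lim_imp_Liminf[symmetric]) simp
      qed
    qed
    also have "\<dots> \<le> liminf (\<lambda>j. \<integral>\<^sup>+x. ennreal ((norm (f j x - rep_L2 (X n) x))\<^sup>2) \<partial>lebesgue)"
      by (intro nn_integral_liminf) auto
    also have "\<dots> \<le> ennreal ((1/4)^k)"
    proof (rule Liminf_le)
      show "\<forall>\<^sub>F j in sequentially. (\<integral>\<^sup>+x. ennreal ((norm (f j x - rep_L2 (X n) x))\<^sup>2) \<partial>lebesgue)
          \<le> ennreal ((1/4)^k)"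
        using eventually_ge_at_top[of k]
        by eventually_elim (simp add: f_def nn_integral_diff_L2 ennreal_leI N2 n rN)
    qed auto
    finally show ?thesis .
  qed
  have diff: "square_integrable (\<lambda>x. g x - rep_L2 (X n) x)" if "n \<ge> N 0" for n
    unfolding square_integrable_def
  proof
    show "integrable lebesgue (\<lambda>x. (norm (g x - rep_L2 (X n) x))\<^sup>2)"
      using bound[OF that] by (intro integrableI_bounded) (auto intro: order.strict_trans1)
  qed simp
  have g: "square_integrable g"
    using square_integrable_add[OF diff[OF order_refl] square_integrable_rep[of "X (N 0)"]] by simp
  have "norm (X n - abs_L2 g) \<le> (1/2)^k" if n: "n \<ge> N k" for n k
  proof -
    have "ennreal ((norm (abs_L2 g - X n))\<^sup>2) =
        (\<integral>\<^sup>+x. ennreal ((norm (g x - rep_L2 (X n) x))\<^sup>2) \<partial>lebesgue)"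
      unfolding nn_integral_diff_L2[symmetric]
      by (intro nn_integral_cong_AE) (use rep_abs_L2[OF g] in auto)
    also have "\<dots> \<le> ennreal ((1/4)^k)"
      by (rule bound[OF n])
    finally have "(norm (abs_L2 g - X n))\<^sup>2 \<le> (1/4)^k"
      by (simp add: ennreal_le_iff)
    also have "\<dots> = ((1/2)^k)\<^sup>2"
      by (simp add: power_mult[symmetric] mult.commute[of k 2]) (simp add: power_mult power2_eq_square)
    finally have "norm (abs_L2 g - X n) \<le> (1/2)^k"
      by (rule power2_le_imp_le) simp
    then show ?thesis
      by (subst norm_minus_commute)
  qed
  then have *: "\<forall>n\<ge>N k. dist (X n) (abs_L2 g) \<le> (1/2)^k" for k
    by (simp add: dist_norm)
  have "X \<longlonglongrightarrow> abs_L2 g"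
  proof (rule metric_LIMSEQ_I)
    fix e :: real assume "0 < e"
    then obtain k where "(1/2)^k < e"
      using real_arch_pow_inv[of e "1/2"] by auto
    then show "\<exists>M. \<forall>n\<ge>M. dist (X n) (abs_L2 g) < e"
      using *[of k] by (meson order.strict_trans1)
  qed
  then show "convergent X" by (rule convergentI)
qed

instance L2 :: (euclidean_space, euclidean_space) banach ..

lemma ex_orthogonal_closed_subspace:
  fixes S :: "'c::{real_inner, complete_space} set"
  assumes S: "subspace S" "closed S" and x: "x \<notin> S"
  shows "\<exists>z. z \<noteq> 0 \<and> (\<forall>t\<in>S. z \<bullet> t = 0)"
proof -
  define d where "d = infdist x S"
  have ne: "S \<noteq> {}" using subspace_0[OF S(1)] by auto
  have d0: "0 \<le> d" by (simp add: d_def infdist_nonneg)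
  have dle: "d \<le> norm (x - s)" if "s \<in> S" for s
    using infdist_le[OF that, of x] by (simp add: d_def dist_norm)
  have "\<exists>s\<in>S. (norm (x - s))\<^sup>2 < d\<^sup>2 + 1 / Suc n" for n
  proof -
    have "sqrt (d\<^sup>2 + 1 / Suc n) > sqrt (d\<^sup>2)"
      by (intro real_sqrt_less_mono) simp
    then have "infdist x S < sqrt (d\<^sup>2 + 1 / Suc n)"
      using d0 by (simp add: d_def)
    then have "(INF a\<in>S. dist x a) < sqrt (d\<^sup>2 + 1 / Suc n)"
      using ne by (simp add: infdist_notempty)
    then obtain s where s: "s \<in> S" "dist x s < sqrt (d\<^sup>2 + 1 / Suc n)"
      using ne by (subst (asm) cINF_less_iff) (auto intro!: bdd_belowI[of _ 0])
    then have "(norm (x - s))\<^sup>2 < (sqrt (d\<^sup>2 + 1 / Suc n))\<^sup>2"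
      by (intro power_strict_mono) (auto simp: dist_norm)
    then show ?thesis using s(1) by auto
  qed
  then obtain s where s: "\<And>n. s n \<in> S" "\<And>n. (norm (x - s n))\<^sup>2 < d\<^sup>2 + 1 / Suc n"
    by metis
  have para: "(norm (s m - s n))\<^sup>2 \<le> 2 / Suc m + 2 / Suc n" for m n
  proof -
    have "(1/2) *\<^sub>R (s m + s n) \<in> S"
      using s(1) S(1) by (intro subspace_scale subspace_add)
    then have "d\<^sup>2 \<le> (norm (x - (1/2) *\<^sub>R (s m + s n)))\<^sup>2"
      using dle d0 by (intro power_mono) auto
    moreover have "(norm (s m - s n))\<^sup>2 = 2 * (norm (x - s m))\<^sup>2 + 2 * (norm (x - s n))\<^sup>2
        - 4 * (norm (x - (1/2) *\<^sub>R (s m + s n)))\<^sup>2"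
      by (simp add: power2_norm_eq_inner algebra_simps inner_commute)
    moreover have "2 / real (Suc m) = 2 * (1 / real (Suc m))" "2 / real (Suc n) = 2 * (1 / real (Suc n))"
      by simp_all
    ultimately show ?thesis
      using s(2)[of m] s(2)[of n] by linarith
  qed
  have "Cauchy s"
  proof (rule metric_CauchyI)
    fix e :: real assume e: "0 < e"
    obtain M where M: "4 / e\<^sup>2 < real M" using reals_Archimedean2 by blast
    have "dist (s m) (s n) < e" if "m \<ge> M" "n \<ge> M" for m n
    proof -
      have "M > 0" using M e by (cases M) (auto simp: field_simps)
      have "2 / Suc m + 2 / Suc n < 2 / M + 2 / M"
        using that \<open>M > 0\<close> by (intro add_strict_mono divide_strict_left_mono) auto
      also have "\<dots> < e\<^sup>2"
        using M e \<open>M > 0\<close> by (simp add: field_simps)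
      finally have "(norm (s m - s n))\<^sup>2 < e\<^sup>2"
        using para[of m n] by linarith
      then show ?thesis
        using e by (simp add: dist_norm power2_less_imp_less)
    qed
    then show "\<exists>M. \<forall>m\<ge>M. \<forall>n\<ge>M. dist (s m) (s n) < e" by blast
  qed
  then obtain y where y: "s \<longlonglongrightarrow> y"
    by (auto simp: Cauchy_convergent_iff convergent_def)
  have yS: "y \<in> S"
    using S(2) y s(1) by (meson closed_sequentially)
  define z where "z = x - y"
  have zd: "(norm z)\<^sup>2 \<le> d\<^sup>2"
  proof (rule LIMSEQ_le)
    show "(\<lambda>n. (norm (x - s n))\<^sup>2) \<longlonglongrightarrow> (norm z)\<^sup>2"
      unfolding z_def by (intro tendsto_intros y)
    show "(\<lambda>n. d\<^sup>2 + 1 / Suc n) \<longlonglongrightarrow> d\<^sup>2"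
      using tendsto_add[OF tendsto_const LIMSEQ_Suc[OF lim_1_over_n], of "d\<^sup>2"] by simp
    show "\<exists>N. \<forall>n\<ge>N. (norm (x - s n))\<^sup>2 \<le> d\<^sup>2 + 1 / Suc n"
      using s(2) by (auto intro: less_imp_le)
  qed
  have "z \<bullet> t = 0" if t: "t \<in> S" for t
  proof (cases "t = 0")
    case False
    define c where "c = (z \<bullet> t) / (t \<bullet> t)"
    have "y + c *\<^sub>R t \<in> S"
      using yS t S(1) by (intro subspace_add subspace_scale)
    then have "d\<^sup>2 \<le> (norm (x - (y + c *\<^sub>R t)))\<^sup>2"
      using dle d0 by (intro power_mono) auto
    also have "x - (y + c *\<^sub>R t) = z - c *\<^sub>R t"
      by (simp add: z_def)
    also have "(norm (z - c *\<^sub>R t))\<^sup>2 = (norm z)\<^sup>2 - 2 * c * (z \<bullet> t) + c * c * (t \<bullet> t)"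
      by (simp add: power2_norm_eq_inner algebra_simps inner_commute)
    also have "\<dots> = (norm z)\<^sup>2 - (z \<bullet> t)\<^sup>2 / (t \<bullet> t)"
      using False by (simp add: c_def field_simps power2_eq_square)
    finally have "(z \<bullet> t)\<^sup>2 / (t \<bullet> t) \<le> 0"
      using zd by linarith
    then show ?thesis
      using False by (simp add: divide_le_0_iff not_le)
        (metis inner_ge_zero inner_eq_zero_iff not_less_iff_gr_or_eq not_less power2_less_eq_zero_iff)
  qed simp
  moreover have "z \<noteq> 0"
    using yS x by (auto simp: z_def)
  ultimately show ?thesis by blast
qed

lemma separable_imp_second_countable:
  fixes D :: "'c::metric_space set"
  assumes "countable D" "closure D = UNIV"
  shows "\<exists>B::'c set set. countable B \<and> open = generate_topology B"
proof -
  define B where "B = (\<lambda>(d, n). ball d (1 / real (Suc n))) ` (D \<times> UNIV)"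
  have "topological_basis B"
  proof (rule topological_basisI)
    fix U :: "'c set" and x assume U: "open U" "x \<in> U"
    then obtain e where e: "0 < e" "ball x e \<subseteq> U"
      by (meson openE)
    obtain n where n: "1 / real (Suc n) < e / 2"
      using e(1) by (meson half_gt_zero nat_approx_posE)
    have "x \<in> closure D" using assms(2) by simp
    then obtain d where d: "d \<in> D" "dist d x < 1 / real (Suc n)"
      by (metis closure_approachable of_nat_0_less_iff zero_less_Suc zero_less_divide_1_iff)
    have "ball d (1 / real (Suc n)) \<subseteq> ball x e"
    proof
      fix y assume "y \<in> ball d (1 / real (Suc n))"
      then show "y \<in> ball x e"
        using d(2) n dist_triangle[of x y d] by (simp add: dist_commute)
    qed
    then show "\<exists>B'\<in>B. x \<in> B' \<and> B' \<subseteq> U"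
      using d e(2) by (intro bexI[of _ "ball d (1 / real (Suc n))"]) (auto simp: B_def)
  qed (auto simp: B_def)
  moreover have "countable B"
    unfolding B_def using assms(1) by auto
  ultimately show ?thesis
    using topological_basis_imp_subbasis by blast
qed

lemma countable_total_imp_second_countable:
  fixes G :: "'c::{real_inner, complete_space} set"
  assumes "countable G" and total: "\<And>z. (\<And>t. t \<in> G \<Longrightarrow> z \<bullet> t = 0) \<Longrightarrow> z = 0"
  shows "\<exists>B::'c set set. countable B \<and> open = generate_topology B"
proof -
  define g where "g = from_nat_into (insert 0 G)"
  have rg: "range g = insert 0 G"
    unfolding g_def using assms(1) by (intro range_from_nat_into) auto
  define comb where "comb qs = (\<Sum>i<length qs. of_rat (qs ! i) *\<^sub>R g i)" for qs :: "rat list"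
  define D where "D = range comb"
  have cD: "countable D" by (simp add: D_def)
  have comb_fun: "(\<Sum>i<n. of_rat (q i) *\<^sub>R g i) \<in> D" for n and q :: "nat \<Rightarrow> rat"
  proof -
    have "(\<Sum>i<n. of_rat (q i) *\<^sub>R g i) = comb (map q [0..<n])"
      by (simp add: comb_def)
    then show ?thesis by (simp add: D_def)
  qed
  have pad: "comb qs = (\<Sum>i<n. of_rat (if i < length qs then qs ! i else 0) *\<^sub>R g i)"
    if "length qs \<le> n" for qs n
    unfolding comb_def using that by (intro sum.mono_neutral_cong_left) auto
  have add: "x + y \<in> D" if "x \<in> D" "y \<in> D" for x y
  proof -
    obtain ps qs where "x = comb ps" "y = comb qs" using \<open>x \<in> D\<close> \<open>y \<in> D\<close> by (auto simp: D_def)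
    then have "x + y = (\<Sum>i<max (length ps) (length qs).
        of_rat ((if i < length ps then ps ! i else 0) + (if i < length qs then qs ! i else 0)) *\<^sub>R g i)"
      by (simp only: pad[of ps "max (length ps) (length qs)"] pad[of qs "max (length ps) (length qs)"]
          max.cobounded1 max.cobounded2 sum.distrib[symmetric] scaleR_add_left[symmetric] of_rat_add)
    then show ?thesis using comb_fun by presburger
  qed
  have scale: "of_rat c *\<^sub>R x \<in> D" if "x \<in> D" for c x
  proof -
    obtain ps where "x = comb ps" using \<open>x \<in> D\<close> by (auto simp: D_def)
    then have "of_rat c *\<^sub>R x = (\<Sum>i<length ps. of_rat (c * ps ! i) *\<^sub>R g i)"
      by (simp add: comb_def scaleR_sum_right of_rat_mult)
    then show ?thesis using comb_fun by presburger
  qed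
  have gD: "g i \<in> D" for i
  proof -
    have "g i = (\<Sum>j<Suc i. of_rat (if j = i then 1 else 0) *\<^sub>R g j)"
      by (simp add: if_distrib[of of_rat] if_distrib[of "\<lambda>c. c *\<^sub>R _"] cong: if_cong)
    then show ?thesis using comb_fun by metis
  qed
  have "subspace (closure D)"
    unfolding subspace_def
  proof (intro conjI ballI allI)
    have "comb [] \<in> D" by (simp add: D_def)
    then show "0 \<in> closure D"
      using closure_subset by (auto simp: comb_def)
  next
    fix x y assume "x \<in> closure D" "y \<in> closure D"
    then obtain a b where "\<And>n. a n \<in> D" "a \<longlonglongrightarrow> x" "\<And>n. b n \<in> D" "b \<longlonglongrightarrow> y"
      by (auto simp: closure_sequential)
    then have "(\<lambda>n. a n + b n) \<longlonglongrightarrow> x + y" "\<And>n. a n + b n \<in> D"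
      by (auto intro: tendsto_add add)
    then show "x + y \<in> closure D"
      unfolding closure_sequential by (intro exI[of _ "\<lambda>n. a n + b n"]) simp
  next
    fix c :: real and x assume "x \<in> closure D"
    then obtain a where a: "\<And>n. a n \<in> D" "a \<longlonglongrightarrow> x"
      by (auto simp: closure_sequential)
    have "c \<in> closure \<rat>" by (simp add: Rats_closure_real)
    then obtain q where q: "\<And>n. q n \<in> \<rat>" "q \<longlonglongrightarrow> c"
      by (auto simp: closure_sequential)
    have "q n *\<^sub>R a n \<in> D" for n
      using q(1)[of n] a(1)[of n] scale by (auto elim!: Rats_cases)
    moreover have "(\<lambda>n. q n *\<^sub>R a n) \<longlonglongrightarrow> c *\<^sub>R x"
      by (intro tendsto_scaleR q a)
    ultimately show "c *\<^sub>R x \<in> closure D"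
      unfolding closure_sequential by (intro exI[of _ "\<lambda>n. q n *\<^sub>R a n"]) simp
  qed
  have "closure D = UNIV"
  proof (rule ccontr)
    assume "closure D \<noteq> UNIV"
    then obtain x where "x \<notin> closure D" by auto
    then obtain z where z: "z \<noteq> 0" "\<And>t. t \<in> closure D \<Longrightarrow> z \<bullet> t = 0"
      using ex_orthogonal_closed_subspace[OF \<open>subspace (closure D)\<close> closed_closure] by blast
    have "t \<in> closure D" if "t \<in> G" for t
    proof -
      have "t \<in> range g" using that rg by auto
      then show ?thesis using gD closure_subset by blast
    qed
    then show False using total z by blast
  qed
  then show ?thesis
    by (rule separable_imp_second_countable[OF cD])
qed

definition rational_box_set :: "'a::euclidean_space set set" where
  "rational_box_set = {box a b | a b. \<forall>i\<in>Basis. a \<bullet> i \<in> \<rat> \<and> b \<bullet> i \<in> \<rat>}"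

lemma countable_rational_box_set: "countable (rational_box_set :: 'a::euclidean_space set set)"
proof -
  define h :: "('a \<Rightarrow> real) \<Rightarrow> 'a" where "h c = (\<Sum>i\<in>Basis. c i *\<^sub>R i)" for c
  have 1: "countable (Basis \<rightarrow>\<^sub>E \<rat> :: ('a \<Rightarrow> real) set)"
    by (intro countable_PiE) (auto simp: countable_rat)
  have 2: "a \<in> h ` (Basis \<rightarrow>\<^sub>E \<rat>)" if "\<forall>i\<in>Basis. a \<bullet> i \<in> \<rat>" for a
  proof (rule image_eqI)
    show "a = h (restrict (\<lambda>i. a \<bullet> i) Basis)"
      by (simp add: h_def euclidean_representation)
  qed (use that in auto)
  have "rational_box_set \<subseteq> (\<lambda>(a, b). box a b) ` (h ` (Basis \<rightarrow>\<^sub>E \<rat>) \<times> h ` (Basis \<rightarrow>\<^sub>E \<rat>))"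
  proof
    fix A :: "'a set" assume "A \<in> rational_box_set"
    then obtain a b where A: "A = box a b" "\<forall>i\<in>Basis. a \<bullet> i \<in> \<rat>" "\<forall>i\<in>Basis. b \<bullet> i \<in> \<rat>"
      unfolding rational_box_set_def by blast
    have "(a, b) \<in> h ` (Basis \<rightarrow>\<^sub>E \<rat>) \<times> h ` (Basis \<rightarrow>\<^sub>E \<rat>)"
      using 2[OF A(2)] 2[OF A(3)] by simp
    then show "A \<in> (\<lambda>(a, b). box a b) ` (h ` (Basis \<rightarrow>\<^sub>E \<rat>) \<times> h ` (Basis \<rightarrow>\<^sub>E \<rat>))"
      unfolding A(1) by (rule rev_image_eqI) simp
  qed
  moreover have "countable (h ` (Basis \<rightarrow>\<^sub>E \<rat>))"
    by (rule countable_image[OF 1])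
  ultimately show ?thesis
    by (meson countable_SIGMA countable_image countable_subset)
qed

lemma Int_stable_rational_box_set: "Int_stable (rational_box_set :: 'a::euclidean_space set set)"
proof (rule Int_stableI)
  fix A B :: "'a set" assume "A \<in> rational_box_set" "B \<in> rational_box_set"
  then obtain a b c d where A: "A = box a b" "B = box c d"
    and rat: "\<forall>i\<in>Basis. a \<bullet> i \<in> \<rat> \<and> b \<bullet> i \<in> \<rat>" "\<forall>i\<in>Basis. c \<bullet> i \<in> \<rat> \<and> d \<bullet> i \<in> \<rat>"
    by (auto simp: rational_box_set_def)
  show "A \<inter> B \<in> rational_box_set"
    unfolding A box_Int_box rational_box_set_def using rat
    by (auto simp: max_def min_def intro!: exI)
qed

lemma borel_eq_rational_box_set: "borel = sigma UNIV (rational_box_set :: 'a::euclidean_space set set)"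
proof (rule borel_eq_countable_basis[OF countable_rational_box_set topological_basisI])
  fix U :: "'a set" and x assume "open U" "x \<in> U"
  then obtain e where "0 < e" "ball x e \<subseteq> U" by (meson openE)
  with rational_boxes[of e x] show "\<exists>B'\<in>rational_box_set. x \<in> B' \<and> B' \<subseteq> U"
    unfolding rational_box_set_def by (smt (verit) mem_Collect_eq order_trans)
qed (auto simp: rational_box_set_def open_box)

lemma UN_rational_box_set: "\<Union>(rational_box_set :: 'a::euclidean_space set set) = UNIV"
proof -
  have "x \<in> \<Union>rational_box_set" for x :: 'a
    using rational_boxes[of 1 x] unfolding rational_box_set_def by force
  then show ?thesis by blast
qed

lemma AE_zero_if_rational_box_integrals_zero:
  fixes h :: "'a::euclidean_space \<Rightarrow> real"
  assumes h: "h \<in> borel_measurable lebesgue"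
    and int: "\<And>A. A \<in> rational_box_set \<Longrightarrow> integrable lebesgue (\<lambda>x. indicator A x * h x)"
    and zero: "\<And>A. A \<in> rational_box_set \<Longrightarrow> (LINT x|lebesgue. indicator A x * h x) = 0"
  shows "AE x in lebesgue. h x = 0"
proof -
  have h': "h \<in> borel_measurable (completion lborel)" using h by simp
  obtain k where [measurable]: "k \<in> borel_measurable lborel" and k: "AE x in lborel. h x = k x"
    using completion_ex_borel_measurable_real[OF h'] by blast
  have kl: "AE x in lebesgue. h x = k x"
    using k by (rule AE_completion)
  have meas: "A \<in> sets borel" if "A \<in> rational_box_set" for A :: "'a set"
    using that by (auto simp: rational_box_set_def)
  have klm: "(\<lambda>x. indicator A x * k x) \<in> borel_measurable lebesgue" if "A \<in> rational_box_set" for A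
  proof -
    note [measurable] = meas[OF that]
    show ?thesis by (intro measurable_completion) measurable
  qed
  have hlm: "(\<lambda>x. indicator A x * h x) \<in> borel_measurable lebesgue" if "A \<in> rational_box_set" for A
    using int[OF that] by simp
  have intk: "integrable lborel (\<lambda>x. indicator A x * k x)" if A: "A \<in> rational_box_set" for A
  proof -
    note [measurable] = meas[OF A]
    have "integrable lebesgue (\<lambda>x. indicator A x * k x)"
      by (rule integrable_cong_AE_imp[OF int[OF A] klm[OF A]]) (use kl in auto)
    then show ?thesis
      by (subst (asm) integrable_completion) auto
  qed
  have zerok: "(LINT x|lborel. indicator A x * k x) = 0" if A: "A \<in> rational_box_set" for A
  proof -
    note [measurable] = meas[OF A]
    have "(LINT x|lborel. indicator A x * k x) = (LINT x|lebesgue. indicator A x * k x)"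
      by (rule integral_completion[symmetric]) measurable
    also have "\<dots> = (LINT x|lebesgue. indicator A x * h x)"
      by (intro integral_cong_AE klm hlm A) (use kl in auto)
    finally show ?thesis using zero[OF A] by simp
  qed
  define M where "M = (\<lambda>c. density lborel (\<lambda>x. ennreal (c * k x)))"
  have em: "emeasure (M c) A = (\<integral>\<^sup>+x. ennreal (c * (indicator A x * k x)) \<partial>lborel)"
    if A: "A \<in> rational_box_set" for A c
  proof -
    note [measurable] = meas[OF A]
    have "emeasure (M c) A = (\<integral>\<^sup>+x. ennreal (c * k x) * indicator A x \<partial>lborel)"
      unfolding M_def by (intro emeasure_density) auto
    also have "\<dots> = (\<integral>\<^sup>+x. ennreal (c * (indicator A x * k x)) \<partial>lborel)"
      by (intro nn_integral_cong) (simp add: indicator_def)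
    finally show ?thesis .
  qed
  have fin: "emeasure (M c) A \<noteq> \<infinity>" if A: "A \<in> rational_box_set" for A c
  proof -
    have "integrable lborel (\<lambda>x. c * (indicator A x * k x))"
      using intk[OF A] by (rule integrable_mult_right)
    then show ?thesis
      unfolding em[OF A] real_integrable_def by simp
  qed
  have eq: "emeasure (M 1) A = emeasure (M (-1)) A" if A: "A \<in> rational_box_set" for A
  proof -
    have "enn2real (emeasure (M 1) A) = enn2real (emeasure (M (-1)) A)"
      using zerok[OF A] real_lebesgue_integral_def[OF intk[OF A]] by (simp add: em[OF A])
    then show ?thesis
      using fin[OF A, of 1] fin[OF A, of "-1"] by (metis ennreal_enn2real infinity_ennreal_def less_top)
  qed
  have "M 1 = M (-1)"
  proof (rule measure_eqI_generator_eq_countable)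
    show "Int_stable (rational_box_set :: 'a set set)" by (rule Int_stable_rational_box_set)
    have sets_M: "sets (M c) = sigma_sets UNIV (rational_box_set :: 'a set set)" for c
      by (simp add: M_def borel_eq_rational_box_set)
    show "sets (M 1) = sigma_sets UNIV rational_box_set" by (rule sets_M)
    show "sets (M (-1)) = sigma_sets UNIV rational_box_set" by (rule sets_M)
    show "emeasure (M 1) A = emeasure (M (-1)) A" if "A \<in> rational_box_set" for A
      by (rule eq[OF that])
    show "emeasure (M 1) A \<noteq> \<infinity>" if "A \<in> rational_box_set" for A
      by (rule fin[OF that])
  qed (use countable_rational_box_set UN_rational_box_set in auto)
  then have "AE x in lborel. ennreal (1 * k x) = ennreal (-1 * k x)"
    unfolding M_def by (intro sigma_finite_measure.density_unique[OF lborel.sigma_finite_measure_axioms]) auto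
  then have "AE x in lborel. k x = 0"
  proof eventually_elim
    case (elim x)
    then show ?case
      by (cases "0 \<le> k x") (auto simp: ennreal_neg ennreal_eq_0_iff)
  qed
  then have "AE x in lebesgue. k x = 0" by (rule AE_completion)
  with kl show ?thesis by eventually_elim simp
qed

instance L2 :: (euclidean_space, euclidean_space) second_countable_topology
proof
  define ind :: "'a set \<Rightarrow> 'b \<Rightarrow> 'a \<Rightarrow> 'b" where "ind A e = (\<lambda>x. indicator A x *\<^sub>R e)" for A e
  define G where "G = (\<lambda>(A, e). abs_L2 (ind A e)) ` (rational_box_set \<times> Basis)"
  have sq: "square_integrable (ind A e)" if A_rat: "A \<in> rational_box_set" for A e
  proof -
    obtain a b where A: "A = box a b" using A_rat by (auto simp: rational_box_set_def)
    have "integrable lebesgue (\<lambda>x. (norm e)\<^sup>2 * indicator (box a b) x :: real)"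
      by (intro integrable_mult_right integrable_real_indicator) (use emeasure_lborel_box_finite[of a b] in auto)
    moreover have "(\<lambda>x. (norm (ind A e x))\<^sup>2) = (\<lambda>x. (norm e)\<^sup>2 * indicator (box a b) x :: real)"
      by (auto simp: ind_def A indicator_def)
    moreover have "ind A e \<in> borel_measurable lebesgue"
      unfolding ind_def A by (intro borel_measurable_scaleR borel_measurable_indicator) auto
    ultimately show ?thesis by (simp add: square_integrable_def)
  qed
  have "countable G"
    unfolding G_def using countable_rational_box_set by (intro countable_image countable_SIGMA) (auto intro: countable_finite)
  moreover have "z = 0" if z: "\<And>t. t \<in> G \<Longrightarrow> z \<bullet> t = 0" for z :: "('a, 'b) L2"
  proof -
    have int: "integrable lebesgue (\<lambda>x. indicator A x * (rep_L2 z x \<bullet> e))"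
      "(LINT x|lebesgue. indicator A x * (rep_L2 z x \<bullet> e)) = z \<bullet> abs_L2 (ind A e)"
      if A: "A \<in> rational_box_set" for A e
    proof -
      have *: "(\<lambda>x. indicator A x * (rep_L2 z x \<bullet> e)) = (\<lambda>x. rep_L2 z x \<bullet> ind A e x)"
        by (simp add: ind_def)
      show "integrable lebesgue (\<lambda>x. indicator A x * (rep_L2 z x \<bullet> e))"
        unfolding * by (intro integrable_inner_square_integrable sq A square_integrable_rep)
      show "(LINT x|lebesgue. indicator A x * (rep_L2 z x \<bullet> e)) = z \<bullet> abs_L2 (ind A e)"
        unfolding * inner_L2_rep
        by (intro integral_cong_AE) (use rep_abs_L2[OF sq[OF A, of e]] sq[OF A, of e] in
            \<open>auto simp: square_integrable_def\<close>)
    qed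
    have "AE x in lebesgue. rep_L2 z x \<bullet> e = 0" if "e \<in> Basis" for e
    proof (rule AE_zero_if_rational_box_integrals_zero)
      fix A :: "'a set" assume A: "A \<in> rational_box_set"
      show "(LINT x|lebesgue. indicator A x * (rep_L2 z x \<bullet> e)) = 0"
        unfolding int(2)[OF A] by (rule z) (use A that in \<open>auto simp: G_def\<close>)
    qed (auto intro: int)
    then have "AE x in lebesgue. \<forall>e\<in>Basis. rep_L2 z x \<bullet> e = 0"
      by (intro AE_finite_allI) auto
    then have "AE x in lebesgue. rep_L2 z x = 0"
      by eventually_elim (simp add: euclidean_all_zero_iff)
    then have "(LINT x|lebesgue. (norm (rep_L2 z x))\<^sup>2) = 0"
      by (intro integral_eq_zero_AE) auto
    then show "z = 0"
      using norm_L2_rep[of z] by simp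
  qed
  ultimately show "\<exists>B::('a, 'b) L2 set set. countable B \<and> open = generate_topology B"
    by (rule countable_total_imp_second_countable)
qed

text \<open>
  \<open>L2_on \<Omega>\<close> is the space of \<open>L\<^sup>2\<close> functions on \<open>\<Omega>\<close>, identified through extension by zero with a closed
  subspace of \<open>L2\<close>; this identification preserves the inner product.
\<close>

definition L2_on :: "'a::euclidean_space set \<Rightarrow> ('a, 'b::euclidean_space) L2 set" where
  "L2_on \<Omega> = {u. AE x in lebesgue. x \<notin> \<Omega> \<longrightarrow> rep_L2 u x = 0}"

section \<open>Lebesgue and Sobolev spaces on a set\<close>

text \<open>
  The spaces below consist of functions defined everywhere, of which only the values almost everywhere
  in \<open>\<Omega>\<close> matter.  The codomain \<open>'b\<close> may be infinite-dimensional, and \<open>\<Omega>\<close> may be an open interval of time: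
  with \<open>'b\<close> an instance of \<open>L2\<close> these are spaces of Bochner measurable functions.
\<close>

definition Lp :: "'a::euclidean_space set \<Rightarrow> real \<Rightarrow> ('a \<Rightarrow> 'b::{banach, second_countable_topology}) set" where
  "Lp \<Omega> p = {u. set_borel_measurable lebesgue \<Omega> u \<and> set_integrable lebesgue \<Omega> (\<lambda>x. norm (u x) powr p)}"

definition Linf_norm :: "'a::euclidean_space set \<Rightarrow> ('a \<Rightarrow> 'b::{banach, second_countable_topology}) \<Rightarrow> ereal" where
  "Linf_norm \<Omega> u = esssup (lebesgue_on \<Omega>) (\<lambda>x. ereal (norm (u x)))"

definition Linf :: "'a::euclidean_space set \<Rightarrow> ('a \<Rightarrow> 'b::{banach, second_countable_topology}) set" where
  "Linf \<Omega> = {u. set_borel_measurable lebesgue \<Omega> u \<and> Linf_norm \<Omega> u < \<infinity>}"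

definition locally_integrable :: "'a::euclidean_space set \<Rightarrow> ('a \<Rightarrow> 'b::{banach, second_countable_topology}) \<Rightarrow> bool" where
  "locally_integrable \<Omega> u \<longleftrightarrow> (\<forall>K. compact K \<and> K \<subseteq> \<Omega> \<longrightarrow> set_integrable lebesgue K u)"

primrec iter_partial :: "'a::euclidean_space list \<Rightarrow> ('a \<Rightarrow> 'b::real_normed_vector) \<Rightarrow> 'a \<Rightarrow> 'b" where
  "iter_partial [] f = f"
| "iter_partial (b # bs) f = (\<lambda>x. frechet_derivative (iter_partial bs f) (at x) b)"

text \<open>
  Infinite differentiability: all iterated partial derivatives are everywhere (Frechet) differentiable,
  hence in particular continuous.
\<close>

definition smooth :: "('a::euclidean_space \<Rightarrow> 'b::real_normed_vector) \<Rightarrow> bool" where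
  "smooth f \<longleftrightarrow> (\<forall>bs x. set bs \<subseteq> Basis \<longrightarrow> iter_partial bs f differentiable (at x))"

definition test_functions :: "'a::euclidean_space set \<Rightarrow> ('a \<Rightarrow> 'b::real_normed_vector) set" where
  "test_functions \<Omega> = {\<phi>. smooth \<phi> \<and> compact (closure {x. \<phi> x \<noteq> 0}) \<and> closure {x. \<phi> x \<noteq> 0} \<subseteq> \<Omega>}"

definition is_weak_deriv ::
  "'a::euclidean_space set \<Rightarrow> 'a \<Rightarrow> ('a \<Rightarrow> 'b::{banach, second_countable_topology}) \<Rightarrow> ('a \<Rightarrow> 'b) \<Rightarrow> bool" where
  "is_weak_deriv \<Omega> b u g \<longleftrightarrow>
     locally_integrable \<Omega> u \<and> locally_integrable \<Omega> g \<and>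
     (\<forall>\<phi>\<in>test_functions \<Omega>.
        (LINT x:\<Omega>|lebesgue. frechet_derivative \<phi> (at x) b *\<^sub>R u x) = - (LINT x:\<Omega>|lebesgue. \<phi> x *\<^sub>R g x))"

text \<open>The weak derivative in direction \<open>b\<close>; on an open \<open>\<Omega>\<close> it is unique up to a null set.\<close>

definition weak_deriv ::
  "'a::euclidean_space set \<Rightarrow> 'a \<Rightarrow> ('a \<Rightarrow> 'b::{banach, second_countable_topology}) \<Rightarrow> 'a \<Rightarrow> 'b" where
  "weak_deriv \<Omega> b u = (SOME g. is_weak_deriv \<Omega> b u g)"

definition W1p :: "'a::euclidean_space set \<Rightarrow> real \<Rightarrow> ('a \<Rightarrow> 'b::{banach, second_countable_topology}) set" where
  "W1p \<Omega> p = {u \<in> Lp \<Omega> p. \<forall>b\<in>Basis. \<exists>g\<in>Lp \<Omega> p. is_weak_deriv \<Omega> b u g}"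

definition W1p_norm :: "'a::euclidean_space set \<Rightarrow> real \<Rightarrow> ('a \<Rightarrow> 'b::{banach, second_countable_topology}) \<Rightarrow> real" where
  "W1p_norm \<Omega> p u =
     ((LINT x:\<Omega>|lebesgue. norm (u x) powr p) +
      (\<Sum>b\<in>Basis. LINT x:\<Omega>|lebesgue. norm (weak_deriv \<Omega> b u x) powr p)) powr (1 / p)"

definition W01p :: "'a::euclidean_space set \<Rightarrow> real \<Rightarrow> ('a \<Rightarrow> 'b::{banach, second_countable_topology}) set" where
  "W01p \<Omega> p = {u \<in> W1p \<Omega> p. \<exists>\<phi>::nat \<Rightarrow> 'a \<Rightarrow> 'b. (\<forall>k. \<phi> k \<in> test_functions \<Omega>) \<and>
     (\<lambda>k. W1p_norm \<Omega> p (\<lambda>x. \<phi> k x - u x)) \<longlonglongrightarrow> 0}"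

section \<open>Functionals on the Sobolev space and their subdifferential\<close>

text \<open>
  A functional on the Sobolev space \<open>W01p \<Omega> p\<close> with values in the reals or \<open>+\<infinity>\<close>.  It acts on
  functions, so it has to give the same value to functions that agree almost everywhere in \<open>\<Omega>\<close>.
\<close>

definition W0_functional ::
  "'a::euclidean_space set \<Rightarrow> real \<Rightarrow> (('a \<Rightarrow> 'b::euclidean_space) \<Rightarrow> ereal) \<Rightarrow> bool" where
  "W0_functional \<Omega> p F \<longleftrightarrow>
     (\<forall>w\<in>W01p \<Omega> p. F w \<noteq> - \<infinity>) \<and>
     (\<forall>v\<in>W01p \<Omega> p. \<forall>w\<in>W01p \<Omega> p. (AE x\<in>\<Omega> in lebesgue. v x = w x) \<longrightarrow> F v = F w)"

definition W0_coercive ::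
  "'a::euclidean_space set \<Rightarrow> real \<Rightarrow> (('a \<Rightarrow> 'b::euclidean_space) \<Rightarrow> ereal) \<Rightarrow> bool" where
  "W0_coercive \<Omega> p F \<longleftrightarrow>
     (\<forall>M::real. \<exists>R. \<forall>w\<in>W01p \<Omega> p. W1p_norm \<Omega> p w \<ge> R \<longrightarrow> F w \<ge> ereal M)"

definition W0_lsc ::
  "'a::euclidean_space set \<Rightarrow> real \<Rightarrow> (('a \<Rightarrow> 'b::euclidean_space) \<Rightarrow> ereal) \<Rightarrow> bool" where
  "W0_lsc \<Omega> p F \<longleftrightarrow>
     (\<forall>w\<in>W01p \<Omega> p. \<forall>v. (\<forall>k. v k \<in> W01p \<Omega> p) \<and> (\<lambda>k. W1p_norm \<Omega> p (\<lambda>x. v k x - w x)) \<longlonglongrightarrow> 0 \<longrightarrow>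
        F w \<le> liminf (\<lambda>k. F (v k)))"

definition L2_W0_convex ::
  "'a::euclidean_space set \<Rightarrow> real \<Rightarrow> (('a \<Rightarrow> 'b::euclidean_space) \<Rightarrow> ereal) \<Rightarrow> bool" where
  "L2_W0_convex \<Omega> p F \<longleftrightarrow>
     (\<forall>v\<in>Lp \<Omega> 2 \<inter> W01p \<Omega> p. \<forall>w\<in>Lp \<Omega> 2 \<inter> W01p \<Omega> p. \<forall>c\<in>{0<..<1}.
        F (\<lambda>x. (1 - c) *\<^sub>R v x + c *\<^sub>R w x) \<le> ereal (1 - c) * F v + ereal c * F w)"

definition dom_F ::
  "'a::euclidean_space set \<Rightarrow> real \<Rightarrow> (('a \<Rightarrow> 'b::euclidean_space) \<Rightarrow> ereal) \<Rightarrow> ('a, 'b) L2 set" where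
  "dom_F \<Omega> p F = {u \<in> L2_on \<Omega>. rep_L2 u \<in> W01p \<Omega> p \<and> F (rep_L2 u) < \<infinity>}"

definition subdiff ::
  "'a::euclidean_space set \<Rightarrow> real \<Rightarrow> (('a \<Rightarrow> 'b::euclidean_space) \<Rightarrow> ereal) \<Rightarrow> ('a, 'b) L2 \<Rightarrow> ('a, 'b) L2 set" where
  "subdiff \<Omega> p F u =
     {v \<in> L2_on \<Omega>. \<forall>w\<in>dom_F \<Omega> p F. F (rep_L2 w) \<ge> F (rep_L2 u) + ereal (v \<bullet> (w - u))}"

definition dom_subdiff ::
  "'a::euclidean_space set \<Rightarrow> real \<Rightarrow> (('a \<Rightarrow> 'b::euclidean_space) \<Rightarrow> ereal) \<Rightarrow> ('a, 'b) L2 set" where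
  "dom_subdiff \<Omega> p F = {u \<in> dom_F \<Omega> p F. subdiff \<Omega> p F u \<noteq> {}}"

definition min_section ::
  "'a::euclidean_space set \<Rightarrow> real \<Rightarrow> (('a \<Rightarrow> 'b::euclidean_space) \<Rightarrow> ereal) \<Rightarrow> ('a, 'b) L2 \<Rightarrow> ('a, 'b) L2" where
  "min_section \<Omega> p F u = arg_min norm (\<lambda>z. z \<in> subdiff \<Omega> p F u)"

section \<open>The gradient flow\<close>

abbreviation time_deriv :: "(real \<Rightarrow> ('a::euclidean_space, 'b::euclidean_space) L2) \<Rightarrow> real \<Rightarrow> ('a, 'b) L2" where
  "time_deriv u \<equiv> weak_deriv {0<..} 1 u"

text \<open>
  That the values of \<open>time_deriv u\<close> lie in \<open>L2_on \<Omega>\<close> for almost every time is part of the inclusion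
  \<open>- time_deriv u t \<in> subdiff \<Omega> p F (u t)\<close>.
\<close>

definition is_solution ::
  "'a::euclidean_space set \<Rightarrow> real \<Rightarrow> (('a \<Rightarrow> 'b::euclidean_space) \<Rightarrow> ereal) \<Rightarrow> ('a, 'b) L2 \<Rightarrow>
   (real \<Rightarrow> ('a, 'b) L2) \<Rightarrow> bool" where
  "is_solution \<Omega> p F u0 u \<longleftrightarrow>
     continuous_on {0..} u \<and> (\<forall>t\<ge>0. u t \<in> L2_on \<Omega>) \<and>
     (\<exists>g. is_weak_deriv {0<..} 1 u g) \<and>
     (\<forall>\<delta>>0. time_deriv u \<in> Linf {\<delta><..}) \<and>
     (\<forall>t>0. u t \<in> dom_subdiff \<Omega> p F) \<and>
     (AE t\<in>{0<..} in lebesgue. - time_deriv u t \<in> subdiff \<Omega> p F (u t)) \<and>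
     u 0 = u0"

end

theory Submission
  imports Defs "HOL-Computational_Algebra.Polynomial"
begin

text \<open>
  On the closed subspace of \<open>L\<^sup>2\<close>-functions supported in \<open>\<Omega>\<close> the functional becomes a convex function
  with closed sublevel sets: nearly energy-minimal elements of a convex set of bounded energy form
  a Cauchy sequence in \<open>W\<^sup>1\<^sup>,\<^sup>p\<close> by uniform convexity, which replaces reflexivity and Mazur's lemma.
  The flow is the limit of iterated resolvents (Crandall and Liggett) and is characterised by the
  evolution variational inequality
  \<open>\<bar>u t - w\<bar>\<^sup>2 / 2 - \<bar>u s - w\<bar>\<^sup>2 / 2 \<le> (t - s) * (\<phi> w - \<phi> (u t))\<close>, which gives contraction, smoothing
  and, at every positive time, the right derivatives \<open>- A0 (u t)\<close> of \<open>u\<close> and \<open>- \<bar>A0 (u t)\<bar>\<^sup>2\<close> of \<open>\<phi> (u t)\<close>.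
  For locally Lipschitz functions a right derivative is already a weak derivative, because
  translation invariance of the integral does not see the side from which the difference quotients
  are taken.
\<close>

section \<open>Gradient flows in Hilbert spaces\<close>

text \<open>Lower semicontinuity is assumed for the Sobolev norm, but the flow converges in L2, and
  for small \<open>p\<close> the Sobolev space need not embed into L2. The two topologies meet only
  in \<open>sublevel_closed\<close>; from there on the argument belongs to convex functions on a
  Hilbert space. Uniform convexity is used in the additive form \<open>\<epsilon>\<close> times the
  energies plus \<open>C\<close> times the midpoint defect: it covers all \<open>p > 1\<close> at
  once, where Clarkson's inequalities split at 2, and it integrates term by term. The evolution
  inequality is kept in integrated form because it contains neither a derivative nor a subgradient
  and so survives limits under mere lower semicontinuity. A competing solution is given by a weak
  derivative only and is not known to satisfy it; uniqueness therefore rests separately on the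
  fundamental lemma and on a fundamental theorem of calculus for weak derivatives with values in L2.
  The initial energy may be infinite. Estimates are therefore made on intervals away from time 0 and
  extended to 0 by continuity or by uniform bounds.\<close>

lemma Cauchy_norm_diff_sq:
  fixes s :: "nat \<Rightarrow> 'h::real_normed_vector"
  assumes le: "\<And>m n. n \<le> m \<Longrightarrow> (norm (s m - s n))\<^sup>2 \<le> e n" and e: "e \<longlonglongrightarrow> 0"
  shows "Cauchy s"
proof (rule metric_CauchyI)
  fix r :: real assume r: "0 < r"
  have "eventually (\<lambda>n. e n < (r/2)\<^sup>2) sequentially"
    using e r by (intro order_tendstoD(2)[OF e]) auto
  then obtain M where M: "\<And>n. n \<ge> M \<Longrightarrow> e n < (r/2)\<^sup>2"
    by (auto simp: eventually_sequentially)
  have *: "norm (s m - s M) < r/2" if "m \<ge> M" for m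
    using le[OF that] M[of M] r by (intro power2_less_imp_less[of _ "r/2"]) auto
  have "dist (s m) (s n) < r" if "m \<ge> M" "n \<ge> M" for m n
    using *[OF that(1)] *[OF that(2)] norm_triangle_ineq4[of "s m - s M" "s n - s M"]
    by (simp add: dist_norm)
  then show "\<exists>M. \<forall>m\<ge>M. \<forall>n\<ge>M. dist (s m) (s n) < r" by blast
qed

text \<open>On a grid of \<open>n + 1\<close> equal steps the right-hand sides telescope to
  \<open>(b - a) * (G a - G b) / (n + 1)\<close>, which tends to 0. This does the work of a
  differential inequality without any regularity of \<open>f\<close> or \<open>G\<close>.\<close>

lemma le_if_increments_le:
  fixes f G :: "real \<Rightarrow> real"
  assumes "a \<le> b"
    and inc: "\<And>s t. a \<le> s \<Longrightarrow> s < t \<Longrightarrow> t \<le> b \<Longrightarrow> f t - f s \<le> (t - s) * (G s - G t)"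
  shows "f b \<le> f a"
proof (cases "a = b")
  case False
  then have ab: "a < b" using assms(1) by simp
  have "f b - f a \<le> (b - a) * (G a - G b) * inverse (real (Suc n))" for n
  proof -
    define h where "h = (b - a) / real (Suc n)"
    have h: "h > 0" using ab by (simp add: h_def)
    define t where "t k = a + real k * h" for k
    have tn: "t (Suc n) = b" by (simp add: t_def h_def)
    have tk: "a \<le> t k" "t k < t (Suc k)" for k
      using h by (auto simp: t_def algebra_simps)
    have tb: "t (Suc k) \<le> b" if "k \<le> n" for k
    proof -
      have "real (Suc k) * h \<le> real (Suc n) * h" using that h by (intro mult_right_mono) auto
      then show ?thesis using tn by (simp add: t_def)
    qed
    have step: "t (Suc k) - t k = h" for k by (simp add: t_def algebra_simps)
    have "f b - f a = (\<Sum>k<Suc n. f (t (Suc k)) - f (t k))"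
      by (subst sum_lessThan_telescope) (use tn in \<open>simp add: t_def\<close>)
    also have "\<dots> \<le> (\<Sum>k<Suc n. h * (G (t k) - G (t (Suc k))))"
    proof (rule sum_mono)
      fix k assume "k \<in> {..<Suc n}"
      then show "f (t (Suc k)) - f (t k) \<le> h * (G (t k) - G (t (Suc k)))"
        using inc[OF tk tb, of k] by (simp add: step)
    qed
    also have "\<dots> = h * (\<Sum>k<Suc n. G (t k) - G (t (Suc k)))"
      by (rule sum_distrib_left[symmetric])
    also have "(\<Sum>k<Suc n. G (t k) - G (t (Suc k))) = G a - G b"
      by (subst sum_lessThan_telescope') (use tn in \<open>simp add: t_def\<close>)
    finally show ?thesis by (simp add: h_def divide_inverse mult_ac)
  qed
  moreover have "(\<lambda>n. (b - a) * (G a - G b) * inverse (real (Suc n))) \<longlonglongrightarrow> (b - a) * (G a - G b) * 0"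
    by (intro tendsto_intros LIMSEQ_inverse_real_of_nat)
  ultimately have "f b - f a \<le> 0"
    by (intro LIMSEQ_le_const[where X="\<lambda>n. (b - a) * (G a - G b) * inverse (real (Suc n))"]) auto
  then show ?thesis by simp
qed simp

text \<open>A difference of two squares, centred at the midpoint. It turns the evolution inequality
  into one for the increment \<open>a - b\<close>, which can be divided by the time step.\<close>

lemma half_square_diff:
  fixes a b w :: "'h::real_inner"
  shows "(norm (a - w))\<^sup>2 / 2 - (norm (b - w))\<^sup>2 / 2 = (a - b) \<bullet> ((1/2) *\<^sub>R (a + b) - w)"
proof -
  have "(a - b) \<bullet> ((1/2) *\<^sub>R (a + b) - w) = ((a - b) \<bullet> (a + b)) / 2 - (a - b) \<bullet> w"
    by (simp add: inner_diff_right)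
  then show ?thesis
    by (simp add: power2_norm_eq_inner inner_diff_left inner_diff_right inner_add_right inner_commute field_simps)
qed

section \<open>Convex functionals, subgradients and resolvents\<close>

text \<open>The value infinity is encoded by the complement of \<open>D\<close>, so that
  \<open>\<phi>\<close> is real valued. \<open>closed_sublevel\<close> says both that
  \<open>\<phi>\<close> is lower semicontinuous and that limits of points of bounded energy stay in
  \<open>D\<close>. The subspace \<open>X\<close> models functions supported in a fixed set.\<close>

locale convex_functional =
  fixes X D :: "'h::{real_inner, complete_space} set" and \<phi> :: "'h \<Rightarrow> real"
  assumes subspace_X: "subspace X" and closed_X: "closed X"
    and D_subset: "D \<subseteq> X" and D_nonempty: "D \<noteq> {}"
    and D_convex: "\<And>x y c. x \<in> D \<Longrightarrow> y \<in> D \<Longrightarrow> 0 < c \<Longrightarrow> c < 1 \<Longrightarrow> (1 - c) *\<^sub>R x + c *\<^sub>R y \<in> D"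
    and phi_convex: "\<And>x y c. x \<in> D \<Longrightarrow> y \<in> D \<Longrightarrow> 0 < c \<Longrightarrow> c < 1 \<Longrightarrow>
        \<phi> ((1 - c) *\<^sub>R x + c *\<^sub>R y) \<le> (1 - c) * \<phi> x + c * \<phi> y"
    and closed_sublevel: "\<And>w M x. (\<And>k. w k \<in> D) \<Longrightarrow> (\<And>k. \<phi> (w k) \<le> M) \<Longrightarrow> w \<longlonglongrightarrow> x \<Longrightarrow> x \<in> D \<and> \<phi> x \<le> M"
begin

text \<open>Without the restriction to \<open>X\<close>, every vector orthogonal to \<open>X\<close>
  could be added to a subgradient, since for \<open>u\<close> in \<open>D\<close> all differences
  \<open>w - u\<close> lie in \<open>X\<close>.\<close>

definition sub :: "'h \<Rightarrow> 'h set" where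
  "sub u = {v \<in> X. \<forall>w\<in>D. \<phi> w \<ge> \<phi> u + v \<bullet> (w - u)}"

definition domA :: "'h set" where "domA = {u \<in> D. sub u \<noteq> {}}"

lemma subD: "v \<in> sub u \<Longrightarrow> w \<in> D \<Longrightarrow> \<phi> w \<ge> \<phi> u + v \<bullet> (w - u)"
  by (simp add: sub_def)

lemma sub_X: "v \<in> sub u \<Longrightarrow> v \<in> X"
  by (simp add: sub_def)

lemma domA_D: "x \<in> domA \<Longrightarrow> x \<in> D"
  by (simp add: domA_def)

lemma sub_monotone:
  assumes "v \<in> sub u" "v' \<in> sub u'" "u \<in> D" "u' \<in> D"
  shows "(v - v') \<bullet> (u - u') \<ge> 0"
  using subD[OF assms(1,4)] subD[OF assms(2,3)] by (simp add: algebra_simps inner_commute)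

lemma lsc:
  assumes "\<And>k. w k \<in> D" "\<And>k. \<phi> (w k) \<le> c k" "c \<longlonglongrightarrow> l" "w \<longlonglongrightarrow> x"
  shows "x \<in> D" "\<phi> x \<le> l"
proof -
  have *: "x \<in> D \<and> \<phi> x \<le> l + e" if e: "e > 0" for e
  proof -
    have "eventually (\<lambda>k. c k < l + e) sequentially"
      using order_tendstoD(2)[OF assms(3), of "l + e"] e by simp
    then obtain N where N: "\<And>k. k \<ge> N \<Longrightarrow> c k < l + e" by (auto simp: eventually_sequentially)
    show ?thesis
    proof (rule closed_sublevel)
      show "w (k + N) \<in> D" for k by (rule assms)
      show "\<phi> (w (k + N)) \<le> l + e" for k using assms(2)[of "k+N"] N[of "k+N"] by simp
      show "(\<lambda>k. w (k + N)) \<longlonglongrightarrow> x" using assms(4) by (rule LIMSEQ_ignore_initial_segment)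
    qed
  qed
  show "x \<in> D" using *[of 1] by simp
  show "\<phi> x \<le> l" by (rule field_le_epsilon) (simp add: *)
qed

text \<open>Takes the place of a separating hyperplane. Lower semicontinuity bounds
  \<open>\<phi>\<close> from below by \<open>\<phi> u - 1\<close> on a ball of radius
  \<open>r\<close>; outside, convexity along segments from \<open>u\<close> lets the bound decay at
  most linearly.\<close>

lemma affine_lower_bound:
  assumes u: "u \<in> D"
  obtains r where "r > 0" "\<And>w. w \<in> D \<Longrightarrow> \<phi> w \<ge> \<phi> u - 1 - norm (w - u) / r"
proof -
  have "\<exists>r>0. \<forall>w\<in>D. norm (w - u) \<le> r \<longrightarrow> \<phi> w \<ge> \<phi> u - 1"
  proof (rule ccontr)
    assume neg: "\<not> ?thesis"
    have "\<exists>w\<in>D. norm (w - u) \<le> inverse (real (Suc k)) \<and> \<phi> w \<le> \<phi> u - 1" for k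
    proof -
      have "0 < inverse (real (Suc k))" by simp
      with neg obtain w where "w \<in> D" "norm (w - u) \<le> inverse (real (Suc k))" "\<not> \<phi> u - 1 \<le> \<phi> w" by blast
      then show ?thesis by (intro bexI[of _ w]) auto
    qed
    then obtain w where w: "\<And>k. w k \<in> D" "\<And>k. norm (w k - u) \<le> inverse (real (Suc k))" "\<And>k. \<phi> (w k) \<le> \<phi> u - 1"
      by metis
    have "(\<lambda>k. w k - u) \<longlonglongrightarrow> 0"
      by (rule Lim_null_comparison[OF _ LIMSEQ_inverse_real_of_nat]) (use w(2) in auto)
    then have "w \<longlonglongrightarrow> u" by (simp add: LIM_zero_iff)
    then have "\<phi> u \<le> \<phi> u - 1" using closed_sublevel[of w "\<phi> u - 1" u] w by blast
    then show False by simp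
  qed
  then obtain r where r: "r > 0" "\<And>w. w \<in> D \<Longrightarrow> norm (w - u) \<le> r \<Longrightarrow> \<phi> w \<ge> \<phi> u - 1" by blast
  show thesis
  proof (rule that[OF r(1)])
    fix w assume w: "w \<in> D"
    show "\<phi> w \<ge> \<phi> u - 1 - norm (w - u) / r"
    proof (cases "norm (w - u) \<le> r")
      case True
      have "0 \<le> norm (w - u) / r" using r(1) by simp
      then show ?thesis using r(2)[OF w True] by linarith
    next
      case False
      \<comment> \<open>The point with this parameter on the segment from \<open>u\<close> to
        \<open>w\<close> has distance exactly \<open>r\<close> from \<open>u\<close>.\<close>
      define c where "c = r / norm (w - u)"
      have n: "norm (w - u) > 0" using False r(1) by linarith
      then have c: "0 < c" "c < 1" using False r(1) by (auto simp: c_def divide_simps)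
      have eq: "(1 - c) *\<^sub>R u + c *\<^sub>R w - u = c *\<^sub>R (w - u)" by (simp add: algebra_simps)
      have "norm ((1 - c) *\<^sub>R u + c *\<^sub>R w - u) \<le> r"
        unfolding eq using c n r(1) by (simp add: c_def)
      then have "\<phi> u - 1 \<le> \<phi> ((1 - c) *\<^sub>R u + c *\<^sub>R w)"
        using r(2)[OF D_convex[OF u w c]] by simp
      also have "\<dots> \<le> (1 - c) * \<phi> u + c * \<phi> w" by (rule phi_convex[OF u w c])
      finally have "c * (\<phi> w - \<phi> u) \<ge> - 1" by (simp add: algebra_simps)
      then have "\<phi> w - \<phi> u \<ge> - 1 / c" using c by (simp add: field_simps)
      then show ?thesis by (simp add: c_def)
    qed
  qed
qed

text \<open>\<open>y\<close> minimises \<open>\<psi>\<close>, the functional plus a quadratic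
  penalty. Strict convexity of the penalty makes minimising sequences Cauchy, which takes the place
  of compactness; the subgradient is the optimality condition.\<close>

lemma resolvent_exists:
  assumes l: "l > 0" and x: "x \<in> X"
  shows "\<exists>y\<in>D. (1/l) *\<^sub>R (x - y) \<in> sub y"
proof -
  define \<psi> where "\<psi> w = \<phi> w + (norm (w - x))\<^sup>2 / (2*l)" for w
  obtain u where u: "u \<in> D" using D_nonempty by blast
  obtain r where r: "r > 0" "\<And>w. w \<in> D \<Longrightarrow> \<phi> w \<ge> \<phi> u - 1 - norm (w - u) / r"
    using affine_lower_bound[OF u] by blast
  have low: "\<psi> w \<ge> \<phi> u - 1 - norm (x - u) / r - l / (2 * r\<^sup>2)" if w: "w \<in> D" for w
  proof -
    have "norm (w - u) / r \<le> (norm (w - x) + norm (x - u)) / r"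
      using norm_triangle_ineq[of "w - x" "x - u"] r(1) by (intro divide_right_mono) auto
    \<comment> \<open>Completing the square: the penalty absorbs the linear loss of the affine
      bound.\<close>
    moreover have "0 \<le> (norm (w - x) - l / r)\<^sup>2 / (2 * l)" using l by simp
    then have "norm (w - x) / r \<le> (norm (w - x))\<^sup>2 / (2*l) + l / (2 * r\<^sup>2)"
      using l r(1) by (simp add: power2_eq_square field_simps)
    ultimately show ?thesis using r(2)[OF w] by (simp add: \<psi>_def add_divide_distrib)
  qed
  define m where "m = Inf (\<psi> ` D)"
  have bdd: "bdd_below (\<psi> ` D)" by (rule bdd_belowI2) (rule low)
  have m: "m \<le> \<psi> w" if "w \<in> D" for w
    unfolding m_def using bdd that by (intro cINF_lower) auto
  have "\<exists>w\<in>D. \<psi> w < m + inverse (real (Suc n))" for n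
  proof -
    have "Inf (\<psi> ` D) < m + inverse (real (Suc n))" by (simp add: m_def)
    then show ?thesis using bdd D_nonempty by (subst (asm) cInf_less_iff) auto
  qed
  then obtain s where s: "\<And>n. s n \<in> D" "\<And>n. \<psi> (s n) < m + inverse (real (Suc n))" by metis
  \<comment> \<open>By the parallelogram law the penalty at the midpoint is smaller than the average
    by \<open>(norm (a - b))\<^sup>2 / (8 * l)\<close>, while \<open>\<psi>\<close> is at least
    \<open>m\<close> there.\<close>
  have mid: "(norm (a - b))\<^sup>2 \<le> 8 * l * ((\<psi> a + \<psi> b) / 2 - m)" if ab: "a \<in> D" "b \<in> D" for a b
  proof -
    define c where "c = (1 - 1/2) *\<^sub>R a + (1/2) *\<^sub>R b"
    define N where "N = (norm (c - x))\<^sup>2 / (2*l)"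
    have "m \<le> \<phi> c + N" using m[OF D_convex[OF ab, of "1/2"]] by (simp add: \<psi>_def N_def c_def)
    moreover have "\<phi> c \<le> (1-1/2) * \<phi> a + (1/2) * \<phi> b" using phi_convex[OF ab, of "1/2"] by (simp add: c_def)
    ultimately have "m \<le> (\<phi> a + \<phi> b) / 2 + (norm (c - x))\<^sup>2 / (2*l)"
      unfolding N_def[symmetric] by (simp add: field_simps)
    moreover have "(norm (c - x))\<^sup>2 = (norm (a - x))\<^sup>2 / 2 + (norm (b - x))\<^sup>2 / 2 - (norm (a - b))\<^sup>2 / 4"
      by (simp add: c_def power2_norm_eq_inner inner_diff_left inner_diff_right inner_add_left inner_add_right
          inner_commute field_simps)
    ultimately have "m \<le> (\<phi> a + \<phi> b) / 2 + ((norm (a - x))\<^sup>2 / 2 + (norm (b - x))\<^sup>2 / 2 - (norm (a - b))\<^sup>2 / 4) / (2*l)"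
      by (simp only:)
    then have "8 * l * m \<le> 8 * l * ((\<phi> a + \<phi> b) / 2 + ((norm (a - x))\<^sup>2 / 2 + (norm (b - x))\<^sup>2 / 2 - (norm (a - b))\<^sup>2 / 4) / (2*l))"
      using l by (intro mult_left_mono) auto
    also have "\<dots> = 4 * (l * (\<phi> a + \<phi> b)) + 2 * (norm (a - x))\<^sup>2 + 2 * (norm (b - x))\<^sup>2 - (norm (a - b))\<^sup>2"
      using l by (simp add: field_simps)
    finally have "(norm (a - b))\<^sup>2 \<le> 4 * (l * (\<phi> a + \<phi> b)) + 2 * (norm (a - x))\<^sup>2 + 2 * (norm (b - x))\<^sup>2 - 8 * l * m"
      by simp
    also have "\<dots> = 8 * l * ((\<psi> a + \<psi> b) / 2 - m)"
      using l by (simp add: \<psi>_def field_simps)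
    finally show ?thesis .
  qed
  have "Cauchy s"
  proof (rule Cauchy_norm_diff_sq)
    fix a b :: nat assume ab: "b \<le> a"
    have "inverse (real (Suc a)) \<le> inverse (real (Suc b))" using ab by (simp add: field_simps)
    then have "(\<psi> (s a) + \<psi> (s b)) / 2 - m \<le> inverse (real (Suc b))" using s(2)[of a] s(2)[of b] by argo
    then have "8 * l * ((\<psi> (s a) + \<psi> (s b)) / 2 - m) \<le> 8 * l * inverse (real (Suc b))"
      using l by (intro mult_left_mono) auto
    with mid[OF s(1) s(1), of a b] show "(norm (s a - s b))\<^sup>2 \<le> 8 * l * inverse (real (Suc b))" by linarith
  next
    show "(\<lambda>n. 8 * l * inverse (real (Suc n))) \<longlonglongrightarrow> 0"
      using tendsto_mult[OF tendsto_const LIMSEQ_inverse_real_of_nat, of "8 * l"] by simp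
  qed
  then obtain y where y: "s \<longlonglongrightarrow> y" by (auto simp: Cauchy_convergent_iff convergent_def)
  have le: "\<phi> (s n) \<le> m + inverse (real (Suc n)) - (norm (s n - x))\<^sup>2 / (2*l)" for n
    using s(2)[of n] by (simp add: \<psi>_def)
  have lim: "(\<lambda>n. m + inverse (real (Suc n)) - (norm (s n - x))\<^sup>2 / (2*l)) \<longlonglongrightarrow> m + 0 - (norm (y - x))\<^sup>2 / (2*l)"
    using l by (intro tendsto_intros y LIMSEQ_inverse_real_of_nat) auto
  have yD: "y \<in> D" and yle: "\<psi> y \<le> m"
    using lsc[OF s(1) le lim y] by (auto simp: \<psi>_def)
  have "(1/l) *\<^sub>R (x - y) \<in> X"
    using x yD D_subset subspace_X by (intro subspace_scale subspace_diff) auto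
  moreover have "\<phi> w \<ge> \<phi> y + (1/l) *\<^sub>R (x - y) \<bullet> (w - y)" if w: "w \<in> D" for w
  proof -
    define K where "K = \<phi> w - \<phi> y - (1/l) *\<^sub>R (x - y) \<bullet> (w - y)"
    define B where "B = (norm (w - y))\<^sup>2 / (2*l)"
    \<comment> \<open>Minimality of \<open>y\<close> against points of the segment to
      \<open>w\<close>, divided by the parameter \<open>c\<close>; letting \<open>c\<close> tend to
      0 leaves the subgradient inequality.\<close>
    have KB: "0 \<le> K + c * B" if c: "0 < c" "c < 1" for c
    proof -
      let ?c = "(1 - c) *\<^sub>R y + c *\<^sub>R w"
      have "\<psi> y \<le> \<psi> ?c" using yle m[OF D_convex[OF yD w c]] by simp
      also have "\<dots> \<le> (1 - c) * \<phi> y + c * \<phi> w + (norm (?c - x))\<^sup>2 / (2*l)"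
        using phi_convex[OF yD w c] by (simp add: \<psi>_def)
      also have "(norm (?c - x))\<^sup>2 = (norm (y - x))\<^sup>2 - 2 * c * ((x - y) \<bullet> (w - y)) + c * c * (norm (w - y))\<^sup>2"
        by (simp add: power2_norm_eq_inner algebra_simps inner_commute)
      finally have "0 \<le> c * (\<phi> w - \<phi> y) + (- 2 * c * ((x - y) \<bullet> (w - y)) + c * c * (norm (w - y))\<^sup>2) / (2*l)"
        by (simp add: \<psi>_def add_divide_distrib diff_divide_distrib algebra_simps)
      also have "\<dots> = c * (K + c * B)"
        unfolding K_def B_def inner_scaleR_left using l by (simp add: field_simps)
      finally show ?thesis using c by (simp add: zero_le_mult_iff)
    qed
    have "0 \<le> K"
    proof (rule LIMSEQ_le_const)
      show "(\<lambda>n. K + inverse (real (Suc n)) * B) \<longlonglongrightarrow> K"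
        using tendsto_add[OF tendsto_const tendsto_mult[OF LIMSEQ_inverse_real_of_nat tendsto_const], of K B] by simp
      show "\<exists>N. \<forall>n\<ge>N. 0 \<le> K + inverse (real (Suc n)) * B"
        by (intro exI[of _ 1] allI impI KB) (auto simp: field_simps)
    qed
    then show ?thesis by (simp add: K_def)
  qed
  ultimately show ?thesis using yD by (auto simp: sub_def)
qed

text \<open>The resolvent of \<open>sub\<close>, that is one implicit Euler step of length
  \<open>l\<close> for the flow.\<close>

definition J :: "real \<Rightarrow> 'h \<Rightarrow> 'h" where
  "J l x = (SOME y. y \<in> D \<and> (1/l) *\<^sub>R (x - y) \<in> sub y)"

lemma J:
  assumes "l > 0" "x \<in> X"
  shows "J l x \<in> D" "(1/l) *\<^sub>R (x - J l x) \<in> sub (J l x)"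
  using someI_ex[of "\<lambda>y. y \<in> D \<and> (1/l) *\<^sub>R (x - y) \<in> sub y"] resolvent_exists[OF assms]
  unfolding J_def by auto

lemma J_X: "l > 0 \<Longrightarrow> x \<in> X \<Longrightarrow> J l x \<in> X"
  using J(1) D_subset by auto

lemma J_iter_X: "l > 0 \<Longrightarrow> x \<in> X \<Longrightarrow> (J l ^^ n) x \<in> X"
  by (induction n) (auto intro: J_X)

lemma J_iter_D: "l > 0 \<Longrightarrow> x \<in> D \<Longrightarrow> (J l ^^ n) x \<in> D"
  using D_subset by (induction n) (auto intro: J(1))

text \<open>
  This inequality between resolvents with different parameters drives the double induction
  of Crandall and Liggett.
\<close>

lemma resolvent_inequality:
  assumes l: "l > 0" and m: "m > 0" and x: "x \<in> X" and y: "y \<in> X"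
  shows "(l + m) * (norm (J l x - J m y))\<^sup>2 \<le> m * (norm (x - J m y))\<^sup>2 + l * (norm (J l x - y))\<^sup>2"
proof -
  define a b where "a = J l x" and "b = J m y"
  have "0 \<le> ((1/l) *\<^sub>R (x - a) - (1/m) *\<^sub>R (y - b)) \<bullet> (a - b)"
    unfolding a_def b_def by (intro sub_monotone J l m x y)
  then have "0 \<le> (l * m) * (((1/l) *\<^sub>R (x - a) - (1/m) *\<^sub>R (y - b)) \<bullet> (a - b))"
    using l m by simp
  also have "\<dots> = m * ((x - a) \<bullet> (a - b)) - l * ((y - b) \<bullet> (a - b))"
    using l m by (simp only: inner_diff_left[of "(1/l) *\<^sub>R _"] right_diff_distrib inner_scaleR_left) simp
  also have "\<dots> = m * ((x - b) \<bullet> (a - b)) + l * ((a - y) \<bullet> (a - b)) - (l + m) * (norm (a - b))\<^sup>2"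
    by (simp add: power2_norm_eq_inner algebra_simps)
  also have "\<dots> \<le> m * ((norm (x - b))\<^sup>2 + (norm (a - b))\<^sup>2) / 2 + l * ((norm (a - y))\<^sup>2 + (norm (a - b))\<^sup>2) / 2
      - (l + m) * (norm (a - b))\<^sup>2"
  proof -
    have "p \<bullet> q \<le> ((norm p)\<^sup>2 + (norm q)\<^sup>2) / 2" for p q :: 'h
      using zero_le_power2[of "norm (p - q)"] unfolding power2_norm_eq_inner
      by (simp add: algebra_simps inner_commute)
    then have "m * ((x - b) \<bullet> (a - b)) \<le> m * (((norm (x - b))\<^sup>2 + (norm (a - b))\<^sup>2) / 2)"
      "l * ((a - y) \<bullet> (a - b)) \<le> l * (((norm (a - y))\<^sup>2 + (norm (a - b))\<^sup>2) / 2)"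
      using l m by (intro mult_left_mono; simp)+
    then show ?thesis by simp
  qed
  finally show ?thesis unfolding a_def[symmetric] b_def[symmetric] by (simp add: field_simps)
qed

section \<open>Slopes and the subgradient of minimal norm\<close>

text \<open>A bound on the descending slope at \<open>x\<close>, written globally thanks to
  convexity. Limits of difference quotients deliver this property, and
  \<open>slope_imp_domA\<close>, the converse of \<open>slope_le_sub\<close>, turns it into a
  subgradient of norm at most \<open>L\<close>.\<close>

definition slope_le :: "'h \<Rightarrow> real \<Rightarrow> bool" where
  "slope_le x L \<longleftrightarrow> (\<forall>w\<in>D. \<phi> x - L * norm (w - x) \<le> \<phi> w)"

lemma slope_le_sub: "v \<in> sub x \<Longrightarrow> slope_le x (norm v)"
  unfolding slope_le_def
proof
  fix w assume "v \<in> sub x" "w \<in> D"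
  then have "\<phi> w \<ge> \<phi> x + v \<bullet> (w - x)" by (rule subD)
  moreover have "\<bar>v \<bullet> (w - x)\<bar> \<le> norm v * norm (w - x)" by (rule Cauchy_Schwarz_ineq2)
  ultimately show "\<phi> x - norm v * norm (w - x) \<le> \<phi> w" by linarith
qed

text \<open>The energy drop from \<open>x\<close> to \<open>J l x\<close> is at least
  \<open>(norm (x - J l x))\<^sup>2 / l\<close> by the subgradient inequality at
  \<open>J l x\<close> tested with \<open>x\<close>, and at most \<open>L * norm (x - J l x)\<close>
  by the slope.\<close>

lemma resolvent_slope:
  assumes x: "x \<in> D" and L: "slope_le x L" and L0: "0 \<le> L" and l: "l > 0"
  shows "norm ((1/l) *\<^sub>R (x - J l x)) \<le> L"
proof -
  have xX: "x \<in> X" using x D_subset by auto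
  have "\<phi> x \<ge> \<phi> (J l x) + (1/l) *\<^sub>R (x - J l x) \<bullet> (x - J l x)" by (rule subD[OF J(2)[OF l xX] x])
  moreover have "\<phi> (J l x) \<ge> \<phi> x - L * norm (J l x - x)" using L J(1)[OF l xX] by (auto simp: slope_le_def)
  ultimately have "(1/l) * (norm (x - J l x))\<^sup>2 \<le> L * norm (x - J l x)"
    by (simp add: power2_norm_eq_inner norm_minus_commute)
  then have "(1/l) * norm (x - J l x) \<le> L \<or> norm (x - J l x) = 0"
    using mult_le_cancel_right_pos[of "norm (x - J l x)" "(1/l) * norm (x - J l x)" L]
    by (cases "x = J l x") (simp_all add: power2_eq_square mult.assoc)
  then show ?thesis using l L0 by auto
qed

lemma domA_resolvent:
  assumes "x \<in> domA" "v \<in> sub x" "l > 0"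
  shows "norm (x - J l x) \<le> l * norm v"
  using resolvent_slope[OF domA_D[OF assms(1)] slope_le_sub[OF assms(2)] norm_ge_zero assms(3)] assms(3)
  by (simp add: pos_divide_le_eq mult.commute)

lemma J_fixed_nonexpansive:
  assumes l: "l > 0" and x: "x \<in> X" and y: "y \<in> X"
  shows "norm (J l x - J l y) \<le> norm (x - y)"
proof -
  have "0 \<le> ((1/l) *\<^sub>R (x - J l x) - (1/l) *\<^sub>R (y - J l y)) \<bullet> (J l x - J l y)"
    by (intro sub_monotone J l x y)
  also have "\<dots> = (1/l) * (((x - J l x) - (y - J l y)) \<bullet> (J l x - J l y))"
    by (simp only: scaleR_diff_right[symmetric] inner_scaleR_left)
  finally have "0 \<le> ((x - J l x) - (y - J l y)) \<bullet> (J l x - J l y)"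
    using l by (simp add: zero_le_divide_iff)
  also have "\<dots> = (x - y) \<bullet> (J l x - J l y) - (norm (J l x - J l y))\<^sup>2"
    by (simp add: power2_norm_eq_inner algebra_simps)
  also have "\<dots> \<le> norm (x - y) * norm (J l x - J l y) - (norm (J l x - J l y))\<^sup>2"
    using norm_cauchy_schwarz by simp
  finally show ?thesis
    by (cases "J l x = J l y") (simp_all add: power2_eq_square)
qed

definition yosida :: "nat \<Rightarrow> 'h \<Rightarrow> 'h" where
  "yosida n x = real (Suc n) *\<^sub>R (x - J (inverse (real (Suc n))) x)"

lemma yosida_eq: "yosida n x = (1 / inverse (real (Suc n))) *\<^sub>R (x - J (inverse (real (Suc n))) x)"
  by (simp add: yosida_def divide_inverse)

lemma J_eq_yosida: "J (inverse (real (Suc n))) x = x - inverse (real (Suc n)) *\<^sub>R yosida n x"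
  by (simp add: yosida_def)

text \<open>Defined as the limit of the Yosida approximations and not as a minimiser of the norm:
  existence of a subgradient, minimality and strong approximation then come together in
  \<open>slope_imp_domA\<close>.\<close>

definition A0 :: "'h \<Rightarrow> 'h" where "A0 x = lim (\<lambda>n. yosida n x)"

text \<open>The Yosida approximations are bounded by \<open>L\<close>, and by monotonicity their
  squared norms increase, with differences that dominate the squared distances. So boundedness alone
  gives strong convergence; the limit is a subgradient by lower semicontinuity.\<close>

lemma slope_imp_domA:
  assumes x: "x \<in> D" and L: "slope_le x L" and L0: "0 \<le> L"
  shows "x \<in> domA" "(\<lambda>n. yosida n x) \<longlonglongrightarrow> A0 x" "A0 x \<in> sub x" "norm (A0 x) \<le> L"
proof -
  have xX: "x \<in> X" using x D_subset by auto
  let ?a = "\<lambda>n. yosida n x" and ?l = "\<lambda>n. inverse (real (Suc n))"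
  have lpos: "?l n > 0" for n by simp
  have aL: "norm (?a n) \<le> L" for n
    unfolding yosida_eq by (rule resolvent_slope[OF x L L0 lpos])
  have asub: "?a n \<in> sub (J (?l n) x)" for n
    unfolding yosida_eq by (rule J(2)[OF lpos xX])
  \<comment> \<open>Since \<open>J (?l n) x = x - ?l n *\<^sub>R ?a n\<close>, monotonicity pairs
    \<open>?a m - ?a n\<close> with \<open>?l n *\<^sub>R ?a n - ?l m *\<^sub>R ?a m\<close>. This
    forces \<open>(?a m - ?a n) \<bullet> ?a n\<close> to be nonnegative.\<close>
  have diff: "(norm (?a m - ?a n))\<^sup>2 \<le> (norm (?a m))\<^sup>2 - (norm (?a n))\<^sup>2" if nm: "n \<le> m" for m n
  proof -
    have ll: "?l m \<le> ?l n" using nm by (simp add: field_simps)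
    have "0 \<le> (?a m - ?a n) \<bullet> (J (?l m) x - J (?l n) x)"
      by (intro sub_monotone asub J lpos xX)
    also have "\<dots> = (?l n - ?l m) * ((?a m - ?a n) \<bullet> ?a n) - ?l m * (norm (?a m - ?a n))\<^sup>2"
      unfolding J_eq_yosida power2_norm_eq_inner by (simp add: algebra_simps inner_commute)
    finally have *: "?l m * (norm (?a m - ?a n))\<^sup>2 \<le> (?l n - ?l m) * ((?a m - ?a n) \<bullet> ?a n)" by simp
    have "0 \<le> (?a m - ?a n) \<bullet> ?a n"
    proof (cases "m = n")
      case False
      then have "?l m < ?l n" using nm by (simp add: field_simps)
      moreover have "0 \<le> ?l m * (norm (?a m - ?a n))\<^sup>2" by simp
      ultimately show ?thesis using * by (smt (verit) mult_pos_neg)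
    qed simp
    then show ?thesis by (simp add: power2_norm_eq_inner algebra_simps inner_commute)
  qed
  have conv: "convergent (\<lambda>n. (norm (?a n))\<^sup>2)"
  proof (rule Bseq_mono_convergent)
    show "Bseq (\<lambda>n. (norm (?a n))\<^sup>2)"
      by (rule BseqI'[of _ "L\<^sup>2"]) (use aL in \<open>auto intro!: power_mono\<close>)
    show "\<forall>m n. m \<le> n \<longrightarrow> (norm (?a m))\<^sup>2 \<le> (norm (?a n))\<^sup>2"
    proof (intro allI impI)
      fix m n :: nat assume "m \<le> n"
      from diff[OF this] show "(norm (?a m))\<^sup>2 \<le> (norm (?a n))\<^sup>2"
        using zero_le_power2[of "norm (?a n - ?a m)"] by linarith
    qed
  qed
  then obtain l where l: "(\<lambda>n. (norm (?a n))\<^sup>2) \<longlonglongrightarrow> l" by (auto simp: convergent_def)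
  have le_l: "(norm (?a m))\<^sup>2 \<le> l" for m
  proof (rule LIMSEQ_le_const[OF l])
    show "\<exists>N. \<forall>n\<ge>N. (norm (?a m))\<^sup>2 \<le> (norm (?a n))\<^sup>2"
    proof (intro exI allI impI)
      fix n :: nat assume "m \<le> n"
      from diff[OF this] show "(norm (?a m))\<^sup>2 \<le> (norm (?a n))\<^sup>2"
        using zero_le_power2[of "norm (?a n - ?a m)"] by linarith
    qed
  qed
  have "Cauchy ?a"
  proof (rule Cauchy_norm_diff_sq)
    show "(norm (?a m - ?a n))\<^sup>2 \<le> l - (norm (?a n))\<^sup>2" if "n \<le> m" for m n
      using diff[OF that] le_l[of m] by linarith
    show "(\<lambda>n. l - (norm (?a n))\<^sup>2) \<longlonglongrightarrow> 0"
      using tendsto_diff[OF tendsto_const l, of l] by simp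
  qed
  then show lim: "?a \<longlonglongrightarrow> A0 x"
    unfolding A0_def by (simp add: Cauchy_convergent_iff convergent_LIMSEQ_iff)
  show "norm (A0 x) \<le> L"
    by (rule LIMSEQ_le_const2[OF tendsto_norm[OF lim]]) (use aL in auto)
  have Jlim: "(\<lambda>n. J (?l n) x) \<longlonglongrightarrow> x"
    unfolding J_eq_yosida
    using tendsto_diff[OF tendsto_const tendsto_scaleR[OF LIMSEQ_inverse_real_of_nat lim], of x] by simp
  have "A0 x \<in> X"
    by (rule closed_sequentially[OF closed_X _ lim]) (use sub_X[OF asub] in auto)
  moreover have "\<phi> w \<ge> \<phi> x + A0 x \<bullet> (w - x)" if w: "w \<in> D" for w
  proof -
    have "\<phi> (J (?l n) x) \<le> \<phi> w - ?a n \<bullet> (w - J (?l n) x)" for n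
      using subD[OF asub w, of n] by simp
    moreover have "(\<lambda>n. \<phi> w - ?a n \<bullet> (w - J (?l n) x)) \<longlonglongrightarrow> \<phi> w - A0 x \<bullet> (w - x)"
      by (intro tendsto_intros lim Jlim)
    ultimately have "\<phi> x \<le> \<phi> w - A0 x \<bullet> (w - x)"
      by (rule lsc(2)[OF J(1)[OF lpos xX] _ _ Jlim])
    then show ?thesis by simp
  qed
  ultimately show "A0 x \<in> sub x" by (simp add: sub_def)
  then show "x \<in> domA" using x by (auto simp: domA_def)
qed

lemma A0:
  assumes "x \<in> domA"
  shows "(\<lambda>n. yosida n x) \<longlonglongrightarrow> A0 x" "A0 x \<in> sub x" "z \<in> sub x \<Longrightarrow> norm (A0 x) \<le> norm z"
proof -
  obtain v where v: "v \<in> sub x" using assms by (auto simp: domA_def)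
  note * = slope_imp_domA[OF domA_D[OF assms] slope_le_sub norm_ge_zero]
  show "(\<lambda>n. yosida n x) \<longlonglongrightarrow> A0 x" "A0 x \<in> sub x" using *[OF v] by auto
  show "z \<in> sub x \<Longrightarrow> norm (A0 x) \<le> norm z" using * by auto
qed

text \<open>
  Elements of the approximate subdifferentials that are no longer than \<open>A0 x\<close> converge strongly to it.
  This replaces weak compactness: testing with the resolvents shows \<open>q \<bullet> yosida n x\<close> to be at
  least \<open>(norm (yosida n x))\<^sup>2\<close> up to an error.
\<close>

lemma tendsto_A0:
  assumes x: "x \<in> domA" and e: "(e \<longlongrightarrow> 0) G"
    and q: "\<And>k w. w \<in> D \<Longrightarrow> \<phi> w \<ge> \<phi> x + q k \<bullet> (w - x) - e k"
    and qn: "\<And>k. norm (q k) \<le> norm (A0 x)"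
  shows "(q \<longlongrightarrow> A0 x) G"
proof -
  have xD: "x \<in> D" and xX: "x \<in> X" using x D_subset domA_D by auto
  let ?v = "A0 x" and ?a = "\<lambda>n. yosida n x" and ?l = "\<lambda>n. inverse (real (Suc n))"
  have lpos: "?l n > 0" for n by simp
  have bound: "(norm (q k - ?v))\<^sup>2 \<le>
      2 * ((norm ?v)\<^sup>2 - (norm (?a n))\<^sup>2 + norm ?v * norm (?a n - ?v)) + 2 * real (Suc n) * e k" for n k
  proof -
    define E where "E = real (Suc n) * e k"
    have "\<phi> (J (?l n) x) \<ge> \<phi> x + q k \<bullet> (J (?l n) x - x) - e k"
      by (rule q[OF J(1)[OF lpos xX]])
    moreover have "\<phi> x \<ge> \<phi> (J (?l n) x) + ?a n \<bullet> (x - J (?l n) x)"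
      unfolding yosida_eq by (rule subD[OF J(2)[OF lpos xX] xD])
    ultimately have "?l n * (norm (?a n))\<^sup>2 \<le> ?l n * (q k \<bullet> ?a n) + e k"
      unfolding J_eq_yosida power2_norm_eq_inner by simp
    then have "real (Suc n) * (?l n * (norm (?a n))\<^sup>2) \<le> real (Suc n) * (?l n * (q k \<bullet> ?a n) + e k)"
      by (intro mult_left_mono) auto
    then have "(norm (?a n))\<^sup>2 \<le> q k \<bullet> ?a n + real (Suc n) * e k"
      by (simp only: distrib_left mult.assoc[symmetric]) simp
    also have "q k \<bullet> ?a n = q k \<bullet> ?v + q k \<bullet> (?a n - ?v)" by (simp add: algebra_simps)
    also have "q k \<bullet> (?a n - ?v) \<le> norm ?v * norm (?a n - ?v)"
      using norm_cauchy_schwarz[of "q k" "?a n - ?v"] mult_right_mono[OF qn[of k] norm_ge_zero[of "?a n - ?v"]]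
      by linarith
    finally have f1: "(norm (?a n))\<^sup>2 \<le> q k \<bullet> ?v + norm ?v * norm (?a n - ?v) + E" by (simp add: E_def)
    have f2: "(norm (q k))\<^sup>2 \<le> (norm ?v)\<^sup>2" using qn by (intro power_mono) auto
    have f3: "(norm (q k - ?v))\<^sup>2 = (norm (q k))\<^sup>2 + (norm ?v)\<^sup>2 - 2 * (q k \<bullet> ?v)"
      by (simp add: power2_norm_eq_inner algebra_simps inner_commute)
    have "(norm (q k - ?v))\<^sup>2 \<le>
        2 * ((norm ?v)\<^sup>2 - (norm (?a n))\<^sup>2 + norm ?v * norm (?a n - ?v)) + 2 * E"
    proof -
      have "z \<le> 2 * (V - a + d) + 2 * E" if "a \<le> b + d + E" "n \<le> V" "z = n + V - 2 * b"
        for z V a d E b n :: real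
        using that by simp
      then show ?thesis using f1 f2 f3 by blast
    qed
    then show ?thesis by (simp only: E_def mult.assoc)
  qed
  have lim: "(\<lambda>n. 2 * ((norm ?v)\<^sup>2 - (norm (?a n))\<^sup>2 + norm ?v * norm (?a n - ?v))) \<longlonglongrightarrow>
      2 * ((norm ?v)\<^sup>2 - (norm ?v)\<^sup>2 + norm ?v * norm (?v - ?v))"
    by (intro tendsto_intros A0(1)[OF x])
  show ?thesis
  proof (rule tendstoI)
    fix r :: real assume r: "0 < r"
    \<comment> \<open>The index \<open>n\<close> has to be fixed before the limit along
      \<open>G\<close> is taken, because the error \<open>e k\<close> enters with the factor
      \<open>Suc n\<close>.\<close>
    have "eventually (\<lambda>n. 2 * ((norm ?v)\<^sup>2 - (norm (?a n))\<^sup>2 + norm ?v * norm (?a n - ?v)) < r\<^sup>2 / 2) sequentially"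
      using r by (intro order_tendstoD(2)[OF lim]) auto
    then obtain n where n: "2 * ((norm ?v)\<^sup>2 - (norm (?a n))\<^sup>2 + norm ?v * norm (?a n - ?v)) < r\<^sup>2 / 2"
      by (auto simp: eventually_sequentially)
    have "((\<lambda>k. 2 * real (Suc n) * e k) \<longlongrightarrow> 2 * real (Suc n) * 0) G"
      by (intro tendsto_intros e)
    then have "eventually (\<lambda>k. 2 * real (Suc n) * e k < r\<^sup>2 / 2) G"
      using r by (intro order_tendstoD(2)) auto
    then show "eventually (\<lambda>k. dist (q k) ?v < r) G"
    proof eventually_elim
      case (elim k)
      have "(norm (q k - ?v))\<^sup>2 < r\<^sup>2" using bound[of k n] n elim by linarith
      then show ?case using r by (simp add: dist_norm power2_less_imp_less)
    qed
  qed
qed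

text \<open>\<open>tendsto_A0\<close> for a constant sequence with error 0.\<close>

lemma A0_unique:
  assumes x: "x \<in> domA" and z: "z \<in> sub x" "norm z \<le> norm (A0 x)"
  shows "z = A0 x"
proof -
  have "((\<lambda>k::nat. z) \<longlongrightarrow> A0 x) sequentially"
    by (rule tendsto_A0[OF x tendsto_const]) (use subD[OF z(1)] z(2) in auto)
  then show ?thesis by (simp add: LIMSEQ_const_iff)
qed

lemma convex_sub: "convex (sub x)"
proof (rule convexI)
  fix v w and a b :: real
  assume v: "v \<in> sub x" and w: "w \<in> sub x" and ab: "0 \<le> a" "0 \<le> b" "a + b = 1"
  have "a *\<^sub>R v + b *\<^sub>R w \<in> X"
    using v w by (intro subspace_add subspace_scale subspace_X sub_X)
  moreover have "\<phi> y \<ge> \<phi> x + (a *\<^sub>R v + b *\<^sub>R w) \<bullet> (y - x)" if y: "y \<in> D" for y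
  proof -
    have "a * \<phi> y + b * \<phi> y \<ge> a * (\<phi> x + v \<bullet> (y - x)) + b * (\<phi> x + w \<bullet> (y - x))"
      by (intro add_mono mult_left_mono ab subD[OF v y] subD[OF w y])
    also have "a * \<phi> y + b * \<phi> y = \<phi> y" using ab(3) by (metis distrib_right mult_1)
    finally have "a * \<phi> x + b * \<phi> x + (a *\<^sub>R v + b *\<^sub>R w) \<bullet> (y - x) \<le> \<phi> y"
      by (simp add: inner_add_left distrib_left)
    also have "a * \<phi> x + b * \<phi> x = \<phi> x" using ab(3) by (metis distrib_right mult_1)
    finally show ?thesis .
  qed
  ultimately show "a *\<^sub>R v + b *\<^sub>R w \<in> sub x" by (simp add: sub_def)
qed

lemma closed_sub: "closed (sub x)"
proof -
  have "sub x = X \<inter> (\<Inter>w\<in>D. {v. v \<bullet> (w - x) \<le> \<phi> w - \<phi> x})"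
    by (auto simp: sub_def algebra_simps)
  moreover have "closed {v. v \<bullet> (w - x) \<le> \<phi> w - \<phi> x}" for w
    by (intro closed_Collect_le continuous_intros)
  ultimately show ?thesis using closed_X by (auto intro!: closed_Int closed_INT)
qed

section \<open>Convergence of the implicit Euler scheme and the evolution inequality\<close>

text \<open>The quadratic expression in \<open>i\<close> and \<open>j\<close> solves the recursion
  of \<open>resolvent_inequality\<close> with equality, so the double induction loses nothing. On
  the borders \<open>i = 0\<close> and \<open>j = 0\<close> it suffices that every step moves by at
  most its length times \<open>norm v\<close>.\<close>

lemma crandall_liggett:
  assumes x: "x \<in> domA" and v: "v \<in> sub x" and l: "l > 0" and m: "m > 0"
  shows "(norm ((J l ^^ i) x - (J m ^^ j) x))\<^sup>2 \<le>
    ((real i * l - real j * m)\<^sup>2 + real i * l\<^sup>2 + real j * m\<^sup>2) * (norm v)\<^sup>2"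
proof -
  have xX: "x \<in> X" using x domA_D D_subset by auto
  have base: "norm ((J l ^^ i) x - x) \<le> real i * l * norm v" if l: "l > 0" for l i
  proof -
    have step: "norm ((J l ^^ Suc i) x - (J l ^^ i) x) \<le> l * norm v" for i
    proof (induction i)
      case 0 show ?case using domA_resolvent[OF x v l] by (simp add: norm_minus_commute)
    next
      case (Suc i)
      have "norm (J l ((J l ^^ Suc i) x) - J l ((J l ^^ i) x)) \<le> norm ((J l ^^ Suc i) x - (J l ^^ i) x)"
        by (intro J_fixed_nonexpansive J_iter_X l xX)
      then show ?case using Suc by simp
    qed
    show ?thesis
    proof (induction i)
      case (Suc i)
      have "norm ((J l ^^ Suc i) x - x) \<le> norm ((J l ^^ Suc i) x - (J l ^^ i) x) + norm ((J l ^^ i) x - x)"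
        using norm_triangle_ineq[of "(J l ^^ Suc i) x - (J l ^^ i) x" "(J l ^^ i) x - x"] by simp
      then show ?case using step[of i] Suc by (simp add: algebra_simps)
    qed simp
  qed
  have base2: "(norm ((J l ^^ i) x - x))\<^sup>2 \<le> ((real i * l)\<^sup>2 + real i * l\<^sup>2) * (norm v)\<^sup>2" if l: "l > 0" for l i
  proof -
    have "(norm ((J l ^^ i) x - x))\<^sup>2 \<le> (real i * l * norm v)\<^sup>2"
      using base[OF l] by (intro power_mono) auto
    also have "\<dots> \<le> ((real i * l)\<^sup>2 + real i * l\<^sup>2) * (norm v)\<^sup>2"
      by (simp add: power_mult_distrib distrib_right)
    finally show ?thesis .
  qed
  show ?thesis
  proof (induction i arbitrary: j)
    case 0 show ?case using base2[OF m, of j] by (simp add: norm_minus_commute)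
  next
    case (Suc i)
    note IHi = Suc
    show ?case
    proof (induction j)
      case 0 show ?case using base2[OF l, of "Suc i"] by simp
    next
      case (Suc j)
      let ?N = "(norm v)\<^sup>2"
      have "(l + m) * (norm (J l ((J l ^^ i) x) - J m ((J m ^^ j) x)))\<^sup>2 \<le>
         m * (norm ((J l ^^ i) x - J m ((J m ^^ j) x)))\<^sup>2 + l * (norm (J l ((J l ^^ i) x) - (J m ^^ j) x))\<^sup>2"
        by (intro resolvent_inequality l m J_iter_X xX)
      also have "\<dots> \<le> m * (((real i * l - real (Suc j) * m)\<^sup>2 + real i * l\<^sup>2 + real (Suc j) * m\<^sup>2) * ?N)
          + l * (((real (Suc i) * l - real j * m)\<^sup>2 + real (Suc i) * l\<^sup>2 + real j * m\<^sup>2) * ?N)"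
        using IHi[of "Suc j"] Suc l m by (intro add_mono mult_left_mono) auto
      also have "\<dots> = (l + m) * (((real (Suc i) * l - real (Suc j) * m)\<^sup>2 + real (Suc i) * l\<^sup>2 + real (Suc j) * m\<^sup>2) * ?N)"
        by (simp add: power2_eq_square algebra_simps)
      finally show ?case using l m by (simp add: mult_le_cancel_left_pos)
    qed
  qed
qed

definition evi :: "(real \<Rightarrow> 'h) \<Rightarrow> bool" where
  "evi u \<longleftrightarrow> continuous_on {0..} u \<and> (\<forall>t>0. u t \<in> D) \<and>
    (\<forall>w\<in>D. \<forall>s t. 0 \<le> s \<longrightarrow> s < t \<longrightarrow>
       (norm (u t - w))\<^sup>2 / 2 - (norm (u s - w))\<^sup>2 / 2 \<le> (t - s) * (\<phi> w - \<phi> (u t)))"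

lemma evi_cont: "evi u \<Longrightarrow> continuous_on {0..} u"
  and evi_D: "evi u \<Longrightarrow> t > 0 \<Longrightarrow> u t \<in> D"
  and evi_ineq: "evi u \<Longrightarrow> w \<in> D \<Longrightarrow> 0 \<le> s \<Longrightarrow> s < t \<Longrightarrow>
    (norm (u t - w))\<^sup>2 / 2 - (norm (u s - w))\<^sup>2 / 2 \<le> (t - s) * (\<phi> w - \<phi> (u t))"
  by (auto simp: evi_def)

text \<open>Dividing by the time step isolates \<open>\<phi> (u k t)\<close> below a convergent
  bound, so that closed sublevel sets yield membership of the limit in \<open>D\<close> and the
  inequality at once. The step \<open>d k\<close> may vary because discrete times only approximate
  \<open>t - s\<close>.\<close>

lemma evi_limit:
  assumes ut: "\<And>k. u k t \<in> D"
    and le: "\<And>k. (norm (u k t - w))\<^sup>2 / 2 - (norm (u k s - w))\<^sup>2 / 2 \<le> d k * (\<phi> w - \<phi> (u k t))"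
    and d: "\<And>k. d k > 0" "d \<longlonglongrightarrow> t - s" "s < t"
    and lim: "(\<lambda>k. u k t) \<longlonglongrightarrow> v t" "(\<lambda>k. u k s) \<longlonglongrightarrow> v s"
  shows "v t \<in> D" "(norm (v t - w))\<^sup>2 / 2 - (norm (v s - w))\<^sup>2 / 2 \<le> (t - s) * (\<phi> w - \<phi> (v t))"
proof -
  let ?c = "\<lambda>k. \<phi> w - ((norm (u k t - w))\<^sup>2 / 2 - (norm (u k s - w))\<^sup>2 / 2) / d k"
  have "\<phi> (u k t) \<le> ?c k" for k
    using le[of k] d(1)[of k] by (simp add: field_simps)
  moreover have "?c \<longlonglongrightarrow> \<phi> w - ((norm (v t - w))\<^sup>2 / 2 - (norm (v s - w))\<^sup>2 / 2) / (t - s)"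
    using d by (intro tendsto_intros lim) auto
  ultimately have *: "v t \<in> D" "\<phi> (v t) \<le> \<phi> w - ((norm (v t - w))\<^sup>2 / 2 - (norm (v s - w))\<^sup>2 / 2) / (t - s)"
    by (rule lsc[OF ut _ _ lim(1)])+
  then show "v t \<in> D" by simp
  have "((norm (v t - w))\<^sup>2 / 2 - (norm (v s - w))\<^sup>2 / 2) / (t - s) \<le> \<phi> w - \<phi> (v t)" using *(2) by simp
  then show "(norm (v t - w))\<^sup>2 / 2 - (norm (v s - w))\<^sup>2 / 2 \<le> (t - s) * (\<phi> w - \<phi> (v t))"
    using d(3) by (simp add: pos_divide_le_eq mult.commute)
qed

text \<open>For a single step this is the subgradient inequality with the square of the increment
  discarded. The energy decreases along the iteration, so in the sum over the steps every value may
  be replaced by the last one.\<close>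

lemma evi_discrete:
  assumes l: "l > 0" and x: "x \<in> D" and w: "w \<in> D" and ij: "i \<le> j"
  shows "(norm ((J l ^^ j) x - w))\<^sup>2 / 2 - (norm ((J l ^^ i) x - w))\<^sup>2 / 2
    \<le> real (j - i) * l * (\<phi> w - \<phi> ((J l ^^ j) x))"
  using ij
proof (induction j rule: dec_induct)
  case (step j)
  let ?y = "(J l ^^ j) x" and ?z = "J l ((J l ^^ j) x)"
  have y: "?y \<in> D" "?y \<in> X" using J_iter_D[OF l x] D_subset by auto
  have sz: "(1/l) *\<^sub>R (?y - ?z) \<in> sub ?z" by (rule J(2)[OF l y(2)])
  have 1: "(norm (?z - w))\<^sup>2 / 2 - (norm (?y - w))\<^sup>2 / 2 \<le> l * (\<phi> w - \<phi> ?z)"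
  proof -
    have "\<phi> w \<ge> \<phi> ?z + (1/l) * ((?y - ?z) \<bullet> (w - ?z))" using subD[OF sz w] by simp
    then have "(?y - ?z) \<bullet> (w - ?z) \<le> l * (\<phi> w - \<phi> ?z)" using l by (simp add: field_simps)
    moreover have "(norm (?z - w))\<^sup>2 / 2 - (norm (?y - w))\<^sup>2 / 2 \<le> (?y - ?z) \<bullet> (w - ?z)"
      using zero_le_power2[of "norm (?y - ?z)"]
      by (simp add: power2_norm_eq_inner inner_diff_left inner_diff_right inner_commute field_simps)
    ultimately show ?thesis by linarith
  qed
  have "\<phi> ?y \<ge> \<phi> ?z + (1/l) * ((?y - ?z) \<bullet> (?y - ?z))" using subD[OF sz y(1)] by simp
  moreover have "0 \<le> (1/l) * ((?y - ?z) \<bullet> (?y - ?z))" using l by simp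
  ultimately have "\<phi> ?z \<le> \<phi> ?y" by linarith
  then have "real (j - i) * l * (\<phi> w - \<phi> ?y) \<le> real (j - i) * l * (\<phi> w - \<phi> ?z)"
    using l by (intro mult_left_mono) auto
  then have "(norm (?z - w))\<^sup>2 / 2 - (norm ((J l ^^ i) x - w))\<^sup>2 / 2
      \<le> real (j - i) * l * (\<phi> w - \<phi> ?z) + l * (\<phi> w - \<phi> ?z)"
    using 1 step.IH by linarith
  also have "\<dots> = real (Suc j - i) * l * (\<phi> w - \<phi> ?z)"
    using step.hyps by (simp add: Suc_diff_le algebra_simps)
  finally show ?case by simp
qed simp

text \<open>\<open>u\<close> is the limit of implicit Euler schemes with step
  \<open>1 / (k + 1)\<close>. By \<open>crandall_liggett\<close> they are Cauchy at every time, and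
  the limit is Lipschitz with constant \<open>norm v\<close> for every subgradient \<open>v\<close>
  of \<open>x\<close>.\<close>

lemma evi_exists_domA:
  assumes x: "x \<in> domA"
  shows "\<exists>u. evi u \<and> u 0 = x \<and> (\<forall>v\<in>sub x. \<forall>t\<ge>0. norm (u t - x) \<le> t * norm v)"
proof -
  define l where "l k = inverse (real (Suc k))" for k
  have l: "l k > 0" for k by (simp add: l_def)
  have l0: "l \<longlonglongrightarrow> 0" unfolding l_def by (rule LIMSEQ_inverse_real_of_nat)
  \<comment> \<open>The number of steps of length \<open>l k\<close> that fit into
    \<open>[0, t]\<close>; thus \<open>N k t * l k\<close> misses \<open>t\<close> by at most
    \<open>l k\<close>.\<close>
  define N where "N k t = nat \<lfloor>t * real (Suc k)\<rfloor>" for k t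
  have Nt: "\<bar>real (N k t) * l k - t\<bar> \<le> l k" "real (N k t) * l k \<le> t" if "t \<ge> 0" for k t
  proof -
    have N: "real (N k t) \<le> t * real (Suc k)" "t * real (Suc k) < real (N k t) + 1"
      unfolding N_def using that by (auto simp: of_nat_floor)
    have "real (N k t) * l k \<le> t * real (Suc k) * l k" "t * real (Suc k) * l k \<le> (real (N k t) + 1) * l k"
      using N l[of k] by (intro mult_right_mono; simp)+
    moreover have "t * real (Suc k) * l k = t" by (simp add: l_def)
    ultimately show "\<bar>real (N k t) * l k - t\<bar> \<le> l k" "real (N k t) * l k \<le> t"
      by (auto simp: algebra_simps)
  qed
  have Nlim: "(\<lambda>k. real (N k t) * l k) \<longlonglongrightarrow> t" if "t \<ge> 0" for t
  proof -
    have "(\<lambda>k. real (N k t) * l k - t) \<longlonglongrightarrow> 0"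
      by (rule Lim_null_comparison[OF _ l0]) (use Nt(1)[OF that] in auto)
    then show ?thesis by (simp add: LIM_zero_iff)
  qed
  have Nlim2: "(\<lambda>k. real (N k t) * (l k)\<^sup>2) \<longlonglongrightarrow> 0" if "t \<ge> 0" for t
    using tendsto_mult[OF Nlim[OF that] l0] by (simp add: power2_eq_square mult.assoc)
  define U where "U k t = (J (l k) ^^ N k t) x" for k t
  have xD: "x \<in> D" by (rule domA_D[OF x])
  have CL: "(norm (U k s - U k' t))\<^sup>2 \<le> ((real (N k s) * l k - real (N k' t) * l k')\<^sup>2
      + real (N k s) * (l k)\<^sup>2 + real (N k' t) * (l k')\<^sup>2) * (norm v)\<^sup>2" if "v \<in> sub x" for k k' s t v
    unfolding U_def by (rule crandall_liggett[OF x that l l])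
  obtain v0 where v0: "v0 \<in> sub x" using x by (auto simp: domA_def)
  have "convergent (\<lambda>k. U k t)" if t: "t \<ge> 0" for t
  proof -
    have "Cauchy (\<lambda>k. U k t)"
    proof (rule Cauchy_norm_diff_sq)
      fix m n :: nat assume nm: "n \<le> m"
      have lmn: "l m \<le> l n" using nm by (simp add: l_def field_simps)
      have "\<bar>real (N m t) * l m - real (N n t) * l n\<bar> \<le> 2 * l n"
        using Nt(1)[OF t, of m] Nt(1)[OF t, of n] lmn by linarith
      then have "(real (N m t) * l m - real (N n t) * l n)\<^sup>2 \<le> (2 * l n)\<^sup>2" by (rule power2_le_iff_abs_le[THEN iffD2, rotated]) (use l[of n] in simp)
      moreover have "real (N m t) * (l m)\<^sup>2 \<le> t * l n"
        using mult_mono[OF Nt(2)[OF t, of m] lmn t] l[of m] by (simp add: power2_eq_square mult.assoc)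
      moreover have "real (N n t) * (l n)\<^sup>2 \<le> t * l n"
        using mult_right_mono[OF Nt(2)[OF t, of n], of "l n"] l[of n] by (simp add: power2_eq_square mult.assoc)
      ultimately have "((real (N m t) * l m - real (N n t) * l n)\<^sup>2 + real (N m t) * (l m)\<^sup>2 + real (N n t) * (l n)\<^sup>2)
          * (norm v0)\<^sup>2 \<le> ((2 * l n)\<^sup>2 + t * l n + t * l n) * (norm v0)\<^sup>2"
        by (intro mult_right_mono) auto
      with CL[OF v0, of m t n t] show "(norm (U m t - U n t))\<^sup>2 \<le> ((2 * l n)\<^sup>2 + t * l n + t * l n) * (norm v0)\<^sup>2" by linarith
    next
      have "(\<lambda>n. ((2 * l n)\<^sup>2 + t * l n + t * l n) * (norm v0)\<^sup>2) \<longlonglongrightarrow> ((2 * 0)\<^sup>2 + t * 0 + t * 0) * (norm v0)\<^sup>2"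
        by (intro tendsto_intros l0)
      then show "(\<lambda>n. ((2 * l n)\<^sup>2 + t * l n + t * l n) * (norm v0)\<^sup>2) \<longlonglongrightarrow> 0" by simp
    qed
    then show ?thesis by (simp add: Cauchy_convergent_iff)
  qed
  define u where "u t = lim (\<lambda>k. U k t)" for t
  have lim: "(\<lambda>k. U k t) \<longlonglongrightarrow> u t" if "t \<ge> 0" for t
    using \<open>\<And>t. t \<ge> 0 \<Longrightarrow> convergent (\<lambda>k. U k t)\<close>[OF that] by (simp add: u_def convergent_LIMSEQ_iff)
  have lip: "norm (u s - u t) \<le> \<bar>s - t\<bar> * norm v" if st: "s \<ge> 0" "t \<ge> 0" and v: "v \<in> sub x" for s t v
  proof -
    have "(\<lambda>k. ((real (N k s) * l k - real (N k t) * l k)\<^sup>2 + real (N k s) * (l k)\<^sup>2 + real (N k t) * (l k)\<^sup>2)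
        * (norm v)\<^sup>2) \<longlonglongrightarrow> ((s - t)\<^sup>2 + 0 + 0) * (norm v)\<^sup>2"
      by (intro tendsto_intros Nlim Nlim2 st)
    moreover have "(\<lambda>k. (norm (U k s - U k t))\<^sup>2) \<longlonglongrightarrow> (norm (u s - u t))\<^sup>2"
      by (intro tendsto_intros lim st)
    ultimately have "(norm (u s - u t))\<^sup>2 \<le> ((s - t)\<^sup>2 + 0 + 0) * (norm v)\<^sup>2"
      by (intro LIMSEQ_le) (use CL[OF v] in auto)
    then have "(norm (u s - u t))\<^sup>2 \<le> (\<bar>s - t\<bar> * norm v)\<^sup>2" by (simp add: power_mult_distrib)
    then show ?thesis by (rule power2_le_imp_le) simp
  qed
  have u0: "u 0 = x"
    using lim[of 0] by (simp add: U_def N_def LIMSEQ_const_iff)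
  have evi1: "u t \<in> D \<and> (norm (u t - w))\<^sup>2 / 2 - (norm (u s - w))\<^sup>2 / 2 \<le> (t - s) * (\<phi> w - \<phi> (u t))"
    if w: "w \<in> D" and st: "0 \<le> s" "s < t" for w s t
  proof -
    have t0: "t \<ge> 0" using st by simp
    have dl: "(\<lambda>k. real (N k t - N k s) * l k) \<longlonglongrightarrow> t - s"
    proof -
      have "N k s \<le> N k t" for k unfolding N_def using st by (intro nat_mono floor_mono mult_right_mono) auto
      then have "(\<lambda>k. real (N k t - N k s) * l k) = (\<lambda>k. real (N k t) * l k - real (N k s) * l k)"
        by (simp add: of_nat_diff left_diff_distrib)
      then show ?thesis using tendsto_diff[OF Nlim[OF t0] Nlim[OF st(1)]] by simp
    qed
    \<comment> \<open>For coarse steps \<open>s\<close> and \<open>t\<close> may be rounded to the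
      same grid point. Shifting the index past these leaves a positive time step, which
      \<open>evi_limit\<close> divides by.\<close>
    then have "eventually (\<lambda>k. real (N k t - N k s) * l k > 0) sequentially"
      using st by (intro order_tendstoD(1)) auto
    then obtain K where K: "\<And>k. k \<ge> K \<Longrightarrow> real (N k t - N k s) * l k > 0"
      by (auto simp: eventually_sequentially)
    have le: "(norm (U (k + K) t - w))\<^sup>2 / 2 - (norm (U (k + K) s - w))\<^sup>2 / 2
        \<le> (real (N (k+K) t - N (k+K) s) * l (k+K)) * (\<phi> w - \<phi> (U (k + K) t))" for k
      unfolding U_def
      using st by (intro evi_discrete l xD w) (auto simp: N_def intro!: nat_mono floor_mono mult_right_mono)
    have UD: "U (k + K) t \<in> D" for k unfolding U_def by (rule J_iter_D[OF l xD])
    note L = evi_limit[of "\<lambda>k. U (k + K)" t w s, OF UD le K LIMSEQ_ignore_initial_segment[OF dl] st(2)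
        LIMSEQ_ignore_initial_segment[OF lim[OF t0]] LIMSEQ_ignore_initial_segment[OF lim[OF st(1)]]]
    show ?thesis using L by auto
  qed
  have "continuous_on {0..} u"
  proof (rule lipschitz_on_continuous_on)
    show "(norm v0)-lipschitz_on {0..} u"
      using lip v0 by (intro lipschitz_onI) (auto simp: dist_norm mult.commute)
  qed
  show ?thesis
  proof (intro exI[of _ u] conjI ballI allI impI u0)
    show "evi u" unfolding evi_def
      using \<open>continuous_on {0..} u\<close> evi1 xD by auto
    show "norm (u t - x) \<le> t * norm v" if "v \<in> sub x" "0 \<le> t" for t v
      using lip[OF that(2) order_refl that(1)] that(2) u0 by simp
  qed
qed


section \<open>Contraction, uniqueness and existence for all initial values\<close>

text \<open>On \<open>[a, b]\<close> the inequality for \<open>u\<close> is tested with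
  \<open>v a\<close> and the one for \<open>v\<close> with \<open>u b\<close>. The mixed distances
  cancel and the energies combine to \<open>\<phi> (v a) - \<phi> (v b)\<close>, an error that
  \<open>le_if_increments_le\<close> removes. Time 0 is reached by continuity, since the energy may
  be infinite there.\<close>

lemma evi_contraction:
  assumes u: "evi u" and v: "evi v" and st: "0 \<le> s" "s \<le> t"
  shows "norm (u t - v t) \<le> norm (u s - v s)"
proof -
  let ?f = "\<lambda>t. (norm (u t - v t))\<^sup>2 / 2"
  have pos: "norm (u t - v t) \<le> norm (u s - v s)" if st: "0 < s" "s \<le> t" for s
  proof -
    have "?f t \<le> ?f s"
    proof (rule le_if_increments_le[OF st(2), where G="\<lambda>t. \<phi> (v t)"])
      fix a b assume ab: "s \<le> a" "a < b" "b \<le> t"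
      have a0: "0 < a" "0 \<le> a" "0 < b" using st ab by auto
      have "(norm (u b - v a))\<^sup>2 / 2 - (norm (u a - v a))\<^sup>2 / 2 \<le> (b - a) * (\<phi> (v a) - \<phi> (u b))"
        by (rule evi_ineq[OF u evi_D[OF v a0(1)] a0(2) ab(2)])
      moreover have "(norm (v b - u b))\<^sup>2 / 2 - (norm (v a - u b))\<^sup>2 / 2 \<le> (b - a) * (\<phi> (u b) - \<phi> (v b))"
        by (rule evi_ineq[OF v evi_D[OF u a0(3)] a0(2) ab(2)])
      ultimately show "?f b - ?f a \<le> (b - a) * (\<phi> (v a) - \<phi> (v b))"
        by (simp add: norm_minus_commute algebra_simps)
    qed
    then show ?thesis by (simp add: power2_le_iff_abs_le)
  qed
  show ?thesis
  proof (cases "s = 0")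
    case False then show ?thesis using pos st by simp
  next
    case True
    show ?thesis
    proof (cases "t = 0")
      case False
      then have t: "0 < t" using st by simp
      let ?r = "\<lambda>n. t * inverse (real (Suc n))"
      have r: "0 < ?r n" "?r n \<le> t" for n using t by (auto simp: field_simps)
      have rl: "?r \<longlonglongrightarrow> 0" using tendsto_mult[OF tendsto_const LIMSEQ_inverse_real_of_nat, of t] by simp
      have "(\<lambda>n. u (?r n)) \<longlonglongrightarrow> u 0" "(\<lambda>n. v (?r n)) \<longlonglongrightarrow> v 0"
        using continuous_on_tendsto_compose[OF evi_cont[OF u] rl] continuous_on_tendsto_compose[OF evi_cont[OF v] rl] r(1)
        by (auto simp: less_imp_le)
      then have "(\<lambda>n. norm (u (?r n) - v (?r n))) \<longlonglongrightarrow> norm (u 0 - v 0)"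
        by (intro tendsto_intros)
      then have "norm (u t - v t) \<le> norm (u 0 - v 0)"
        by (rule LIMSEQ_le_const) (use pos r in auto)
      then show ?thesis using True by simp
    qed (use True in simp)
  qed
qed

text \<open>The resolvents of \<open>x\<close> lie in \<open>domA\<close> and tend to
  \<open>x\<close>: their subgradient inequality tested with \<open>x\<close> bounds the squared
  displacement by the step length times an energy drop, and the affine lower bound limits this
  drop.\<close>

lemma D_subset_closure_domA: "D \<subseteq> closure domA"
proof
  fix x assume x: "x \<in> D"
  then have xX: "x \<in> X" using D_subset by auto
  obtain r where r: "r > 0" "\<And>w. w \<in> D \<Longrightarrow> \<phi> w \<ge> \<phi> x - 1 - norm (w - x) / r"
    using affine_lower_bound[OF x] by blast
  let ?l = "\<lambda>n. inverse (real (Suc n))"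
  have lpos: "?l n > 0" for n by simp
  have le: "(norm (J (?l n) x - x))\<^sup>2 \<le> 2 * ?l n + (?l n / r)\<^sup>2" for n
  proof -
    let ?d = "norm (J (?l n) x - x)"
    have "\<phi> x \<ge> \<phi> (J (?l n) x) + (1/?l n) *\<^sub>R (x - J (?l n) x) \<bullet> (x - J (?l n) x)"
      by (rule subD[OF J(2)[OF lpos xX] x])
    also have "(1/?l n) *\<^sub>R (x - J (?l n) x) \<bullet> (x - J (?l n) x) = (1/?l n) * ?d\<^sup>2"
      by (simp only: inner_scaleR_left power2_norm_eq_inner[symmetric] norm_minus_commute)
    finally have "(1/?l n) * ?d\<^sup>2 \<le> 1 + ?d / r" using r(2)[OF J(1)[OF lpos xX], of n] by linarith
    then have "?l n * ((1/?l n) * ?d\<^sup>2) \<le> ?l n * (1 + ?d / r)" by (intro mult_left_mono) auto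
    moreover have "?l n * ((1/?l n) * ?d\<^sup>2) = ?d\<^sup>2" by simp
    moreover have "?l n * (1 + ?d / r) = ?l n + ?d * (?l n / r)" by (simp add: distrib_left)
    ultimately have "?d\<^sup>2 \<le> ?l n + ?d * (?l n / r)" by (simp only:)
    moreover have "0 \<le> (?d - ?l n / r)\<^sup>2" by simp
    then have "?d * (?l n / r) \<le> ?d\<^sup>2 / 2 + (?l n / r)\<^sup>2 / 2"
      by (simp only: power2_diff)
    ultimately show ?thesis by linarith
  qed
  have "(\<lambda>n. 2 * ?l n + (?l n / r)\<^sup>2) \<longlonglongrightarrow> 2 * 0 + (0 / r)\<^sup>2"
    using r(1) by (intro tendsto_intros LIMSEQ_inverse_real_of_nat) auto
  then have lim: "(\<lambda>n. 2 * ?l n + (?l n / r)\<^sup>2) \<longlonglongrightarrow> 0" by simp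
  have "(\<lambda>n. (norm (J (?l n) x - x))\<^sup>2) \<longlonglongrightarrow> 0"
    by (rule Lim_null_comparison[OF _ lim]) (use le in simp)
  then have "(\<lambda>n. sqrt ((norm (J (?l n) x - x))\<^sup>2)) \<longlonglongrightarrow> sqrt 0" by (rule tendsto_real_sqrt)
  then have "(\<lambda>n. J (?l n) x - x) \<longlonglongrightarrow> 0"
    by (simp add: tendsto_norm_zero_iff)
  then have "(\<lambda>n. J (?l n) x) \<longlonglongrightarrow> x" by (simp add: LIM_zero_iff)
  moreover have "J (?l n) x \<in> domA" for n
    using J[OF lpos xX, of n] by (auto simp: domA_def)
  ultimately show "x \<in> closure domA"
    unfolding closure_sequential by (intro exI[of _ "\<lambda>n. J (?l n) x"] conjI allI)
qed

text \<open>By contraction the flows from approximating initial values in \<open>domA\<close> are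
  uniformly Cauchy on the whole half-line, and the evolution inequality is stable under such
  limits.\<close>

lemma evi_exists:
  assumes x: "x \<in> closure D"
  shows "\<exists>u. evi u \<and> u 0 = x"
proof -
  have "x \<in> closure domA"
    using x closure_mono[OF D_subset_closure_domA] by auto
  then obtain y where y: "\<And>k. y k \<in> domA" "y \<longlonglongrightarrow> x"
    unfolding closure_sequential by auto
  have "\<exists>u. evi u \<and> u 0 = y k" for k using evi_exists_domA[OF y(1)] by blast
  then obtain U where U: "\<And>k. evi (U k)" "\<And>k. U k 0 = y k" by metis
  have dist: "norm (U k t - U j t) \<le> norm (y k - y j)" if "t \<ge> 0" for k j t
    using evi_contraction[OF U(1) U(1) order_refl that, of k j] U(2) by simp
  have cy: "Cauchy y" using y(2) by (rule LIMSEQ_imp_Cauchy)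
  have uc: "uniformly_Cauchy_on {0..} U"
    unfolding uniformly_Cauchy_on_def
  proof (intro allI impI)
    fix e :: real assume "e > 0"
    then obtain M where M: "\<And>m n. m \<ge> M \<Longrightarrow> n \<ge> M \<Longrightarrow> dist (y m) (y n) < e"
      using cy by (metis metric_CauchyD)
    then show "\<exists>M. \<forall>t\<in>{0..}. \<forall>m\<ge>M. \<forall>n\<ge>M. dist (U m t) (U n t) < e"
    proof (intro exI ballI allI impI)
      fix t m n assume "t \<in> {0::real..}" "M \<le> m" "M \<le> n"
      then show "dist (U m t) (U n t) < e"
        using dist[of t m n] M[of m n] by (simp add: dist_norm)
    qed
  qed
  then obtain u where u: "uniform_limit {0..} U u sequentially"
    using uniformly_convergent_eq_Cauchy uniformly_convergent_on_def by (metis Cauchy_uniformly_convergent)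
  have lim: "(\<lambda>k. U k t) \<longlonglongrightarrow> u t" if "t \<ge> 0" for t
    using tendsto_uniform_limitI[OF u] that by auto
  have cont: "continuous_on {0..} u"
    by (rule uniform_limit_theorem[OF _ u]) (auto intro: always_eventually evi_cont U(1))
  have ev: "u t \<in> D \<and> (norm (u t - w))\<^sup>2 / 2 - (norm (u s - w))\<^sup>2 / 2 \<le> (t - s) * (\<phi> w - \<phi> (u t))"
    if w: "w \<in> D" and st: "0 \<le> s" "s < t" for w s t
  proof -
    have t: "t > 0" "t \<ge> 0" using st by auto
    note L = evi_limit[of U t w s "\<lambda>k. t - s" u, OF evi_D[OF U(1) t(1)] evi_ineq[OF U(1) w st] _ tendsto_const st(2)
        lim[OF t(2)] lim[OF st(1)]]
    show ?thesis using L st by auto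
  qed
  have "u 0 = x" using LIMSEQ_unique[OF lim[of 0]] y(2) U(2) by simp
  moreover have "evi u" unfolding evi_def using cont ev D_nonempty by auto
  ultimately show ?thesis by blast
qed

lemma evi_unique:
  assumes "evi u" "evi v" "u 0 = v 0" "t \<ge> 0"
  shows "u t = v t"
  using evi_contraction[OF assms(1,2) order_refl assms(4)] assms(3) by simp

lemma evi_shift:
  assumes u: "evi u" and a: "0 \<le> a"
  shows "evi (\<lambda>t. u (t + a))"
  unfolding evi_def
proof (intro conjI allI impI ballI)
  show "continuous_on {0..} (\<lambda>t. u (t + a))"
    using a by (intro continuous_on_compose2[OF evi_cont[OF u]] continuous_intros) auto
  show "u (t + a) \<in> D" if "t > 0" for t using a that by (intro evi_D[OF u]) auto
  show "(norm (u (t + a) - w))\<^sup>2 / 2 - (norm (u (s + a) - w))\<^sup>2 / 2 \<le> (t - s) * (\<phi> w - \<phi> (u (t + a)))"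
    if "w \<in> D" "0 \<le> s" "s < t" for s t w
    using evi_ineq[OF u that(1), of "s + a" "t + a"] that a by simp
qed

section \<open>Energy decay, speed and smoothing\<close>

text \<open>The case \<open>w = u s\<close> of the inequality; at time 0 it is available only if the
  initial value has finite energy.\<close>

lemma evi_phi_decrease:
  assumes u: "evi u" and st: "0 \<le> s" "s \<le> t" and us: "u s \<in> D"
  shows "(norm (u t - u s))\<^sup>2 / 2 \<le> (t - s) * (\<phi> (u s) - \<phi> (u t))" "\<phi> (u t) \<le> \<phi> (u s)"
proof -
  show *: "(norm (u t - u s))\<^sup>2 / 2 \<le> (t - s) * (\<phi> (u s) - \<phi> (u t))"
    using evi_ineq[OF u us st(1), of t] st by (cases "s = t") auto
  show "\<phi> (u t) \<le> \<phi> (u s)"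
  proof (cases "s = t")
    case False
    then have "0 < t - s" using st by simp
    moreover have "0 \<le> (t - s) * (\<phi> (u s) - \<phi> (u t))" using * zero_le_power2[of "norm (u t - u s)"] by linarith
    ultimately show ?thesis by (simp add: zero_le_mult_iff)
  qed simp
qed

text \<open>The time shift of a flow is a flow, so contraction applies to the pair.\<close>

lemma evi_increment_antimono:
  assumes u: "evi u" and st: "0 \<le> s" "s \<le> t" and h: "0 \<le> h"
  shows "norm (u (t + h) - u t) \<le> norm (u (s + h) - u s)"
  using evi_contraction[OF evi_shift[OF u h] u st] by simp

text \<open>By uniqueness the flow after time \<open>t\<close> is the one constructed from Euler
  schemes started at \<open>u t\<close>, and the displacement of that one is controlled by any
  subgradient at \<open>u t\<close>.\<close>

lemma evi_increment_le:
  assumes u: "evi u" and t: "0 \<le> t" and d: "u t \<in> domA" and v: "v \<in> sub (u t)" and h: "0 \<le> h"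
  shows "norm (u (t + h) - u t) \<le> h * norm v"
proof -
  obtain U where U: "evi U" "U 0 = u t" "\<And>h. 0 \<le> h \<Longrightarrow> norm (U h - u t) \<le> h * norm v"
    using evi_exists_domA[OF d] v by blast
  have "u (h + t) = U h"
    by (rule evi_unique[OF evi_shift[OF u t] U(1) _ h]) (simp add: U(2))
  then show ?thesis using U(3)[OF h] by (simp add: add.commute)
qed

text \<open>Converts a bound on the speed into a bound on the slope. After
  \<open>half_square_diff\<close> the inequality on \<open>[t, t + h n]\<close> can be divided by
  \<open>h n\<close>, and only the energy at \<open>t + h n\<close> remains to be passed to the
  limit by lower semicontinuity. In particular finite energy at \<open>t\<close> is a
  conclusion.\<close>

lemma evi_slope_le:
  assumes u: "evi u" and t: "0 \<le> t" and C: "0 \<le> C"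
    and h: "h \<longlonglongrightarrow> 0" "\<And>n. 0 < h n" "\<And>n. norm (u (t + h n) - u t) \<le> C * h n"
  shows "u t \<in> D" "slope_le (u t) C"
proof -
  have th: "0 < t + h n" for n using t h(2)[of n] by simp
  have lim: "(\<lambda>n. u (t + h n)) \<longlonglongrightarrow> u t"
  proof (rule continuous_on_tendsto_compose[OF evi_cont[OF u]])
    show "(\<lambda>n. t + h n) \<longlonglongrightarrow> t" using tendsto_add[OF tendsto_const h(1), of t] by simp
  qed (use t th in \<open>auto simp: less_imp_le\<close>)
  have *: "u t \<in> D \<and> \<phi> (u t) \<le> \<phi> w + C * norm (u t - w)" if w: "w \<in> D" for w
  proof -
    have le: "\<phi> (u (t + h n)) \<le> \<phi> w + C * norm ((1/2) *\<^sub>R (u (t + h n) + u t) - w)" for n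
    proof -
      let ?m = "(1/2) *\<^sub>R (u (t + h n) + u t) - w"
      have "(u (t + h n) - u t) \<bullet> ?m \<le> (t + h n - t) * (\<phi> w - \<phi> (u (t + h n)))"
        using evi_ineq[OF u w t, of "t + h n"] h(2)[of n] half_square_diff[of "u (t + h n)" w "u t"] by simp
      moreover have "- ((C * h n) * norm ?m) \<le> (u (t + h n) - u t) \<bullet> ?m"
        using Cauchy_Schwarz_ineq2[of "u (t + h n) - u t" ?m] mult_right_mono[OF h(3)[of n], of "norm ?m"] by simp
      ultimately have "h n * (- (C * norm ?m)) \<le> h n * (\<phi> w - \<phi> (u (t + h n)))"
        by (simp add: mult_ac)
      then have "- (C * norm ?m) \<le> \<phi> w - \<phi> (u (t + h n))" using h(2)[of n] by (simp only: mult_le_cancel_left_pos)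
      then show ?thesis by linarith
    qed
    have "(\<lambda>n. \<phi> w + C * norm ((1/2) *\<^sub>R (u (t + h n) + u t) - w)) \<longlonglongrightarrow>
        \<phi> w + C * norm ((1/2) *\<^sub>R (u t + u t) - w)"
      by (intro tendsto_intros lim)
    moreover have "(1/2) *\<^sub>R (u t + u t) = u t" by (simp add: scaleR_2[symmetric])
    ultimately have L: "(\<lambda>n. \<phi> w + C * norm ((1/2) *\<^sub>R (u (t + h n) + u t) - w)) \<longlonglongrightarrow> \<phi> w + C * norm (u t - w)"
      by simp
    show ?thesis using lsc[OF evi_D[OF u th] le L lim] by simp
  qed
  show "u t \<in> D" using * D_nonempty by blast
  show "slope_le (u t) C" unfolding slope_le_def
    using * by (auto simp: norm_minus_commute algebra_simps)
qed

text \<open>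
  Smoothing: the increments over a fixed step decrease in time, and the sum of their squares is
  controlled by the decrease of the functional.
\<close>

lemma evi_domA:
  assumes u: "evi u" and t: "0 < t"
  shows "u t \<in> domA"
proof -
  define K where "K = \<phi> (u (t/2)) - \<phi> (u t)"
  \<comment> \<open>On the grid from \<open>t / 2\<close> to \<open>t\<close> with
    \<open>n + 1\<close> steps of length \<open>h n\<close>, every squared increment dominates the
    one at \<open>t\<close>; hence \<open>(n + 1) * (norm (u (t + h n) - u t))\<^sup>2 / 2 \<le> h n
    * K\<close>. As \<open>(n + 1) * h n = t / 2\<close>, the speed at \<open>t\<close> is at most
    \<open>C\<close>.\<close>
  define C where "C = sqrt (4 * K / t)"
  define h where "h n = t / 2 * inverse (real (Suc n))" for n
  have h: "0 < h n" for n using t by (simp add: h_def)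
  have K: "0 \<le> K" unfolding K_def using evi_phi_decrease(2)[OF u, of "t/2" t] evi_D[OF u, of "t/2"] t by simp
  have C: "0 \<le> C" using K t by (simp add: C_def)
  have hl: "h \<longlonglongrightarrow> 0" unfolding h_def
    using tendsto_mult[OF tendsto_const LIMSEQ_inverse_real_of_nat, of "t/2"] by simp
  have inc: "norm (u (t + h n) - u t) \<le> C * h n" for n
  proof -
    define s where "s k = t/2 + real k * h n" for k
    have s0: "s 0 = t / 2" "s (Suc n) = t" by (simp_all add: s_def h_def field_simps)
    have sS: "s (Suc k) = s k + h n" for k by (simp add: s_def algebra_simps)
    have spos: "0 < s k" for k using t h[of n] by (simp add: s_def add_pos_nonneg less_imp_le)
    have sle: "s k \<le> t" if "k \<le> n" for k
    proof -
      have "real k * h n \<le> real (Suc n) * h n" using that h[of n] by (intro mult_right_mono) auto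
      then show ?thesis using s0(2) by (simp add: s_def)
    qed
    let ?d = "(norm (u (t + h n) - u t))\<^sup>2 / 2"
    have "real (Suc n) * ?d = (\<Sum>k<Suc n. ?d)" by simp
    also have "\<dots> \<le> (\<Sum>k<Suc n. h n * (\<phi> (u (s k)) - \<phi> (u (s (Suc k)))))"
    proof (rule sum_mono)
      fix k assume "k \<in> {..<Suc n}"
      then have "norm (u (t + h n) - u t) \<le> norm (u (s k + h n) - u (s k))"
        using sle[of k] spos[of k] h[of n] by (intro evi_increment_antimono[OF u]) (auto simp: less_imp_le)
      then have "?d \<le> (norm (u (s (Suc k)) - u (s k)))\<^sup>2 / 2"
        by (simp add: sS power_mono)
      also have "\<dots> \<le> (s (Suc k) - s k) * (\<phi> (u (s k)) - \<phi> (u (s (Suc k))))"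
        using spos[of k] h[of n] by (intro evi_phi_decrease(1)[OF u] evi_D[OF u]) (auto simp: sS)
      finally show "?d \<le> h n * (\<phi> (u (s k)) - \<phi> (u (s (Suc k))))" by (simp add: sS)
    qed
    also have "\<dots> = h n * K"
      unfolding sum_distrib_left[symmetric] by (subst sum_lessThan_telescope') (simp add: s0 K_def)
    finally have "h n * (real (Suc n) * ?d) \<le> h n * (h n * K)" using h[of n] by (intro mult_left_mono) auto
    moreover have "h n * (real (Suc n) * ?d) = t / 4 * (norm (u (t + h n) - u t))\<^sup>2"
      by (simp add: h_def field_simps)
    ultimately have "(norm (u (t + h n) - u t))\<^sup>2 \<le> (4 * K / t) * (h n)\<^sup>2"
      using t by (simp add: field_simps power2_eq_square)
    also have "\<dots> = (C * h n)\<^sup>2" using K t by (simp add: C_def power_mult_distrib)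
    finally show ?thesis using C h[of n] by (auto intro: power2_le_imp_le)
  qed
  have "u t \<in> D" "slope_le (u t) C" using evi_slope_le[OF u _ C hl h inc] t by auto
  then show ?thesis using slope_imp_domA(1) C by blast
qed

section \<open>Right derivatives of the flow and of its energy\<close>

text \<open>The increments at \<open>t\<close> are bounded by those at \<open>s\<close>, hence by
  \<open>norm (A0 (u s))\<close> times the step; \<open>evi_slope_le\<close> reads this as a slope
  bound at \<open>t\<close>.\<close>

lemma evi_A0_antimono:
  assumes u: "evi u" and st: "0 \<le> s" "s \<le> t" and us: "u s \<in> domA"
  shows "u t \<in> domA" "norm (A0 (u t)) \<le> norm (A0 (u s))"
proof -
  let ?h = "\<lambda>n. inverse (real (Suc n))"
  have inc: "norm (u (t + ?h n) - u t) \<le> norm (A0 (u s)) * ?h n" for n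
    using evi_increment_antimono[OF u st, of "?h n"] evi_increment_le[OF u st(1) us A0(2)[OF us], of "?h n"]
    by (simp add: mult.commute)
  have "u t \<in> D" "slope_le (u t) (norm (A0 (u s)))"
    using evi_slope_le[OF u _ norm_ge_zero LIMSEQ_inverse_real_of_nat _ inc] st by auto
  then show "u t \<in> domA" "norm (A0 (u t)) \<le> norm (A0 (u s))"
    using slope_imp_domA(1,4) by auto
qed

lemma evi_lipschitz:
  assumes u: "evi u" and a: "0 \<le> a" "u a \<in> domA" and st: "a \<le> s" "a \<le> t"
  shows "norm (u t - u s) \<le> norm (A0 (u a)) * \<bar>t - s\<bar>"
proof -
  have *: "norm (u t - u s) \<le> norm (A0 (u a)) * (t - s)" if "a \<le> s" "s \<le> t" for s t
    using evi_increment_antimono[OF u a(1) that(1), of "t - s"] evi_increment_le[OF u a A0(2)[OF a(2)], of "t - s"] that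
    by (simp add: mult.commute)
  show ?thesis
  proof (cases "s \<le> t")
    case True then show ?thesis using *[of s t] st by simp
  next
    case False then show ?thesis using *[of t s] st by (simp add: norm_minus_commute)
  qed
qed

text \<open>The vectors \<open>A0 (u (t + h n))\<close> are no longer than \<open>A0 (u t)\<close>.
  Since \<open>u\<close> and its energy change little, they are subgradients at \<open>u t\<close>
  up to an error of order \<open>h n\<close>, so \<open>tendsto_A0\<close> applies.\<close>

lemma evi_A0_right_continuous:
  assumes u: "evi u" and t: "0 \<le> t" "u t \<in> domA" and h: "h \<longlonglongrightarrow> 0" "\<And>n. 0 < h n"
  shows "(\<lambda>n. A0 (u (t + h n))) \<longlonglongrightarrow> A0 (u t)"
proof (rule tendsto_A0[OF t(2)])
  let ?v = "A0 (u t)"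
  have lim: "(\<lambda>n. 2 * (norm ?v * (norm ?v * h n))) \<longlonglongrightarrow> 2 * (norm ?v * (norm ?v * 0))"
    by (intro tendsto_intros h(1))
  then show "(\<lambda>n. 2 * (norm ?v * (norm ?v * h n))) \<longlonglongrightarrow> 0" by simp
  have *: "u (t + h n) \<in> domA" "norm (A0 (u (t + h n))) \<le> norm ?v" for n
    using evi_A0_antimono[OF u t(1) _ t(2), of "t + h n"] h(2)[of n] by auto
  show "norm (A0 (u (t + h n))) \<le> norm ?v" for n by (rule *(2))
  fix n w assume w: "w \<in> D"
  let ?x = "u (t + h n)" and ?y = "u t"
  have d: "norm (?x - ?y) \<le> norm ?v * h n"
    using evi_lipschitz[OF u t order_refl, of "t + h n"] h(2)[of n] by simp
  have "\<phi> w \<ge> \<phi> ?x + A0 ?x \<bullet> (w - ?x)" by (rule subD[OF A0(2)[OF *(1)] w])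
  moreover have "\<phi> ?x \<ge> \<phi> ?y + ?v \<bullet> (?x - ?y)"
    by (rule subD[OF A0(2)[OF t(2)] domA_D[OF *(1)]])
  moreover have "\<bar>?v \<bullet> (?x - ?y)\<bar> \<le> norm ?v * (norm ?v * h n)"
    using Cauchy_Schwarz_ineq2[of ?v "?x - ?y"] mult_left_mono[OF d, of "norm ?v"] by simp
  moreover have "\<bar>A0 ?x \<bullet> (?x - ?y)\<bar> \<le> norm ?v * (norm ?v * h n)"
    using Cauchy_Schwarz_ineq2[of "A0 ?x" "?x - ?y"] mult_mono[OF *(2)[of n] d] by simp
  moreover have "A0 ?x \<bullet> (w - ?x) = A0 ?x \<bullet> (w - ?y) - A0 ?x \<bullet> (?x - ?y)" by (simp add: algebra_simps)
  ultimately show "\<phi> w \<ge> \<phi> ?y + A0 ?x \<bullet> (w - ?y) - 2 * (norm ?v * (norm ?v * h n))"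
    by linarith
qed

text \<open>By the evolution inequality on \<open>[t, t + h n]\<close> the backward quotients
  \<open>?q n\<close> are subgradients at \<open>u t\<close> up to an error of order
  \<open>h n\<close>, and they are no longer than \<open>A0 (u t)\<close>. So
  \<open>tendsto_A0\<close> gives strong convergence at each such \<open>t\<close>, not merely
  almost everywhere.\<close>

lemma evi_right_derivative:
  assumes u: "evi u" and t: "0 \<le> t" "u t \<in> domA" and h: "h \<longlonglongrightarrow> 0" "\<And>n. 0 < h n"
  shows "(\<lambda>n. (1 / h n) *\<^sub>R (u (t + h n) - u t)) \<longlonglongrightarrow> - A0 (u t)"
proof -
  let ?v = "A0 (u t)" and ?q = "\<lambda>n. (1 / h n) *\<^sub>R (u t - u (t + h n))"
  have "?q \<longlonglongrightarrow> ?v"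
  proof (rule tendsto_A0[OF t(2)])
    have lim: "(\<lambda>n. norm ?v * (norm ?v * h n)) \<longlonglongrightarrow> norm ?v * (norm ?v * 0)"
      by (intro tendsto_intros h(1))
    then show "(\<lambda>n. norm ?v * (norm ?v * h n)) \<longlonglongrightarrow> 0" by simp
    have d: "norm (u (t + h n) - u t) \<le> norm ?v * h n" for n
      using evi_lipschitz[OF u t order_refl, of "t + h n"] h(2)[of n] by simp
    show "norm (?q n) \<le> norm ?v" for n
      using d[of n] h(2)[of n] by (simp add: norm_minus_commute pos_divide_le_eq mult.commute)
    fix n w assume w: "w \<in> D"
    let ?x = "u (t + h n)" and ?y = "u t"
    have xD: "?x \<in> D" using t(1) h(2)[of n] by (intro evi_D[OF u]) simp
    have "(?x - ?y) \<bullet> ((1/2) *\<^sub>R (?x + ?y) - w) \<le> h n * (\<phi> w - \<phi> ?x)"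
      using evi_ineq[OF u w t(1), of "t + h n"] h(2)[of n] half_square_diff[of ?x w ?y] by simp
    moreover have "(?x - ?y) \<bullet> ((1/2) *\<^sub>R (?x + ?y) - w) = (?y - ?x) \<bullet> (w - ?y) + (?x - ?y) \<bullet> (?x - ?y) / 2"
      by (simp add: inner_diff_left inner_diff_right inner_add_left inner_add_right inner_commute field_simps)
    moreover have "0 \<le> (?x - ?y) \<bullet> (?x - ?y) / 2" by simp
    ultimately have "(?y - ?x) \<bullet> (w - ?y) \<le> h n * (\<phi> w - \<phi> ?x)" by linarith
    then have "?q n \<bullet> (w - ?y) \<le> \<phi> w - \<phi> ?x"
      using h(2)[of n] by (simp only: inner_scaleR_left) (simp add: pos_divide_le_eq mult.commute)
    moreover have "\<phi> ?x \<ge> \<phi> ?y + ?v \<bullet> (?x - ?y)" by (rule subD[OF A0(2)[OF t(2)] xD])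
    moreover have "\<bar>?v \<bullet> (?x - ?y)\<bar> \<le> norm ?v * (norm ?v * h n)"
      using Cauchy_Schwarz_ineq2[of ?v "?x - ?y"] mult_left_mono[OF d[of n], of "norm ?v"] by simp
    ultimately show "\<phi> w \<ge> \<phi> ?y + ?q n \<bullet> (w - ?y) - norm ?v * (norm ?v * h n)" by linarith
  qed
  then have "(\<lambda>n. - ?q n) \<longlonglongrightarrow> - ?v" by (rule tendsto_minus)
  then show ?thesis by (simp add: scaleR_minus_right[symmetric] del: scaleR_minus_right)
qed

text \<open>The subgradient inequality at \<open>s\<close> bounds the decrease from \<open>s\<close>
  to \<open>t\<close>; exchanging the times gives the other sign.\<close>

lemma evi_phi_lipschitz:
  assumes u: "evi u" and a: "0 \<le> a" "u a \<in> domA" and st: "a \<le> s" "a \<le> t"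
  shows "\<bar>\<phi> (u t) - \<phi> (u s)\<bar> \<le> (norm (A0 (u a)))\<^sup>2 * \<bar>t - s\<bar>"
proof -
  have *: "\<phi> (u s) - \<phi> (u t) \<le> (norm (A0 (u a)))\<^sup>2 * \<bar>t - s\<bar>" if st: "a \<le> s" "a \<le> t" for s t
  proof -
    have d: "u s \<in> domA" "norm (A0 (u s)) \<le> norm (A0 (u a))" "u t \<in> D"
      using evi_A0_antimono[OF u a(1) _ a(2)] st domA_D by auto
    have "\<phi> (u t) \<ge> \<phi> (u s) + A0 (u s) \<bullet> (u t - u s)" by (rule subD[OF A0(2)[OF d(1)] d(3)])
    moreover have "\<bar>A0 (u s) \<bullet> (u t - u s)\<bar> \<le> norm (A0 (u a)) * (norm (A0 (u a)) * \<bar>t - s\<bar>)"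
      using Cauchy_Schwarz_ineq2[of "A0 (u s)" "u t - u s"] mult_mono[OF d(2) evi_lipschitz[OF u a st]] by simp
    ultimately show ?thesis by (simp add: power2_eq_square mult.assoc)
  qed
  show ?thesis using *[OF st] *[OF st(2,1)] unfolding abs_minus_commute[of s t] by linarith
qed

text \<open>The subgradient inequalities at \<open>t\<close> and at \<open>t + h n\<close> enclose
  the quotient between two inner products with the quotient of \<open>u\<close>; both subgradients
  tend to \<open>A0 (u t)\<close> by right continuity.\<close>

lemma evi_phi_right_derivative:
  assumes u: "evi u" and t: "0 \<le> t" "u t \<in> domA" and h: "h \<longlonglongrightarrow> 0" "\<And>n. 0 < h n"
  shows "(\<lambda>n. (\<phi> (u (t + h n)) - \<phi> (u t)) / h n) \<longlonglongrightarrow> - (norm (A0 (u t)))\<^sup>2"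
proof (rule tendsto_sandwich)
  let ?v = "A0 (u t)" and ?d = "\<lambda>n. (1 / h n) *\<^sub>R (u (t + h n) - u t)"
  note lim = evi_right_derivative[OF u t h]
  have eq: "- (norm ?v)\<^sup>2 = ?v \<bullet> (- ?v)" by (simp add: power2_norm_eq_inner)
  have dA: "u (t + h n) \<in> domA" for n
    using evi_A0_antimono[OF u t(1) _ t(2), of "t + h n"] h(2)[of n] by auto
  show "(\<lambda>n. ?v \<bullet> ?d n) \<longlonglongrightarrow> - (norm ?v)\<^sup>2" "(\<lambda>n. A0 (u (t + h n)) \<bullet> ?d n) \<longlonglongrightarrow> - (norm ?v)\<^sup>2"
    unfolding eq by (intro tendsto_intros lim evi_A0_right_continuous[OF u t h])+
  have "?v \<bullet> ?d n \<le> (\<phi> (u (t + h n)) - \<phi> (u t)) / h n" for n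
  proof -
    have "\<phi> (u (t + h n)) \<ge> \<phi> (u t) + ?v \<bullet> (u (t + h n) - u t)" by (rule subD[OF A0(2)[OF t(2)] domA_D[OF dA]])
    then show ?thesis using h(2)[of n] by (simp only: inner_scaleR_right) (simp add: divide_right_mono)
  qed
  then show "\<forall>\<^sub>F n in sequentially. ?v \<bullet> ?d n \<le> (\<phi> (u (t + h n)) - \<phi> (u t)) / h n" by simp
  have "(\<phi> (u (t + h n)) - \<phi> (u t)) / h n \<le> A0 (u (t + h n)) \<bullet> ?d n" for n
  proof -
    have "\<phi> (u t) \<ge> \<phi> (u (t + h n)) + A0 (u (t + h n)) \<bullet> (u t - u (t + h n))"
      by (rule subD[OF A0(2)[OF dA] domA_D[OF t(2)]])
    then have "\<phi> (u (t + h n)) - \<phi> (u t) \<le> A0 (u (t + h n)) \<bullet> (u (t + h n) - u t)"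
      by (simp add: inner_diff_right)
    then show ?thesis using h(2)[of n] by (simp only: inner_scaleR_right) (simp add: divide_right_mono)
  qed
  then show "\<forall>\<^sub>F n in sequentially. (\<phi> (u (t + h n)) - \<phi> (u t)) / h n \<le> A0 (u (t + h n)) \<bullet> ?d n" by simp
qed

end

section \<open>Smooth cutoff functions\<close>

text \<open>The witness lists the derivatives of all orders, so that \<open>smooth_prod\<close> can
  name the iterated partial derivatives of a product.\<close>

definition smooth1 :: "(real \<Rightarrow> real) \<Rightarrow> bool" where
  "smooth1 f \<longleftrightarrow> (\<exists>E. E 0 = f \<and> (\<forall>k t. (E k has_real_derivative E (Suc k) t) (at t)))"

lemma smooth1_affine:
  assumes "smooth1 f" shows "smooth1 (\<lambda>t. f (c * t + d))"
proof -
  obtain E where E: "E 0 = f" "\<And>k t. (E k has_real_derivative E (Suc k) t) (at t)"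
    using assms unfolding smooth1_def by blast
  have "((\<lambda>t. c ^ k * E k (c * t + d)) has_real_derivative c ^ Suc k * E (Suc k) (c * t + d)) (at t)" for k t
    by (rule derivative_eq_intros DERIV_chain2[OF E(2)] refl | simp)+
  then show ?thesis unfolding smooth1_def
    by (intro exI[of _ "\<lambda>k t. c ^ k * E k (c * t + d)"]) (simp add: E(1))
qed

lemma smooth1_diff:
  assumes "smooth1 f" "smooth1 g" shows "smooth1 (\<lambda>t. f t - g t)"
proof -
  obtain E where E: "E 0 = f" "\<And>k t. (E k has_real_derivative E (Suc k) t) (at t)"
    using assms(1) unfolding smooth1_def by blast
  obtain E' where E': "E' 0 = g" "\<And>k t. (E' k has_real_derivative E' (Suc k) t) (at t)"
    using assms(2) unfolding smooth1_def by blast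
  show ?thesis unfolding smooth1_def
    by (intro exI[of _ "\<lambda>k t. E k t - E' k t"]) (auto simp: E(1) E'(1) intro!: derivative_intros E(2) E'(2))
qed

lemma has_real_derivative_zero_if_quadratic:
  fixes f :: "real \<Rightarrow> real"
  assumes le: "\<And>t. \<bar>f t\<bar> \<le> C * (t - a)\<^sup>2"
  shows "(f has_real_derivative 0) (at a)"
  unfolding DERIV_def
proof (rule Lim_null_comparison)
  have fa: "f a = 0" using le[of a] by simp
  have "norm ((f (a + h) - f a) / h) \<le> C * \<bar>h\<bar>" if "h \<noteq> 0" for h
  proof -
    have "\<bar>f (a + h)\<bar> / \<bar>h\<bar> \<le> C * h\<^sup>2 / \<bar>h\<bar>" using le[of "a + h"] by (intro divide_right_mono) auto
    moreover have "C * h\<^sup>2 / \<bar>h\<bar> = C * \<bar>h\<bar>" using that by (cases "h > 0") (auto simp: power2_eq_square)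
    ultimately show ?thesis by (simp add: fa)
  qed
  then show "\<forall>\<^sub>F h in at 0. norm ((f (a + h) - f a) / h) \<le> C * \<bar>h\<bar>"
    by (auto simp: eventually_at_filter)
  show "((\<lambda>h. C * \<bar>h\<bar>) \<longlongrightarrow> 0) (at 0)"
    by (auto intro!: tendsto_eq_intros)
qed

definition quad_poly :: "real poly" where "quad_poly = [:0, 1, -1:]"

lemma poly_quad_poly: "poly quad_poly t = t * (1 - t)"
  by (simp add: quad_poly_def algebra_simps)

text \<open>With \<open>q = t * (1 - t)\<close> and numerator \<open>P\<close>, the recursion brings
  the derivative of \<open>P / q^(2 * n) * exp (- 1 / q)\<close> to the denominator
  \<open>q^(2 * n + 2)\<close>. The three terms come from differentiating the numerator, the
  denominator and the exponent.\<close>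

primrec bump_poly :: "nat \<Rightarrow> real poly" where
  "bump_poly 0 = 1"
| "bump_poly (Suc n) = pderiv (bump_poly n) * quad_poly\<^sup>2
     - smult (real (2 * n)) (bump_poly n * pderiv quad_poly * quad_poly) + bump_poly n * pderiv quad_poly"

text \<open>The \<open>n\<close>-th derivative of \<open>exp (- 1 / (t * (1 - t)))\<close>, extended by zero outside the unit interval.\<close>

definition bump :: "nat \<Rightarrow> real \<Rightarrow> real" where
  "bump n t = (if 0 < t \<and> t < 1
     then poly (bump_poly n) t / (t * (1 - t)) ^ (2 * n) * exp (- 1 / (t * (1 - t))) else 0)"

lemma power_le_fact_exp:
  fixes y :: real assumes "0 \<le> y" shows "y ^ n \<le> fact n * exp y"
proof -
  have "(\<Sum>k\<in>{n}. inverse (fact k) * y ^ k) \<le> (\<Sum>k. inverse (fact k) * y ^ k)"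
    using assms by (intro sum_le_suminf) (auto intro: summable_exp)
  then have "inverse (fact n) * y ^ n \<le> exp y" by (simp add: exp_def scaleR_conv_of_real)
  then show ?thesis by (simp add: field_simps)
qed

text \<open>The exponential series bounds \<open>(1 / q)^(2 * n + 2)\<close> by a multiple of
  \<open>exp (1 / q)\<close>; this beats the denominator \<open>q^(2 * n)\<close> and leaves the
  square of \<open>q\<close>. Quadratic decay is what makes the derivative vanish at the
  endpoints.\<close>

lemma bump_quadratic:
  obtains C where "0 \<le> C" "\<And>t. 0 < t \<Longrightarrow> t < 1 \<Longrightarrow> \<bar>bump n t\<bar> \<le> C * (t * (1 - t))\<^sup>2"
proof -
  have "bounded (poly (bump_poly n) ` {0..1})"
    by (intro compact_imp_bounded compact_continuous_image continuous_intros) auto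
  then obtain B where B: "\<And>t. t \<in> {0..1} \<Longrightarrow> \<bar>poly (bump_poly n) t\<bar> \<le> B"
    unfolding bounded_iff by (metis imageI real_norm_def)
  have B0: "0 \<le> B" using B[of 0] by (meson abs_ge_zero atLeastAtMost_iff order.refl order.trans zero_le_one)
  show thesis
  proof (rule that)
    show "0 \<le> B * fact (2 * n + 2)" using B0 by simp
    fix t :: real assume t: "0 < t" "t < 1"
    define q where "q = t * (1 - t)"
    have q: "q > 0" using t by (simp add: q_def)
    have "(1 / q) ^ (2 * n + 2) \<le> fact (2 * n + 2) * exp (1 / q)"
      using q by (intro power_le_fact_exp) simp
    then have "q\<^sup>2 * ((1 / q) ^ (2 * n + 2) * exp (- 1 / q)) \<le> q\<^sup>2 * (fact (2 * n + 2))"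
      using q by (intro mult_left_mono) (simp_all add: exp_minus field_simps)
    moreover have "q\<^sup>2 * ((1 / q) ^ (2 * n + 2) * exp (- 1 / q)) = exp (- 1 / q) / q ^ (2 * n)"
      using q by (simp add: field_simps power_add power2_eq_square)
    ultimately have *: "exp (- 1 / q) / q ^ (2 * n) \<le> fact (2 * n + 2) * q\<^sup>2" by (simp only: mult.commute)
    have "\<bar>bump n t\<bar> = \<bar>poly (bump_poly n) t\<bar> * (exp (- 1 / q) / q ^ (2 * n))"
      using t q by (simp add: bump_def q_def[symmetric] abs_mult)
    also have "\<dots> \<le> B * (fact (2 * n + 2) * q\<^sup>2)"
      using B[of t] t q * by (intro mult_mono) auto
    finally show "\<bar>bump n t\<bar> \<le> B * fact (2 * n + 2) * (t * (1 - t))\<^sup>2" by (simp add: q_def mult.assoc)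
  qed
qed

lemma bump_has_derivative: "(bump n has_real_derivative bump (Suc n) t) (at t)"
proof (cases "0 < t \<and> t < 1")
  case True
  let ?q = "t * (1 - t)"
  let ?f = "\<lambda>t. poly (bump_poly n) t / (t * (1 - t)) ^ (2 * n) * exp (- 1 / (t * (1 - t)))"
  let ?P = "poly (bump_poly n) t" and ?P' = "poly (pderiv (bump_poly n)) t"
  have q: "?q \<noteq> 0" using True by simp
  have q': "poly (pderiv quad_poly) t = 1 - 2 * t" by (simp add: quad_poly_def pderiv_pCons)
  have dq: "((\<lambda>t. t * (1 - t)) has_real_derivative 1 - 2 * t) (at t)"
    by (rule derivative_eq_intros refl | simp)+
  have dpow: "((\<lambda>t. (t * (1 - t)) ^ (2 * n)) has_real_derivative real (2 * n) * ?q ^ (2 * n - 1) * (1 - 2 * t)) (at t)"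
    using DERIV_power[OF dq, of "2 * n"] by (simp add: mult.assoc mult.commute[of "1 - 2 * t"])
  have dexp: "((\<lambda>t. exp (- 1 / (t * (1 - t)))) has_real_derivative exp (- 1 / ?q) * ((1 - 2 * t) / ?q\<^sup>2)) (at t)"
    by (rule derivative_eq_intros dq refl q | simp add: power2_eq_square)+
  have "(?f has_real_derivative
      (?P' * ?q ^ (2 * n) - ?P * (real (2 * n) * ?q ^ (2 * n - 1) * (1 - 2 * t))) / (?q ^ (2 * n) * ?q ^ (2 * n)) * exp (- 1 / ?q)
      + exp (- 1 / ?q) * ((1 - 2 * t) / ?q\<^sup>2) * (?P / ?q ^ (2 * n))) (at t)"
    by (rule DERIV_mult DERIV_divide poly_DERIV dpow dexp power_not_zero[OF q])+
  also have "(?P' * ?q ^ (2 * n) - ?P * (real (2 * n) * ?q ^ (2 * n - 1) * (1 - 2 * t))) / (?q ^ (2 * n) * ?q ^ (2 * n)) * exp (- 1 / ?q)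
      + exp (- 1 / ?q) * ((1 - 2 * t) / ?q\<^sup>2) * (?P / ?q ^ (2 * n)) = bump (Suc n) t"
  proof -
    define Q E where "Q = ?q" and "E = exp (- 1 / Q)"
    have Q: "Q \<noteq> 0" using q by (simp add: Q_def)
    have b: "bump (Suc n) t = (?P' * Q\<^sup>2 - real (2 * n) * (?P * (1 - 2 * t) * Q) + ?P * (1 - 2 * t)) / Q ^ (2 * Suc n) * E"
      using True by (simp add: bump_def poly_quad_poly q' Q_def E_def)
    have *: "(?P' * Q ^ (2 * n) - ?P * (real (2 * n) * Q ^ (2 * n - 1) * (1 - 2 * t))) / (Q ^ (2 * n) * Q ^ (2 * n))
        = (?P' * Q\<^sup>2 - real (2 * n) * (?P * (1 - 2 * t) * Q)) / Q ^ (2 * Suc n)"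
    \<comment> \<open>For \<open>n = 0\<close> the truncated exponent \<open>2 * n - 1\<close> is
      harmless because of the factor \<open>2 * n\<close>.\<close>
    proof (cases n)
      case (Suc m)
      then have "Q ^ (2 * n) = Q ^ (2 * n - 1) * Q" by (simp add: power_eq_if)
      then show ?thesis using Q by (simp add: field_simps power2_eq_square)
    qed (use Q in \<open>simp add: field_simps power2_eq_square\<close>)
    have **: "(1 - 2 * t) / Q\<^sup>2 * (?P / Q ^ (2 * n)) = ?P * (1 - 2 * t) / Q ^ (2 * Suc n)"
      using Q by (simp add: field_simps power2_eq_square)
    show ?thesis unfolding Q_def[symmetric] E_def[symmetric] b * mult.assoc[of E] **
      by (simp only: add_divide_distrib distrib_right mult.commute[of E])
  qed
  finally have d: "(?f has_real_derivative bump (Suc n) t) (at t)" .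
  show ?thesis
    by (rule has_field_derivative_transform_within_open[OF d, of "{0<..<1}"]) (use True in \<open>auto simp: bump_def\<close>)
next
  case False
  obtain C where C: "0 \<le> C" "\<And>t. 0 < t \<Longrightarrow> t < 1 \<Longrightarrow> \<bar>bump n t\<bar> \<le> C * (t * (1 - t))\<^sup>2"
    using bump_quadratic by blast
  have "\<bar>bump n s\<bar> \<le> C * (s - t)\<^sup>2" for s
  proof (cases "0 < s \<and> s < 1")
    case True
    \<comment> \<open>\<open>t\<close> lies outside the open unit interval, so its distance to
      \<open>s\<close> is at least that of \<open>s\<close> to one of the endpoints.\<close>
    have "s * (1 - s) \<le> \<bar>s - t\<bar>"
    proof (cases "t \<le> 0")
      case True
      have "s * (1 - s) \<le> s * 1" using \<open>0 < s \<and> s < 1\<close> by (intro mult_left_mono) auto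
      also have "s * 1 \<le> \<bar>s - t\<bar>" using True \<open>0 < s \<and> s < 1\<close> by simp
      finally show ?thesis .
    next
      case False
      then have "1 \<le> t" using \<open>\<not> (0 < t \<and> t < 1)\<close> by simp
      have "s * (1 - s) \<le> 1 * (1 - s)" using \<open>0 < s \<and> s < 1\<close> by (intro mult_right_mono) auto
      also have "1 * (1 - s) \<le> \<bar>s - t\<bar>" using \<open>1 \<le> t\<close> \<open>0 < s \<and> s < 1\<close> by simp
      finally show ?thesis .
    qed
    then have "(s * (1 - s))\<^sup>2 \<le> (s - t)\<^sup>2"
      using True by (subst power2_abs[of "s - t", symmetric], intro power_mono) auto
    then show ?thesis using C(2)[of s] C(1) True mult_left_mono by (meson order.trans)
  qed (use C(1) in \<open>auto simp: bump_def\<close>)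
  then have "(bump n has_real_derivative 0) (at t)" by (rule has_real_derivative_zero_if_quadratic)
  moreover have "bump (Suc n) t = 0" unfolding bump_def using False by (simp only: if_False)
  ultimately show ?thesis by (simp only:)
qed

lemma smooth_step_exists:
  obtains \<Psi> where "smooth1 \<Psi>" "\<And>t. t \<le> 0 \<Longrightarrow> \<Psi> t = 0" "\<And>t. t \<ge> 1 \<Longrightarrow> \<Psi> t = 1" "mono \<Psi>"
proof -
  have cont: "continuous_on S (bump 0)" for S
    by (intro continuous_at_imp_continuous_on ballI DERIV_isCont[OF bump_has_derivative])
  have nn: "0 \<le> bump 0 t" for t by (simp add: bump_def)
  \<comment> \<open>Starting at -1 makes every point of the unit interval interior to an interval of
    integration; the bump vanishes on the added piece.\<close>
  define G where "G t = integral {-1..t} (bump 0)" for t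
  have d: "(G has_real_derivative bump 0 t) (at t)" for t
  proof (cases "t > -1")
    case True
    have "(G has_real_derivative bump 0 t) (at t within {-1..t+1})"
      unfolding G_def using True by (intro integral_has_real_derivative cont) auto
    then show ?thesis
      using True at_within_interior[of t "{-1..t+1}"] by simp
  next
    case False
    have "(G has_real_derivative 0) (at t)"
    proof (rule has_field_derivative_transform_within_open[OF DERIV_const])
      fix s :: real assume "s \<in> {..<0}"
      then have "integral {-1..s} (bump 0) = integral {-1..s} (\<lambda>_. 0)"
        by (intro integral_cong) (auto simp: bump_def)
      then show "0 = G s" by (simp add: G_def)
    qed (use False in auto)
    then show ?thesis using False by (simp add: bump_def)
  qed
  have Gmono: "G s \<le> G t" if "s \<le> t" for s t
    by (rule DERIV_nonneg_imp_nondecreasing[OF that]) (use d nn in blast)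
  have G0: "G t = 0" if "t \<le> 0" for t
  proof -
    have "integral {-1..t} (bump 0) = integral {-1..t} (\<lambda>_. 0)"
      using that by (intro integral_cong) (auto simp: bump_def)
    then show ?thesis by (simp add: G_def)
  qed
  have G1: "G t = G 1" if "t \<ge> 1" for t
  proof -
    have "integral {-1..1} (bump 0) + integral {1..t} (bump 0) = integral {-1..t} (bump 0)"
      using that by (intro Henstock_Kurzweil_Integration.integral_combine integrable_continuous_real cont) auto
    moreover have "integral {1..t} (bump 0) = integral {1..t} (\<lambda>_. 0)"
      by (intro integral_cong) (auto simp: bump_def)
    ultimately show ?thesis by (simp add: G_def)
  qed
  have "G 0 < G 1"
  proof (rule DERIV_pos_imp_increasing_open[where f=G])
    show "\<exists>y. (G has_real_derivative y) (at x) \<and> y > 0" if "0 < x" "x < 1" for x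
      using d[of x] that by (intro exI[of _ "bump 0 x"]) (simp add: bump_def)
    show "continuous_on {0..1} G" by (intro continuous_at_imp_continuous_on ballI DERIV_isCont[OF d])
  qed simp
  then have G1pos: "G 1 > 0" by (simp add: G0)
  show thesis
  proof (rule that[of "\<lambda>t. G t / G 1"])
    show "smooth1 (\<lambda>t. G t / G 1)"
      unfolding smooth1_def
    proof (intro exI[of _ "\<lambda>k t. (case k of 0 \<Rightarrow> G t | Suc k \<Rightarrow> bump k t) / G 1"] conjI allI)
      fix k t
      show "((\<lambda>t. (case k of 0 \<Rightarrow> G t | Suc k \<Rightarrow> bump k t) / G 1) has_real_derivative
          (case Suc k of 0 \<Rightarrow> G t | Suc k \<Rightarrow> bump k t) / G 1) (at t)"
        by (cases k) (auto intro!: DERIV_cdivide d bump_has_derivative)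
    qed simp
    show "mono (\<lambda>t. G t / G 1)" using Gmono G1pos by (intro monoI divide_right_mono) auto
    show "G t / G 1 = 1" if "t \<ge> 1" for t using G1[OF that] G1pos by simp
  qed (simp add: G0)
qed

definition smooth_step :: "real \<Rightarrow> real" where
  "smooth_step = (SOME \<Psi>. smooth1 \<Psi> \<and> (\<forall>t\<le>0. \<Psi> t = 0) \<and> (\<forall>t\<ge>1. \<Psi> t = 1) \<and> mono \<Psi>)"

lemma smooth_step:
  shows "smooth1 smooth_step" "t \<le> 0 \<Longrightarrow> smooth_step t = 0" "t \<ge> 1 \<Longrightarrow> smooth_step t = 1" "mono smooth_step"
proof -
  have "\<exists>\<Psi>. smooth1 \<Psi> \<and> (\<forall>t\<le>0. \<Psi> t = 0) \<and> (\<forall>t\<ge>1. \<Psi> t = 1) \<and> mono \<Psi>"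
    using smooth_step_exists by metis
  from someI_ex[OF this, folded smooth_step_def]
  show "smooth1 smooth_step" "t \<le> 0 \<Longrightarrow> smooth_step t = 0" "t \<ge> 1 \<Longrightarrow> smooth_step t = 1" "mono smooth_step"
    by auto
qed

text \<open>Rises on \<open>[a, a + 1/k]\<close> and falls on \<open>[b - 1/k, b]\<close>; the shift
  by 1 puts the descent to the left of \<open>b\<close>, which keeps the support in
  \<open>[a, b]\<close>. If \<open>1 \<le> k * (b - a)\<close>, monotonicity of the step makes the
  difference nonnegative even where the ramps overlap.\<close>

definition cutoff :: "real \<Rightarrow> real \<Rightarrow> real \<Rightarrow> real \<Rightarrow> real" where
  "cutoff a b k t = smooth_step (k * (t - a)) - smooth_step (k * (t - b) + 1)"

lemma smooth1_cutoff: "smooth1 (cutoff a b k)"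
proof -
  have "cutoff a b k = (\<lambda>t. smooth_step (k * t + (- k * a)) - smooth_step (k * t + (1 - k * b)))"
    by (auto simp: cutoff_def fun_eq_iff algebra_simps)
  then show ?thesis by (simp only:) (intro smooth1_diff smooth1_affine smooth_step)
qed

lemma smooth_step_range: "0 \<le> smooth_step t" "smooth_step t \<le> 1"
proof -
  have "smooth_step (min t 0) \<le> smooth_step t" "smooth_step t \<le> smooth_step (max t 1)"
    by (rule monoD[OF smooth_step(4)], simp)+
  then show "0 \<le> smooth_step t" "smooth_step t \<le> 1" by (simp_all add: smooth_step(2,3))
qed

lemma cutoff_range:
  assumes "0 < k" "1 \<le> k * (b - a)"
  shows "0 \<le> cutoff a b k t" "cutoff a b k t \<le> 1"
proof -
  have "smooth_step (k * (t - b) + 1) \<le> smooth_step (k * (t - a))"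
    using assms by (intro monoD[OF smooth_step(4)]) (simp add: algebra_simps)
  then show "0 \<le> cutoff a b k t" by (simp add: cutoff_def)
  show "cutoff a b k t \<le> 1" using smooth_step_range[of "k * (t - a)"] smooth_step_range[of "k * (t - b) + 1"]
    by (simp add: cutoff_def)
qed

lemma cutoff_outside:
  assumes "0 < k" "1 \<le> k * (b - a)" "t \<le> a \<or> b \<le> t"
  shows "cutoff a b k t = 0"
proof (cases "t \<le> a")
  case True
  then have "k * (t - a) \<le> 0" using assms by (simp add: mult_le_0_iff)
  moreover have "k * (t - b) + 1 \<le> 0"
    using calculation assms(2) unfolding right_diff_distrib by linarith
  ultimately show ?thesis by (simp add: cutoff_def smooth_step)
next
  case False
  then have "0 \<le> k * (t - b)" using assms by simp
  moreover have "1 \<le> k * (t - a)"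
    using calculation assms(2) unfolding right_diff_distrib by linarith
  ultimately show ?thesis by (simp add: cutoff_def smooth_step)
qed

lemma cutoff_inside:
  assumes "a < t" "t < b"
  shows "\<forall>\<^sub>F n in sequentially. cutoff a b (real n) t = 1"
proof -
  obtain N where N: "1 / min (t - a) (b - t) < real N" using reals_Archimedean2 by blast
  have "cutoff a b (real n) t = 1" if "n \<ge> N" for n
  proof -
    have m: "min (t - a) (b - t) > 0" using assms by simp
    have "1 / min (t - a) (b - t) \<le> real n" using N that by linarith
    then have "1 \<le> real n * min (t - a) (b - t)" using m by (simp add: pos_divide_le_eq)
    moreover have "real n * min (t - a) (b - t) \<le> real n * (t - a)" "real n * min (t - a) (b - t) \<le> real n * (b - t)"
      by (intro mult_left_mono; simp)+
    ultimately have "1 \<le> real n * (t - a)" "1 \<le> real n * (b - t)" by linarith+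
    then show ?thesis by (simp add: cutoff_def smooth_step algebra_simps)
  qed
  then show ?thesis by (auto simp: eventually_sequentially)
qed

section \<open>Test functions\<close>

text \<open>A partial derivative in direction \<open>b\<close> differentiates only the factor
  belonging to \<open>b\<close>. Hence \<open>iter_partial bs\<close> is again a product, whose
  factor for \<open>i\<close> is the derivative of order \<open>count_list bs i\<close>.\<close>

lemma smooth_prod:
  assumes "\<And>i. i \<in> Basis \<Longrightarrow> smooth1 (f i)"
  shows "smooth (\<lambda>x::'a::euclidean_space. \<Prod>i\<in>Basis. f i (x \<bullet> i))"
proof -
  have "\<forall>i\<in>Basis. \<exists>E. E 0 = f i \<and> (\<forall>k t. (E k has_real_derivative E (Suc k) t) (at t))"
    using assms by (auto simp: smooth1_def)
  then obtain E where E: "\<And>i. i \<in> Basis \<Longrightarrow> E i 0 = f i"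
    "\<And>i k t. i \<in> Basis \<Longrightarrow> (E i k has_real_derivative E i (Suc k) t) (at t)" by metis
  have d: "((\<lambda>x::'a. \<Prod>i\<in>Basis. E i (c i) (x \<bullet> i)) has_derivative
      (\<lambda>y. \<Sum>i\<in>Basis. (y \<bullet> i) * E i (Suc (c i)) (x \<bullet> i) * (\<Prod>j\<in>Basis-{i}. E j (c j) (x \<bullet> j)))) (at x)" for c x
  proof (rule has_derivative_prod)
    fix i :: 'a assume i: "i \<in> Basis"
    have "((\<lambda>x. x \<bullet> i) has_derivative (\<lambda>y. y \<bullet> i)) (at x)" by (auto intro!: derivative_eq_intros)
    from DERIV_compose_FDERIV[OF E(2)[OF i] this]
    show "((\<lambda>x. E i (c i) (x \<bullet> i)) has_derivative (\<lambda>y. (y \<bullet> i) * E i (Suc (c i)) (x \<bullet> i))) (at x)" .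
  qed
  have it: "iter_partial bs (\<lambda>x. \<Prod>i\<in>Basis. f i (x \<bullet> i)) = (\<lambda>x::'a. \<Prod>i\<in>Basis. E i (count_list bs i) (x \<bullet> i))"
    if "set bs \<subseteq> Basis" for bs
    using that
  proof (induction bs)
    case Nil show ?case by (simp add: E(1))
  next
    case (Cons b bs)
    have b: "b \<in> Basis" using Cons.prems by simp
    have "iter_partial (b # bs) (\<lambda>x. \<Prod>i\<in>Basis. f i (x \<bullet> i)) x = (\<Prod>i\<in>Basis. E i (count_list (b # bs) i) (x \<bullet> i))" for x
    proof -
      have "iter_partial (b # bs) (\<lambda>x. \<Prod>i\<in>Basis. f i (x \<bullet> i)) x
        = (\<Sum>i\<in>Basis. (b \<bullet> i) * E i (Suc (count_list bs i)) (x \<bullet> i) * (\<Prod>j\<in>Basis-{i}. E j (count_list bs j) (x \<bullet> j)))"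
        using Cons by (simp add: frechet_derivative_at[OF d, symmetric])
      also have "\<dots> = (\<Sum>i\<in>{b}. (b \<bullet> i) * E i (Suc (count_list bs i)) (x \<bullet> i) * (\<Prod>j\<in>Basis-{i}. E j (count_list bs j) (x \<bullet> j)))"
        using b by (intro sum.mono_neutral_right) (auto simp: inner_Basis)
      also have "\<dots> = E b (Suc (count_list bs b)) (x \<bullet> b) * (\<Prod>j\<in>Basis-{b}. E j (count_list bs j) (x \<bullet> j))"
        using b by simp
      also have "(\<Prod>j\<in>Basis-{b}. E j (count_list bs j) (x \<bullet> j)) = (\<Prod>j\<in>Basis-{b}. E j (count_list (b # bs) j) (x \<bullet> j))"
        by (intro prod.cong) auto
      finally show ?thesis
        using b by (simp add: prod.remove[OF finite_Basis b])
    qed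
    then show ?case by blast
  qed
  show ?thesis unfolding smooth_def using it d by (auto simp: differentiable_def)
qed

definition box_cutoff :: "'a::euclidean_space \<Rightarrow> 'a \<Rightarrow> nat \<Rightarrow> 'a \<Rightarrow> real" where
  "box_cutoff a b n x = (\<Prod>i\<in>Basis. cutoff (a \<bullet> i) (b \<bullet> i) (real n) (x \<bullet> i))"

lemma box_cutoff:
  fixes a b :: "'a::euclidean_space"
  assumes n: "0 < n" "\<And>i. i \<in> Basis \<Longrightarrow> 1 \<le> real n * (b \<bullet> i - a \<bullet> i)"
  shows "0 \<le> box_cutoff a b n x" "box_cutoff a b n x \<le> 1" "x \<notin> box a b \<Longrightarrow> box_cutoff a b n x = 0"
    "cbox a b \<subseteq> \<Omega> \<Longrightarrow> box_cutoff a b n \<in> test_functions \<Omega>"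
proof -
  show "0 \<le> box_cutoff a b n x" "box_cutoff a b n x \<le> 1"
    unfolding box_cutoff_def using n cutoff_range by (auto intro!: prod_nonneg prod_le_1)
  show out: "box_cutoff a b n x = 0" if x: "x \<notin> box a b" for x
  proof -
    obtain i where "i \<in> Basis" "x \<bullet> i \<le> a \<bullet> i \<or> b \<bullet> i \<le> x \<bullet> i"
      using x unfolding mem_box by (meson not_less)
    then show ?thesis unfolding box_cutoff_def using n cutoff_outside by (intro prod_zero bexI[of _ i]) auto
  qed
  assume \<Omega>: "cbox a b \<subseteq> \<Omega>"
  have "{x. box_cutoff a b n x \<noteq> 0} \<subseteq> cbox a b" using out box_subset_cbox by blast
  then have cl: "closure {x. box_cutoff a b n x \<noteq> 0} \<subseteq> cbox a b" by (simp add: closure_minimal closed_cbox)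
  moreover have "compact (closure {x. box_cutoff a b n x \<noteq> 0})"
    using cl by (meson bounded_cbox bounded_subset closed_closure compact_eq_bounded_closed)
  moreover have "smooth (box_cutoff a b n)"
    using smooth_prod[of "\<lambda>i. cutoff (a \<bullet> i) (b \<bullet> i) (real n)"] smooth1_cutoff by (simp add: box_cutoff_def[abs_def])
  ultimately show "box_cutoff a b n \<in> test_functions \<Omega>" using \<Omega> by (auto simp: test_functions_def)
qed

lemma box_cutoff_eventually:
  fixes a b :: "'a::euclidean_space"
  assumes ab: "box a b \<noteq> {}"
  shows "\<forall>\<^sub>F n in sequentially. 0 < n \<and> (\<forall>i\<in>Basis. 1 \<le> real n * (b \<bullet> i - a \<bullet> i))"
proof -
  have "\<forall>\<^sub>F n in sequentially. 1 \<le> real n * (b \<bullet> i - a \<bullet> i)" if i: "i \<in> Basis" for i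
  proof -
    have pos: "0 < b \<bullet> i - a \<bullet> i" using ab i by (simp add: box_ne_empty)
    obtain N where N: "1 / (b \<bullet> i - a \<bullet> i) < real N" using reals_Archimedean2 by blast
    have "1 \<le> real n * (b \<bullet> i - a \<bullet> i)" if "n \<ge> N" for n
    proof -
      have "1 / (b \<bullet> i - a \<bullet> i) \<le> real n" using N that by linarith
      then show ?thesis using pos by (simp add: pos_divide_le_eq)
    qed
    then show ?thesis by (auto simp: eventually_sequentially)
  qed
  then have "\<forall>\<^sub>F n in sequentially. \<forall>i\<in>Basis. 1 \<le> real n * (b \<bullet> i - a \<bullet> i)"
    by (simp add: eventually_ball_finite)
  then show ?thesis using eventually_gt_at_top[of 0] by eventually_elim auto
qed

lemma box_cutoff_tendsto:
  fixes a b :: "'a::euclidean_space"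
  assumes ab: "box a b \<noteq> {}"
  shows "(\<lambda>n. box_cutoff a b n x) \<longlonglongrightarrow> indicator (box a b) x"
proof (cases "x \<in> box a b")
  case True
  have "\<forall>\<^sub>F n in sequentially. \<forall>i\<in>Basis. cutoff (a \<bullet> i) (b \<bullet> i) (real n) (x \<bullet> i) = 1"
    using True by (intro eventually_ball_finite ballI cutoff_inside) (auto simp: mem_box)
  then have "\<forall>\<^sub>F n in sequentially. box_cutoff a b n x = 1"
    by eventually_elim (simp add: box_cutoff_def)
  then show ?thesis using True by (simp add: tendsto_eventually)
next
  case False
  have "\<forall>\<^sub>F n in sequentially. box_cutoff a b n x = 0"
    using box_cutoff_eventually[OF ab] by eventually_elim (use box_cutoff(3) False in blast)
  then show ?thesis using False by (simp add: tendsto_eventually)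
qed

section \<open>Measurability, translation invariance and integration by parts\<close>

text \<open>By completeness of Lebesgue measure a change on a null set does not spoil
  preimages.\<close>

lemma borel_measurable_lebesgue_cong_AE:
  assumes f: "f \<in> borel_measurable lebesgue" and ae: "AE x in lebesgue. f x = g x"
  shows "g \<in> borel_measurable lebesgue"
proof (rule measurableI)
  fix A :: "'b set" assume A: "A \<in> sets borel"
  show "g -` A \<inter> space lebesgue \<in> sets lebesgue"
  proof (rule completion.in_sets_AE)
    show "AE x in lebesgue. (x \<in> f -` A \<inter> space lebesgue) = (x \<in> g -` A \<inter> space lebesgue)"
      using ae by eventually_elim auto
    show "f -` A \<inter> space lebesgue \<in> sets lebesgue" using f A by (rule measurable_sets)
  qed simp
qed simp

lemma AE_indicator_scaleR_cong:
  fixes f g :: "'a \<Rightarrow> 'b::real_vector"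
  assumes "AE x\<in>S in M. f x = g x"
  shows "AE x in M. (indicator S x :: real) *\<^sub>R f x = indicator S x *\<^sub>R g x"
  using assms by eventually_elim (auto simp: indicator_def)

lemma set_borel_measurable_cong_AE:
  fixes f g :: "'a::euclidean_space \<Rightarrow> 'b::real_normed_vector"
  assumes "set_borel_measurable lebesgue S f" and "AE x\<in>S in lebesgue. f x = g x"
  shows "set_borel_measurable lebesgue S g"
  using assms(1) unfolding set_borel_measurable_def
  by (rule borel_measurable_lebesgue_cong_AE) (rule AE_indicator_scaleR_cong[OF assms(2)])

lemma set_integrable_cong_AE':
  fixes f g :: "'a::euclidean_space \<Rightarrow> 'b::{banach, second_countable_topology}"
  assumes "set_integrable lebesgue S f" and "AE x\<in>S in lebesgue. f x = g x"
  shows "set_integrable lebesgue S g"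
proof -
  have m: "set_borel_measurable lebesgue S f" using assms(1) by (simp add: set_integrable_def set_borel_measurable_def)
  show ?thesis
    using assms(1) set_borel_measurable_cong_AE[OF m assms(2)] AE_indicator_scaleR_cong[OF assms(2)]
    unfolding set_integrable_def set_borel_measurable_def
    by (rule integrable_cong_AE_imp)
qed

lemma set_integral_cong_AE':
  fixes f g :: "'a::euclidean_space \<Rightarrow> 'b::{banach, second_countable_topology}"
  assumes "set_borel_measurable lebesgue S f" and "AE x\<in>S in lebesgue. f x = g x"
  shows "(LINT x:S|lebesgue. f x) = (LINT x:S|lebesgue. g x)"
  unfolding set_lebesgue_integral_def
  using set_borel_measurable_cong_AE[OF assms] assms(1) AE_indicator_scaleR_cong[OF assms(2)]
  by (intro integral_cong_AE) (auto simp: set_borel_measurable_def)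

lemma set_integrable_measurable:
  "set_integrable M S f \<Longrightarrow> set_borel_measurable M S f"
  by (simp add: set_integrable_def set_borel_measurable_def)

lemma continuous_borel_measurable_lebesgue:
  fixes f :: "'a::euclidean_space \<Rightarrow> 'b::topological_space"
  assumes "continuous_on UNIV f" shows "f \<in> borel_measurable lebesgue"
  using borel_measurable_continuous_onI[OF assms] by (intro measurable_completion) auto

text \<open>The functions that the weak formulation is tested with enter only through the following properties.\<close>

lemma test_function_properties:
  fixes \<phi> :: "'a::euclidean_space \<Rightarrow> 'b::real_normed_vector"
  assumes t: "\<phi> \<in> test_functions \<Omega>" and b: "b \<in> Basis"
  obtains K B where "compact K" "K \<subseteq> \<Omega>" "\<And>x. x \<notin> K \<Longrightarrow> \<phi> x = 0"
    "\<And>x. x \<notin> K \<Longrightarrow> frechet_derivative \<phi> (at x) b = 0"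
    "\<And>x. norm (\<phi> x) \<le> B" "\<And>x. norm (frechet_derivative \<phi> (at x) b) \<le> B"
    "continuous_on UNIV \<phi>" "continuous_on UNIV (\<lambda>x. frechet_derivative \<phi> (at x) b)"
    "\<And>x. \<phi> differentiable (at x)"
proof -
  let ?K = "closure {x. \<phi> x \<noteq> 0}" and ?d = "\<lambda>x. frechet_derivative \<phi> (at x) b"
  have sm: "smooth \<phi>" and K: "compact ?K" "?K \<subseteq> \<Omega>" using t by (auto simp: test_functions_def)
  have d: "\<phi> differentiable (at x)" for x using sm[unfolded smooth_def, rule_format, of "[]" x] by simp
  have d2: "?d differentiable (at x)" for x
    using sm[unfolded smooth_def, rule_format, of "[b]" x] b by simp
  have c: "continuous_on UNIV \<phi>" "continuous_on UNIV ?d"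
    using d d2 by (auto intro!: continuous_at_imp_continuous_on differentiable_imp_continuous_within)
  have z: "\<phi> x = 0" if "x \<notin> ?K" for x using that closure_subset[of "{x. \<phi> x \<noteq> 0}"] by blast
  have z2: "?d x = 0" if x: "x \<notin> ?K" for x
  proof -
    have "(\<phi> has_derivative (\<lambda>_. 0)) (at x)"
    proof (rule has_derivative_transform_within_open[OF has_derivative_const[of 0], where s = "- ?K"])
      show "open (- ?K)" by (intro open_Compl closed_closure)
      show "x \<in> - ?K" using x by blast
      show "0 = \<phi> y" if "y \<in> - ?K" for y using z[OF ComplD[OF that]] by (rule sym)
    qed
    from frechet_derivative_at[OF this] show ?thesis by metis
  qed
  have "bounded (\<phi> ` ?K)" "bounded (?d ` ?K)"
    using K c by (auto intro!: compact_imp_bounded compact_continuous_image intro: continuous_on_subset)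
  then obtain B1 B2 where "\<forall>y\<in>\<phi> ` ?K. norm y \<le> B1" "\<forall>y\<in>?d ` ?K. norm y \<le> B2"
    unfolding bounded_iff by (elim exE)
  then have B: "\<And>x. x \<in> ?K \<Longrightarrow> norm (\<phi> x) \<le> B1" "\<And>x. x \<in> ?K \<Longrightarrow> norm (?d x) \<le> B2"
    by (simp_all only: ball_simps)
  have b1: "norm (\<phi> x) \<le> max 0 (max B1 B2)" for x
    by (cases "x \<in> ?K") (use B(1)[of x] z[of x] in auto)
  have b2: "norm (?d x) \<le> max 0 (max B1 B2)" for x
    by (cases "x \<in> ?K") (use B(2)[of x] z2[of x] in auto)
  show thesis by (rule that[OF K z z2 b1 b2 c d])
qed

text \<open>The factor \<open>c\<close> vanishes off \<open>K\<close>, so the indicator of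
  \<open>\<Omega>\<close> can be exchanged for that of \<open>K\<close>, over which \<open>u\<close>
  is integrable.\<close>

lemma compact_support_mult_locally_integrable:
  fixes u :: "'a::euclidean_space \<Rightarrow> 'b::{banach, second_countable_topology}" and c :: "'a \<Rightarrow> real"
  assumes u: "locally_integrable \<Omega> u" and c: "continuous_on UNIV c" "\<And>x. \<bar>c x\<bar> \<le> B"
    and K: "compact K" "K \<subseteq> \<Omega>" "\<And>x. x \<notin> K \<Longrightarrow> c x = 0"
  shows "set_integrable lebesgue \<Omega> (\<lambda>x. c x *\<^sub>R u x)"
    "(LINT x:\<Omega>|lebesgue. c x *\<^sub>R u x) = (LINT x|lebesgue. c x *\<^sub>R (indicator K x *\<^sub>R u x))"
    "integrable lebesgue (\<lambda>x. c x *\<^sub>R (indicator K x *\<^sub>R u x))"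
proof -
  have eq: "(\<lambda>x. indicator \<Omega> x *\<^sub>R (c x *\<^sub>R u x)) = (\<lambda>x. c x *\<^sub>R (indicator K x *\<^sub>R u x))"
    using K by (auto simp: fun_eq_iff indicator_def)
  have i: "integrable lebesgue (\<lambda>x. indicator K x *\<^sub>R u x)"
    using u K by (simp add: locally_integrable_def set_integrable_def)
  note [measurable] = continuous_borel_measurable_lebesgue[OF c(1)] borel_measurable_integrable[OF i]
  have "integrable lebesgue (\<lambda>x. B *\<^sub>R norm (indicator K x *\<^sub>R u x))"
    by (intro integrable_scaleR_right integrable_norm i)
  then show int: "integrable lebesgue (\<lambda>x. c x *\<^sub>R (indicator K x *\<^sub>R u x))"
  proof (rule Bochner_Integration.integrable_bound)
    show "AE x in lebesgue. norm (c x *\<^sub>R (indicator K x *\<^sub>R u x)) \<le> norm (B *\<^sub>R norm (indicator K x *\<^sub>R u x))"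
    proof (intro AE_I2)
      fix x
      have "\<bar>c x\<bar> \<le> \<bar>B\<bar>" using c(2)[of x] by linarith
      then show "norm (c x *\<^sub>R (indicator K x *\<^sub>R u x)) \<le> norm (B *\<^sub>R norm (indicator K x *\<^sub>R u x))"
        by (auto simp: abs_mult mult.assoc intro!: mult_right_mono)
    qed
  qed measurable
  show "set_integrable lebesgue \<Omega> (\<lambda>x. c x *\<^sub>R u x)" unfolding set_integrable_def eq by (rule int)
  show "(LINT x:\<Omega>|lebesgue. c x *\<^sub>R u x) = (LINT x|lebesgue. c x *\<^sub>R (indicator K x *\<^sub>R u x))"
    unfolding set_lebesgue_integral_def eq ..
qed

text \<open>
  Translation invariance makes the integrals of the difference quotients vanish. This yields integration by
  parts both in space and, for functions that have only right derivatives, in time.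
\<close>

lemma integral_directional_derivative_zero:
  fixes f d :: "'a::euclidean_space \<Rightarrow> 'b::{banach, second_countable_topology}" and e :: 'a
  defines "h \<equiv> \<lambda>n. inverse (real (Suc n))"
  assumes c: "continuous_on UNIV f" and K: "compact K" "\<And>x. x \<notin> K \<Longrightarrow> f x = 0"
    and L: "\<And>x n. norm (f (x + h n *\<^sub>R e) - f x) \<le> L * h n"
    and d: "\<And>x. (\<lambda>n. (1 / h n) *\<^sub>R (f (x + h n *\<^sub>R e) - f x)) \<longlonglongrightarrow> d x"
  shows "integrable lebesgue d" "(LINT x|lebesgue. d x) = 0"
proof -
  have h: "0 < h n" "h n \<le> 1" for n by (auto simp: h_def field_simps)
  obtain R where R: "\<And>x. x \<in> K \<Longrightarrow> norm x \<le> R" using compact_imp_bounded[OF K(1)] by (auto simp: bounded_iff)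
  have L0: "0 \<le> L" using order_trans[OF norm_ge_zero L[of 0 0]] by (simp add: h_def)
  let ?s = "\<lambda>n x. (1 / h n) *\<^sub>R (f (x + h n *\<^sub>R e) - f x)"
  \<comment> \<open>The steps \<open>h n\<close> are at most 1, so the quotients vanish unless
    \<open>x\<close> is within \<open>norm e\<close> of \<open>K\<close>, and \<open>R\<close>
    bounds the norms in \<open>K\<close>.\<close>
  let ?w = "\<lambda>x. L * indicator (cball 0 (R + norm e)) x"
  have [measurable]: "f \<in> borel_measurable borel" by (rule borel_measurable_continuous_onI[OF c])
  have bound: "norm (?s n x) \<le> ?w x" for n x
  proof (cases "x \<in> cball 0 (R + norm e)")
    case True
    then show ?thesis using L[where x=x and n=n] h[of n] by (simp add: pos_divide_le_eq)
  next
    case False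
    have "f x = 0" by (rule K(2)) (use False R[of x] norm_ge_zero[of e] in \<open>auto intro: order_trans\<close>)
    moreover have "f (x + h n *\<^sub>R e) = 0"
    proof (rule K(2), rule notI)
      assume "x + h n *\<^sub>R e \<in> K"
      then have "norm (x + h n *\<^sub>R e) \<le> R" by (rule R)
      moreover have "norm (h n *\<^sub>R e) \<le> norm e" using h[of n] by (simp add: mult_left_le_one_le)
      moreover have "norm x \<le> norm (x + h n *\<^sub>R e) + norm (h n *\<^sub>R e)"
        using norm_triangle_ineq4[of "x + h n *\<^sub>R e" "h n *\<^sub>R e"] by simp
      ultimately show False using False by simp
    qed
    ultimately show ?thesis using L0 by simp
  qed
  have wi: "integrable lborel ?w"
    by (intro integrable_mult_right integrable_real_indicator)
      (auto simp: emeasure_lborel_cball_finite[unfolded infinity_ennreal_def])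
  have [measurable]: "d \<in> borel_measurable lborel"
    by (rule borel_measurable_LIMSEQ_metric[OF _ d]) measurable
  have D: "integrable lborel d" "(\<lambda>n. integral\<^sup>L lborel (?s n)) \<longlonglongrightarrow> integral\<^sup>L lborel d"
    using d bound wi
    by (intro integrable_dominated_convergence[where s="?s" and w="?w"] integral_dominated_convergence[where w="?w"]
        AE_I2; simp)+
  have fi: "integrable lborel f"
  proof -
    have "integrable lborel (\<lambda>x. indicator K x *\<^sub>R f x)"
      by (rule borel_integrable_compact[OF K(1)]) (rule continuous_on_subset[OF c], simp)
    moreover have "(\<lambda>x. indicator K x *\<^sub>R f x) = f" using K(2) by (auto simp: fun_eq_iff indicator_def)
    ultimately show ?thesis by simp
  qed
  have z: "integral\<^sup>L lborel (?s n) = 0" for n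
  proof -
    have tr: "integrable lborel (\<lambda>x. f (h n *\<^sub>R e + x))" "(LINT x|lborel. f (h n *\<^sub>R e + x)) = integral\<^sup>L lborel f"
      using integrable_distr[of "(+) (h n *\<^sub>R e)" lborel borel f] integral_distr[of "(+) (h n *\<^sub>R e)" lborel borel f] fi
      by (simp_all add: lborel_distr_plus)
    then show ?thesis using fi by (simp add: add.commute)
  qed
  have "integral\<^sup>L lborel d = 0" using D(2) unfolding z LIMSEQ_const_iff by simp
  then show "(LINT x|lebesgue. d x) = 0" by (simp add: integral_completion)
  show "integrable lebesgue d" using D(1) by (simp add: integrable_completion)
qed

lemma has_derivative_directional_limit:
  assumes "(f has_derivative D) (at x)" and h: "h \<longlonglongrightarrow> 0" "\<And>n. 0 < h n"
  shows "(\<lambda>n. (1 / h n) *\<^sub>R (f (x + h n *\<^sub>R e) - f x)) \<longlonglongrightarrow> D e"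
proof (cases "e = 0")
  case True
  then show ?thesis using has_derivative_bounded_linear[OF assms(1)] by (simp add: linear_simps)
next
  case False
  interpret D: bounded_linear D by (rule has_derivative_bounded_linear[OF assms(1)])
  have "filterlim (\<lambda>n. h n *\<^sub>R e) (at 0) sequentially"
    using tendsto_scaleR[OF h(1) tendsto_const, of e] h(2) False
    by (auto simp: filterlim_at less_imp_neq[symmetric])
  then have "(\<lambda>n. norm (f (x + h n *\<^sub>R e) - f x - D (h n *\<^sub>R e)) / norm (h n *\<^sub>R e)) \<longlonglongrightarrow> 0"
    using filterlim_compose[OF conjunct2[OF assms(1)[unfolded has_derivative_at]]] by blast
  then have "(\<lambda>n. norm e * (norm (f (x + h n *\<^sub>R e) - f x - D (h n *\<^sub>R e)) / norm (h n *\<^sub>R e))) \<longlonglongrightarrow> norm e * 0"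
    by (intro tendsto_intros)
  moreover have "norm e * (norm (f (x + h n *\<^sub>R e) - f x - D (h n *\<^sub>R e)) / norm (h n *\<^sub>R e))
      = norm ((1 / h n) *\<^sub>R (f (x + h n *\<^sub>R e) - f x) - D e)" for n
  proof -
    have "(1 / h n) *\<^sub>R (f (x + h n *\<^sub>R e) - f x) - D e = (1 / h n) *\<^sub>R (f (x + h n *\<^sub>R e) - f x - D (h n *\<^sub>R e))"
      using h(2)[of n] by (simp add: D.scaleR scaleR_diff_right less_imp_neq[symmetric])
    then have "norm ((1 / h n) *\<^sub>R (f (x + h n *\<^sub>R e) - f x) - D e) = (1 / h n) * norm (f (x + h n *\<^sub>R e) - f x - D (h n *\<^sub>R e))"
      using h(2)[of n] by (simp only: norm_scaleR) simp
    then show ?thesis using False h(2)[of n] by simp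
  qed
  ultimately have "(\<lambda>n. norm ((1 / h n) *\<^sub>R (f (x + h n *\<^sub>R e) - f x) - D e)) \<longlonglongrightarrow> 0" by simp
  then show ?thesis by (simp add: tendsto_norm_zero_iff LIM_zero_iff)
qed

lemma directional_lipschitz:
  fixes f :: "'a::real_normed_vector \<Rightarrow> 'b::real_normed_vector"
  assumes d: "\<And>x. (f has_derivative D x) (at x)" and B: "\<And>x. norm (D x e) \<le> B" and h: "0 \<le> h"
  shows "norm (f (x + h *\<^sub>R e) - f x) \<le> B * h"
proof -
  have g: "((\<lambda>s. f (x + s *\<^sub>R e)) has_derivative (\<lambda>t. t *\<^sub>R D (x + s *\<^sub>R e) e)) (at s within UNIV)" for s
  proof -
    have "((\<lambda>s. f (x + s *\<^sub>R e)) has_derivative (\<lambda>t. D (x + s *\<^sub>R e) (t *\<^sub>R e))) (at s)"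
      by (rule has_derivative_compose[OF _ d]) (auto intro!: derivative_eq_intros)
    then show ?thesis using has_derivative_bounded_linear[OF d] by (simp add: linear_simps)
  qed
  have "norm (f (x + h *\<^sub>R e) - f (x + 0 *\<^sub>R e)) \<le> B * norm (h - 0)"
  proof (rule differentiable_bound[OF convex_UNIV g])
    show "onorm (\<lambda>t. t *\<^sub>R D (x + s *\<^sub>R e) e) \<le> B" for s
      by (rule onorm_le) (simp add: B mult.commute[of B] mult_left_mono)
  qed auto
  then show ?thesis using h by simp
qed

text \<open>The product of \<open>\<phi>\<close> with a scalar test function has compact support, so
  the integral of its directional derivative vanishes; the product rule splits this integral into
  the two sides of the identity.\<close>

lemma is_weak_deriv_test_function:
  fixes \<phi> :: "'a::euclidean_space \<Rightarrow> 'b::{banach, second_countable_topology}"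
  assumes t: "\<phi> \<in> test_functions \<Omega>'" and b: "b \<in> Basis"
  shows "is_weak_deriv \<Omega> b \<phi> (\<lambda>x. frechet_derivative \<phi> (at x) b)"
proof -
  obtain K B where \<phi>: "compact K" "K \<subseteq> \<Omega>'" "\<And>x. x \<notin> K \<Longrightarrow> \<phi> x = 0"
    "\<And>x. x \<notin> K \<Longrightarrow> frechet_derivative \<phi> (at x) b = 0"
    "\<And>x. norm (\<phi> x) \<le> B" "\<And>x. norm (frechet_derivative \<phi> (at x) b) \<le> B"
    "continuous_on UNIV \<phi>" "continuous_on UNIV (\<lambda>x. frechet_derivative \<phi> (at x) b)"
    "\<And>x. \<phi> differentiable (at x)"
    by (rule test_function_properties[OF t b], rule that; assumption)
  have loc: "locally_integrable \<Omega> f" if f: "continuous_on UNIV f" for f :: "'a \<Rightarrow> 'b"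
    unfolding locally_integrable_def set_integrable_def
  proof (intro allI impI)
    fix K assume "compact K \<and> K \<subseteq> \<Omega>"
    then have "integrable lborel (\<lambda>x. indicator K x *\<^sub>R f x)"
      by (intro borel_integrable_compact) (auto intro: continuous_on_subset[OF f])
    then show "integrable lebesgue (\<lambda>x. indicator K x *\<^sub>R f x)"
      by (subst integrable_completion) auto
  qed
  show ?thesis unfolding is_weak_deriv_def
  proof (intro conjI ballI loc \<phi>)
    fix \<psi> :: "'a \<Rightarrow> real" assume "\<psi> \<in> test_functions \<Omega>"
    note \<psi>t = test_function_properties[OF this b]
    obtain K' B' where \<psi>: "compact K'" "K' \<subseteq> \<Omega>" "\<And>x. x \<notin> K' \<Longrightarrow> \<psi> x = 0"
      "\<And>x. x \<notin> K' \<Longrightarrow> frechet_derivative \<psi> (at x) b = 0"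
      "\<And>x. norm (\<psi> x) \<le> B'" "\<And>x. norm (frechet_derivative \<psi> (at x) b) \<le> B'"
      "continuous_on UNIV \<psi>" "continuous_on UNIV (\<lambda>x. frechet_derivative \<psi> (at x) b)"
      "\<And>x. \<psi> differentiable (at x)"
      by (rule \<psi>t, rule that; assumption)
    let ?f = "\<lambda>x. \<psi> x *\<^sub>R \<phi> x"
    let ?D = "\<lambda>x e. \<psi> x *\<^sub>R frechet_derivative \<phi> (at x) e + frechet_derivative \<psi> (at x) e *\<^sub>R \<phi> x"
    have D: "(?f has_derivative ?D x) (at x)" for x
      by (rule has_derivative_scaleR[OF frechet_derivative_works[THEN iffD1, OF \<psi>(9)]
            frechet_derivative_works[THEN iffD1, OF \<phi>(9)]])
    have B0: "0 \<le> B" "0 \<le> B'" using order_trans[OF norm_ge_zero \<phi>(5)] order_trans[OF norm_ge_zero \<psi>(5)] by auto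
    have "norm (?D x b) \<le> B' * B + B' * B" for x
    proof (rule norm_triangle_le, rule add_mono)
      show "norm (\<psi> x *\<^sub>R frechet_derivative \<phi> (at x) b) \<le> B' * B"
        unfolding norm_scaleR by (rule mult_mono[OF \<psi>(5)[unfolded real_norm_def] \<phi>(6) B0(2) norm_ge_zero])
      show "norm (frechet_derivative \<psi> (at x) b *\<^sub>R \<phi> x) \<le> B' * B"
        unfolding norm_scaleR by (rule mult_mono[OF \<psi>(6)[unfolded real_norm_def] \<phi>(5) B0(2) norm_ge_zero])
    qed
    note lip = directional_lipschitz[OF D this]
    have int: "(LINT x|lebesgue. ?D x b) = 0"
    proof (rule integral_directional_derivative_zero)
      show "continuous_on UNIV ?f" by (intro continuous_intros \<phi> \<psi>)
      show "compact K'" "x \<notin> K' \<Longrightarrow> ?f x = 0" for x using \<psi> by auto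
      show "(\<lambda>n. (1 / inverse (real (Suc n))) *\<^sub>R (?f (x + inverse (real (Suc n)) *\<^sub>R b) - ?f x)) \<longlonglongrightarrow> ?D x b" for x
        by (rule has_derivative_directional_limit[OF D LIMSEQ_inverse_real_of_nat]) simp
      show "norm (?f (x + inverse (real (Suc n)) *\<^sub>R b) - ?f x) \<le> (B' * B + B' * B) * inverse (real (Suc n))" for x n
        by (rule lip) simp
    qed
    have \<psi>B: "\<And>x. \<bar>\<psi> x\<bar> \<le> B'" "\<And>x. \<bar>frechet_derivative \<psi> (at x) b\<bar> \<le> B'" using \<psi>(5,6) by simp_all
    have 1: "integrable lebesgue (\<lambda>x. \<psi> x *\<^sub>R (indicator K' x *\<^sub>R frechet_derivative \<phi> (at x) b))"
      by (rule compact_support_mult_locally_integrable(3)[OF loc[OF \<phi>(8)] \<psi>(7) \<psi>B(1) \<psi>(1,2,3)])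
    have 2: "integrable lebesgue (\<lambda>x. frechet_derivative \<psi> (at x) b *\<^sub>R (indicator K' x *\<^sub>R \<phi> x))"
      by (rule compact_support_mult_locally_integrable(3)[OF loc[OF \<phi>(7)] \<psi>(8) \<psi>B(2) \<psi>(1,2,4)])
    have eq1: "(LINT x:\<Omega>|lebesgue. \<psi> x *\<^sub>R frechet_derivative \<phi> (at x) b)
        = (LINT x|lebesgue. \<psi> x *\<^sub>R (indicator K' x *\<^sub>R frechet_derivative \<phi> (at x) b))"
      by (rule compact_support_mult_locally_integrable(2)[OF loc[OF \<phi>(8)] \<psi>(7) \<psi>B(1) \<psi>(1,2,3)])
    have eq2: "(LINT x:\<Omega>|lebesgue. frechet_derivative \<psi> (at x) b *\<^sub>R \<phi> x)
        = (LINT x|lebesgue. frechet_derivative \<psi> (at x) b *\<^sub>R (indicator K' x *\<^sub>R \<phi> x))"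
      by (rule compact_support_mult_locally_integrable(2)[OF loc[OF \<phi>(7)] \<psi>(8) \<psi>B(2) \<psi>(1,2,4)])
    have "?D x b = \<psi> x *\<^sub>R (indicator K' x *\<^sub>R frechet_derivative \<phi> (at x) b) + frechet_derivative \<psi> (at x) b *\<^sub>R (indicator K' x *\<^sub>R \<phi> x)" for x
      using \<psi>(3,4)[of x] by (cases "x \<in> K'") auto
    then have "(LINT x|lebesgue. \<psi> x *\<^sub>R (indicator K' x *\<^sub>R frechet_derivative \<phi> (at x) b))
      + (LINT x|lebesgue. frechet_derivative \<psi> (at x) b *\<^sub>R (indicator K' x *\<^sub>R \<phi> x)) = 0"
      using int 1 2 by simp
    then show "(LINT x:\<Omega>|lebesgue. frechet_derivative \<psi> (at x) b *\<^sub>R \<phi> x) = - (LINT x:\<Omega>|lebesgue. \<psi> x *\<^sub>R frechet_derivative \<phi> (at x) b)"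
      unfolding eq1 eq2 by (simp only: eq_neg_iff_add_eq_0 add.commute)
  qed
qed

section \<open>Uniqueness of weak derivatives\<close>

text \<open>Smooth cutoffs tend to the indicator of a box, so the integral of \<open>g\<close>
  vanishes over every box with closure in \<open>\<Omega>\<close>. Inside such a box these integrals
  determine \<open>g\<close>, and countably many closed boxes cover \<open>\<Omega>\<close>.\<close>

lemma fundamental_lemma_real:
  fixes g :: "'a::euclidean_space \<Rightarrow> real"
  assumes \<Omega>: "open \<Omega>" and g: "locally_integrable \<Omega> g"
    and zero: "\<And>\<phi>. \<phi> \<in> test_functions \<Omega> \<Longrightarrow> (LINT x:\<Omega>|lebesgue. \<phi> x *\<^sub>R g x) = 0"
  shows "AE x\<in>\<Omega> in lebesgue. g x = 0"
proof -
  have box0: "(LINT x|lebesgue. indicator (box a b) x * g x) = 0" if ab: "cbox a b \<subseteq> \<Omega>" for a b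
  proof (cases "box a b = {}")
    case False
    let ?G = "\<lambda>x. indicator (cbox a b) x *\<^sub>R g x"
    have i: "integrable lebesgue ?G"
      using g ab by (simp add: locally_integrable_def set_integrable_def)
    note [measurable] = borel_measurable_integrable[OF i]
    obtain N where N: "\<And>n. n \<ge> N \<Longrightarrow> 0 < n \<and> (\<forall>i\<in>Basis. 1 \<le> real n * (b \<bullet> i - a \<bullet> i))"
      using box_cutoff_eventually[OF False] by (auto simp: eventually_sequentially)
    let ?c = "\<lambda>n. box_cutoff a b (n + N)"
    have c: "0 \<le> ?c n x" "?c n x \<le> 1" "x \<notin> box a b \<Longrightarrow> ?c n x = 0" "?c n \<in> test_functions \<Omega>" for n x
      using box_cutoff[where n = "n + N" and a = a and b = b] N[of "n + N"] ab by auto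
    obtain bb :: 'a where bb: "bb \<in> Basis" using nonempty_Basis by blast
    have [measurable]: "?c n \<in> borel_measurable lebesgue" for n
      using test_function_properties[OF c(4) bb] continuous_borel_measurable_lebesgue by metis
    have "(LINT x|lebesgue. ?c n x *\<^sub>R ?G x) = 0" for n
    proof -
      have "(\<lambda>x. indicator \<Omega> x *\<^sub>R (?c n x *\<^sub>R g x)) = (\<lambda>x. ?c n x *\<^sub>R ?G x)"
        using c(3)[of _ n] ab box_subset_cbox[of a b] by (auto simp: indicator_def fun_eq_iff)
      then show ?thesis using zero[OF c(4)[of n]] unfolding set_lebesgue_integral_def by (simp only:)
    qed
    moreover have "(\<lambda>n. LINT x|lebesgue. ?c n x *\<^sub>R ?G x) \<longlonglongrightarrow> (LINT x|lebesgue. indicator (box a b) x * g x)"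
    proof (rule integral_dominated_convergence)
      show "integrable lebesgue (\<lambda>x. norm (?G x))" using i by simp
      have eq: "?c n x *\<^sub>R ?G x = ?c n x * g x" for n x
        using c(3)[of x n] box_subset_cbox[of a b] by (auto simp: indicator_def)
      have "(\<lambda>n. ?c n x * g x) \<longlonglongrightarrow> indicator (box a b) x * g x" for x
        by (intro tendsto_intros LIMSEQ_ignore_initial_segment box_cutoff_tendsto False)
      then show "AE x in lebesgue. (\<lambda>n. ?c n x *\<^sub>R ?G x) \<longlonglongrightarrow> indicator (box a b) x * g x"
        unfolding eq by simp
      have eq': "(\<lambda>x. indicator (box a b) x * g x) = (\<lambda>x. indicator (box a b) x * ?G x)"
        using box_subset_cbox[of a b] by (auto simp: fun_eq_iff indicator_def)
      show "(\<lambda>x. indicator (box a b) x * g x) \<in> borel_measurable lebesgue" unfolding eq'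
        by (intro borel_measurable_times borel_measurable_indicator borel_measurable_integrable[OF i]) auto
      show "AE x in lebesgue. norm (?c n x *\<^sub>R ?G x) \<le> norm (?G x)" for n
        using c(1,2) by (auto intro!: AE_I2 mult_left_le_one_le simp: abs_mult)
    qed measurable
    ultimately show ?thesis by (simp add: LIMSEQ_const_iff)
  qed simp
  have cb: "AE x in lebesgue. x \<in> cbox a b \<longrightarrow> g x = 0" if ab: "cbox a b \<subseteq> \<Omega>" for a b
  proof -
    let ?h = "\<lambda>x. indicator (box a b) x * g x"
    have i: "integrable lebesgue (\<lambda>x. indicator (cbox a b) x *\<^sub>R g x)"
      using g ab by (simp add: locally_integrable_def set_integrable_def)
    have "(\<lambda>x. indicator (box a b) x * (indicator (cbox a b) x *\<^sub>R g x)) = ?h"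
      using box_subset_cbox[of a b] by (auto simp: fun_eq_iff indicator_def)
    then have ih: "integrable lebesgue ?h"
      using integrable_mult_indicator[OF _ i, of "box a b"] by simp
    have "AE x in lebesgue. ?h x = 0"
    proof (rule AE_zero_if_rational_box_integrals_zero)
      show "?h \<in> borel_measurable lebesgue" using ih by simp
      fix A :: "'a set" assume "A \<in> rational_box_set"
      then obtain c d where A: "A = box c d" by (auto simp: rational_box_set_def)
      have As: "A \<in> sets lebesgue" by (simp add: A)
      show "integrable lebesgue (\<lambda>x. indicator A x * ?h x)"
        by (rule integrable_mult_indicator[OF As ih, unfolded real_scaleR_def])
      \<comment> \<open>Boxes are stable under intersection, which reduces the localised integrals
        to \<open>box0\<close>; the closure of a nonempty intersection remains in
        \<open>cbox a b\<close>.\<close>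
      obtain a' b' where ab': "box a b \<inter> box c d = box a' b'" unfolding box_Int_box by blast
      have cl: "box a' b' = {} \<or> cbox a' b' \<subseteq> \<Omega>"
      proof (cases "box a' b' = {}")
        case False
        then have "cbox a' b' = closure (box a' b')" by (simp add: closure_box)
        also have "\<dots> \<subseteq> closure (box a b)" using ab' by (intro closure_mono) auto
        also have "\<dots> \<subseteq> cbox a b" by (simp add: closure_minimal box_subset_cbox closed_cbox)
        finally show ?thesis using ab by blast
      qed simp
      have "(\<lambda>x. indicator A x * ?h x) = (\<lambda>x. indicator (box a' b') x * g x)"
        unfolding ab'[symmetric] A by (auto simp: fun_eq_iff indicator_def)
      then show "(LINT x|lebesgue. indicator A x * ?h x) = 0" using cl box0[of a' b'] by auto
    qed
    moreover have "AE x in lebesgue. x \<notin> cbox a b - box a b"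
      by (rule AE_not_in) (use negligible_frontier_interval[of a b] in \<open>simp add: negligible_iff_null_sets\<close>)
    ultimately show ?thesis by eventually_elim (auto simp: indicator_def)
  qed
  obtain \<D> where \<D>: "countable \<D>" "\<D> \<subseteq> Pow \<Omega>" "\<And>X. X \<in> \<D> \<Longrightarrow> \<exists>a b. X = cbox a b" "\<Union>\<D> = \<Omega>"
    using open_countable_Union_open_cbox[OF \<Omega>] by metis
  have "AE x in lebesgue. \<forall>X\<in>\<D>. x \<in> X \<longrightarrow> g x = 0"
  proof (subst AE_ball_countable[OF \<D>(1)], intro ballI)
    fix X assume X: "X \<in> \<D>"
    then obtain a b where "X = cbox a b" using \<D>(3) by blast
    then show "AE x in lebesgue. x \<in> X \<longrightarrow> g x = 0" using cb[of a b] X \<D>(2) by auto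
  qed
  then show ?thesis by eventually_elim (use \<D>(4) in auto)
qed

text \<open>The scalar lemma applies to \<open>g x \<bullet> d\<close> for each \<open>d\<close>.
  Restricting \<open>d\<close> to a countable dense set keeps the exceptional set null, and a vector
  orthogonal to a dense set is 0.\<close>

lemma fundamental_lemma:
  fixes g :: "'a::euclidean_space \<Rightarrow> 'b::{banach, real_inner, second_countable_topology}"
  assumes \<Omega>: "open \<Omega>" and g: "locally_integrable \<Omega> g"
    and zero: "\<And>\<phi>. \<phi> \<in> test_functions \<Omega> \<Longrightarrow> (LINT x:\<Omega>|lebesgue. \<phi> x *\<^sub>R g x) = 0"
  shows "AE x\<in>\<Omega> in lebesgue. g x = 0"
proof -
  obtain D :: "'b set" where D: "countable D" "\<And>X. open X \<Longrightarrow> X \<noteq> {} \<Longrightarrow> \<exists>d\<in>D. d \<in> X"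
    using countable_dense_exists by blast
  obtain bb :: 'a where bb: "bb \<in> Basis" using nonempty_Basis by blast
  have "AE x in lebesgue. x \<in> \<Omega> \<longrightarrow> g x \<bullet> d = 0" for d
  proof (rule fundamental_lemma_real[OF \<Omega>])
    show "locally_integrable \<Omega> (\<lambda>x. g x \<bullet> d)"
      unfolding locally_integrable_def set_integrable_def
    proof (intro allI impI)
      fix K assume "compact K \<and> K \<subseteq> \<Omega>"
      then have "integrable lebesgue (\<lambda>x. (indicator K x *\<^sub>R g x) \<bullet> d)"
        using g by (intro integrable_inner_left) (auto simp: locally_integrable_def set_integrable_def)
      then show "integrable lebesgue (\<lambda>x. indicator K x *\<^sub>R (g x \<bullet> d))" by simp
    qed
    fix \<phi> :: "'a \<Rightarrow> real" assume t: "\<phi> \<in> test_functions \<Omega>"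
    from test_function_properties[OF t bb]
    obtain K B where \<phi>: "compact K" "K \<subseteq> \<Omega>" "\<And>x. x \<notin> K \<Longrightarrow> \<phi> x = 0"
      "\<And>x. norm (\<phi> x) \<le> B" "continuous_on UNIV \<phi>" by metis
    have "set_integrable lebesgue \<Omega> (\<lambda>x. \<phi> x *\<^sub>R g x)"
      by (rule compact_support_mult_locally_integrable(1)[OF g \<phi>(5) _ \<phi>(1,2,3)]) (use \<phi>(4) in simp)
    then have "(LINT x|lebesgue. (indicator \<Omega> x *\<^sub>R (\<phi> x *\<^sub>R g x)) \<bullet> d) = (LINT x|lebesgue. indicator \<Omega> x *\<^sub>R (\<phi> x *\<^sub>R g x)) \<bullet> d"
      by (intro integral_inner_left) (simp add: set_integrable_def)
    also have "\<dots> = 0" using zero[OF t] by (simp add: set_lebesgue_integral_def)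
    finally show "(LINT x:\<Omega>|lebesgue. \<phi> x *\<^sub>R (g x \<bullet> d)) = 0"
      by (simp add: set_lebesgue_integral_def mult.assoc)
  qed
  then have "AE x in lebesgue. \<forall>d\<in>D. x \<in> \<Omega> \<longrightarrow> g x \<bullet> d = 0"
    by (intro AE_ball_countable[THEN iffD2, OF D(1)] ballI)
  then show ?thesis
  proof eventually_elim
    case (elim x)
    show ?case
    proof (rule impI, rule ccontr)
      assume x: "x \<in> \<Omega>" and n: "g x \<noteq> 0"
      then obtain d where d: "d \<in> D" "d \<in> ball (g x) (norm (g x))" using D(2)[of "ball (g x) (norm (g x))"] by auto
      have "norm (g x) * norm (g x) = g x \<bullet> (g x - d)"
        using elim d(1) x by (simp add: inner_diff_right power2_norm_eq_inner[symmetric] power2_eq_square)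
      also have "\<dots> \<le> norm (g x) * norm (g x - d)" by (rule norm_cauchy_schwarz)
      also have "\<dots> < norm (g x) * norm (g x)" using d(2) n by (intro mult_strict_left_mono) (auto simp: dist_norm)
      finally show False by simp
    qed
  qed
qed


lemma locally_integrable_cong_AE:
  fixes u v :: "'a::euclidean_space \<Rightarrow> 'b::{banach, second_countable_topology}"
  assumes "locally_integrable \<Omega> u" "AE x\<in>\<Omega> in lebesgue. u x = v x"
  shows "locally_integrable \<Omega> v"
  unfolding locally_integrable_def
proof (intro allI impI)
  fix K assume K: "compact K \<and> K \<subseteq> \<Omega>"
  have "AE x\<in>K in lebesgue. u x = v x" using assms(2) by eventually_elim (use K in auto)
  then show "set_integrable lebesgue K v"
    using assms(1) K by (intro set_integrable_cong_AE'[of K u v]) (auto simp: locally_integrable_def)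
qed

lemma locally_integrable_add:
  fixes u v :: "'a::euclidean_space \<Rightarrow> 'b::{banach, second_countable_topology}"
  assumes "locally_integrable \<Omega> u" "locally_integrable \<Omega> v"
  shows "locally_integrable \<Omega> (\<lambda>x. u x + v x)"
  using assms by (auto simp: locally_integrable_def intro!: set_integral_add)

lemma locally_integrable_scaleR:
  fixes u :: "'a::euclidean_space \<Rightarrow> 'b::{banach, second_countable_topology}"
  assumes "locally_integrable \<Omega> u"
  shows "locally_integrable \<Omega> (\<lambda>x. c *\<^sub>R u x)"
  using assms by (auto simp: locally_integrable_def intro!: set_integrable_scaleR_right)

lemma test_integrable:
  fixes u :: "'a::euclidean_space \<Rightarrow> 'b::{banach, second_countable_topology}"
  assumes u: "locally_integrable \<Omega> u" and t: "\<phi> \<in> test_functions \<Omega>" and b: "b \<in> Basis"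
  shows "set_integrable lebesgue \<Omega> (\<lambda>x. \<phi> x *\<^sub>R u x)"
    "set_integrable lebesgue \<Omega> (\<lambda>x. frechet_derivative \<phi> (at x) b *\<^sub>R u x)"
proof -
  obtain K B where \<phi>: "compact K" "K \<subseteq> \<Omega>" "\<And>x. x \<notin> K \<Longrightarrow> \<phi> x = 0"
    "\<And>x. x \<notin> K \<Longrightarrow> frechet_derivative \<phi> (at x) b = 0"
    "\<And>x. norm (\<phi> x) \<le> B" "\<And>x. norm (frechet_derivative \<phi> (at x) b) \<le> B"
    "continuous_on UNIV \<phi>" "continuous_on UNIV (\<lambda>x. frechet_derivative \<phi> (at x) b)"
    "\<And>x. \<phi> differentiable (at x)"
    by (rule test_function_properties[OF t b], rule that; assumption)
  show "set_integrable lebesgue \<Omega> (\<lambda>x. \<phi> x *\<^sub>R u x)"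
    by (rule compact_support_mult_locally_integrable(1)[OF u \<phi>(7) _ \<phi>(1,2,3)]) (use \<phi>(5) in simp)
  show "set_integrable lebesgue \<Omega> (\<lambda>x. frechet_derivative \<phi> (at x) b *\<^sub>R u x)"
    by (rule compact_support_mult_locally_integrable(1)[OF u \<phi>(8) _ \<phi>(1,2,4)]) (use \<phi>(6) in simp)
qed

lemma is_weak_deriv_add:
  fixes u v :: "'a::euclidean_space \<Rightarrow> 'b::{banach, second_countable_topology}"
  assumes b: "b \<in> Basis" and u: "is_weak_deriv \<Omega> b u g" and v: "is_weak_deriv \<Omega> b v h"
  shows "is_weak_deriv \<Omega> b (\<lambda>x. u x + v x) (\<lambda>x. g x + h x)"
  unfolding is_weak_deriv_def
proof (intro conjI ballI)
  have loc: "locally_integrable \<Omega> u" "locally_integrable \<Omega> g" "locally_integrable \<Omega> v" "locally_integrable \<Omega> h"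
    using u v by (auto simp: is_weak_deriv_def)
  then show "locally_integrable \<Omega> (\<lambda>x. u x + v x)" "locally_integrable \<Omega> (\<lambda>x. g x + h x)"
    by (auto intro: locally_integrable_add)
  fix \<phi> :: "'a \<Rightarrow> real" assume t: "\<phi> \<in> test_functions \<Omega>"
  note i1 = set_integral_add(2)[OF test_integrable(2)[OF loc(1) t b] test_integrable(2)[OF loc(3) t b]]
  note i2 = set_integral_add(2)[OF test_integrable(1)[OF loc(2) t b] test_integrable(1)[OF loc(4) t b]]
  show "(LINT x:\<Omega>|lebesgue. frechet_derivative \<phi> (at x) b *\<^sub>R (u x + v x)) = - (LINT x:\<Omega>|lebesgue. \<phi> x *\<^sub>R (g x + h x))"
    using u v t unfolding scaleR_add_right i1 i2 by (simp add: is_weak_deriv_def)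
qed

lemma is_weak_deriv_scaleR:
  assumes b: "b \<in> Basis" and u: "is_weak_deriv \<Omega> b u g"
  shows "is_weak_deriv \<Omega> b (\<lambda>x. c *\<^sub>R u x) (\<lambda>x. c *\<^sub>R g x)"
proof -
  have "(LINT x:\<Omega>|lebesgue. a x *\<^sub>R c *\<^sub>R f x) = c *\<^sub>R (LINT x:\<Omega>|lebesgue. a x *\<^sub>R f x)"
    for a :: "'a \<Rightarrow> real" and f :: "'a \<Rightarrow> 'b"
  proof -
    have "(LINT x:\<Omega>|lebesgue. a x *\<^sub>R c *\<^sub>R f x) = (LINT x:\<Omega>|lebesgue. c *\<^sub>R (a x *\<^sub>R f x))"
      by (simp add: mult.commute)
    then show ?thesis by (simp only: set_integral_scaleR_right)
  qed
  then show ?thesis using u unfolding is_weak_deriv_def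
    by (auto simp: locally_integrable_scaleR)
qed

lemma is_weak_deriv_diff:
  assumes b: "b \<in> Basis" and u: "is_weak_deriv \<Omega> b u g" and v: "is_weak_deriv \<Omega> b v h"
  shows "is_weak_deriv \<Omega> b (\<lambda>x. u x - v x) (\<lambda>x. g x - h x)"
  using is_weak_deriv_add[OF b u is_weak_deriv_scaleR[OF b v, of "-1"]] by simp

lemma is_weak_deriv_cong_AE:
  assumes b: "b \<in> Basis" and u: "is_weak_deriv \<Omega> b u g"
    and eq: "AE x\<in>\<Omega> in lebesgue. u x = v x" "AE x\<in>\<Omega> in lebesgue. g x = h x"
  shows "is_weak_deriv \<Omega> b v h"
proof -
  have loc: "locally_integrable \<Omega> u" "locally_integrable \<Omega> g" using u by (auto simp: is_weak_deriv_def)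
  have "(LINT x:\<Omega>|lebesgue. frechet_derivative \<phi> (at x) b *\<^sub>R v x) = - (LINT x:\<Omega>|lebesgue. \<phi> x *\<^sub>R h x)"
    if t: "\<phi> \<in> test_functions \<Omega>" for \<phi>
  proof -
    have "(LINT x:\<Omega>|lebesgue. frechet_derivative \<phi> (at x) b *\<^sub>R u x) = (LINT x:\<Omega>|lebesgue. frechet_derivative \<phi> (at x) b *\<^sub>R v x)"
      by (rule set_integral_cong_AE'[OF set_integrable_measurable[OF test_integrable(2)[OF loc(1) t b]]])
        (use eq(1) in \<open>auto elim: eventually_mono\<close>)
    moreover have "(LINT x:\<Omega>|lebesgue. \<phi> x *\<^sub>R g x) = (LINT x:\<Omega>|lebesgue. \<phi> x *\<^sub>R h x)"
      by (rule set_integral_cong_AE'[OF set_integrable_measurable[OF test_integrable(1)[OF loc(2) t b]]])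
        (use eq(2) in \<open>auto elim: eventually_mono\<close>)
    ultimately show ?thesis using u t by (simp add: is_weak_deriv_def)
  qed
  then show ?thesis unfolding is_weak_deriv_def
    using loc locally_integrable_cong_AE eq by blast
qed

lemma is_weak_deriv_unique:
  fixes u :: "'a::euclidean_space \<Rightarrow> 'b::{banach, real_inner, second_countable_topology}"
  assumes b: "b \<in> Basis" and \<Omega>: "open \<Omega>" and g: "is_weak_deriv \<Omega> b u g" and h: "is_weak_deriv \<Omega> b u h"
  shows "AE x\<in>\<Omega> in lebesgue. g x = h x"
proof -
  have d: "is_weak_deriv \<Omega> b (\<lambda>x. 0) (\<lambda>x. g x - h x)"
    using is_weak_deriv_diff[OF b g h] by simp
  have "AE x\<in>\<Omega> in lebesgue. g x - h x = 0"
    by (rule fundamental_lemma[OF \<Omega>]) (use d in \<open>auto simp: is_weak_deriv_def\<close>)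
  then show ?thesis by simp
qed

lemma weak_deriv_is_weak_deriv:
  "is_weak_deriv \<Omega> b u g \<Longrightarrow> is_weak_deriv \<Omega> b u (weak_deriv \<Omega> b u)"
  unfolding weak_deriv_def by (rule someI[where P = "is_weak_deriv \<Omega> b u"])

text \<open>\<open>weak_deriv\<close> is an arbitrary choice among all versions; uniqueness pins it
  down up to a null set.\<close>

lemma weak_deriv_AE:
  fixes u :: "'a::euclidean_space \<Rightarrow> 'b::{banach, real_inner, second_countable_topology}"
  assumes "b \<in> Basis" "open \<Omega>" "is_weak_deriv \<Omega> b u g"
  shows "AE x\<in>\<Omega> in lebesgue. weak_deriv \<Omega> b u x = g x"
  by (rule is_weak_deriv_unique[OF assms(1,2) weak_deriv_is_weak_deriv[OF assms(3)] assms(3)])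

section \<open>Weak derivatives in time\<close>

text \<open>For a test function \<open>\<psi>\<close> the right difference quotients of
  \<open>\<psi> t *\<^sub>R u t\<close> converge at every point, are bounded and have integral 0, so
  dominated convergence yields the integration by parts formula. Lipschitz bounds are asked for only
  away from time 0, where the speed of the flow may blow up.\<close>

lemma is_weak_deriv_right_derivative:
  fixes u g :: "real \<Rightarrow> 'b::{banach, second_countable_topology}"
  defines "h \<equiv> \<lambda>n. inverse (real (Suc n))"
  assumes \<Omega>: "open \<Omega>" "\<Omega> \<subseteq> {0<..}"
    and lip: "\<And>\<delta> M. \<delta> > 0 \<Longrightarrow> \<exists>L. \<forall>s\<in>{\<delta>..M}. \<forall>t\<in>{\<delta>..M}. norm (u t - u s) \<le> L * \<bar>t - s\<bar>"
    and d: "\<And>t. t > 0 \<Longrightarrow> (\<lambda>n. (1 / h n) *\<^sub>R (u (t + h n) - u t)) \<longlonglongrightarrow> g t"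
  shows "is_weak_deriv \<Omega> 1 u g" "continuous_on {0<..} u" "set_borel_measurable lebesgue {0<..} g"
proof -
  have h: "0 < h n" for n by (simp add: h_def)
  have h1: "h n \<le> 1" for n by (simp add: h_def field_simps)
  have h_eq: "inverse (real (Suc n)) = h n" for n by (simp add: h_def)
  have hl: "h \<longlonglongrightarrow> 0" unfolding h_def by (rule LIMSEQ_inverse_real_of_nat)
  have c: "isCont u t" if t: "t > 0" for t
  proof -
    obtain L where L: "\<forall>s\<in>{t/2..2*t}. \<forall>r\<in>{t/2..2*t}. norm (u r - u s) \<le> L * \<bar>r - s\<bar>"
      using lip[of "t/2" "2*t"] t by auto
    have "\<bar>L\<bar>-lipschitz_on {t/2..2*t} u"
    proof (rule lipschitz_onI)
      fix r s assume "r \<in> {t/2..2*t}" "s \<in> {t/2..2*t}"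
      then have "norm (u r - u s) \<le> L * \<bar>r - s\<bar>" using L by blast
      also have "\<dots> \<le> \<bar>L\<bar> * \<bar>r - s\<bar>" by (intro mult_right_mono) auto
      finally show "dist (u r) (u s) \<le> \<bar>L\<bar> * dist r s" by (simp add: dist_norm)
    qed simp
    then have "continuous_on {t/2..2*t} u" by (rule lipschitz_on_continuous_on)
    then show ?thesis
      using t by (intro continuous_on_interior[of "{t/2..2*t}"]) auto
  qed
  then show cu: "continuous_on {0<..} u" by (auto intro!: continuous_at_imp_continuous_on)
  have meas: "(\<lambda>t. indicator {0<..} t *\<^sub>R f t) \<in> borel_measurable lebesgue"
    if "continuous_on {0<..} f" for f :: "real \<Rightarrow> 'b"
    using borel_measurable_continuous_on_indicator[OF _ that] by (intro measurable_completion) auto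
  have mg: "(\<lambda>t. indicator {0<..} t *\<^sub>R g t) \<in> borel_measurable lebesgue"
  proof (rule borel_measurable_LIMSEQ_metric)
    show "(\<lambda>t. indicator {0<..} t *\<^sub>R ((1 / h n) *\<^sub>R (u (t + h n) - u t))) \<in> borel_measurable lebesgue" for n
      using h[of n] by (intro meas continuous_intros continuous_on_compose2[OF cu] cu) (auto intro: add_pos_pos)
    show "(\<lambda>n. indicator {0<..} t *\<^sub>R ((1 / h n) *\<^sub>R (u (t + h n) - u t))) \<longlonglongrightarrow> indicator {0<..} t *\<^sub>R g t" for t
      using d[of t] by (cases "t > 0") auto
  qed
  then show "set_borel_measurable lebesgue {0<..} g" by (simp add: set_borel_measurable_def)
  have locu: "locally_integrable \<Omega> u"
    unfolding locally_integrable_def set_integrable_def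
  proof (intro allI impI)
    fix K assume "compact K \<and> K \<subseteq> \<Omega>"
    then have "integrable lborel (\<lambda>x. indicator K x *\<^sub>R u x)"
      using \<Omega> by (intro borel_integrable_compact) (auto intro: continuous_on_subset[OF cu])
    then show "integrable lebesgue (\<lambda>x. indicator K x *\<^sub>R u x)"
      by (subst integrable_completion) auto
  qed
  have locg: "locally_integrable \<Omega> g"
    unfolding locally_integrable_def
  proof (intro allI impI)
    fix K assume K: "compact K \<and> K \<subseteq> \<Omega>"
    show "set_integrable lebesgue K g"
    proof (cases "K = {}")
      case False
      obtain \<delta> where \<delta>: "\<delta> \<in> K" "\<And>t. t \<in> K \<Longrightarrow> \<delta> \<le> t" using compact_attains_inf[of K] K False by auto
      then have \<delta>0: "\<delta> > 0" using K \<Omega> by auto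
      obtain M where M: "\<And>t. t \<in> K \<Longrightarrow> t \<le> M" using compact_attains_sup[of K] K False by blast
      obtain L where L: "\<forall>s\<in>{\<delta>..M+1}. \<forall>t\<in>{\<delta>..M+1}. norm (u t - u s) \<le> L * \<bar>t - s\<bar>"
        using lip[OF \<delta>0] by blast
      have gL: "norm (g t) \<le> L" if "t \<in> {\<delta>..M}" for t
      proof (rule LIMSEQ_le_const2[OF tendsto_norm[OF d]])
        show "t > 0" using that \<delta>0 by simp
        have "norm ((1 / h n) *\<^sub>R (u (t + h n) - u t)) \<le> L" for n
        proof -
          have "norm (u (t + h n) - u t) \<le> L * \<bar>t + h n - t\<bar>"
            using L[rule_format, of t "t + h n"] that h[of n] h1[of n] by simp
          then show ?thesis using h[of n] by (simp add: pos_divide_le_eq)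
        qed
        then show "\<exists>N. \<forall>n\<ge>N. norm ((1 / h n) *\<^sub>R (u (t + h n) - u t)) \<le> L" by blast
      qed
      have Kf: "emeasure lebesgue K < \<infinity>" using K emeasure_compact_finite[of K] by (simp add: compact_imp_closed)
      have Ks: "K \<in> sets lebesgue" using K by (simp add: compact_imp_closed)
      have "set_integrable lebesgue K (\<lambda>_. L)"
        unfolding set_integrable_def using Kf Ks by (simp add: integrable_real_indicator)
      then show ?thesis
      proof (rule set_integrable_bound)
        have eq: "(\<lambda>t. indicator K t *\<^sub>R (indicator {0<..} t *\<^sub>R g t)) = (\<lambda>t. indicator K t *\<^sub>R g t)"
          using K \<Omega> by (auto simp: fun_eq_iff indicator_def)
        have "(\<lambda>t. indicator K t *\<^sub>R (indicator {0<..} t *\<^sub>R g t)) \<in> borel_measurable lebesgue"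
          by (intro borel_measurable_scaleR borel_measurable_indicator Ks mg)
        then show "set_borel_measurable lebesgue K g"
          unfolding set_borel_measurable_def eq .
        show "AE x in lebesgue. x \<in> K \<longrightarrow> norm (g x) \<le> norm L"
          using gL \<delta>(2) M by (auto intro!: AE_I2 order_trans[OF _ abs_ge_self])
      qed
    qed (simp add: set_integrable_def)
  qed
  show "is_weak_deriv \<Omega> 1 u g" unfolding is_weak_deriv_def
  proof (intro conjI ballI locu locg)
    fix \<psi> :: "real \<Rightarrow> real" assume t: "\<psi> \<in> test_functions \<Omega>"
    have b1: "(1::real) \<in> Basis" by simp
    obtain K B where \<psi>: "compact K" "K \<subseteq> \<Omega>" "\<And>x. x \<notin> K \<Longrightarrow> \<psi> x = 0"
      "\<And>x. x \<notin> K \<Longrightarrow> frechet_derivative \<psi> (at x) 1 = 0"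
      "\<And>x. norm (\<psi> x) \<le> B" "\<And>x. norm (frechet_derivative \<psi> (at x) 1) \<le> B"
      "continuous_on UNIV \<psi>" "continuous_on UNIV (\<lambda>x. frechet_derivative \<psi> (at x) 1)"
      "\<And>x. \<psi> differentiable (at x)"
      by (rule test_function_properties[OF t b1], rule that; assumption)
    have B0: "0 \<le> B" using order_trans[OF norm_ge_zero \<psi>(5)] by auto
    \<comment> \<open>The margins serve the shifts by \<open>h n \<le> 1\<close>: for
      \<open>t\<close> in \<open>[\<delta>, M]\<close> the point \<open>t + h n\<close> stays in
      \<open>[\<delta>, M + 2]\<close>, and for \<open>t < \<delta>\<close> it does not reach
      \<open>K\<close> once \<open>h n < \<delta>\<close>.\<close>
    obtain \<delta> M where \<delta>: "\<delta> > 0" "\<And>t. t \<in> K \<Longrightarrow> 2 * \<delta> \<le> t \<and> t \<le> M" "\<delta> \<le> M + 1"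
    proof (cases "K = {}")
      case False
      obtain a where a: "a \<in> K" "\<And>t. t \<in> K \<Longrightarrow> a \<le> t" using compact_attains_inf[OF \<psi>(1) False] by auto
      obtain b where b: "b \<in> K" "\<And>t. t \<in> K \<Longrightarrow> t \<le> b" using compact_attains_sup[OF \<psi>(1) False] by auto
      show ?thesis using that[of "a/2" b] a b b(2)[OF a(1)] \<psi>(2) \<Omega>(2) by auto
    next
      case True then show ?thesis using that[of 1 0] by simp
    qed
    let ?I = "{\<delta>..M + 2}" and ?c = "\<lambda>t. min (max t \<delta>) (M + 2)"
    obtain L where L: "\<forall>s\<in>?I. \<forall>t\<in>?I. norm (u t - u s) \<le> L * \<bar>t - s\<bar>" using lip[OF \<delta>(1)] by blast
    have cI: "?c t \<in> ?I" for t using \<delta>(3) by auto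
    have L0: "0 \<le> L"
    proof -
      have "\<delta> \<in> ?I" "\<delta> + 1 \<in> ?I" using \<delta>(3) by auto
      then have "norm (u (\<delta> + 1) - u \<delta>) \<le> L * \<bar>(\<delta> + 1) - \<delta>\<bar>" using L by blast
      then have "norm (u (\<delta> + 1) - u \<delta>) \<le> L" by simp
      with norm_ge_zero show ?thesis by (rule order_trans)
    qed
    text \<open>Modifying \<open>u\<close> off the support of \<open>\<psi>\<close> makes it globally Lipschitz continuous.\<close>
    define w where "w t = u (?c t)" for t
    have wl: "norm (w t - w s) \<le> L * \<bar>t - s\<bar>" for s t
    proof -
      have "norm (w t - w s) \<le> L * \<bar>?c t - ?c s\<bar>" unfolding w_def using L cI by blast
      also have "\<dots> \<le> L * \<bar>t - s\<bar>" by (rule mult_left_mono[OF _ L0]) (auto simp: max_def min_def)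
      finally show ?thesis .
    qed
    have cw: "continuous_on UNIV w"
      by (rule lipschitz_on_continuous_on[of L]) (use wl L0 in \<open>auto intro!: lipschitz_onI simp: dist_norm\<close>)
    let ?f = "\<lambda>t. \<psi> t *\<^sub>R w t" and ?\<psi>' = "\<lambda>t. frechet_derivative \<psi> (at t) 1"
    let ?d = "\<lambda>t. \<psi> t *\<^sub>R (indicator K t *\<^sub>R g t) + ?\<psi>' t *\<^sub>R (indicator K t *\<^sub>R u t)"
    define C where "C = norm (w \<delta>) + L * \<bar>M - \<delta>\<bar>"
    have D\<psi>: "(\<psi> has_derivative frechet_derivative \<psi> (at t)) (at t)" for t
      using \<psi>(9) frechet_derivative_works by blast
    have "(LINT x|lebesgue. ?d x) = 0"
    proof (rule integral_directional_derivative_zero[of ?f K 1 "B * L + B * C", unfolded h_eq])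
      show "continuous_on UNIV ?f" by (intro continuous_intros \<psi> cw)
      show "compact K" "x \<notin> K \<Longrightarrow> ?f x = 0" for x using \<psi> by auto
      show "norm (?f (t + h n *\<^sub>R 1) - ?f t) \<le> (B * L + B * C) * h n" for t n
      proof (cases "t \<le> M")
        case True
        have "norm (w t) \<le> norm (w \<delta>) + norm (w t - w \<delta>)" using norm_triangle_sub by blast
        also have "norm (w t - w \<delta>) \<le> L * \<bar>?c t - ?c \<delta>\<bar>" unfolding w_def using L cI by blast
        also have "\<dots> \<le> L * \<bar>M - \<delta>\<bar>" using True \<delta>(3) by (intro mult_left_mono[OF _ L0]) (auto simp: max_def min_def)
        finally have wC: "norm (w t) \<le> C" by (simp add: C_def)
        have "?f (t + h n *\<^sub>R 1) - ?f t = \<psi> (t + h n) *\<^sub>R (w (t + h n) - w t) + (\<psi> (t + h n *\<^sub>R 1) - \<psi> t) *\<^sub>R w t"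
          by (simp add: algebra_simps)
        also have "norm \<dots> \<le> B * (L * h n) + (B * h n) * C"
        proof (rule norm_triangle_le, rule add_mono)
          show "norm (\<psi> (t + h n) *\<^sub>R (w (t + h n) - w t)) \<le> B * (L * h n)"
            unfolding norm_scaleR using \<psi>(5)[of "t + h n"] wl[of "t + h n" t] h[of n] B0 by (intro mult_mono) auto
          have "norm (\<psi> (t + h n *\<^sub>R 1) - \<psi> t) \<le> B * h n"
            using directional_lipschitz[OF D\<psi> \<psi>(6)] h[of n] by simp
          then show "norm ((\<psi> (t + h n *\<^sub>R 1) - \<psi> t) *\<^sub>R w t) \<le> (B * h n) * C"
            unfolding norm_scaleR using wC h[of n] B0 by (intro mult_mono) auto
        qed
        finally show ?thesis by (simp add: algebra_simps)
      next
        case False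
        then have "t \<notin> K" "t + h n \<notin> K" using \<delta>(2)[of t] \<delta>(2)[of "t + h n"] h[of n] by auto
        moreover have "0 \<le> C" using L0 by (simp add: C_def)
        ultimately show ?thesis using \<psi>(3) B0 L0 h[of n] by simp
      qed
      show "(\<lambda>n. (1 / h n) *\<^sub>R (?f (t + h n *\<^sub>R 1) - ?f t)) \<longlonglongrightarrow> ?d t" for t
      proof (cases "\<delta> \<le> t \<and> t \<le> M")
        case True
        have t0: "t > 0" using True \<delta> by simp
        have "(1 / h n) *\<^sub>R (?f (t + h n *\<^sub>R 1) - ?f t) = \<psi> (t + h n) *\<^sub>R ((1 / h n) *\<^sub>R (u (t + h n) - u t))
            + ((1 / h n) *\<^sub>R (\<psi> (t + h n *\<^sub>R 1) - \<psi> t)) *\<^sub>R u t" for n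
        proof -
          have "w (t + h n) = u (t + h n)" "w t = u t"
            using True h[of n] h1[of n] by (simp_all add: w_def max_absorb1 min_absorb1)
          then show ?thesis by (simp add: algebra_simps)
        qed
        moreover have "(\<lambda>n. \<psi> (t + h n)) \<longlonglongrightarrow> \<psi> t"
        proof (rule continuous_on_tendsto_compose[OF \<psi>(7)])
          show "(\<lambda>n. t + h n) \<longlonglongrightarrow> t" using tendsto_add[OF tendsto_const hl, of t] by simp
        qed auto
        then have "(\<lambda>n. \<psi> (t + h n) *\<^sub>R ((1 / h n) *\<^sub>R (u (t + h n) - u t))
            + ((1 / h n) *\<^sub>R (\<psi> (t + h n *\<^sub>R 1) - \<psi> t)) *\<^sub>R u t) \<longlonglongrightarrow> \<psi> t *\<^sub>R g t + ?\<psi>' t *\<^sub>R u t"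
          by (intro tendsto_intros d t0 has_derivative_directional_limit[OF D\<psi> hl h])
        moreover have "\<psi> t *\<^sub>R g t + ?\<psi>' t *\<^sub>R u t = ?d t" using \<psi>(3,4)[of t] by (cases "t \<in> K") auto
        ultimately show ?thesis by simp
      next
        case False
        have "\<forall>\<^sub>F n in sequentially. h n < \<delta>" by (rule order_tendstoD(2)[OF hl \<delta>(1)])
        then have "\<forall>\<^sub>F n in sequentially. (1 / h n) *\<^sub>R (?f (t + h n *\<^sub>R 1) - ?f t) = 0"
        proof eventually_elim
          case (elim n)
          have "t + h n \<notin> K" "t \<notin> K" using \<delta>(2)[of "t + h n"] \<delta>(2)[of t] elim False \<delta>(1) h[of n] by auto
          then show ?case using \<psi>(3) by simp
        qed
        moreover have "?d t = 0"
        proof -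
          have "t \<notin> K" using \<delta>(2)[of t] False \<delta>(1) by auto
          then show ?thesis by simp
        qed
        ultimately show ?thesis by (simp add: tendsto_eventually)
      qed
    qed
    then have zero: "(LINT x|lebesgue. \<psi> x *\<^sub>R (indicator K x *\<^sub>R g x) + ?\<psi>' x *\<^sub>R (indicator K x *\<^sub>R u x)) = 0" .
    have \<psi>B: "\<And>x. \<bar>\<psi> x\<bar> \<le> B" "\<And>x. \<bar>?\<psi>' x\<bar> \<le> B" using \<psi>(5,6) by simp_all
    have i1: "integrable lebesgue (\<lambda>x. \<psi> x *\<^sub>R (indicator K x *\<^sub>R g x))"
      by (rule compact_support_mult_locally_integrable(3)[OF locg \<psi>(7) \<psi>B(1) \<psi>(1,2,3)])
    have i2: "integrable lebesgue (\<lambda>x. ?\<psi>' x *\<^sub>R (indicator K x *\<^sub>R u x))"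
      by (rule compact_support_mult_locally_integrable(3)[OF locu \<psi>(8) \<psi>B(2) \<psi>(1,2,4)])
    have eq1: "(LINT x:\<Omega>|lebesgue. \<psi> x *\<^sub>R g x) = (LINT x|lebesgue. \<psi> x *\<^sub>R (indicator K x *\<^sub>R g x))"
      by (rule compact_support_mult_locally_integrable(2)[OF locg \<psi>(7) \<psi>B(1) \<psi>(1,2,3)])
    have eq2: "(LINT x:\<Omega>|lebesgue. ?\<psi>' x *\<^sub>R u x) = (LINT x|lebesgue. ?\<psi>' x *\<^sub>R (indicator K x *\<^sub>R u x))"
      by (rule compact_support_mult_locally_integrable(2)[OF locu \<psi>(8) \<psi>B(2) \<psi>(1,2,4)])
    have "(LINT x:\<Omega>|lebesgue. \<psi> x *\<^sub>R g x) + (LINT x:\<Omega>|lebesgue. ?\<psi>' x *\<^sub>R u x) = 0"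
      unfolding eq1 eq2 using zero by (simp only: Bochner_Integration.integral_add[OF i1 i2])
    then show "(LINT x:\<Omega>|lebesgue. frechet_derivative \<psi> (at x) 1 *\<^sub>R u x) = - (LINT x:\<Omega>|lebesgue. \<psi> x *\<^sub>R g x)"
      by (simp add: eq_neg_iff_add_eq_0 add.commute)
  qed
qed


lemma smooth_step_derivative:
  obtains d where "\<And>t. (smooth_step has_real_derivative d t) (at t)" "continuous_on UNIV d"
    "\<And>t. 0 \<le> d t" "\<And>t. t < 0 \<or> 1 < t \<Longrightarrow> d t = 0"
proof -
  obtain E where E: "E 0 = smooth_step" "\<And>k t. (E k has_real_derivative E (Suc k) t) (at t)"
    using smooth_step(1) unfolding smooth1_def by blast
  have d: "(smooth_step has_real_derivative E 1 t) (at t)" for t using E(2)[of 0 t] by (simp add: E(1))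
  have "continuous_on UNIV (E 1)"
    by (intro continuous_at_imp_continuous_on ballI DERIV_isCont[OF E(2)])
  moreover have "0 \<le> E 1 t" for t
    by (rule mono_on_imp_deriv_nonneg[OF _ d, of UNIV]) (use smooth_step(4) in auto)
  moreover have "E 1 t = 0" if t: "t < 0 \<or> 1 < t" for t
  proof -
    obtain c S where S: "open S" "t \<in> S" "\<And>x. x \<in> S \<Longrightarrow> c = smooth_step x"
    proof (cases "t < 0")
      case True show ?thesis by (rule that[of "{..<0}" 0]) (use True smooth_step(2) in auto)
    next
      case False show ?thesis by (rule that[of "{1<..}" 1]) (use t False smooth_step(3) in auto)
    qed
    have "(smooth_step has_real_derivative 0) (at t)"
      by (rule has_field_derivative_transform_within_open[OF DERIV_const S])
    then show ?thesis using DERIV_unique[OF d] by blast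
  qed
  ultimately show thesis using that[OF d] by blast
qed

text \<open>As the derivative of \<open>A\<close> the weight \<open>a\<close> has integral 1, so the
  integral is an average of values within \<open>e\<close> of \<open>z\<close>.\<close>

lemma mollifier_bound:
  fixes v :: "real \<Rightarrow> 'b::{banach, second_countable_topology}"
  assumes a: "continuous_on UNIV a" "\<And>x. 0 \<le> a x" "\<And>x. x \<notin> {c..d} \<Longrightarrow> a x = 0"
    and A: "\<And>x. (A has_real_derivative a x) (at x)" "A d - A c = 1" and cd: "c \<le> d"
    and v: "integrable lebesgue (\<lambda>x. a x *\<^sub>R v x)" "\<And>x. x \<in> {c..d} \<Longrightarrow> norm (v x - z) \<le> e"
  shows "norm ((LINT x|lebesgue. a x *\<^sub>R v x) - z) \<le> e"
proof -
  have "has_bochner_integral lborel (\<lambda>x. a x * indicator {c..d} x) (A d - A c)"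
    by (rule has_bochner_integral_FTC_Icc_real[OF cd A(1)])
      (use a(1) in \<open>simp add: continuous_on_eq_continuous_at\<close>)
  moreover have "(\<lambda>x. a x * indicator {c..d} x) = a" using a(3) by (auto simp: fun_eq_iff indicator_def)
  ultimately have "has_bochner_integral lborel a 1" using A(2) by simp
  then have ai: "integrable lebesgue a" "(LINT x|lebesgue. a x) = 1"
    using continuous_borel_measurable_lebesgue[OF a(1)] borel_measurable_continuous_onI[OF a(1)]
    by (auto simp: has_bochner_integral_iff integrable_completion integral_completion)
  have "(LINT x|lebesgue. a x *\<^sub>R v x) - z = (LINT x|lebesgue. a x *\<^sub>R v x - a x *\<^sub>R z)"
    using v(1) ai by (subst Bochner_Integration.integral_diff) auto
  also have "norm \<dots> \<le> (LINT x|lebesgue. norm (a x *\<^sub>R v x - a x *\<^sub>R z))" by (rule integral_norm_bound)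
  also have "\<dots> \<le> (LINT x|lebesgue. a x * e)"
  proof (rule integral_mono)
    show "integrable lebesgue (\<lambda>x. norm (a x *\<^sub>R v x - a x *\<^sub>R z))" using v(1) ai by auto
    show "integrable lebesgue (\<lambda>x. a x * e)" using ai by auto
    fix x
    show "norm (a x *\<^sub>R v x - a x *\<^sub>R z) \<le> a x * e"
    proof (cases "x \<in> {c..d}")
      case True
      have "norm (a x *\<^sub>R v x - a x *\<^sub>R z) = a x * norm (v x - z)"
        using a(2)[of x] by (simp add: scaleR_diff_right[symmetric] del: scaleR_diff_right)
      then show ?thesis using v(2)[OF True] a(2)[of x] by (simp add: mult_left_mono)
    qed (use a(3) in simp)
  qed
  also have "\<dots> = e" using ai by simp
  finally show ?thesis .
qed

text \<open>The weak formulation is tested with cutoffs of the interval from \<open>s\<close> to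
  \<open>t\<close>. They tend to its indicator, while their derivatives are differences of two
  approximate unit masses at \<open>s\<close> and at \<open>t\<close>, where \<open>v\<close> is
  continuous.\<close>

lemma weak_deriv_integral:
  fixes v g :: "real \<Rightarrow> 'b::{banach, second_countable_topology}"
  assumes v: "continuous_on {0<..} v" and g: "is_weak_deriv {0<..} 1 v g" and st: "0 < s" "s < t"
  shows "set_integrable lebesgue {s<..<t} g" "v t - v s = (LINT x:{s<..<t}|lebesgue. g x)"
proof -
  have loc: "locally_integrable {0<..} v" "locally_integrable {0<..} g" using g by (auto simp: is_weak_deriv_def)
  have gi: "set_integrable lebesgue {s..t} g"
  proof -
    have "compact {s..t}" "{s..t} \<subseteq> {0<..}" using st by auto
    then show ?thesis using loc(2) unfolding locally_integrable_def by blast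
  qed
  then show gi': "set_integrable lebesgue {s<..<t} g" by (rule set_integrable_subset) auto
  have st_box: "box s t \<noteq> {}" "cbox s t \<subseteq> {0<..}" using st by auto
  obtain N where N: "\<And>n. n \<ge> N \<Longrightarrow> 0 < n \<and> 1 \<le> real n * (t - s)"
    using box_cutoff_eventually[OF st_box(1)] by (auto simp: eventually_sequentially)
  let ?c = "\<lambda>n. box_cutoff s t (n + N)"
  have c: "0 \<le> ?c n x" "?c n x \<le> 1" "x \<notin> box s t \<Longrightarrow> ?c n x = 0" "?c n \<in> test_functions {0<..}" for n x
    using box_cutoff[where n = "n + N" and a = s and b = t] N[of "n + N"] st_box by auto
  have b1: "(1::real) \<in> Basis" by simp
  have eqc: "?c n = cutoff s t (real (n + N))" for n by (simp add: box_cutoff_def fun_eq_iff)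
  have test: "(LINT x:{0<..}|lebesgue. frechet_derivative (?c n) (at x) 1 *\<^sub>R v x) = - (LINT x:{0<..}|lebesgue. ?c n x *\<^sub>R g x)" for n
    using g c(4)[of n] by (auto simp: is_weak_deriv_def)
  have lim1: "(\<lambda>n. LINT x:{0<..}|lebesgue. ?c n x *\<^sub>R g x) \<longlonglongrightarrow> (LINT x:{s<..<t}|lebesgue. g x)"
    unfolding set_lebesgue_integral_def
  proof (rule integral_dominated_convergence)
    show "(\<lambda>x. indicator {s<..<t} x *\<^sub>R g x) \<in> borel_measurable lebesgue"
      using gi' by (simp add: set_integrable_def)
    show "(\<lambda>x. indicator {0<..} x *\<^sub>R ?c n x *\<^sub>R g x) \<in> borel_measurable lebesgue" for n
      using test_integrable(1)[OF loc(2) c(4) b1] by (simp add: set_integrable_def)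
    show "integrable lebesgue (\<lambda>x. norm (indicator {s..t} x *\<^sub>R g x))"
      using gi by (simp only: set_integrable_def integrable_norm)
    have eq: "indicator {0<..} x *\<^sub>R ?c n x *\<^sub>R g x = ?c n x *\<^sub>R (indicator {s..t} x *\<^sub>R g x)" for n x
      using c(3)[of x n] st by (auto simp: indicator_def)
    have "(\<lambda>n. ?c n x *\<^sub>R (indicator {s..t} x *\<^sub>R g x)) \<longlonglongrightarrow> indicator (box s t) x *\<^sub>R (indicator {s..t} x *\<^sub>R g x)" for x
      by (intro tendsto_intros LIMSEQ_ignore_initial_segment box_cutoff_tendsto st_box)
    moreover have eq2: "indicator (box s t) x *\<^sub>R (indicator {s..t} x *\<^sub>R g x) = indicator {s<..<t} x *\<^sub>R g x" for x
      by (auto simp: indicator_def)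
    ultimately have "(\<lambda>n. ?c n x *\<^sub>R (indicator {s..t} x *\<^sub>R g x)) \<longlonglongrightarrow> indicator {s<..<t} x *\<^sub>R g x" for x
      by (simp only: eq2)
    then show "AE x in lebesgue. (\<lambda>n. indicator {0<..} x *\<^sub>R ?c n x *\<^sub>R g x) \<longlonglongrightarrow> indicator {s<..<t} x *\<^sub>R g x"
      unfolding eq by (intro AE_I2)
    show "AE x in lebesgue. norm (indicator {0<..} x *\<^sub>R ?c n x *\<^sub>R g x) \<le> norm (indicator {s..t} x *\<^sub>R g x)" for n
      unfolding eq using c(1,2)[of n] by (auto intro!: AE_I2 mult_left_le_one_le simp: mult.assoc)
  qed
  obtain d where d: "\<And>t. (smooth_step has_real_derivative d t) (at t)" "continuous_on UNIV d"
    "\<And>t. 0 \<le> d t" "\<And>t. t < 0 \<or> 1 < t \<Longrightarrow> d t = 0"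
    by (rule smooth_step_derivative, rule that; assumption)
  \<comment> \<open>The derivatives of the rising ramp, to the right of \<open>s\<close>, and of the
    falling ramp, to the left of \<open>t\<close>.\<close>
  define a where "a n x = real (n + N) * d (real (n + N) * (x - s))" for n x
  define b where "b n x = real (n + N) * d (real (n + N) * (x - t) + 1)" for n x
  have A: "((\<lambda>x. smooth_step (real (n + N) * (x - s))) has_real_derivative a n x) (at x)"
    "((\<lambda>x. smooth_step (real (n + N) * (x - t) + 1)) has_real_derivative b n x) (at x)" for n x
  proof -
    have "((\<lambda>x. smooth_step (k * (x - r) + c)) has_real_derivative d (k * (x - r) + c) * k) (at x)" for k r c
      by (rule DERIV_chain2[OF d(1)]) (auto intro!: derivative_eq_intros)
    from this[of "real (n + N)" s 0] this[of "real (n + N)" t 1]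
    show "((\<lambda>x. smooth_step (real (n + N) * (x - s))) has_real_derivative a n x) (at x)"
      "((\<lambda>x. smooth_step (real (n + N) * (x - t) + 1)) has_real_derivative b n x) (at x)"
      unfolding a_def b_def by (simp_all only: add_0_right mult.commute[of _ "d _"])
  qed
  have fd: "frechet_derivative (?c n) (at x) 1 = a n x - b n x" for n x
  proof -
    have "(?c n has_real_derivative (a n x - b n x)) (at x)"
      unfolding eqc cutoff_def[abs_def] by (intro DERIV_diff A)
    from frechet_derivative_at[OF this[unfolded has_field_derivative_def]]
    show ?thesis by (metis mult.right_neutral)
  qed
  have cont: "continuous_on UNIV (a n)" "continuous_on UNIV (b n)" for n
    unfolding a_def b_def by (intro continuous_intros continuous_on_compose2[OF d(2)]; simp)+
  have nn: "0 \<le> a n x" "0 \<le> b n x" for n x unfolding a_def b_def using d(3) by auto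
  let ?h = "\<lambda>n. 1 / real (n + N)"
  have nN: "0 < real (n + N)" "1 \<le> real (n + N) * (t - s)" for n using N[of "n + N"] by auto
  have hst: "0 < ?h n" "?h n \<le> t - s" for n using nN[of n] by (auto simp: pos_divide_le_eq mult.commute)
  have out: "x \<notin> {s..s + ?h n} \<Longrightarrow> a n x = 0" "x \<notin> {t - ?h n..t} \<Longrightarrow> b n x = 0" for n x
  proof -
    have k: "real (n + N) * ?h n = 1" using nN[of n] by simp
    show "a n x = 0" if "x \<notin> {s..s + ?h n}"
    proof -
      have "x - s < 0 \<or> ?h n < x - s" using that by auto
      then have "real (n + N) * (x - s) < 0 \<or> 1 < real (n + N) * (x - s)"
        using nN(1)[of n] mult_strict_left_mono[OF _ nN(1)[of n], of "?h n" "x - s"] unfolding k by (auto simp: mult_less_0_iff)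
      then show ?thesis using d(4) by (simp add: a_def)
    qed
    show "b n x = 0" if "x \<notin> {t - ?h n..t}"
    proof -
      have "x - t < - ?h n \<or> 0 < x - t" using that by auto
      then have "real (n + N) * (x - t) < - 1 \<or> 0 < real (n + N) * (x - t)"
        using nN(1)[of n] mult_strict_left_mono[OF _ nN(1)[of n], of "x - t" "- ?h n"] k by auto
      then have "real (n + N) * (x - t) + 1 < 0 \<or> 1 < real (n + N) * (x - t) + 1" by auto
      then show ?thesis using d(4) by (simp add: b_def)
    qed
  qed
  have compl: "integrable lebesgue (\<lambda>x. f x *\<^sub>R v x)"
    if "continuous_on UNIV f" "\<And>x. x \<notin> {c..d} \<Longrightarrow> f x = 0" "0 < c" for f :: "real \<Rightarrow> real" and c d
  proof -
    have "integrable lborel (\<lambda>x. indicator {c..d} x *\<^sub>R (f x *\<^sub>R v x))"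
      using that(3) by (intro borel_integrable_compact continuous_intros continuous_on_subset[OF that(1)] continuous_on_subset[OF v]) auto
    then have "integrable lebesgue (\<lambda>x. indicator {c..d} x *\<^sub>R (f x *\<^sub>R v x))"
      by (subst integrable_completion) auto
    moreover have "(\<lambda>x. indicator {c..d} x *\<^sub>R (f x *\<^sub>R v x)) = (\<lambda>x. f x *\<^sub>R v x)"
      using that(2) by (auto simp: fun_eq_iff indicator_def)
    ultimately show ?thesis by simp
  qed
  have ia: "integrable lebesgue (\<lambda>x. a n x *\<^sub>R v x)" for n by (rule compl[OF cont(1) out(1) st(1)])
  have ib: "integrable lebesgue (\<lambda>x. b n x *\<^sub>R v x)" for n
  proof (rule compl[OF cont(2) out(2)])
    have "s \<le> t - ?h n" using hst(2)[of n] by argo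
    with st(1) show "0 < t - ?h n" by (rule less_le_trans)
  qed
  \<comment> \<open>Stated for both endpoints at once: nonnegative weights of total mass 1 on
    intervals of length \<open>?h n\<close> that contain \<open>r\<close>.\<close>
  have lim_av: "(\<lambda>n. LINT x|lebesgue. f n x *\<^sub>R v x) \<longlonglongrightarrow> v r"
    if f: "\<And>n. continuous_on UNIV (f n)" "\<And>n x. 0 \<le> f n x" "\<And>n x. x \<notin> {c n..e n} \<Longrightarrow> f n x = 0"
      "\<And>n x. (A n has_real_derivative f n x) (at x)" "\<And>n. A n (e n) - A n (c n) = 1"
      "\<And>n. integrable lebesgue (\<lambda>x. f n x *\<^sub>R v x)"
      "\<And>n. c n \<le> r" "\<And>n. r \<le> e n" "\<And>n. e n - c n = ?h n" "0 < r"
    for f A :: "nat \<Rightarrow> real \<Rightarrow> real" and c e r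
  proof (rule LIMSEQ_I)
    fix \<epsilon> :: real assume \<epsilon>: "0 < \<epsilon>"
    have "isCont v r" using v f(10) by (simp add: continuous_on_eq_continuous_at)
    then obtain \<delta> where \<delta>: "\<delta> > 0" "\<And>x. dist x r < \<delta> \<Longrightarrow> dist (v x) (v r) < \<epsilon>/2"
      using \<epsilon> by (metis continuous_at_eps_delta half_gt_zero dist_norm)
    obtain M where M: "1 / \<delta> < real M" using reals_Archimedean2 by blast
    have "norm ((LINT x|lebesgue. f n x *\<^sub>R v x) - v r) < \<epsilon>" if n: "n \<ge> M" for n
    proof -
      have "1 / \<delta> < real (n + N)" using M n by linarith
      then have h\<delta>: "?h n < \<delta>" using \<delta>(1) nN(1)[of n] by (simp add: field_simps)
      have "norm ((LINT x|lebesgue. f n x *\<^sub>R v x) - v r) \<le> \<epsilon>/2"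
      proof (rule mollifier_bound[OF f(1,2,3,4,5)])
        show "c n \<le> e n" using f(7)[of n] f(8)[of n] by linarith
        show "integrable lebesgue (\<lambda>x. f n x *\<^sub>R v x)" by (rule f)
        fix x assume "x \<in> {c n..e n}"
        then have "dist x r \<le> ?h n" using f(7)[of n] f(8)[of n] f(9)[of n] by (auto simp: dist_real_def)
        then show "norm (v x - v r) \<le> \<epsilon>/2" using \<delta>(2)[of x] h\<delta> by (auto simp: dist_norm)
      qed
      then show ?thesis using \<epsilon> by linarith
    qed
    then show "\<exists>M. \<forall>n\<ge>M. norm ((LINT x|lebesgue. f n x *\<^sub>R v x) - v r) < \<epsilon>" by blast
  qed
  have la: "(\<lambda>n. LINT x|lebesgue. a n x *\<^sub>R v x) \<longlonglongrightarrow> v s"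
    by (rule lim_av[OF cont(1) nn(1) out(1) A(1) _ ia])
      (use st nN hst in \<open>auto simp: smooth_step less_imp_le less_imp_neq[symmetric]\<close>)
  have lb: "(\<lambda>n. LINT x|lebesgue. b n x *\<^sub>R v x) \<longlonglongrightarrow> v t"
    by (rule lim_av[OF cont(2) nn(2) out(2) A(2) _ ib])
      (use st nN hst in \<open>auto simp: smooth_step less_imp_le less_imp_neq[symmetric]\<close>)
  have "(LINT x:{0<..}|lebesgue. frechet_derivative (?c n) (at x) 1 *\<^sub>R v x)
      = (LINT x|lebesgue. a n x *\<^sub>R v x) - (LINT x|lebesgue. b n x *\<^sub>R v x)" for n
  proof -
    have "indicator {0<..} x *\<^sub>R ((a n x - b n x) *\<^sub>R v x) = a n x *\<^sub>R v x - b n x *\<^sub>R v x" for x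
      using out(1)[of x n] out(2)[of x n] hst[of n] st
      by (cases "x > 0") (auto simp: scaleR_diff_left)
    then show ?thesis unfolding set_lebesgue_integral_def fd using ia ib by simp
  qed
  with test have "(\<lambda>n. - (LINT x:{0<..}|lebesgue. ?c n x *\<^sub>R g x)) \<longlonglongrightarrow> v s - v t"
    using tendsto_diff[OF la lb] by simp
  moreover have "(\<lambda>n. - (LINT x:{0<..}|lebesgue. ?c n x *\<^sub>R g x)) \<longlonglongrightarrow> - (LINT x:{s<..<t}|lebesgue. g x)"
    by (intro tendsto_minus lim1)
  ultimately have "v s - v t = - (LINT x:{s<..<t}|lebesgue. g x)" by (rule LIMSEQ_unique)
  then show "v t - v s = (LINT x:{s<..<t}|lebesgue. g x)" by (simp add: algebra_simps minus_equation_iff)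
qed

section \<open>Uniform convexity and completeness of Lebesgue spaces\<close>

text \<open>The mean value theorem on the two halves of \<open>[x, y]\<close>, with a strictly
  increasing derivative since \<open>p > 1\<close>.\<close>

lemma powr_midpoint_strict:
  fixes x y p :: real
  assumes "0 \<le> x" "x < y" "1 < p"
  shows "((x + y) / 2) powr p < (x powr p + y powr p) / 2"
proof -
  define m where "m = (x + y) / 2"
  have m: "x < m" "m < y" "0 < m" using assms by (auto simp: m_def)
  have cont: "continuous_on S (\<lambda>t. t powr p)" if "S \<subseteq> {0..}" for S
    using that assms(3) by (intro continuous_on_powr' continuous_intros) auto
  have der: "((\<lambda>t. t powr p) has_real_derivative p * t powr (p - 1)) (at t)" if "0 < t" for t
    using has_real_derivative_powr[OF that, of p] by simp
  have ex: "\<exists>z. a < z \<and> z < b \<and> b powr p - a powr p = (b - a) * (p * z powr (p - 1))" if ab: "0 \<le> a" "a < b" for a b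
  proof -
    have "continuous_on {a..b} (\<lambda>t. t powr p)" using ab by (intro cont) auto
    moreover have "(\<lambda>t. t powr p) differentiable (at t)" if "a < t" "t < b" for t
      using der[of t] ab that by (auto simp: real_differentiable_def)
    ultimately obtain l z where z: "a < z" "z < b" "((\<lambda>t. t powr p) has_real_derivative l) (at z)"
      "b powr p - a powr p = (b - a) * l" using MVT[OF ab(2)] by metis
    have "l = p * z powr (p - 1)" by (rule DERIV_unique[OF z(3) der]) (use z ab in simp)
    then show ?thesis using z by blast
  qed
  obtain z1 where z1: "x < z1" "z1 < m" "m powr p - x powr p = (m - x) * (p * z1 powr (p - 1))"
    using ex[OF assms(1) m(1)] by blast
  obtain z2 where z2: "m < z2" "z2 < y" "y powr p - m powr p = (y - m) * (p * z2 powr (p - 1))"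
    using ex[OF less_imp_le[OF m(3)] m(2)] by blast
  have "z1 powr (p - 1) < z2 powr (p - 1)" using z1 z2 assms by (intro powr_less_mono2) auto
  then have "(m - x) * (p * z1 powr (p - 1)) < (m - x) * (p * z2 powr (p - 1))"
    using m assms by (intro mult_strict_left_mono) auto
  moreover have e: "m - x = y - m" by (simp add: m_def field_simps)
  ultimately have "(m - x) * (p * z1 powr (p - 1)) < (y - m) * (p * z2 powr (p - 1))" by (simp only: e)
  then have "m powr p - x powr p < y powr p - m powr p" by (simp only: z1(3) z2(3))
  then show ?thesis unfolding m_def by (simp add: field_simps)
qed

text \<open>Strictness has two sources: the parallelogram law if the norms are equal, strict
  convexity of the power if they differ.\<close>

lemma norm_powr_midpoint:
  fixes a b :: "'b::real_inner" and p :: real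
  assumes p: "1 < p"
  shows "norm ((1/2) *\<^sub>R (a + b)) powr p \<le> (norm a powr p + norm b powr p) / 2"
    and "a \<noteq> b \<Longrightarrow> norm ((1/2) *\<^sub>R (a + b)) powr p < (norm a powr p + norm b powr p) / 2"
proof -
  have strict: "norm ((1/2) *\<^sub>R (a + b)) powr p < (norm a powr p + norm b powr p) / 2" if ab: "a \<noteq> b"
  proof (cases "norm a = norm b")
    case True
    have "(norm ((1/2) *\<^sub>R (a + b)))\<^sup>2 = (norm a)\<^sup>2 / 2 + (norm b)\<^sup>2 / 2 - (norm (a - b))\<^sup>2 / 4"
      by (simp add: power2_norm_eq_inner inner_diff_left inner_diff_right inner_add_left inner_add_right
          inner_commute field_simps)
    moreover have "0 < (norm (a - b))\<^sup>2" using ab by simp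
    ultimately have "(norm ((1/2) *\<^sub>R (a + b)))\<^sup>2 < (norm a)\<^sup>2" unfolding True[symmetric] by linarith
    then have "norm ((1/2) *\<^sub>R (a + b)) < norm a" by (rule power2_less_imp_less) simp
    then have "norm ((1/2) *\<^sub>R (a + b)) powr p < norm a powr p" using p by (intro powr_less_mono2) auto
    then show ?thesis using True by simp
  next
    case False
    have "norm ((1/2) *\<^sub>R (a + b)) \<le> (norm a + norm b) / 2"
      using norm_triangle_ineq[of a b] by simp
    then have "norm ((1/2) *\<^sub>R (a + b)) powr p \<le> ((norm a + norm b) / 2) powr p"
      using p by (intro powr_mono2) auto
    also have "\<dots> < (norm a powr p + norm b powr p) / 2"
    proof (cases "norm a < norm b")
      case True then show ?thesis using powr_midpoint_strict[of "norm a" "norm b" p] p by simp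
    next
      case False
      then have "norm b < norm a" using \<open>norm a \<noteq> norm b\<close> by simp
      then show ?thesis using powr_midpoint_strict[of "norm b" "norm a" p] p by (simp add: add.commute)
    qed
    finally show ?thesis .
  qed
  then show "a \<noteq> b \<Longrightarrow> norm ((1/2) *\<^sub>R (a + b)) powr p < (norm a powr p + norm b powr p) / 2" .
  show "norm ((1/2) *\<^sub>R (a + b)) powr p \<le> (norm a powr p + norm b powr p) / 2"
  proof (cases "a = b")
    case True then show ?thesis by (simp add: scaleR_2[symmetric])
  qed (use strict in simp)
qed

text \<open>
  By homogeneity the defect in the midpoint inequality has to be bounded from below only on a compact set.
\<close>

lemma norm_powr_uniformly_convex:
  fixes p \<epsilon> :: real
  assumes p: "1 < p" and \<epsilon>: "0 < \<epsilon>"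
  obtains C where "0 \<le> C" "\<And>a b :: 'b::euclidean_space. norm (a - b) powr p \<le>
    \<epsilon> * (norm a powr p + norm b powr p)
    + C * ((norm a powr p + norm b powr p) / 2 - norm ((1/2) *\<^sub>R (a + b)) powr p)"
proof -
  let ?s = "\<lambda>x :: 'b \<times> 'b. norm (fst x) powr p + norm (snd x) powr p"
  let ?d = "\<lambda>x :: 'b \<times> 'b. ?s x / 2 - norm ((1/2) *\<^sub>R (fst x + snd x)) powr p"
  let ?e = "\<lambda>x :: 'b \<times> 'b. norm (fst x - snd x) powr p"
  have cont: "continuous_on UNIV ?s" "continuous_on UNIV ?d" "continuous_on UNIV ?e"
    using p by (auto intro!: continuous_intros continuous_on_powr')
  \<comment> \<open>Normalised pairs whose distance is bounded from below; on this compact set the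
    positive defect \<open>?d\<close> has a positive lower bound \<open>m\<close>.\<close>
  define K where "K = {x. ?s x = 1 \<and> \<epsilon> \<le> ?e x}"
  have le1: "norm (fst x) \<le> 1 \<and> norm (snd x) \<le> 1" if "?s x = 1" for x
  proof -
    have "norm (fst x) powr p \<le> 1 powr p" "norm (snd x) powr p \<le> 1 powr p"
      using that powr_ge_zero[of "norm (fst x)" p] powr_ge_zero[of "norm (snd x)" p] by (simp_all del: powr_ge_zero)
    then show ?thesis using p powr_less_mono2[of p 1 "norm (fst x)"] powr_less_mono2[of p 1 "norm (snd x)"]
      by (meson less_le_not_le linorder_le_less_linear not_le order_less_trans zero_le_one zero_less_one)
  qed
  have "compact K"
  proof (rule compact_eq_bounded_closed[THEN iffD2, OF conjI])
    show "bounded K"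
    proof (rule boundedI)
      fix x assume "x \<in> K"
      then have "norm (fst x) \<le> 1 \<and> norm (snd x) \<le> 1" by (intro le1) (simp add: K_def)
      then show "norm x \<le> 2" using norm_Pair_le[of "fst x" "snd x"] by simp
    qed
    show "closed K"
      unfolding K_def by (intro closed_Collect_conj closed_Collect_eq closed_Collect_le cont continuous_on_const)
  qed
  have pos: "0 < ?d x" if "x \<in> K" for x
  proof -
    have "?e x \<noteq> 0" using that \<epsilon> by (auto simp: K_def)
    then have "fst x \<noteq> snd x" by auto
    then show ?thesis using norm_powr_midpoint(2)[OF p] by simp
  qed
  obtain m where m: "0 < m" "\<And>x. x \<in> K \<Longrightarrow> m \<le> ?d x"
  proof (cases "K = {}")
    case False
    obtain x where "x \<in> K" "\<And>y. y \<in> K \<Longrightarrow> ?d x \<le> ?d y"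
      using continuous_attains_inf[OF \<open>compact K\<close> False continuous_on_subset[OF cont(2)]] by auto
    then show ?thesis using that pos by blast
  qed (use that[of 1] in auto)
  \<comment> \<open>The numerator comes from \<open>norm (a - b) \<le> 2\<close>, valid on
    normalised pairs.\<close>
  define C where "C = 2 powr p / m"
  have C: "0 \<le> C" using m by (simp add: C_def)
  have dn: "0 \<le> ?d x" for x using norm_powr_midpoint(1)[OF p, of "fst x" "snd x"] by simp
  have unit: "?e x \<le> \<epsilon> + C * ?d x" if x: "?s x = 1" for x
  proof (cases "\<epsilon> \<le> ?e x")
    case True
    have "norm (fst x - snd x) \<le> 2" using le1[OF x] norm_triangle_ineq4[of "fst x" "snd x"] by linarith
    then have "?e x \<le> 2 powr p" using p by (intro powr_mono2) auto
    also have "\<dots> = C * m" using m by (simp add: C_def)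
    also have "\<dots> \<le> C * ?d x" using C m x True by (intro mult_left_mono) (auto simp: K_def)
    finally show ?thesis using \<epsilon> by linarith
  next
    case False
    moreover have "0 \<le> C * ?d x" using C dn by (intro mult_nonneg_nonneg)
    ultimately show ?thesis by linarith
  qed
  show thesis
  proof (rule that[OF C])
    fix a b :: 'b
    let ?S = "norm a powr p + norm b powr p"
    show "norm (a - b) powr p \<le> \<epsilon> * ?S + C * (?S / 2 - norm ((1/2) *\<^sub>R (a + b)) powr p)"
    proof (cases "a = 0 \<and> b = 0")
      case False
      have S: "0 < ?S" using False by (auto intro: add_pos_nonneg add_nonneg_pos)
      define t where "t = ?S powr (1 / p)"
      have t: "0 < t" "t powr p = ?S" using S p by (auto simp: t_def powr_powr)
      have sc: "norm ((1 / t) *\<^sub>R z) powr p = norm z powr p / ?S" for z :: 'b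
      proof -
        have "norm ((1 / t) *\<^sub>R z) = norm z / t" using t by simp
        then show ?thesis using t by (simp add: powr_divide)
      qed
      let ?x = "((1 / t) *\<^sub>R a, (1 / t) *\<^sub>R b)"
      have "?s ?x = 1" using S by (simp only: fst_conv snd_conv sc add_divide_distrib[symmetric]) simp
      from unit[OF this] have "norm ((1 / t) *\<^sub>R (a - b)) powr p \<le>
         \<epsilon> + C * ((norm ((1 / t) *\<^sub>R a) powr p + norm ((1 / t) *\<^sub>R b) powr p) / 2 - norm ((1 / t) *\<^sub>R ((1/2) *\<^sub>R (a + b))) powr p)"
        by (simp only: fst_conv snd_conv scaleR_diff_right scaleR_add_right scaleR_scaleR mult.commute)
      then have "norm (a - b) powr p / ?S \<le> \<epsilon> + C * (?S / 2 - norm ((1/2) *\<^sub>R (a + b)) powr p) / ?S"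
      proof -
        have *: "C * ((A / S + B / S) / 2 - X / S) = C * ((A + B) / 2 - X) / S" for A B X S :: real
          by (cases "S = 0") (auto simp: field_simps)
        assume "norm ((1 / t) *\<^sub>R (a - b)) powr p \<le>
         \<epsilon> + C * ((norm ((1 / t) *\<^sub>R a) powr p + norm ((1 / t) *\<^sub>R b) powr p) / 2 - norm ((1 / t) *\<^sub>R ((1/2) *\<^sub>R (a + b))) powr p)"
        then show ?thesis unfolding sc * .
      qed
      then have "norm (a - b) powr p / ?S * ?S \<le> (\<epsilon> + C * (?S / 2 - norm ((1/2) *\<^sub>R (a + b)) powr p) / ?S) * ?S"
        using S by (intro mult_right_mono) auto
      then show ?thesis using S by (simp add: distrib_right)
    qed simp
  qed
qed

section \<open>Completeness of Lebesgue spaces and convergence on sets of finite measure\<close>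

lemma norm_add_powr_le:
  fixes a b :: "'b::real_normed_vector"
  assumes "0 \<le> p"
  shows "norm (a + b) powr p \<le> 2 powr p * (norm a powr p + norm b powr p)"
proof -
  have "norm (a + b) \<le> 2 * max (norm a) (norm b)" using norm_triangle_ineq[of a b] by linarith
  then have "norm (a + b) powr p \<le> (2 * max (norm a) (norm b)) powr p" using assms by (intro powr_mono2) auto
  also have "\<dots> = 2 powr p * max (norm a) (norm b) powr p" by (simp add: powr_mult)
  also have "max (norm a) (norm b) powr p \<le> norm a powr p + norm b powr p"
    by (cases "norm a \<le> norm b") (auto simp: max_def)
  finally show ?thesis by simp
qed

lemma integrable_powr_add:
  fixes f g :: "'a \<Rightarrow> 'b::{banach, second_countable_topology}"
  assumes p: "0 \<le> p" and [measurable]: "f \<in> borel_measurable M" "g \<in> borel_measurable M"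
    and "integrable M (\<lambda>x. norm (f x) powr p)" "integrable M (\<lambda>x. norm (g x) powr p)"
  shows "integrable M (\<lambda>x. norm (f x + g x) powr p)"
    "(LINT x|M. norm (f x + g x) powr p) \<le> 2 powr p * ((LINT x|M. norm (f x) powr p) + (LINT x|M. norm (g x) powr p))"
proof -
  have i: "integrable M (\<lambda>x. 2 powr p * (norm (f x) powr p + norm (g x) powr p))" using assms by auto
  show *: "integrable M (\<lambda>x. norm (f x + g x) powr p)"
    by (rule Bochner_Integration.integrable_bound[OF i]) (use norm_add_powr_le[OF p] in auto)
  have "(LINT x|M. norm (f x + g x) powr p) \<le> (LINT x|M. 2 powr p * (norm (f x) powr p + norm (g x) powr p))"
    by (rule integral_mono[OF * i]) (rule norm_add_powr_le[OF p])
  also have "\<dots> = 2 powr p * ((LINT x|M. norm (f x) powr p) + (LINT x|M. norm (g x) powr p))"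
    using assms by simp
  finally show "(LINT x|M. norm (f x + g x) powr p) \<le> 2 powr p * ((LINT x|M. norm (f x) powr p) + (LINT x|M. norm (g x) powr p))" .
qed

text \<open>Through the weight \<open>2^k\<close> mere boundedness of the terms forces the
  increments to decay geometrically, with ratio \<open>(1/2) powr (1/p)\<close>.\<close>

lemma summable_powr_increments_convergent:
  fixes s :: "nat \<Rightarrow> 'b::banach"
  assumes p: "0 < p" and "(\<Sum>k. ennreal (2^k * norm (s (Suc k) - s k) powr p)) < \<infinity>"
  shows "convergent s"
proof -
  let ?d = "\<lambda>k. norm (s (Suc k) - s k)"
  have "summable (\<lambda>k. 2^k * ?d k powr p)"
    using assms by (intro summable_suminf_not_top) auto
  then have "Bseq (\<lambda>k. 2^k * ?d k powr p)"
    by (intro convergent_imp_Bseq summable_LIMSEQ_zero[THEN convergentI])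
  then obtain C where C: "0 < C" "\<And>k. norm (2^k * ?d k powr p) \<le> C"
    by (auto simp: Bseq_def)
  define \<theta> :: real where "\<theta> = (1/2) powr (1/p)"
  have \<theta>: "0 < \<theta>" "\<theta> < 1" unfolding \<theta>_def using p powr_less_mono2[of "1/p" "1/2" 1] by auto
  have le: "norm (?d k) \<le> C powr (1/p) * \<theta> ^ k" for k
  proof -
    have "?d k powr p \<le> C * (1/2) ^ k" using C(2)[of k] by (simp add: field_simps)
    then have "(?d k powr p) powr (1/p) \<le> (C * (1/2) ^ k) powr (1/p)" using p by (intro powr_mono2) auto
    also have "\<dots> = C powr (1/p) * ((1/2) ^ k) powr (1/p)" using C by (simp add: powr_mult)
    also have "((1/2) ^ k) powr (1/p) = \<theta> ^ k"
      unfolding \<theta>_def by (simp add: powr_realpow[symmetric] powr_powr mult.commute)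
    finally show ?thesis using p by (simp add: powr_powr)
  qed
  have "summable (\<lambda>k. C powr (1/p) * \<theta> ^ k)"
    using \<theta> by (intro summable_mult summable_geometric) simp
  then have "summable (\<lambda>k. s (Suc k) - s k)"
    by (rule summable_norm_cancel[OF summable_comparison_test']) (use le in auto)
  then have "convergent (\<lambda>n. \<Sum>k<n. s (Suc k) - s k)"
    by (simp add: summable_iff_convergent)
  then have "convergent (\<lambda>n. s n - s 0)"
    by (simp add: sum_lessThan_telescope)
  then have "convergent (\<lambda>n. (s n - s 0) + s 0)"
    by (intro convergent_add convergent_const)
  then show ?thesis by simp
qed

text \<open>The Riesz-Fischer argument on p-th powers. Along a subsequence with distances below
  \<open>(1/4)^k\<close> the series weighted by \<open>2^k\<close> still converges, which gives a
  limit almost everywhere; Fatou's lemma shows that the full sequence tends to it.\<close>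

lemma Lp_complete:
  fixes f :: "nat \<Rightarrow> 'a \<Rightarrow> 'b::{banach, second_countable_topology}"
  assumes p: "0 < p" and f[measurable]: "\<And>n. f n \<in> borel_measurable M"
    and fi: "\<And>n. integrable M (\<lambda>x. norm (f n x) powr p)"
    and cauchy: "\<And>e. e > 0 \<Longrightarrow> \<exists>K. \<forall>m\<ge>K. \<forall>n\<ge>K. (LINT x|M. norm (f m x - f n x) powr p) < e"
  obtains g where "g \<in> borel_measurable M" "integrable M (\<lambda>x. norm (g x) powr p)"
    "(\<lambda>n. LINT x|M. norm (f n x - g x) powr p) \<longlonglongrightarrow> 0"
proof -
  have fd: "integrable M (\<lambda>x. norm (f m x - f n x) powr p)" for m n
    using integrable_powr_add(1)[of p "f m" M "\<lambda>x. - f n x"] p fi by simp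
  have nn: "(\<integral>\<^sup>+x. ennreal (norm (f m x - f n x) powr p) \<partial>M) = ennreal (LINT x|M. norm (f m x - f n x) powr p)" for m n
    by (rule nn_integral_eq_integral[OF fd]) auto
  have "\<forall>k. \<exists>K. \<forall>m\<ge>K. \<forall>n\<ge>K. (LINT x|M. norm (f m x - f n x) powr p) < (1/4)^k"
    using cauchy by simp
  then obtain K where K: "\<And>k m n. m \<ge> K k \<Longrightarrow> n \<ge> K k \<Longrightarrow> (LINT x|M. norm (f m x - f n x) powr p) < (1/4)^k"
    by metis
  \<comment> \<open>The sum makes \<open>r j\<close> at least \<open>K k\<close> for all
    \<open>k \<le> j\<close>, whether or not \<open>K\<close> is monotone.\<close>
  define r where "r k = (\<Sum>i\<le>k. K i)" for k
  have rK: "K k \<le> r j" if "k \<le> j" for k j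
    unfolding r_def using that by (intro member_le_sum) auto
  define g where "g x = lim (\<lambda>k. f (r k) x)" for x
  have g[measurable]: "g \<in> borel_measurable M"
    unfolding g_def by (intro borel_measurable_lim_metric) auto
  have "(\<integral>\<^sup>+x. (\<Sum>k. ennreal (2^k * norm (f (r (Suc k)) x - f (r k) x) powr p)) \<partial>M) =
      (\<Sum>k. \<integral>\<^sup>+x. ennreal (2^k * norm (f (r (Suc k)) x - f (r k) x) powr p) \<partial>M)"
    by (intro nn_integral_suminf) auto
  also have "\<dots> = (\<Sum>k. ennreal (2^k) * ennreal (LINT x|M. norm (f (r (Suc k)) x - f (r k) x) powr p))"
    by (simp add: ennreal_mult nn_integral_cmult nn)
  also have "\<dots> \<le> (\<Sum>k. ennreal ((1/2)^k))"
  proof (intro suminf_le)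
    fix k
    have "(2::real)^k * (LINT x|M. norm (f (r (Suc k)) x - f (r k) x) powr p) \<le> 2^k * (1/4)^k"
      by (rule mult_left_mono[OF less_imp_le[OF K[OF rK rK]]]) auto
    also have "\<dots> = (1/2)^k"
      by (simp add: power_mult_distrib[symmetric])
    finally show "ennreal (2^k) * ennreal (LINT x|M. norm (f (r (Suc k)) x - f (r k) x) powr p) \<le> ennreal ((1/2)^k)"
      by (simp add: ennreal_mult[symmetric] ennreal_leI)
  qed auto
  also have "\<dots> = ennreal (\<Sum>k. (1/2)^k)"
    by (intro suminf_ennreal2) auto
  also have "\<dots> < \<infinity>" by simp
  finally have "(\<integral>\<^sup>+x. (\<Sum>k. ennreal (2^k * norm (f (r (Suc k)) x - f (r k) x) powr p)) \<partial>M) \<noteq> \<infinity>"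
    by simp
  then have "AE x in M. (\<Sum>k. ennreal (2^k * norm (f (r (Suc k)) x - f (r k) x) powr p)) \<noteq> \<infinity>"
    by (intro nn_integral_PInf_AE) auto
  then have lim: "AE x in M. (\<lambda>k. f (r k) x) \<longlonglongrightarrow> g x"
  proof eventually_elim
    case (elim x)
    then have "convergent (\<lambda>k. f (r k) x)"
      by (intro summable_powr_increments_convergent[OF p]) (simp add: less_top)
    then show ?case
      by (simp add: g_def convergent_LIMSEQ_iff)
  qed
  have bound: "(\<integral>\<^sup>+x. ennreal (norm (f n x - g x) powr p) \<partial>M) \<le> ennreal ((1/4)^k)"
    if n: "n \<ge> K k" for n k
  proof -
    have "(\<integral>\<^sup>+x. ennreal (norm (f n x - g x) powr p) \<partial>M) =
        (\<integral>\<^sup>+x. liminf (\<lambda>j. ennreal (norm (f n x - f (r j) x) powr p)) \<partial>M)"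
    proof (intro nn_integral_cong_AE)
      show "AE x in M. ennreal (norm (f n x - g x) powr p) = liminf (\<lambda>j. ennreal (norm (f n x - f (r j) x) powr p))"
        using lim
      proof eventually_elim
        case (elim x)
        then have "(\<lambda>j. ennreal (norm (f n x - f (r j) x) powr p)) \<longlonglongrightarrow> ennreal (norm (f n x - g x) powr p)"
          using p by (intro tendsto_ennrealI tendsto_powr2 tendsto_intros) auto
        then show ?case
          by (intro lim_imp_Liminf[symmetric]) simp
      qed
    qed
    also have "\<dots> \<le> liminf (\<lambda>j. \<integral>\<^sup>+x. ennreal (norm (f n x - f (r j) x) powr p) \<partial>M)"
      by (intro nn_integral_liminf) auto
    also have "\<dots> \<le> ennreal ((1/4)^k)"
    proof (rule Liminf_le)
      show "\<forall>\<^sub>F j in sequentially. (\<integral>\<^sup>+x. ennreal (norm (f n x - f (r j) x) powr p) \<partial>M) \<le> ennreal ((1/4)^k)"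
        using eventually_ge_at_top[of k]
        by eventually_elim (simp add: nn ennreal_leI less_imp_le K n rK)
    qed auto
    finally show ?thesis .
  qed
  have di: "integrable M (\<lambda>x. norm (f n x - g x) powr p)" if "n \<ge> K 0" for n
    using bound[OF that] by (intro integrableI_bounded) (auto intro: order.strict_trans1)
  have gi: "integrable M (\<lambda>x. norm (g x) powr p)"
    using integrable_powr_add(1)[of p "\<lambda>x. - (f (K 0) x - g x)" M "f (K 0)"] di[of "K 0"] fi[of "K 0"] p
    by (simp add: norm_minus_commute)
  have le: "(LINT x|M. norm (f n x - g x) powr p) \<le> (1/4)^k" if n: "n \<ge> K k" for n k
  proof -
    have i: "integrable M (\<lambda>x. norm (f n x - g x) powr p)"
      using integrable_powr_add(1)[of p "f n" M "\<lambda>x. - g x"] fi gi p by simp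
    have "ennreal (LINT x|M. norm (f n x - g x) powr p) \<le> ennreal ((1/4)^k)"
      using bound[OF n] nn_integral_eq_integral[OF i] by simp
    then show ?thesis by (simp add: ennreal_le_iff)
  qed
  have "(\<lambda>n. LINT x|M. norm (f n x - g x) powr p) \<longlonglongrightarrow> 0"
  proof (rule LIMSEQ_I)
    fix e :: real assume "0 < e"
    then obtain k where k: "(1/4)^k < e" using real_arch_pow_inv[of e "1/4"] by auto
    have "norm ((LINT x|M. norm (f n x - g x) powr p) - 0) < e" if "n \<ge> K k" for n
    proof -
      have "0 \<le> (LINT x|M. norm (f n x - g x) powr p)" by (rule Bochner_Integration.integral_nonneg) simp
      then show ?thesis using le[OF that] k by simp
    qed
    then show "\<exists>N. \<forall>n\<ge>N. norm ((LINT x|M. norm (f n x - g x) powr p) - 0) < e" by blast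
  qed
  with that[OF g gi] show thesis by blast
qed

lemma le_one_plus_powr: "1 \<le> p \<Longrightarrow> 0 \<le> t \<Longrightarrow> t \<le> 1 + t powr p" for t p :: real
proof (cases "t \<le> 1")
  case False
  assume "1 \<le> p" "0 \<le> t"
  then have "t powr 1 \<le> t powr p" using False by (intro powr_mono) auto
  then show ?thesis using False by simp
qed (simp add: add_increasing2)

lemma (in finite_measure) integrable_powr_imp_integrable:
  fixes f :: "'a \<Rightarrow> 'b::{banach, second_countable_topology}"
  assumes p: "1 \<le> p" and [measurable]: "f \<in> borel_measurable M" and "integrable M (\<lambda>x. norm (f x) powr p)"
  shows "integrable M f"
proof (rule Bochner_Integration.integrable_bound)
  show "integrable M (\<lambda>x. 1 + norm (f x) powr p)" using assms by auto
  show "AE x in M. norm (f x) \<le> norm (1 + norm (f x) powr p)"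
    using le_one_plus_powr[OF p norm_ge_zero] by (intro AE_I2) (simp add: abs_of_nonneg)
qed measurable

text \<open>In place of Hoelder's inequality, \<open>t \<le> d + d powr (1 - p) * t powr p\<close>
  for any threshold \<open>d > 0\<close> is integrated over a space of finite measure.\<close>

lemma (in finite_measure) Lp_tendsto_imp_L1_tendsto:
  fixes f :: "nat \<Rightarrow> 'a \<Rightarrow> 'b::{banach, second_countable_topology}"
  assumes p: "1 \<le> p" and f[measurable]: "\<And>n. f n \<in> borel_measurable M"
    and fi: "\<And>n. integrable M (\<lambda>x. norm (f n x) powr p)"
    and lim: "(\<lambda>n. LINT x|M. norm (f n x) powr p) \<longlonglongrightarrow> 0"
  shows "(\<lambda>n. LINT x|M. norm (f n x)) \<longlonglongrightarrow> 0"
proof (rule LIMSEQ_I)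
  fix e :: real assume e: "0 < e"
  define \<mu> where "\<mu> = measure M (space M)"
  have \<mu>: "0 \<le> \<mu>" by (simp add: \<mu>_def)
  \<comment> \<open>Small enough that \<open>d * \<mu> \<le> e / 2\<close>; the summand 1 covers the
    case \<open>\<mu> = 0\<close>.\<close>
  define d where "d = e / (2 * (\<mu> + 1))"
  have d: "d > 0" using e \<mu> by (simp add: d_def)
  have pw: "t \<le> d + d powr (1 - p) * t powr p" if "0 \<le> t" for t
  proof (cases "t \<le> d")
    case False
    then have "t powr (1 - p) \<le> d powr (1 - p)" using d p by (intro powr_mono2') auto
    then have "t powr (1 - p) * t powr p \<le> d powr (1 - p) * t powr p" by (intro mult_right_mono) auto
    then show ?thesis using False d by (simp add: powr_add[symmetric])
  qed (simp add: add_increasing2)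
  have int: "integrable M (f n)" for n by (rule integrable_powr_imp_integrable[OF p f fi])
  have le: "(LINT x|M. norm (f n x)) \<le> d * \<mu> + d powr (1 - p) * (LINT x|M. norm (f n x) powr p)" for n
  proof -
    have "(LINT x|M. norm (f n x)) \<le> (LINT x|M. d + d powr (1 - p) * norm (f n x) powr p)"
      using int fi by (intro integral_mono pw) auto
    also have "\<dots> = d * \<mu> + d powr (1 - p) * (LINT x|M. norm (f n x) powr p)"
      using fi by (simp add: \<mu>_def mult.commute)
    finally show ?thesis .
  qed
  have "d * \<mu> \<le> d * (\<mu> + 1)" using d by (intro mult_left_mono) auto
  also have "\<dots> = e / 2" using \<mu> by (simp add: d_def field_simps)
  finally have half: "d * \<mu> \<le> e / 2" .
  have "(\<lambda>n. d powr (1 - p) * (LINT x|M. norm (f n x) powr p)) \<longlonglongrightarrow> d powr (1 - p) * 0"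
    by (intro tendsto_intros lim)
  then have "\<forall>\<^sub>F n in sequentially. d powr (1 - p) * (LINT x|M. norm (f n x) powr p) < e / 2"
    using e by (intro order_tendstoD(2)) auto
  then have "\<forall>\<^sub>F n in sequentially. norm ((LINT x|M. norm (f n x)) - 0) < e"
  proof eventually_elim
    case (elim n)
    have "0 \<le> (LINT x|M. norm (f n x))" by (rule Bochner_Integration.integral_nonneg) simp
    then show ?case using elim le[of n] half by simp
  qed
  then show "\<exists>N. \<forall>n\<ge>N. norm ((LINT x|M. norm (f n x)) - 0) < e" by (simp add: eventually_sequentially)
qed

section \<open>Sobolev spaces\<close>

definition Lp_energy :: "'a::euclidean_space set \<Rightarrow> real \<Rightarrow> ('a \<Rightarrow> 'b::{banach, second_countable_topology}) \<Rightarrow> real" where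
  "Lp_energy \<Omega> p u = (LINT x:\<Omega>|lebesgue. norm (u x) powr p)"

text \<open>The p-th power of the Sobolev norm. It is additive over the derivatives and inherits
  pointwise inequalities between p-th powers.\<close>

definition W1p_energy :: "'a::euclidean_space set \<Rightarrow> real \<Rightarrow> ('a \<Rightarrow> 'b::{banach, second_countable_topology}) \<Rightarrow> real" where
  "W1p_energy \<Omega> p u = Lp_energy \<Omega> p u + (\<Sum>b\<in>Basis. Lp_energy \<Omega> p (weak_deriv \<Omega> b u))"

lemma W1p_norm_energy: "W1p_norm \<Omega> p u = W1p_energy \<Omega> p u powr (1 / p)"
  by (simp add: W1p_norm_def W1p_energy_def Lp_energy_def)

lemma Lp_energy_nonneg: "0 \<le> Lp_energy \<Omega> p u"
  unfolding Lp_energy_def set_lebesgue_integral_def by (rule Bochner_Integration.integral_nonneg) simp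

lemma W1p_energy_nonneg: "0 \<le> W1p_energy \<Omega> p u"
  unfolding W1p_energy_def by (intro add_nonneg_nonneg sum_nonneg Lp_energy_nonneg)

lemma W1p_norm_tendsto_0_iff:
  assumes p: "0 < p"
  shows "(\<lambda>k. W1p_norm \<Omega> p (v k)) \<longlonglongrightarrow> 0 \<longleftrightarrow> (\<lambda>k. W1p_energy \<Omega> p (v k)) \<longlonglongrightarrow> 0"
proof
  assume "(\<lambda>k. W1p_norm \<Omega> p (v k)) \<longlonglongrightarrow> 0"
  then have "(\<lambda>k. W1p_norm \<Omega> p (v k) powr p) \<longlonglongrightarrow> 0 powr p"
    using p by (intro tendsto_powr2 tendsto_const) (auto simp: W1p_norm_energy)
  then show "(\<lambda>k. W1p_energy \<Omega> p (v k)) \<longlonglongrightarrow> 0"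
    using p by (simp add: W1p_norm_energy powr_powr abs_of_nonneg[OF W1p_energy_nonneg])
next
  assume "(\<lambda>k. W1p_energy \<Omega> p (v k)) \<longlonglongrightarrow> 0"
  then have "(\<lambda>k. W1p_energy \<Omega> p (v k) powr (1/p)) \<longlonglongrightarrow> 0 powr (1/p)"
    using p by (intro tendsto_powr2 tendsto_const) (auto intro!: always_eventually W1p_energy_nonneg)
  then show "(\<lambda>k. W1p_norm \<Omega> p (v k)) \<longlonglongrightarrow> 0" by (simp add: W1p_norm_energy)
qed

lemma test_functions_add:
  fixes \<phi> \<psi> :: "'a::euclidean_space \<Rightarrow> 'b::real_normed_vector"
  assumes "\<phi> \<in> test_functions \<Omega>" "\<psi> \<in> test_functions \<Omega>"
  shows "(\<lambda>x. \<phi> x + \<psi> x) \<in> test_functions \<Omega>"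
proof -
  have sm: "smooth \<phi>" "smooth \<psi>" using assms by (auto simp: test_functions_def)
  have it: "iter_partial bs (\<lambda>x. \<phi> x + \<psi> x) = (\<lambda>x. iter_partial bs \<phi> x + iter_partial bs \<psi> x)"
    if "set bs \<subseteq> Basis" for bs
    using that
  proof (induction bs)
    case (Cons b bs)
    have d: "iter_partial bs \<phi> differentiable (at x)" "iter_partial bs \<psi> differentiable (at x)" for x
      using sm Cons.prems by (auto simp: smooth_def)
    then have "((\<lambda>x. iter_partial bs \<phi> x + iter_partial bs \<psi> x) has_derivative
       (\<lambda>h. frechet_derivative (iter_partial bs \<phi>) (at x) h + frechet_derivative (iter_partial bs \<psi>) (at x) h)) (at x)" for x
      by (intro has_derivative_add frechet_derivative_works[THEN iffD1])
    note fd = frechet_derivative_at[OF this, symmetric]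
    have IH: "iter_partial bs (\<lambda>x. \<phi> x + \<psi> x) = (\<lambda>x. iter_partial bs \<phi> x + iter_partial bs \<psi> x)" using Cons by simp
    show ?case unfolding iter_partial.simps IH fd ..
  qed simp
  have "smooth (\<lambda>x. \<phi> x + \<psi> x)" unfolding smooth_def
  proof (intro allI impI)
    fix bs :: "'a list" and x assume bs: "set bs \<subseteq> Basis"
    then have "iter_partial bs \<phi> differentiable (at x)" "iter_partial bs \<psi> differentiable (at x)"
      using sm by (auto simp: smooth_def)
    then show "iter_partial bs (\<lambda>x. \<phi> x + \<psi> x) differentiable (at x)"
      unfolding it[OF bs] by (rule differentiable_add)
  qed
  moreover have "closure {x. \<phi> x + \<psi> x \<noteq> 0} \<subseteq> closure {x. \<phi> x \<noteq> 0} \<union> closure {x. \<psi> x \<noteq> 0}"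
    unfolding closure_Un[symmetric] by (rule closure_mono) auto
  moreover have "compact (closure {x. \<phi> x + \<psi> x \<noteq> 0})"
  proof -
    have "bounded (closure {x. \<phi> x \<noteq> 0} \<union> closure {x. \<psi> x \<noteq> 0})"
      using assms unfolding test_functions_def by (auto intro: compact_imp_bounded)
    then show ?thesis using calculation(2) bounded_subset closed_closure compact_eq_bounded_closed by blast
  qed
  ultimately show ?thesis using assms unfolding test_functions_def by blast
qed

lemma test_functions_scaleR:
  fixes \<phi> :: "'a::euclidean_space \<Rightarrow> 'b::real_normed_vector"
  assumes "\<phi> \<in> test_functions \<Omega>"
  shows "(\<lambda>x. c *\<^sub>R \<phi> x) \<in> test_functions \<Omega>"
proof -
  have sm: "smooth \<phi>" using assms by (auto simp: test_functions_def)
  have it: "iter_partial bs (\<lambda>x. c *\<^sub>R \<phi> x) = (\<lambda>x. c *\<^sub>R iter_partial bs \<phi> x)"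
    if "set bs \<subseteq> Basis" for bs
    using that
  proof (induction bs)
    case (Cons b bs)
    have d: "iter_partial bs \<phi> differentiable (at x)" for x
      using sm Cons.prems by (auto simp: smooth_def)
    then have "((\<lambda>x. c *\<^sub>R iter_partial bs \<phi> x) has_derivative
       (\<lambda>h. c *\<^sub>R frechet_derivative (iter_partial bs \<phi>) (at x) h)) (at x)" for x
      by (intro has_derivative_scaleR_right frechet_derivative_works[THEN iffD1])
    note fd = frechet_derivative_at[OF this, symmetric]
    have IH: "iter_partial bs (\<lambda>x. c *\<^sub>R \<phi> x) = (\<lambda>x. c *\<^sub>R iter_partial bs \<phi> x)" using Cons by simp
    show ?case unfolding iter_partial.simps IH fd ..
  qed simp
  have "smooth (\<lambda>x. c *\<^sub>R \<phi> x)" unfolding smooth_def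
  proof (intro allI impI)
    fix bs :: "'a list" and x assume bs: "set bs \<subseteq> Basis"
    then have "iter_partial bs \<phi> differentiable (at x)" using sm by (auto simp: smooth_def)
    then show "iter_partial bs (\<lambda>x. c *\<^sub>R \<phi> x) differentiable (at x)"
      unfolding it[OF bs] by (intro differentiable_scaleR differentiable_const)
  qed
  moreover have sub: "closure {x. c *\<^sub>R \<phi> x \<noteq> 0} \<subseteq> closure {x. \<phi> x \<noteq> 0}"
    by (rule closure_mono) auto
  moreover have "compact (closure {x. c *\<^sub>R \<phi> x \<noteq> 0})"
    using sub assms unfolding test_functions_def
    by (metis (mono_tags, lifting) bounded_subset closed_closure compact_eq_bounded_closed mem_Collect_eq)
  ultimately show ?thesis using assms unfolding test_functions_def by auto
qed

lemma test_functions_zero: "(\<lambda>x::'a::euclidean_space. 0 :: 'b::real_normed_vector) \<in> test_functions \<Omega>"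
proof -
  have "iter_partial bs (\<lambda>x::'a. 0 :: 'b) = (\<lambda>x. 0)" for bs
    by (induction bs) simp_all
  then show ?thesis by (simp add: test_functions_def smooth_def)
qed

locale bounded_open =
  fixes \<Omega> :: "'a::euclidean_space set" and p :: real
  assumes open_\<Omega>: "open \<Omega>" and bounded_\<Omega>: "bounded \<Omega>" and p_ge_1: "1 \<le> p"
begin

lemma sets_\<Omega> [measurable, simp]: "\<Omega> \<in> sets lebesgue"
  using open_\<Omega> by auto

sublocale finite_measure "lebesgue_on \<Omega>"
proof
  have "emeasure lebesgue \<Omega> = emeasure lborel \<Omega>"
    using open_\<Omega> by simp
  also have "\<dots> < \<infinity>" by (rule emeasure_bounded_finite[OF bounded_\<Omega>])
  finally have "emeasure lebesgue \<Omega> \<noteq> \<infinity>" by (rule less_imp_neq)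
  moreover have "emeasure (lebesgue_on \<Omega>) (space (lebesgue_on \<Omega>)) = emeasure lebesgue \<Omega>"
    by (subst emeasure_restrict_space) auto
  ultimately show "emeasure (lebesgue_on \<Omega>) (space (lebesgue_on \<Omega>)) \<noteq> \<infinity>" by (simp only:) simp
qed

lemma Lp_iff: "u \<in> Lp \<Omega> q \<longleftrightarrow> u \<in> borel_measurable (lebesgue_on \<Omega>) \<and> integrable (lebesgue_on \<Omega>) (\<lambda>x. norm (u x) powr q)"
  by (simp add: Lp_def set_borel_measurable_def set_integrable_def borel_measurable_restrict_space_iff integrable_restrict_space)

lemma set_integral_eq: "(LINT x:\<Omega>|lebesgue. f x) = (LINT x|lebesgue_on \<Omega>. f x)"
  for f :: "'a \<Rightarrow> 'c::{banach, second_countable_topology}"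
  by (simp add: set_lebesgue_integral_def integral_restrict_space)

lemma AE_eq: "(AE x in lebesgue_on \<Omega>. P x) \<longleftrightarrow> (AE x\<in>\<Omega> in lebesgue. P x)"
  by (simp add: AE_restrict_space_iff)

lemma Lp_energy_eq: "Lp_energy \<Omega> q u = (LINT x|lebesgue_on \<Omega>. norm (u x) powr q)"
  by (simp add: Lp_energy_def set_integral_eq)

lemma Lp_set_integrable:
  assumes "u \<in> Lp \<Omega> p" shows "integrable (lebesgue_on \<Omega>) u" "set_integrable lebesgue \<Omega> u" "locally_integrable \<Omega> u"
proof -
  show "integrable (lebesgue_on \<Omega>) u"
    by (rule integrable_powr_imp_integrable[OF p_ge_1]) (use assms in \<open>simp_all add: Lp_iff\<close>)
  then show *: "set_integrable lebesgue \<Omega> u"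
    by (simp add: set_integrable_def integrable_restrict_space)
  show "locally_integrable \<Omega> u" unfolding locally_integrable_def
  proof (intro allI impI)
    fix K assume "compact K \<and> K \<subseteq> \<Omega>"
    then show "set_integrable lebesgue K u"
      by (intro set_integrable_subset[OF *]) (auto simp: compact_imp_closed)
  qed
qed

lemma Lp_add:
  assumes "0 \<le> q" "u \<in> Lp \<Omega> q" "v \<in> Lp \<Omega> q"
  shows "(\<lambda>x. u x + v x) \<in> Lp \<Omega> q" "Lp_energy \<Omega> q (\<lambda>x. u x + v x) \<le> 2 powr q * (Lp_energy \<Omega> q u + Lp_energy \<Omega> q v)"
  using assms integrable_powr_add[of q u "lebesgue_on \<Omega>" v] by (auto simp: Lp_iff Lp_energy_eq)

lemma Lp_scaleR:
  assumes "u \<in> Lp \<Omega> q"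
  shows "(\<lambda>x. c *\<^sub>R u x) \<in> Lp \<Omega> q" "Lp_energy \<Omega> q (\<lambda>x. c *\<^sub>R u x) = \<bar>c\<bar> powr q * Lp_energy \<Omega> q u"
  using assms by (auto simp: Lp_iff Lp_energy_eq powr_mult)

lemma Lp_diff:
  assumes "0 \<le> q" "u \<in> Lp \<Omega> q" "v \<in> Lp \<Omega> q"
  shows "(\<lambda>x. u x - v x) \<in> Lp \<Omega> q"
  using Lp_add(1)[OF assms(1,2) Lp_scaleR(1)[OF assms(3), of "-1"]] by simp

lemma Lp_cong_AE:
  fixes u v :: "'a \<Rightarrow> 'b::{banach, second_countable_topology}"
  assumes "u \<in> Lp \<Omega> q" "AE x\<in>\<Omega> in lebesgue. u x = v x"
  shows "v \<in> Lp \<Omega> q" "Lp_energy \<Omega> q u = Lp_energy \<Omega> q v"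
proof -
  have u: "set_borel_measurable lebesgue \<Omega> u" "set_integrable lebesgue \<Omega> (\<lambda>x. norm (u x) powr q)"
    using assms by (auto simp: Lp_def)
  have ae: "AE x\<in>\<Omega> in lebesgue. norm (u x) powr q = norm (v x) powr q"
    using assms(2) by eventually_elim auto
  show "v \<in> Lp \<Omega> q"
    using set_borel_measurable_cong_AE[OF u(1) assms(2)] set_integrable_cong_AE'[OF u(2) ae] by (simp add: Lp_def)
  show "Lp_energy \<Omega> q u = Lp_energy \<Omega> q v"
    unfolding Lp_energy_def by (rule set_integral_cong_AE'[OF set_integrable_measurable[OF u(2)] ae])
qed

lemma Lp_continuous:
  fixes f :: "'a \<Rightarrow> 'b::{banach, second_countable_topology}"
  assumes "continuous_on UNIV f" "\<And>x. norm (f x) \<le> B"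
  shows "f \<in> Lp \<Omega> p"
  unfolding Lp_iff
proof
  show m: "f \<in> borel_measurable (lebesgue_on \<Omega>)"
    by (rule measurable_restrict_space1[OF continuous_borel_measurable_lebesgue[OF assms(1)]])
  show "integrable (lebesgue_on \<Omega>) (\<lambda>x. norm (f x) powr p)"
  proof (rule integrable_const_bound)
    show "AE x in lebesgue_on \<Omega>. norm (norm (f x) powr p) \<le> B powr p"
      using assms(2) p_ge_1 by (intro AE_I2) (auto intro: powr_mono2)
  qed (use m in measurable)
qed

text \<open>On a set of finite measure convergence in \<open>Lp\<close> implies convergence in L1,
  and \<open>c\<close> is bounded.\<close>

lemma test_integral_tendsto:
  fixes f :: "nat \<Rightarrow> 'a \<Rightarrow> 'b::{banach, second_countable_topology}"
  assumes f: "\<And>n. f n \<in> Lp \<Omega> p" "g \<in> Lp \<Omega> p"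
    and lim: "(\<lambda>n. Lp_energy \<Omega> p (\<lambda>x. f n x - g x)) \<longlonglongrightarrow> 0"
    and c: "continuous_on UNIV c" "\<And>x. \<bar>c x\<bar> \<le> B"
  shows "(\<lambda>n. LINT x:\<Omega>|lebesgue. c x *\<^sub>R f n x) \<longlonglongrightarrow> (LINT x:\<Omega>|lebesgue. c x *\<^sub>R g x)"
proof -
  have d: "(\<lambda>x. f n x - g x) \<in> Lp \<Omega> p" for n
    by (rule Lp_diff[OF _ f]) (use p_ge_1 in simp)
  have L1: "(\<lambda>n. LINT x|lebesgue_on \<Omega>. norm (f n x - g x)) \<longlonglongrightarrow> 0"
    using d lim by (intro Lp_tendsto_imp_L1_tendsto[OF p_ge_1]) (auto simp: Lp_iff Lp_energy_eq)
  have cm: "c \<in> borel_measurable (lebesgue_on \<Omega>)"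
    by (rule measurable_restrict_space1[OF continuous_borel_measurable_lebesgue[OF c(1)]])
  have ci: "integrable (lebesgue_on \<Omega>) (\<lambda>x. c x *\<^sub>R h x)" if "integrable (lebesgue_on \<Omega>) h" for h :: "'a \<Rightarrow> 'b"
  proof (rule Bochner_Integration.integrable_bound)
    show "integrable (lebesgue_on \<Omega>) (\<lambda>x. B *\<^sub>R h x)" using that by simp
    show "(\<lambda>x. c x *\<^sub>R h x) \<in> borel_measurable (lebesgue_on \<Omega>)" using cm that by auto
    have "\<bar>c x\<bar> \<le> \<bar>B\<bar>" for x using c(2)[of x] by linarith
    then show "AE x in lebesgue_on \<Omega>. norm (c x *\<^sub>R h x) \<le> norm (B *\<^sub>R h x)"
      by (intro AE_I2) (auto intro!: mult_right_mono)
  qed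
  have "(\<lambda>n. (LINT x:\<Omega>|lebesgue. c x *\<^sub>R f n x) - (LINT x:\<Omega>|lebesgue. c x *\<^sub>R g x)) \<longlonglongrightarrow> 0"
  proof (rule Lim_null_comparison)
    have "(\<lambda>n. B * (LINT x|lebesgue_on \<Omega>. norm (f n x - g x))) \<longlonglongrightarrow> B * 0"
      by (intro tendsto_intros L1)
    then show "(\<lambda>n. B * (LINT x|lebesgue_on \<Omega>. norm (f n x - g x))) \<longlonglongrightarrow> 0" by simp
    have "norm ((LINT x:\<Omega>|lebesgue. c x *\<^sub>R f n x) - (LINT x:\<Omega>|lebesgue. c x *\<^sub>R g x)) \<le> B * (LINT x|lebesgue_on \<Omega>. norm (f n x - g x))" for n
    proof -
      have di: "integrable (lebesgue_on \<Omega>) (\<lambda>x. f n x - g x)" by (rule Lp_set_integrable(1)[OF d])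
      have "(LINT x:\<Omega>|lebesgue. c x *\<^sub>R f n x) - (LINT x:\<Omega>|lebesgue. c x *\<^sub>R g x) = (LINT x|lebesgue_on \<Omega>. c x *\<^sub>R (f n x - g x))"
        unfolding set_integral_eq scaleR_diff_right
        by (rule Bochner_Integration.integral_diff[symmetric]; intro ci Lp_set_integrable f)
      also have "norm \<dots> \<le> (LINT x|lebesgue_on \<Omega>. norm (c x *\<^sub>R (f n x - g x)))" by (rule integral_norm_bound)
      also have "\<dots> \<le> (LINT x|lebesgue_on \<Omega>. B * norm (f n x - g x))"
      proof (rule integral_mono)
        show "integrable (lebesgue_on \<Omega>) (\<lambda>x. norm (c x *\<^sub>R (f n x - g x)))" by (rule integrable_norm[OF ci[OF di]])
        show "integrable (lebesgue_on \<Omega>) (\<lambda>x. B * norm (f n x - g x))" using di by simp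
        show "norm (c x *\<^sub>R (f n x - g x)) \<le> B * norm (f n x - g x)" for x
          unfolding norm_scaleR by (intro mult_right_mono c) simp
      qed
      finally show ?thesis by simp
    qed
    then show "\<forall>\<^sub>F n in sequentially. norm ((LINT x:\<Omega>|lebesgue. c x *\<^sub>R f n x) - (LINT x:\<Omega>|lebesgue. c x *\<^sub>R g x))
        \<le> B * (LINT x|lebesgue_on \<Omega>. norm (f n x - g x))" by simp
  qed
  then show ?thesis by (simp add: LIM_zero_iff)
qed

text \<open>Weak differentiation is a closed operator: both sides of its defining identity pass to
  the limit.\<close>

lemma is_weak_deriv_limit:
  fixes u g :: "nat \<Rightarrow> 'a \<Rightarrow> 'b::{banach, second_countable_topology}"
  assumes b: "b \<in> Basis" and w: "\<And>n. is_weak_deriv \<Omega> b (u n) (g n)"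
    and u: "\<And>n. u n \<in> Lp \<Omega> p" "v \<in> Lp \<Omega> p" "(\<lambda>n. Lp_energy \<Omega> p (\<lambda>x. u n x - v x)) \<longlonglongrightarrow> 0"
    and g: "\<And>n. g n \<in> Lp \<Omega> p" "h \<in> Lp \<Omega> p" "(\<lambda>n. Lp_energy \<Omega> p (\<lambda>x. g n x - h x)) \<longlonglongrightarrow> 0"
  shows "is_weak_deriv \<Omega> b v h"
  unfolding is_weak_deriv_def
proof (intro conjI ballI Lp_set_integrable(3)[OF u(2)] Lp_set_integrable(3)[OF g(2)])
  fix \<psi> :: "'a \<Rightarrow> real" assume t: "\<psi> \<in> test_functions \<Omega>"
  obtain K B where \<psi>: "compact K" "K \<subseteq> \<Omega>" "\<And>x. x \<notin> K \<Longrightarrow> \<psi> x = 0"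
    "\<And>x. x \<notin> K \<Longrightarrow> frechet_derivative \<psi> (at x) b = 0"
    "\<And>x. norm (\<psi> x) \<le> B" "\<And>x. norm (frechet_derivative \<psi> (at x) b) \<le> B"
    "continuous_on UNIV \<psi>" "continuous_on UNIV (\<lambda>x. frechet_derivative \<psi> (at x) b)"
    "\<And>x. \<psi> differentiable (at x)"
    by (rule test_function_properties[OF t b], rule that; assumption)
  have 1: "(\<lambda>n. LINT x:\<Omega>|lebesgue. frechet_derivative \<psi> (at x) b *\<^sub>R u n x) \<longlonglongrightarrow> (LINT x:\<Omega>|lebesgue. frechet_derivative \<psi> (at x) b *\<^sub>R v x)"
    by (rule test_integral_tendsto[OF u \<psi>(8)]) (use \<psi>(6) in simp)
  have 2: "(\<lambda>n. LINT x:\<Omega>|lebesgue. \<psi> x *\<^sub>R g n x) \<longlonglongrightarrow> (LINT x:\<Omega>|lebesgue. \<psi> x *\<^sub>R h x)"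
    by (rule test_integral_tendsto[OF g \<psi>(7)]) (use \<psi>(5) in simp)
  have "(LINT x:\<Omega>|lebesgue. frechet_derivative \<psi> (at x) b *\<^sub>R u n x) = - (LINT x:\<Omega>|lebesgue. \<psi> x *\<^sub>R g n x)" for n
    using w[of n] t by (simp add: is_weak_deriv_def)
  then show "(LINT x:\<Omega>|lebesgue. frechet_derivative \<psi> (at x) b *\<^sub>R v x) = - (LINT x:\<Omega>|lebesgue. \<psi> x *\<^sub>R h x)"
    using LIMSEQ_unique[OF 1] tendsto_minus[OF 2] by simp
qed

text \<open>\<open>W1p\<close> provides some derivative in \<open>Lp\<close>; the chosen
  \<open>weak_deriv\<close> agrees with it almost everywhere and so lies in \<open>Lp\<close>
  too.\<close>

lemma W1p_weak_deriv:
  fixes u :: "'a \<Rightarrow> 'b::{banach, real_inner, second_countable_topology}"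
  assumes u: "u \<in> W1p \<Omega> p" and b: "b \<in> Basis"
  shows "is_weak_deriv \<Omega> b u (weak_deriv \<Omega> b u)" "weak_deriv \<Omega> b u \<in> Lp \<Omega> p" "u \<in> Lp \<Omega> p"
proof -
  obtain g where g: "g \<in> Lp \<Omega> p" "is_weak_deriv \<Omega> b u g" using u b by (auto simp: W1p_def)
  show "is_weak_deriv \<Omega> b u (weak_deriv \<Omega> b u)" by (rule weak_deriv_is_weak_deriv[OF g(2)])
  have "AE x\<in>\<Omega> in lebesgue. g x = weak_deriv \<Omega> b u x"
    using weak_deriv_AE[OF b open_\<Omega> g(2)] by eventually_elim auto
  then show "weak_deriv \<Omega> b u \<in> Lp \<Omega> p" by (rule Lp_cong_AE(1)[OF g(1)])
  show "u \<in> Lp \<Omega> p" using u by (simp add: W1p_def)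
qed

text \<open>By uniqueness of weak derivatives the energy may be computed with whichever versions are
  at hand.\<close>

lemma W1p_I:
  fixes u :: "'a \<Rightarrow> 'b::{banach, real_inner, second_countable_topology}"
  assumes "u \<in> Lp \<Omega> p" "\<And>b. b \<in> Basis \<Longrightarrow> g b \<in> Lp \<Omega> p" "\<And>b. b \<in> Basis \<Longrightarrow> is_weak_deriv \<Omega> b u (g b)"
  shows "u \<in> W1p \<Omega> p" "W1p_energy \<Omega> p u = Lp_energy \<Omega> p u + (\<Sum>b\<in>Basis. Lp_energy \<Omega> p (g b))"
proof -
  show u: "u \<in> W1p \<Omega> p" using assms by (auto simp: W1p_def)
  have "Lp_energy \<Omega> p (weak_deriv \<Omega> b u) = Lp_energy \<Omega> p (g b)" if b: "b \<in> Basis" for b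
    by (rule Lp_cong_AE(2)[OF W1p_weak_deriv(2)[OF u b] weak_deriv_AE[OF b open_\<Omega> assms(3)[OF b]]])
  then show "W1p_energy \<Omega> p u = Lp_energy \<Omega> p u + (\<Sum>b\<in>Basis. Lp_energy \<Omega> p (g b))"
    by (simp add: W1p_energy_def)
qed

lemma W1p_add:
  fixes u v :: "'a \<Rightarrow> 'b::{banach, real_inner, second_countable_topology}"
  assumes u: "u \<in> W1p \<Omega> p" and v: "v \<in> W1p \<Omega> p"
  shows "(\<lambda>x. u x + v x) \<in> W1p \<Omega> p"
    "W1p_energy \<Omega> p (\<lambda>x. u x + v x) \<le> 2 powr p * (W1p_energy \<Omega> p u + W1p_energy \<Omega> p v)"
proof -
  obtain bb :: 'a where bb: "bb \<in> Basis" using nonempty_Basis by blast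
  have p: "0 \<le> p" using p_ge_1 by simp
  note * = W1p_I[of "\<lambda>x. u x + v x" "\<lambda>b x. weak_deriv \<Omega> b u x + weak_deriv \<Omega> b v x",
      OF Lp_add(1)[OF p W1p_weak_deriv(3)[OF u bb] W1p_weak_deriv(3)[OF v bb]]
        Lp_add(1)[OF p W1p_weak_deriv(2)[OF u] W1p_weak_deriv(2)[OF v]]
        is_weak_deriv_add[OF _ W1p_weak_deriv(1)[OF u] W1p_weak_deriv(1)[OF v]]]
  show "(\<lambda>x. u x + v x) \<in> W1p \<Omega> p" by (rule *(1))
  have "W1p_energy \<Omega> p (\<lambda>x. u x + v x) = Lp_energy \<Omega> p (\<lambda>x. u x + v x) +
      (\<Sum>b\<in>Basis. Lp_energy \<Omega> p (\<lambda>x. weak_deriv \<Omega> b u x + weak_deriv \<Omega> b v x))" by (rule *(2))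
  also have "\<dots> \<le> 2 powr p * (Lp_energy \<Omega> p u + Lp_energy \<Omega> p v) +
      (\<Sum>b\<in>Basis. 2 powr p * (Lp_energy \<Omega> p (weak_deriv \<Omega> b u) + Lp_energy \<Omega> p (weak_deriv \<Omega> b v)))"
    by (intro add_mono sum_mono Lp_add(2)[OF p] W1p_weak_deriv(2) W1p_weak_deriv(3)[OF _ bb] u v)
  also have "\<dots> = 2 powr p * (W1p_energy \<Omega> p u + W1p_energy \<Omega> p v)"
    by (simp add: W1p_energy_def sum_distrib_left[symmetric] sum.distrib algebra_simps)
  finally show "W1p_energy \<Omega> p (\<lambda>x. u x + v x) \<le> 2 powr p * (W1p_energy \<Omega> p u + W1p_energy \<Omega> p v)" .
qed

lemma W1p_scaleR:
  fixes u :: "'a \<Rightarrow> 'b::{banach, real_inner, second_countable_topology}"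
  assumes u: "u \<in> W1p \<Omega> p"
  shows "(\<lambda>x. c *\<^sub>R u x) \<in> W1p \<Omega> p" "W1p_energy \<Omega> p (\<lambda>x. c *\<^sub>R u x) = \<bar>c\<bar> powr p * W1p_energy \<Omega> p u"
proof -
  obtain bb :: 'a where bb: "bb \<in> Basis" using nonempty_Basis by blast
  note * = W1p_I[of "\<lambda>x. c *\<^sub>R u x" "\<lambda>b x. c *\<^sub>R weak_deriv \<Omega> b u x",
      OF Lp_scaleR(1)[OF W1p_weak_deriv(3)[OF u bb]] Lp_scaleR(1)[OF W1p_weak_deriv(2)[OF u]]
        is_weak_deriv_scaleR[OF _ W1p_weak_deriv(1)[OF u]]]
  show "(\<lambda>x. c *\<^sub>R u x) \<in> W1p \<Omega> p" by (rule *(1))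
  have "W1p_energy \<Omega> p (\<lambda>x. c *\<^sub>R u x) = Lp_energy \<Omega> p (\<lambda>x. c *\<^sub>R u x) +
      (\<Sum>b\<in>Basis. Lp_energy \<Omega> p (\<lambda>x. c *\<^sub>R weak_deriv \<Omega> b u x))" by (rule *(2))
  also have "\<dots> = \<bar>c\<bar> powr p * Lp_energy \<Omega> p u + (\<Sum>b\<in>Basis. \<bar>c\<bar> powr p * Lp_energy \<Omega> p (weak_deriv \<Omega> b u))"
    using Lp_scaleR(2)[OF W1p_weak_deriv(2)[OF u]] Lp_scaleR(2)[OF W1p_weak_deriv(3)[OF u bb]] by simp
  also have "\<dots> = \<bar>c\<bar> powr p * W1p_energy \<Omega> p u"
    by (simp add: W1p_energy_def sum_distrib_left[symmetric] distrib_left)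
  finally show "W1p_energy \<Omega> p (\<lambda>x. c *\<^sub>R u x) = \<bar>c\<bar> powr p * W1p_energy \<Omega> p u" .
qed

lemma W1p_diff:
  fixes u v :: "'a \<Rightarrow> 'b::{banach, real_inner, second_countable_topology}"
  assumes u: "u \<in> W1p \<Omega> p" and v: "v \<in> W1p \<Omega> p"
  shows "(\<lambda>x. u x - v x) \<in> W1p \<Omega> p"
    "W1p_energy \<Omega> p (\<lambda>x. u x - v x) = Lp_energy \<Omega> p (\<lambda>x. u x - v x)
      + (\<Sum>b\<in>Basis. Lp_energy \<Omega> p (\<lambda>x. weak_deriv \<Omega> b u x - weak_deriv \<Omega> b v x))"
proof -
  obtain bb :: 'a where bb: "bb \<in> Basis" using nonempty_Basis by blast
  have p: "0 \<le> p" using p_ge_1 by simp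
  note * = W1p_I[of "\<lambda>x. u x - v x" "\<lambda>b x. weak_deriv \<Omega> b u x - weak_deriv \<Omega> b v x",
      OF Lp_diff[OF p W1p_weak_deriv(3)[OF u bb] W1p_weak_deriv(3)[OF v bb]]
        Lp_diff[OF p W1p_weak_deriv(2)[OF u] W1p_weak_deriv(2)[OF v]]
        is_weak_deriv_diff[OF _ W1p_weak_deriv(1)[OF u] W1p_weak_deriv(1)[OF v]]]
  show "(\<lambda>x. u x - v x) \<in> W1p \<Omega> p" by (rule *(1))
  show "W1p_energy \<Omega> p (\<lambda>x. u x - v x) = Lp_energy \<Omega> p (\<lambda>x. u x - v x)
      + (\<Sum>b\<in>Basis. Lp_energy \<Omega> p (\<lambda>x. weak_deriv \<Omega> b u x - weak_deriv \<Omega> b v x))" by (rule *(2))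
qed

lemma W1p_cong_AE:
  fixes u v :: "'a \<Rightarrow> 'b::{banach, real_inner, second_countable_topology}"
  assumes u: "u \<in> W1p \<Omega> p" and eq: "AE x\<in>\<Omega> in lebesgue. u x = v x"
  shows "v \<in> W1p \<Omega> p" "W1p_energy \<Omega> p v = W1p_energy \<Omega> p u"
proof -
  obtain bb :: 'a where bb: "bb \<in> Basis" using nonempty_Basis by blast
  note ul = W1p_weak_deriv(3)[OF u bb]
  note * = W1p_I[of v "\<lambda>b. weak_deriv \<Omega> b u", OF Lp_cong_AE(1)[OF ul eq] W1p_weak_deriv(2)[OF u]
      is_weak_deriv_cong_AE[OF _ W1p_weak_deriv(1)[OF u] eq]]
  show "v \<in> W1p \<Omega> p" by (rule *(1)) auto
  have "W1p_energy \<Omega> p v = Lp_energy \<Omega> p v + (\<Sum>b\<in>Basis. Lp_energy \<Omega> p (weak_deriv \<Omega> b u))" by (rule *(2)) auto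
  then show "W1p_energy \<Omega> p v = W1p_energy \<Omega> p u" using Lp_cong_AE(2)[OF ul eq] by (simp add: W1p_energy_def)
qed

lemma test_function_W1p:
  fixes \<phi> :: "'a \<Rightarrow> 'b::{banach, real_inner, second_countable_topology}"
  assumes t: "\<phi> \<in> test_functions \<Omega>" shows "\<phi> \<in> W1p \<Omega> p"
proof (rule W1p_I(1)[where g = "\<lambda>b x. frechet_derivative \<phi> (at x) b"])
  obtain bb :: 'a where bb: "bb \<in> Basis" using nonempty_Basis by blast
  show "\<phi> \<in> Lp \<Omega> p" by (rule test_function_properties[OF t bb], rule Lp_continuous; assumption)
  fix b :: 'a assume b: "b \<in> Basis"
  show "(\<lambda>x. frechet_derivative \<phi> (at x) b) \<in> Lp \<Omega> p"
    by (rule test_function_properties[OF t b], rule Lp_continuous; assumption)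
  show "is_weak_deriv \<Omega> b \<phi> (\<lambda>x. frechet_derivative \<phi> (at x) b)" by (rule is_weak_deriv_test_function[OF t b])
qed

lemma W01p_iff:
  fixes u :: "'a \<Rightarrow> 'b::{banach, real_inner, second_countable_topology}"
  shows "u \<in> W01p \<Omega> p \<longleftrightarrow> u \<in> W1p \<Omega> p \<and> (\<forall>e>0. \<exists>\<phi>\<in>test_functions \<Omega>. W1p_energy \<Omega> p (\<lambda>x. \<phi> x - u x) < e)"
proof -
  have p: "0 < p" using p_ge_1 by simp
  have "(\<exists>\<phi>::nat \<Rightarrow> 'a \<Rightarrow> 'b. (\<forall>k. \<phi> k \<in> test_functions \<Omega>) \<and> (\<lambda>k. W1p_energy \<Omega> p (\<lambda>x. \<phi> k x - u x)) \<longlonglongrightarrow> 0)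
     \<longleftrightarrow> (\<forall>e>0. \<exists>\<phi>\<in>test_functions \<Omega>. W1p_energy \<Omega> p (\<lambda>x. \<phi> x - u x) < e)" (is "?L = ?R")
  proof
    assume ?L
    then obtain \<phi> :: "nat \<Rightarrow> 'a \<Rightarrow> 'b" where \<phi>: "\<And>k. \<phi> k \<in> test_functions \<Omega>" "(\<lambda>k. W1p_energy \<Omega> p (\<lambda>x. \<phi> k x - u x)) \<longlonglongrightarrow> 0"
      by blast
    show ?R
    proof (intro allI impI)
      fix e :: real assume "0 < e"
      then have "\<forall>\<^sub>F k in sequentially. W1p_energy \<Omega> p (\<lambda>x. \<phi> k x - u x) < e" by (rule order_tendstoD(2)[OF \<phi>(2)])
      then obtain k where "W1p_energy \<Omega> p (\<lambda>x. \<phi> k x - u x) < e" by (auto simp: eventually_sequentially)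
      then show "\<exists>\<phi>\<in>test_functions \<Omega>. W1p_energy \<Omega> p (\<lambda>x. \<phi> x - u x) < e" using \<phi>(1) by blast
    qed
  next
    assume ?R
    then have "\<forall>k::nat. \<exists>\<phi>\<in>test_functions \<Omega>. W1p_energy \<Omega> p (\<lambda>x. \<phi> x - u x) < inverse (real (Suc k))" by simp
    then obtain \<phi> :: "nat \<Rightarrow> 'a \<Rightarrow> 'b" where \<phi>: "\<And>k. \<phi> k \<in> test_functions \<Omega>"
      "\<And>k. W1p_energy \<Omega> p (\<lambda>x. \<phi> k x - u x) < inverse (real (Suc k))" by metis
    have "(\<lambda>k. W1p_energy \<Omega> p (\<lambda>x. \<phi> k x - u x)) \<longlonglongrightarrow> 0"
    proof (rule Lim_null_comparison[OF _ LIMSEQ_inverse_real_of_nat])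
      have "norm (W1p_energy \<Omega> p (\<lambda>x. \<phi> k x - u x)) \<le> inverse (real (Suc k))" for k
        using \<phi>(2)[of k] W1p_energy_nonneg[of \<Omega> p "\<lambda>x. \<phi> k x - u x"] by (simp del: of_nat_Suc)
      then show "\<forall>\<^sub>F k in sequentially. norm (W1p_energy \<Omega> p (\<lambda>x. \<phi> k x - u x)) \<le> inverse (real (Suc k))" by (intro always_eventually allI)
    qed
    then show ?L using \<phi>(1) by blast
  qed
  then show ?thesis unfolding W01p_def W1p_norm_tendsto_0_iff[OF p] by (simp only: mem_Collect_eq)
qed

text \<open>The energy satisfies a triangle inequality up to the factor \<open>2 powr p\<close>,
  which the choice of \<open>d\<close> anticipates.\<close>

lemma W01p_closed:
  fixes u :: "'a \<Rightarrow> 'b::{banach, real_inner, second_countable_topology}"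
  assumes u: "u \<in> W1p \<Omega> p" and w: "\<And>e. e > 0 \<Longrightarrow> \<exists>w\<in>W01p \<Omega> p. W1p_energy \<Omega> p (\<lambda>x. w x - u x) < e"
  shows "u \<in> W01p \<Omega> p"
  unfolding W01p_iff
proof (intro conjI u allI impI)
  fix e :: real assume e: "0 < e"
  define d where "d = e / (2 * 2 powr p)"
  have d: "0 < d" using e by (simp add: d_def)
  obtain w where w: "w \<in> W01p \<Omega> p" "W1p_energy \<Omega> p (\<lambda>x. w x - u x) < d" using w[OF d] by blast
  then obtain \<phi> :: "'a \<Rightarrow> 'b" where \<phi>: "\<phi> \<in> test_functions \<Omega>" "W1p_energy \<Omega> p (\<lambda>x. \<phi> x - w x) < d"
    using d by (auto simp: W01p_iff)
  have w1: "w \<in> W1p \<Omega> p" using w(1) by (simp add: W01p_iff)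
  have "W1p_energy \<Omega> p (\<lambda>x. (\<phi> x - w x) + (w x - u x)) \<le> 2 powr p * (W1p_energy \<Omega> p (\<lambda>x. \<phi> x - w x) + W1p_energy \<Omega> p (\<lambda>x. w x - u x))"
    by (intro W1p_add(2) W1p_diff(1) test_function_W1p \<phi> w1 u)
  also have "\<dots> < 2 powr p * (d + d)" using \<phi>(2) w(2) by (intro mult_strict_left_mono add_strict_mono) auto
  also have "\<dots> = e" by (simp add: d_def)
  finally show "\<exists>\<phi>\<in>test_functions \<Omega>. W1p_energy \<Omega> p (\<lambda>x. \<phi> x - u x) < e" using \<phi>(1) by (intro bexI[of _ \<phi>]) auto
qed

lemma W01p_add:
  fixes u v :: "'a \<Rightarrow> 'b::{banach, real_inner, second_countable_topology}"
  assumes u: "u \<in> W01p \<Omega> p" and v: "v \<in> W01p \<Omega> p"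
  shows "(\<lambda>x. u x + v x) \<in> W01p \<Omega> p"
  unfolding W01p_iff
proof (intro conjI allI impI)
  have w: "u \<in> W1p \<Omega> p" "v \<in> W1p \<Omega> p" using u v by (auto simp: W01p_iff)
  then show "(\<lambda>x. u x + v x) \<in> W1p \<Omega> p" by (rule W1p_add)
  fix e :: real assume e: "0 < e"
  define d where "d = e / (2 * 2 powr p)"
  have d: "0 < d" using e by (simp add: d_def)
  obtain \<phi> :: "'a \<Rightarrow> 'b" where \<phi>: "\<phi> \<in> test_functions \<Omega>" "W1p_energy \<Omega> p (\<lambda>x. \<phi> x - u x) < d"
    using d u by (auto simp: W01p_iff)
  obtain \<psi> :: "'a \<Rightarrow> 'b" where \<psi>: "\<psi> \<in> test_functions \<Omega>" "W1p_energy \<Omega> p (\<lambda>x. \<psi> x - v x) < d"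
    using d v by (auto simp: W01p_iff)
  have "W1p_energy \<Omega> p (\<lambda>x. (\<phi> x - u x) + (\<psi> x - v x)) \<le> 2 powr p * (W1p_energy \<Omega> p (\<lambda>x. \<phi> x - u x) + W1p_energy \<Omega> p (\<lambda>x. \<psi> x - v x))"
    by (intro W1p_add(2) W1p_diff(1) test_function_W1p \<phi> \<psi> w)
  also have "\<dots> < 2 powr p * (d + d)" using \<phi>(2) \<psi>(2) by (intro mult_strict_left_mono add_strict_mono) auto
  also have "\<dots> = e" by (simp add: d_def)
  finally show "\<exists>\<phi>\<in>test_functions \<Omega>. W1p_energy \<Omega> p (\<lambda>x. \<phi> x - (u x + v x)) < e"
    using test_functions_add[OF \<phi>(1) \<psi>(1)] by (intro bexI[of _ "\<lambda>x. \<phi> x + \<psi> x"]) (simp_all add: algebra_simps)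
qed

lemma W01p_scaleR:
  fixes u :: "'a \<Rightarrow> 'b::{banach, real_inner, second_countable_topology}"
  assumes u: "u \<in> W01p \<Omega> p"
  shows "(\<lambda>x. c *\<^sub>R u x) \<in> W01p \<Omega> p"
  unfolding W01p_iff
proof (intro conjI allI impI)
  have w: "u \<in> W1p \<Omega> p" using u by (auto simp: W01p_iff)
  then show "(\<lambda>x. c *\<^sub>R u x) \<in> W1p \<Omega> p" by (rule W1p_scaleR)
  fix e :: real assume e: "0 < e"
  define d where "d = e / (\<bar>c\<bar> powr p + 1)"
  have d: "0 < d" using e by (simp add: d_def add_nonneg_pos)
  obtain \<phi> :: "'a \<Rightarrow> 'b" where \<phi>: "\<phi> \<in> test_functions \<Omega>" "W1p_energy \<Omega> p (\<lambda>x. \<phi> x - u x) < d"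
    using d u by (auto simp: W01p_iff)
  have "W1p_energy \<Omega> p (\<lambda>x. c *\<^sub>R (\<phi> x - u x)) = \<bar>c\<bar> powr p * W1p_energy \<Omega> p (\<lambda>x. \<phi> x - u x)"
    by (intro W1p_scaleR(2) W1p_diff(1) test_function_W1p \<phi> w)
  also have "\<dots> \<le> \<bar>c\<bar> powr p * d" using \<phi>(2) by (intro mult_left_mono) auto
  also have "\<dots> < (\<bar>c\<bar> powr p + 1) * d" using d by (intro mult_strict_right_mono) auto
  also have "\<dots> = e" using powr_ge_zero[of "\<bar>c\<bar>" p] by (simp add: d_def del: powr_ge_zero)
  finally show "\<exists>\<phi>\<in>test_functions \<Omega>. W1p_energy \<Omega> p (\<lambda>x. \<phi> x - c *\<^sub>R u x) < e"
    using test_functions_scaleR[OF \<phi>(1)] by (intro bexI[of _ "\<lambda>x. c *\<^sub>R \<phi> x"]) (simp_all add: scaleR_diff_right)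
qed

text \<open>The energy of the difference is 0, so \<open>u\<close> itself is an arbitrarily good
  approximation of \<open>v\<close> and closedness applies.\<close>

lemma W01p_cong_AE:
  fixes u v :: "'a \<Rightarrow> 'b::{banach, real_inner, second_countable_topology}"
  assumes u: "u \<in> W01p \<Omega> p" and eq: "AE x\<in>\<Omega> in lebesgue. u x = v x"
  shows "v \<in> W01p \<Omega> p"
proof (rule W01p_closed)
  have w: "u \<in> W1p \<Omega> p" using u by (auto simp: W01p_iff)
  show v: "v \<in> W1p \<Omega> p" by (rule W1p_cong_AE(1)[OF w eq])
  have "W1p_energy \<Omega> p (\<lambda>x. u x - v x) = W1p_energy \<Omega> p (\<lambda>x. 0 *\<^sub>R u x)"
    by (rule W1p_cong_AE(2)[OF W1p_scaleR(1)[OF w]]) (use eq in \<open>auto elim: eventually_mono\<close>)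
  also have "\<dots> = 0" using W1p_scaleR(2)[OF w, of 0] p_ge_1 by simp
  finally show "\<exists>w\<in>W01p \<Omega> p. W1p_energy \<Omega> p (\<lambda>x. w x - v x) < e" if "e > 0" for e
    using u that by (intro bexI[of _ u]) auto
qed

lemma W01p_zero: "(\<lambda>x. 0 :: 'b::{banach, real_inner, second_countable_topology}) \<in> W01p \<Omega> p"
proof -
  have "(\<lambda>x. 0 :: 'b) \<in> W1p \<Omega> p" by (rule test_function_W1p[OF test_functions_zero])
  moreover have "W1p_energy \<Omega> p (\<lambda>x. 0 :: 'b) = 0"
    using W1p_scaleR(2)[OF calculation, of 0] p_ge_1 by simp
  ultimately show ?thesis unfolding W01p_iff using test_functions_zero by (auto intro!: bexI[of _ "\<lambda>x. 0"])
qed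

text \<open>The pointwise inequality is linear in p-th powers, so it integrates with the same
  constants.\<close>

lemma Lp_energy_uniformly_convex:
  fixes u v :: "'a \<Rightarrow> 'b::euclidean_space"
  assumes C: "\<And>a b :: 'b. norm (a - b) powr p \<le> \<epsilon> * (norm a powr p + norm b powr p)
      + C * ((norm a powr p + norm b powr p) / 2 - norm ((1/2) *\<^sub>R (a + b)) powr p)"
    and u: "u \<in> Lp \<Omega> p" and v: "v \<in> Lp \<Omega> p"
  shows "Lp_energy \<Omega> p (\<lambda>x. u x - v x) \<le> \<epsilon> * (Lp_energy \<Omega> p u + Lp_energy \<Omega> p v)
      + C * ((Lp_energy \<Omega> p u + Lp_energy \<Omega> p v) / 2 - Lp_energy \<Omega> p (\<lambda>x. (1/2) *\<^sub>R (u x + v x)))"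
proof -
  have p: "0 \<le> p" using p_ge_1 by simp
  have i: "integrable (lebesgue_on \<Omega>) (\<lambda>x. norm (u x) powr p)" "integrable (lebesgue_on \<Omega>) (\<lambda>x. norm (v x) powr p)"
    using u v by (auto simp: Lp_iff)
  have id: "integrable (lebesgue_on \<Omega>) (\<lambda>x. norm (u x - v x) powr p)"
    using Lp_diff[OF p u v] by (simp add: Lp_iff)
  have im: "integrable (lebesgue_on \<Omega>) (\<lambda>x. norm ((1/2) *\<^sub>R (u x + v x)) powr p)"
    using Lp_scaleR(1)[OF Lp_add(1)[OF p u v], of "1/2"] unfolding Lp_iff by blast
  have ir: "integrable (lebesgue_on \<Omega>) (\<lambda>x. \<epsilon> * (norm (u x) powr p + norm (v x) powr p)
      + C * ((norm (u x) powr p + norm (v x) powr p) / 2 - norm ((1/2) *\<^sub>R (u x + v x)) powr p))"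
    by (intro Bochner_Integration.integrable_add Bochner_Integration.integrable_diff integrable_mult_right
        Bochner_Integration.integrable_divide i im)
  have "Lp_energy \<Omega> p (\<lambda>x. u x - v x) \<le> (LINT x|lebesgue_on \<Omega>. \<epsilon> * (norm (u x) powr p + norm (v x) powr p)
      + C * ((norm (u x) powr p + norm (v x) powr p) / 2 - norm ((1/2) *\<^sub>R (u x + v x)) powr p))"
    unfolding Lp_energy_eq by (rule integral_mono[OF id ir C])
  also have "\<dots> = \<epsilon> * (Lp_energy \<Omega> p u + Lp_energy \<Omega> p v)
      + C * ((Lp_energy \<Omega> p u + Lp_energy \<Omega> p v) / 2 - Lp_energy \<Omega> p (\<lambda>x. (1/2) *\<^sub>R (u x + v x)))"
    unfolding Lp_energy_eq using i im
    by (simp only: Bochner_Integration.integral_add Bochner_Integration.integral_diff integral_mult_right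
        Bochner_Integration.integral_divide Bochner_Integration.integrable_add Bochner_Integration.integrable_diff integrable_mult_right
        Bochner_Integration.integrable_divide integral_divide_zero integral_mult_right_zero)
  finally show ?thesis .
qed

text \<open>The same pointwise constant serves the function and each of its derivatives, so the
  bounds add up; \<open>C\<close> depends on \<open>\<epsilon>\<close> but not on \<open>u\<close>
  and \<open>v\<close>.\<close>

lemma W1p_energy_uniformly_convex:
  assumes p: "1 < p" and \<epsilon>: "0 < \<epsilon>"
  obtains C where "0 \<le> C" "\<And>u v :: 'a \<Rightarrow> 'b::euclidean_space. u \<in> W1p \<Omega> p \<Longrightarrow> v \<in> W1p \<Omega> p \<Longrightarrow>
    W1p_energy \<Omega> p (\<lambda>x. u x - v x) \<le> \<epsilon> * (W1p_energy \<Omega> p u + W1p_energy \<Omega> p v)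
      + C * ((W1p_energy \<Omega> p u + W1p_energy \<Omega> p v) / 2 - W1p_energy \<Omega> p (\<lambda>x. (1/2) *\<^sub>R (u x + v x)))"
proof -
  obtain C where C: "0 \<le> C" "\<And>a b :: 'b. norm (a - b) powr p \<le> \<epsilon> * (norm a powr p + norm b powr p)
      + C * ((norm a powr p + norm b powr p) / 2 - norm ((1/2) *\<^sub>R (a + b)) powr p)"
    using norm_powr_uniformly_convex[OF p \<epsilon>, where ?'b = 'b] by blast
  note Lp_uc = Lp_energy_uniformly_convex[of \<epsilon> C, OF C(2)]
  obtain bb :: 'a where bb: "bb \<in> Basis" using nonempty_Basis by blast
  have p0: "0 \<le> p" using p by simp
  show thesis
  proof (rule that[OF C(1)])
    fix u v :: "'a \<Rightarrow> 'b" assume u: "u \<in> W1p \<Omega> p" and v: "v \<in> W1p \<Omega> p"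
    let ?m = "\<lambda>b x. (1/2) *\<^sub>R (weak_deriv \<Omega> b u x + weak_deriv \<Omega> b v x)"
    have m: "W1p_energy \<Omega> p (\<lambda>x. (1/2) *\<^sub>R (u x + v x)) = Lp_energy \<Omega> p (\<lambda>x. (1/2) *\<^sub>R (u x + v x))
        + (\<Sum>b\<in>Basis. Lp_energy \<Omega> p (?m b))"
      by (rule W1p_I(2)) (intro Lp_scaleR(1) Lp_add(1) p0 W1p_weak_deriv(2) W1p_weak_deriv(3)[OF _ bb] u v
          is_weak_deriv_scaleR is_weak_deriv_add W1p_weak_deriv(1); assumption)+
    have s1: "Lp_energy \<Omega> p (\<lambda>x. u x - v x) \<le> \<epsilon> * (Lp_energy \<Omega> p u + Lp_energy \<Omega> p v)
      + C * ((Lp_energy \<Omega> p u + Lp_energy \<Omega> p v) / 2 - Lp_energy \<Omega> p (\<lambda>x. (1/2) *\<^sub>R (u x + v x)))"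
      by (rule Lp_uc[OF W1p_weak_deriv(3)[OF u bb] W1p_weak_deriv(3)[OF v bb]])
    have s2: "(\<Sum>b\<in>Basis. Lp_energy \<Omega> p (\<lambda>x. weak_deriv \<Omega> b u x - weak_deriv \<Omega> b v x)) \<le>
       (\<Sum>b\<in>Basis. \<epsilon> * (Lp_energy \<Omega> p (weak_deriv \<Omega> b u) + Lp_energy \<Omega> p (weak_deriv \<Omega> b v))
      + C * ((Lp_energy \<Omega> p (weak_deriv \<Omega> b u) + Lp_energy \<Omega> p (weak_deriv \<Omega> b v)) / 2 - Lp_energy \<Omega> p (?m b)))"
      by (rule sum_mono) (rule Lp_uc[OF W1p_weak_deriv(2)[OF u] W1p_weak_deriv(2)[OF v]])
    define A B M where "A = (\<Sum>b\<in>Basis. Lp_energy \<Omega> p (weak_deriv \<Omega> b u))"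
      and "B = (\<Sum>b\<in>Basis. Lp_energy \<Omega> p (weak_deriv \<Omega> b v))" and "M = (\<Sum>b\<in>Basis. Lp_energy \<Omega> p (?m b))"
    have s3: "(\<Sum>b\<in>Basis. \<epsilon> * (Lp_energy \<Omega> p (weak_deriv \<Omega> b u) + Lp_energy \<Omega> p (weak_deriv \<Omega> b v))
      + C * ((Lp_energy \<Omega> p (weak_deriv \<Omega> b u) + Lp_energy \<Omega> p (weak_deriv \<Omega> b v)) / 2 - Lp_energy \<Omega> p (?m b)))
      = \<epsilon> * (A + B) + C * ((A + B) / 2 - M)"
      by (simp only: sum.distrib sum_distrib_left[symmetric] sum_subtractf sum_divide_distrib[symmetric] A_def B_def M_def)
    have alg: "\<epsilon> * (a + b) + C * ((a + b) / 2 - c) + (\<epsilon> * (A + B) + C * ((A + B) / 2 - M))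
        = \<epsilon> * ((a + A) + (b + B)) + C * (((a + A) + (b + B)) / 2 - (c + M))" for a b c :: real
      by (simp add: field_simps)
    show "W1p_energy \<Omega> p (\<lambda>x. u x - v x) \<le> \<epsilon> * (W1p_energy \<Omega> p u + W1p_energy \<Omega> p v)
      + C * ((W1p_energy \<Omega> p u + W1p_energy \<Omega> p v) / 2 - W1p_energy \<Omega> p (\<lambda>x. (1/2) *\<^sub>R (u x + v x)))"
      using add_mono[OF s1 s2] unfolding s3 alg m W1p_diff(2)[OF u v]
      by (simp only: W1p_energy_def A_def B_def M_def)
  qed
qed

end

section \<open>From convergence in L2 to convergence in the Sobolev norm\<close>

lemma rep_add_L2: "AE x in lebesgue. rep_L2 (u + v) x = rep_L2 u x + rep_L2 v x"
proof -
  have "u + v = abs_L2 (\<lambda>x. rep_L2 u x + rep_L2 v x)"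
    by (simp add: plus_L2_def)
  then show ?thesis
    using rep_abs_L2[OF square_integrable_add[OF square_integrable_rep square_integrable_rep]] by metis
qed

lemma rep_scaleR_L2: "AE x in lebesgue. rep_L2 (c *\<^sub>R u) x = c *\<^sub>R rep_L2 u x"
proof -
  have "c *\<^sub>R u = abs_L2 (\<lambda>x. c *\<^sub>R rep_L2 u x)"
    by (simp add: scaleR_L2_def)
  then show ?thesis
    using rep_abs_L2[OF square_integrable_scaleR[OF square_integrable_rep]] by metis
qed

lemma norm_powr_2: "norm x powr 2 = (norm x)\<^sup>2"
  by (cases "x = 0") (simp_all add: powr_numeral)

lemma L2_convergence_on:
  fixes w :: "nat \<Rightarrow> ('a::euclidean_space, 'b::euclidean_space) L2" and u v :: "('a, 'b) L2"
  assumes \<Omega>: "\<Omega> \<in> sets lebesgue" and w: "w \<longlonglongrightarrow> u"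
  shows "rep_L2 v \<in> Lp \<Omega> 2" "(\<lambda>n. Lp_energy \<Omega> 2 (\<lambda>x. rep_L2 (w n) x - rep_L2 u x)) \<longlonglongrightarrow> 0"
proof -
  have si: "set_integrable lebesgue \<Omega> (\<lambda>x. norm (f x) powr 2)" if "square_integrable f" for f :: "'a \<Rightarrow> 'b"
    using that \<Omega> unfolding norm_powr_2 set_integrable_def
    by (intro integrable_mult_indicator) (auto simp: square_integrable_def)
  have sm: "set_borel_measurable lebesgue \<Omega> f" if "square_integrable f" for f :: "'a \<Rightarrow> 'b"
    using that \<Omega> unfolding set_borel_measurable_def by (auto simp: square_integrable_def)
  show "rep_L2 v \<in> Lp \<Omega> 2" using si[OF square_integrable_rep[of v]] sm[OF square_integrable_rep[of v]] by (simp add: Lp_def)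
  show "(\<lambda>n. Lp_energy \<Omega> 2 (\<lambda>x. rep_L2 (w n) x - rep_L2 u x)) \<longlonglongrightarrow> 0"
  proof (rule Lim_null_comparison)
    have "(\<lambda>n. (norm (w n - u))\<^sup>2) \<longlonglongrightarrow> (norm (u - u))\<^sup>2" by (intro tendsto_intros w)
    then show "(\<lambda>n. (norm (w n - u))\<^sup>2) \<longlonglongrightarrow> 0" by simp
    have "Lp_energy \<Omega> 2 (\<lambda>x. rep_L2 (w n) x - rep_L2 u x) \<le> (norm (w n - u))\<^sup>2" for n
    proof -
      have sq: "square_integrable (\<lambda>x. rep_L2 (w n) x - rep_L2 u x)"
        using square_integrable_add[of "rep_L2 (w n)" "\<lambda>x. - 1 *\<^sub>R rep_L2 u x"]
          square_integrable_scaleR[of "rep_L2 u" "-1"] by simp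
      have "Lp_energy \<Omega> 2 (\<lambda>x. rep_L2 (w n) x - rep_L2 u x) \<le> (LINT x|lebesgue. (norm (rep_L2 (w n) x - rep_L2 u x))\<^sup>2)"
        unfolding Lp_energy_def set_lebesgue_integral_def norm_powr_2
      proof (rule integral_mono)
        show "integrable lebesgue (\<lambda>x. indicator \<Omega> x *\<^sub>R (norm (rep_L2 (w n) x - rep_L2 u x))\<^sup>2)"
          using si[OF sq] by (simp add: set_integrable_def norm_powr_2)
        show "integrable lebesgue (\<lambda>x. (norm (rep_L2 (w n) x - rep_L2 u x))\<^sup>2)"
          using sq by (simp add: square_integrable_def)
      qed (simp add: indicator_def)
      also have "\<dots> = (LINT x|lebesgue. (norm (rep_L2 (w n - u) x))\<^sup>2)"
      proof (rule integral_cong_AE)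
        show "AE x in lebesgue. (norm (rep_L2 (w n) x - rep_L2 u x))\<^sup>2 = (norm (rep_L2 (w n - u) x))\<^sup>2"
          using rep_diff_L2[of "w n" u] by eventually_elim simp
      qed measurable
      also have "\<dots> = (norm (w n - u))\<^sup>2" by (rule norm_L2_rep[symmetric])
      finally show ?thesis .
    qed
    then show "\<forall>\<^sub>F n in sequentially. norm (Lp_energy \<Omega> 2 (\<lambda>x. rep_L2 (w n) x - rep_L2 u x)) \<le> (norm (w n - u))\<^sup>2"
      by (simp add: Lp_energy_nonneg)
  qed
qed

context bounded_open
begin

text \<open>On a set of finite measure both limits are also limits in L1. This identifies limits in
  spaces with different exponents.\<close>

lemma Lp_limit_unique:
  fixes f :: "nat \<Rightarrow> 'a \<Rightarrow> 'b::euclidean_space"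
  assumes f: "\<And>n. f n \<in> Lp \<Omega> p" "\<And>n. f n \<in> Lp \<Omega> q" and g: "g \<in> Lp \<Omega> p" and h: "h \<in> Lp \<Omega> q" and q: "1 \<le> q"
    and lim: "(\<lambda>n. Lp_energy \<Omega> p (\<lambda>x. f n x - g x)) \<longlonglongrightarrow> 0" "(\<lambda>n. Lp_energy \<Omega> q (\<lambda>x. f n x - h x)) \<longlonglongrightarrow> 0"
  shows "AE x\<in>\<Omega> in lebesgue. g x = h x"
proof -
  have p0: "0 \<le> p" and q0: "0 \<le> q" using p_ge_1 q by auto
  have dg: "(\<lambda>x. f n x - g x) \<in> Lp \<Omega> p" for n by (rule Lp_diff[OF p0 f(1) g])
  have dh: "(\<lambda>x. f n x - h x) \<in> Lp \<Omega> q" for n by (rule Lp_diff[OF q0 f(2) h])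
  have L1: "(\<lambda>n. LINT x|lebesgue_on \<Omega>. norm (f n x - g x)) \<longlonglongrightarrow> 0"
    using dg lim(1) by (intro Lp_tendsto_imp_L1_tendsto[OF p_ge_1]) (auto simp: Lp_iff Lp_energy_eq)
  have L2: "(\<lambda>n. LINT x|lebesgue_on \<Omega>. norm (f n x - h x)) \<longlonglongrightarrow> 0"
    using dh lim(2) by (intro Lp_tendsto_imp_L1_tendsto[OF q]) (auto simp: Lp_iff Lp_energy_eq)
  have ig: "integrable (lebesgue_on \<Omega>) (\<lambda>x. f n x - g x)" for n
    by (rule integrable_powr_imp_integrable[OF p_ge_1]) (use dg in \<open>simp_all add: Lp_iff\<close>)
  have ih: "integrable (lebesgue_on \<Omega>) (\<lambda>x. f n x - h x)" for n
    by (rule integrable_powr_imp_integrable[OF q]) (use dh in \<open>simp_all add: Lp_iff\<close>)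
  have igh: "integrable (lebesgue_on \<Omega>) (\<lambda>x. g x - h x)"
    using Bochner_Integration.integrable_diff[OF ih[of 0] ig[of 0]] by simp
  have le: "(LINT x|lebesgue_on \<Omega>. norm (g x - h x)) \<le> (LINT x|lebesgue_on \<Omega>. norm (f n x - g x)) + (LINT x|lebesgue_on \<Omega>. norm (f n x - h x))" for n
  proof -
    have "(LINT x|lebesgue_on \<Omega>. norm (g x - h x)) \<le> (LINT x|lebesgue_on \<Omega>. norm (f n x - g x) + norm (f n x - h x))"
    proof (rule integral_mono)
      show "norm (g x - h x) \<le> norm (f n x - g x) + norm (f n x - h x)" for x
        using norm_triangle_ineq4[of "f n x - h x" "f n x - g x"] by (simp add: add.commute)
    qed (use igh ig ih in auto)
    then show ?thesis using ig ih by simp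
  qed
  have "(\<lambda>n. (LINT x|lebesgue_on \<Omega>. norm (f n x - g x)) + (LINT x|lebesgue_on \<Omega>. norm (f n x - h x))) \<longlonglongrightarrow> 0 + 0"
    by (intro tendsto_add L1 L2)
  then have "(LINT x|lebesgue_on \<Omega>. norm (g x - h x)) \<le> 0 + 0"
    by (rule LIMSEQ_le_const) (use le in auto)
  moreover have "0 \<le> (LINT x|lebesgue_on \<Omega>. norm (g x - h x))" by (rule Bochner_Integration.integral_nonneg) simp
  ultimately have "(LINT x|lebesgue_on \<Omega>. norm (g x - h x)) = 0" by simp
  then have "AE x in lebesgue_on \<Omega>. norm (g x - h x) = 0"
    using igh by (subst (asm) integral_nonneg_eq_0_iff_AE) auto
  then show ?thesis unfolding AE_eq by eventually_elim simp
qed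

text \<open>
  A substitute for Mazur's lemma: nearly energy-minimal elements of \<open>C\<close> in shrinking balls
  around \<open>u\<close> form a Cauchy sequence in the Sobolev norm, by uniform convexity.
\<close>

lemma closure_convex_energy_bounded:
  fixes C :: "('a, 'b::euclidean_space) L2 set"
  assumes p: "1 < p" and conv: "convex C" and W: "\<And>w. w \<in> C \<Longrightarrow> rep_L2 w \<in> W01p \<Omega> p"
    and R: "\<And>w. w \<in> C \<Longrightarrow> W1p_energy \<Omega> p (rep_L2 w) \<le> R" and u: "u \<in> closure C"
  obtains w where "\<And>n::nat. w n \<in> C" "rep_L2 u \<in> W01p \<Omega> p"
    "(\<lambda>n. W1p_energy \<Omega> p (\<lambda>x. rep_L2 (w n) x - rep_L2 u x)) \<longlonglongrightarrow> 0"
proof -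
  let ?E = "\<lambda>w. W1p_energy \<Omega> p (rep_L2 w)" and ?i = "\<lambda>n. inverse (real (Suc n))"
  obtain bb :: 'a where bb: "bb \<in> Basis" using nonempty_Basis by blast
  have W1: "rep_L2 w \<in> W1p \<Omega> p" if "w \<in> C" for w using W[OF that] by (simp add: W01p_iff)
  \<comment> \<open>Shrinking the ball raises the infimum \<open>d n\<close> of the energy over
    \<open>K n\<close>; being bounded by \<open>R\<close> these infima converge. Nearly minimal
    elements of \<open>K n\<close> thus have almost equal energies and at the same time tend to
    \<open>u\<close> in L2.\<close>
  define K where "K n = C \<inter> ball u (?i n)" for n
  have Kne: "K n \<noteq> {}" for n
  proof -
    have "\<exists>y\<in>C. dist y u < ?i n" using u by (simp add: closure_approachable del: of_nat_Suc)
    then show ?thesis by (auto simp: K_def dist_commute)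
  qed
  have Kconv: "convex (K n)" for n unfolding K_def by (intro convex_Int conv convex_ball)
  have Kmono: "K m \<subseteq> K n" if "n \<le> m" for m n
  proof -
    have "?i m \<le> ?i n" using that by (simp add: field_simps)
    then have "ball u (?i m) \<subseteq> ball u (?i n)" by (rule subset_ball)
    then show ?thesis unfolding K_def by blast
  qed
  define d where "d n = Inf (?E ` K n)" for n
  have bdd: "bdd_below (?E ` K n)" for n by (rule bdd_belowI2[where m = 0]) (rule W1p_energy_nonneg)
  have dle: "d n \<le> ?E w" if "w \<in> K n" for w n unfolding d_def using bdd that by (intro cINF_lower) auto
  have dmono: "d n \<le> d m" if "n \<le> m" for m n
    unfolding d_def using Kne bdd Kmono[OF that] by (intro cINF_superset_mono) auto
  have dR: "d n \<le> R" for n using Kne[of n] dle R unfolding K_def by (meson IntD1 all_not_in_conv order_trans)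
  have "\<exists>w\<in>K n. ?E w < d n + ?i n" for n
  proof -
    have "Inf (?E ` K n) < d n + ?i n" by (simp add: d_def)
    then show ?thesis using bdd Kne by (subst (asm) cInf_less_iff) auto
  qed
  then obtain w where w: "\<And>n. w n \<in> K n" "\<And>n. ?E (w n) < d n + ?i n" by metis
  have wC: "w n \<in> C" for n using w(1)[of n] by (simp add: K_def)
  have wl: "w \<longlonglongrightarrow> u"
  proof -
    have "(\<lambda>n. w n - u) \<longlonglongrightarrow> 0"
    proof (rule Lim_null_comparison[OF _ LIMSEQ_inverse_real_of_nat])
      have "norm (w n - u) \<le> ?i n" for n using w(1)[of n] by (simp add: K_def dist_norm norm_minus_commute)
      then show "\<forall>\<^sub>F n in sequentially. norm (w n - u) \<le> ?i n" by simp
    qed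
    then show ?thesis by (simp add: LIM_zero_iff)
  qed
  have "convergent d"
  proof (rule Bseq_mono_convergent)
    have "norm (d n) \<le> max \<bar>d 0\<bar> \<bar>R\<bar>" for n using dR[of n] dmono[of 0 n] by auto
    then show "Bseq d" by (rule BseqI')
    show "\<forall>m n. m \<le> n \<longrightarrow> d m \<le> d n" using dmono by blast
  qed
  then obtain dl where dl: "d \<longlonglongrightarrow> dl" by (auto simp: convergent_def)
  have d_le: "d n \<le> dl" for n using dl dmono by (meson incseq_le monoI)
  \<comment> \<open>For \<open>n \<le> m\<close> the midpoint lies in the convex set
    \<open>K n\<close>. The defect in the uniform convexity inequality is therefore at most
    \<open>dl - d n + ?i n\<close>, which tends to 0.\<close>
  have mid: "d n \<le> W1p_energy \<Omega> p (\<lambda>x. (1/2) *\<^sub>R (rep_L2 (w n) x + rep_L2 (w m) x))" if nm: "n \<le> m" for n m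
  proof -
    let ?m = "(1/2) *\<^sub>R (w n + w m)"
    have "?m \<in> K n"
      using convexD[OF Kconv w(1)[of n], of "w m" "1/2" "1/2"] Kmono[OF nm] w(1)[of m] by (auto simp: scaleR_add_right)
    then have "d n \<le> ?E ?m" by (rule dle)
    also have "?E ?m = W1p_energy \<Omega> p (\<lambda>x. (1/2) *\<^sub>R (rep_L2 (w n) x + rep_L2 (w m) x))"
    proof (rule W1p_cong_AE(2)[symmetric, OF W1])
      show "?m \<in> C" using \<open>?m \<in> K n\<close> by (simp add: K_def)
      show "AE x\<in>\<Omega> in lebesgue. rep_L2 ?m x = (1/2) *\<^sub>R (rep_L2 (w n) x + rep_L2 (w m) x)"
        using rep_scaleR_L2[of "1/2" "w n + w m"] rep_add_L2[of "w n" "w m"] by eventually_elim simp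
    qed
    finally show ?thesis .
  qed
  have cauchy: "\<exists>N. \<forall>m\<ge>N. \<forall>n\<ge>N. W1p_energy \<Omega> p (\<lambda>x. rep_L2 (w m) x - rep_L2 (w n) x) < e" if e: "e > 0" for e
  proof -
    \<comment> \<open>Energies on \<open>C\<close> are at most \<open>\<bar>R\<bar>\<close>, so with
      this choice the first term of the uniform convexity bound is at most
      \<open>e / 2\<close>.\<close>
    define \<epsilon> where "\<epsilon> = e / (4 * (\<bar>R\<bar> + 1))"
    have \<epsilon>: "0 < \<epsilon>" "\<epsilon> * (2 * \<bar>R\<bar>) \<le> e / 2" using e by (auto simp: \<epsilon>_def field_simps)
    obtain C' where C': "0 \<le> C'" "\<And>u v :: 'a \<Rightarrow> 'b. u \<in> W1p \<Omega> p \<Longrightarrow> v \<in> W1p \<Omega> p \<Longrightarrow>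
      W1p_energy \<Omega> p (\<lambda>x. u x - v x) \<le> \<epsilon> * (W1p_energy \<Omega> p u + W1p_energy \<Omega> p v)
      + C' * ((W1p_energy \<Omega> p u + W1p_energy \<Omega> p v) / 2 - W1p_energy \<Omega> p (\<lambda>x. (1/2) *\<^sub>R (u x + v x)))"
      using W1p_energy_uniformly_convex[OF p \<epsilon>(1), where ?'b = 'b] by blast
    have "(\<lambda>n. C' * (dl - d n + ?i n)) \<longlonglongrightarrow> C' * (dl - dl + 0)"
      by (intro tendsto_intros dl LIMSEQ_inverse_real_of_nat)
    then have "\<forall>\<^sub>F n in sequentially. C' * (dl - d n + ?i n) < e / 2" using e by (intro order_tendstoD(2)) auto
    then obtain N where N: "\<And>n. n \<ge> N \<Longrightarrow> C' * (dl - d n + ?i n) < e / 2" by (auto simp: eventually_sequentially)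
    have *: "W1p_energy \<Omega> p (\<lambda>x. rep_L2 (w n) x - rep_L2 (w m) x) < e" if nm: "N \<le> n" "n \<le> m" for n m
    proof -
      have im: "?i m \<le> ?i n" using nm by (simp add: field_simps)
      have "(?E (w n) + ?E (w m)) / 2 - W1p_energy \<Omega> p (\<lambda>x. (1/2) *\<^sub>R (rep_L2 (w n) x + rep_L2 (w m) x)) \<le> dl - d n + ?i n"
        using w(2)[of n] w(2)[of m] mid[OF nm(2)] d_le[of n] d_le[of m] im by argo
      then have "C' * ((?E (w n) + ?E (w m)) / 2 - W1p_energy \<Omega> p (\<lambda>x. (1/2) *\<^sub>R (rep_L2 (w n) x + rep_L2 (w m) x))) < e / 2"
        using N[OF nm(1)] mult_left_mono[OF _ C'(1)] by (meson order.strict_trans1)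
      moreover have "\<epsilon> * (?E (w n) + ?E (w m)) \<le> \<epsilon> * (2 * \<bar>R\<bar>)"
        using R[OF wC[of n]] R[OF wC[of m]] \<epsilon>(1) by (intro mult_left_mono) auto
      ultimately show ?thesis using C'(2)[OF W1[OF wC[of n]] W1[OF wC[of m]]] \<epsilon>(2) by linarith
    qed
    have sym: "W1p_energy \<Omega> p (\<lambda>x. rep_L2 (w n) x - rep_L2 (w m) x) = W1p_energy \<Omega> p (\<lambda>x. rep_L2 (w m) x - rep_L2 (w n) x)" for m n
      using W1p_scaleR(2)[OF W1p_diff(1)[OF W1[OF wC[of n]] W1[OF wC[of m]]], of "-1"] by simp
    show ?thesis
    proof (intro exI allI impI)
      fix m n assume "N \<le> m" "N \<le> n"
      then show "W1p_energy \<Omega> p (\<lambda>x. rep_L2 (w m) x - rep_L2 (w n) x) < e"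
        using *[of m n] *[of n m] sym[of m n] by (cases "m \<le> n") auto
    qed
  qed
  have part: "Lp_energy \<Omega> p (\<lambda>x. rep_L2 (w m) x - rep_L2 (w n) x) \<le> W1p_energy \<Omega> p (\<lambda>x. rep_L2 (w m) x - rep_L2 (w n) x)"
    "b \<in> Basis \<Longrightarrow> Lp_energy \<Omega> p (\<lambda>x. weak_deriv \<Omega> b (rep_L2 (w m)) x - weak_deriv \<Omega> b (rep_L2 (w n)) x)
      \<le> W1p_energy \<Omega> p (\<lambda>x. rep_L2 (w m) x - rep_L2 (w n) x)" for m n b
  proof -
    note eq = W1p_diff(2)[OF W1[OF wC[of m]] W1[OF wC[of n]]]
    let ?s = "\<lambda>b. Lp_energy \<Omega> p (\<lambda>x. weak_deriv \<Omega> b (rep_L2 (w m)) x - weak_deriv \<Omega> b (rep_L2 (w n)) x)"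
    have "0 \<le> (\<Sum>b\<in>Basis. ?s b)" by (intro sum_nonneg Lp_energy_nonneg)
    then show "Lp_energy \<Omega> p (\<lambda>x. rep_L2 (w m) x - rep_L2 (w n) x) \<le> W1p_energy \<Omega> p (\<lambda>x. rep_L2 (w m) x - rep_L2 (w n) x)"
      unfolding eq by simp
    assume b: "b \<in> Basis"
    have "?s b \<le> (\<Sum>b\<in>Basis. ?s b)" by (rule member_le_sum[OF b]) (auto intro: Lp_energy_nonneg)
    also have "\<dots> \<le> W1p_energy \<Omega> p (\<lambda>x. rep_L2 (w m) x - rep_L2 (w n) x)"
      unfolding eq using Lp_energy_nonneg by simp
    finally show "?s b \<le> W1p_energy \<Omega> p (\<lambda>x. rep_L2 (w m) x - rep_L2 (w n) x)" .
  qed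
  have complete: "\<exists>g. g \<in> Lp \<Omega> p \<and> (\<lambda>n. Lp_energy \<Omega> p (\<lambda>x. f n x - g x)) \<longlonglongrightarrow> 0"
    if f: "\<And>n. f n \<in> Lp \<Omega> p" and le: "\<And>m n. Lp_energy \<Omega> p (\<lambda>x. f m x - f n x) \<le> W1p_energy \<Omega> p (\<lambda>x. rep_L2 (w m) x - rep_L2 (w n) x)"
    for f :: "nat \<Rightarrow> 'a \<Rightarrow> 'b"
  proof -
    have p0: "0 < p" using p by simp
    have fm: "\<And>n. f n \<in> borel_measurable (lebesgue_on \<Omega>)" "\<And>n. integrable (lebesgue_on \<Omega>) (\<lambda>x. norm (f n x) powr p)"
      using f by (auto simp: Lp_iff)
    have cau: "\<exists>N. \<forall>m\<ge>N. \<forall>n\<ge>N. (LINT x|lebesgue_on \<Omega>. norm (f m x - f n x) powr p) < e" if "e > 0" for e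
      using cauchy[OF that] le unfolding Lp_energy_eq by (meson order.strict_trans1)
    obtain g where "g \<in> borel_measurable (lebesgue_on \<Omega>)"
      "integrable (lebesgue_on \<Omega>) (\<lambda>x. norm (g x) powr p)"
      "(\<lambda>n. LINT x|lebesgue_on \<Omega>. norm (f n x - g x) powr p) \<longlonglongrightarrow> 0"
      by (rule Lp_complete[OF p0 fm cau], assumption, rule that; assumption)
    then show ?thesis by (intro exI[of _ g]) (simp add: Lp_iff Lp_energy_eq)
  qed
  have wp: "rep_L2 (w n) \<in> Lp \<Omega> p" for n by (rule W1p_weak_deriv(3)[OF W1[OF wC] bb])
  obtain g0 where g0: "g0 \<in> Lp \<Omega> p" "(\<lambda>n. Lp_energy \<Omega> p (\<lambda>x. rep_L2 (w n) x - g0 x)) \<longlonglongrightarrow> 0"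
    using complete[OF wp part(1)] by blast
  have "\<forall>b\<in>Basis. \<exists>g. g \<in> Lp \<Omega> p \<and> (\<lambda>n. Lp_energy \<Omega> p (\<lambda>x. weak_deriv \<Omega> b (rep_L2 (w n)) x - g x)) \<longlonglongrightarrow> 0"
    by (intro ballI complete W1p_weak_deriv(2)[OF W1[OF wC]] part(2))
  from bchoice[OF this] obtain g where "\<forall>b\<in>Basis. g b \<in> Lp \<Omega> p \<and>
    (\<lambda>n. Lp_energy \<Omega> p (\<lambda>x. weak_deriv \<Omega> b (rep_L2 (w n)) x - g b x)) \<longlonglongrightarrow> 0" ..
  then have g: "\<And>b. b \<in> Basis \<Longrightarrow> g b \<in> Lp \<Omega> p"
    "\<And>b. b \<in> Basis \<Longrightarrow> (\<lambda>n. Lp_energy \<Omega> p (\<lambda>x. weak_deriv \<Omega> b (rep_L2 (w n)) x - g b x)) \<longlonglongrightarrow> 0" by blast+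
  \<comment> \<open>The limit \<open>g0\<close> comes from completeness of \<open>Lp\<close>; it is
    \<open>u\<close> because \<open>w\<close> tends to \<open>u\<close> in L2.\<close>
  have eq: "AE x\<in>\<Omega> in lebesgue. g0 x = rep_L2 u x"
    by (rule Lp_limit_unique[OF wp L2_convergence_on(1)[OF sets_\<Omega> wl] g0(1) L2_convergence_on(1)[OF sets_\<Omega> wl] _ g0(2)
          L2_convergence_on(2)[OF sets_\<Omega> wl]]) simp
  have uL: "rep_L2 u \<in> Lp \<Omega> p" by (rule Lp_cong_AE(1)[OF g0(1) eq])
  have p0: "0 \<le> p" using p by simp
  have ulim: "(\<lambda>n. Lp_energy \<Omega> p (\<lambda>x. rep_L2 (w n) x - rep_L2 u x)) \<longlonglongrightarrow> 0"
  proof -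
    have "Lp_energy \<Omega> p (\<lambda>x. rep_L2 (w n) x - g0 x) = Lp_energy \<Omega> p (\<lambda>x. rep_L2 (w n) x - rep_L2 u x)" for n
      by (rule Lp_cong_AE(2)[OF Lp_diff[OF p0 wp g0(1)]]) (use eq in \<open>auto elim: eventually_mono\<close>)
    then show ?thesis using g0(2) by simp
  qed
  have wd: "is_weak_deriv \<Omega> b (rep_L2 u) (g b)" if b: "b \<in> Basis" for b
    by (rule is_weak_deriv_limit[OF b W1p_weak_deriv(1)[OF W1[OF wC] b] wp uL ulim W1p_weak_deriv(2)[OF W1[OF wC] b] g(1)[OF b] g(2)[OF b]])
  have u1: "rep_L2 u \<in> W1p \<Omega> p" by (rule W1p_I(1)[OF uL g(1) wd])
  have conv: "(\<lambda>n. W1p_energy \<Omega> p (\<lambda>x. rep_L2 (w n) x - rep_L2 u x)) \<longlonglongrightarrow> 0"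
  proof -
    have "W1p_energy \<Omega> p (\<lambda>x. rep_L2 (w n) x - rep_L2 u x) = Lp_energy \<Omega> p (\<lambda>x. rep_L2 (w n) x - rep_L2 u x)
        + (\<Sum>b\<in>Basis. Lp_energy \<Omega> p (\<lambda>x. weak_deriv \<Omega> b (rep_L2 (w n)) x - g b x))" for n
    proof (rule W1p_I(2))
      show "(\<lambda>x. rep_L2 (w n) x - rep_L2 u x) \<in> Lp \<Omega> p" by (rule Lp_diff[OF p0 wp uL])
      show "(\<lambda>x. weak_deriv \<Omega> b (rep_L2 (w n)) x - g b x) \<in> Lp \<Omega> p" if b: "b \<in> Basis" for b
        by (rule Lp_diff[OF p0 W1p_weak_deriv(2)[OF W1[OF wC] b] g(1)[OF b]])
      show "is_weak_deriv \<Omega> b (\<lambda>x. rep_L2 (w n) x - rep_L2 u x) (\<lambda>x. weak_deriv \<Omega> b (rep_L2 (w n)) x - g b x)"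
        if b: "b \<in> Basis" for b
        by (rule is_weak_deriv_diff[OF b W1p_weak_deriv(1)[OF W1[OF wC] b] wd[OF b]])
    qed
    moreover have "(\<lambda>n. Lp_energy \<Omega> p (\<lambda>x. rep_L2 (w n) x - rep_L2 u x)
        + (\<Sum>b\<in>Basis. Lp_energy \<Omega> p (\<lambda>x. weak_deriv \<Omega> b (rep_L2 (w n)) x - g b x))) \<longlonglongrightarrow> 0 + (\<Sum>b\<in>(Basis::'a set). 0)"
      by (intro tendsto_add ulim tendsto_sum g(2))
    ultimately show ?thesis by simp
  qed
  have "rep_L2 u \<in> W01p \<Omega> p"
  proof (rule W01p_closed[OF u1])
    fix e :: real assume "0 < e"
    then have "\<forall>\<^sub>F n in sequentially. W1p_energy \<Omega> p (\<lambda>x. rep_L2 (w n) x - rep_L2 u x) < e"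
      by (rule order_tendstoD(2)[OF conv])
    then obtain n where "W1p_energy \<Omega> p (\<lambda>x. rep_L2 (w n) x - rep_L2 u x) < e" by (auto simp: eventually_sequentially)
    then show "\<exists>v\<in>W01p \<Omega> p. W1p_energy \<Omega> p (\<lambda>x. v x - rep_L2 u x) < e" using W[OF wC] by blast
  qed
  then show thesis using that wC conv by blast
qed

end

section \<open>The functional on square integrable functions\<close>

lemma rep_zero_L2: "AE x in lebesgue. rep_L2 0 x = 0"
  using rep_abs_L2[OF square_integrable_zero] by (simp add: zero_L2_def)

lemma subspace_L2_on: "subspace (L2_on \<Omega> :: ('a::euclidean_space, 'b::euclidean_space) L2 set)"
  unfolding subspace_def
proof (intro conjI ballI allI)
  show "(0 :: ('a, 'b) L2) \<in> L2_on \<Omega>"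
    unfolding L2_on_def using rep_zero_L2[where ?'a = 'a and ?'b = 'b] by (auto elim: eventually_mono)
next
  fix u v :: "('a, 'b) L2"
  assume "u \<in> L2_on \<Omega>" "v \<in> L2_on \<Omega>"
  then have "AE x in lebesgue. x \<notin> \<Omega> \<longrightarrow> rep_L2 u x = 0" "AE x in lebesgue. x \<notin> \<Omega> \<longrightarrow> rep_L2 v x = 0"
    by (auto simp: L2_on_def)
  then have "AE x in lebesgue. x \<notin> \<Omega> \<longrightarrow> rep_L2 (u + v) x = 0"
    using rep_add_L2[of u v] by eventually_elim simp
  then show "u + v \<in> L2_on \<Omega>" by (simp add: L2_on_def)
next
  fix c :: real and u :: "('a, 'b) L2"
  assume "u \<in> L2_on \<Omega>"
  then have "AE x in lebesgue. x \<notin> \<Omega> \<longrightarrow> rep_L2 u x = 0" by (simp add: L2_on_def)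
  then have "AE x in lebesgue. x \<notin> \<Omega> \<longrightarrow> rep_L2 (c *\<^sub>R u) x = 0"
    using rep_scaleR_L2[of c u] by eventually_elim simp
  then show "c *\<^sub>R u \<in> L2_on \<Omega>" by (simp add: L2_on_def)
qed

text \<open>On the complement of \<open>\<Omega>\<close> the members of the sequence vanish, so
  their distance to the limit there is the constant energy of the limit, and it tends to 0.\<close>

lemma closed_L2_on:
  assumes \<Omega>: "\<Omega> \<in> sets lebesgue"
  shows "closed (L2_on \<Omega> :: ('a::euclidean_space, 'b::euclidean_space) L2 set)"
  unfolding closed_sequential_limits
proof (intro allI impI, elim conjE)
  fix w :: "nat \<Rightarrow> ('a, 'b) L2" and u assume w: "\<forall>n. w n \<in> L2_on \<Omega>" and lim: "w \<longlonglongrightarrow> u"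
  have c: "- \<Omega> \<in> sets lebesgue" using \<Omega> by (simp add: Compl_in_sets_lebesgue)
  note L = L2_convergence_on[OF c lim]
  have uL: "rep_L2 u \<in> Lp (- \<Omega>) 2" by (rule L(1))
  have ui: "integrable lebesgue (\<lambda>x. indicator (- \<Omega>) x *\<^sub>R norm (rep_L2 u x) powr 2)"
    using uL by (simp add: Lp_def set_integrable_def)
  have "Lp_energy (- \<Omega>) 2 (\<lambda>x. rep_L2 (w n) x - rep_L2 u x) = Lp_energy (- \<Omega>) 2 (rep_L2 u)" for n
    unfolding Lp_energy_def set_lebesgue_integral_def
  proof (rule integral_cong_AE)
    have "AE x in lebesgue. x \<notin> \<Omega> \<longrightarrow> rep_L2 (w n) x = 0" using w by (simp add: L2_on_def)
    then show "AE x in lebesgue. indicator (- \<Omega>) x *\<^sub>R norm (rep_L2 (w n) x - rep_L2 u x) powr 2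
        = indicator (- \<Omega>) x *\<^sub>R norm (rep_L2 u x) powr 2"
      by eventually_elim (auto simp: indicator_def)
    show "(\<lambda>x. indicator (- \<Omega>) x *\<^sub>R norm (rep_L2 (w n) x - rep_L2 u x) powr 2) \<in> borel_measurable lebesgue"
      using c by measurable
  qed (use ui in auto)
  then have "Lp_energy (- \<Omega>) 2 (rep_L2 u) = 0" using L(2) by (simp add: LIMSEQ_const_iff)
  then have "AE x in lebesgue. indicator (- \<Omega>) x *\<^sub>R norm (rep_L2 u x) powr 2 = 0"
    unfolding Lp_energy_def set_lebesgue_integral_def using ui by (subst (asm) integral_nonneg_eq_0_iff_AE) auto
  then show "u \<in> L2_on \<Omega>" unfolding L2_on_def by (auto elim!: eventually_mono simp: indicator_def split: if_splits)
qed

locale sobolev_functional = bounded_open \<Omega> p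
  for \<Omega> :: "'a::euclidean_space set" and p :: real +
  fixes F :: "('a \<Rightarrow> 'b::euclidean_space) \<Rightarrow> ereal"
  assumes p_gt_1: "1 < p" and functional: "W0_functional \<Omega> p F" and F0: "F (\<lambda>x. 0) < \<infinity>"
    and coercive: "W0_coercive \<Omega> p F" and lsc_F: "W0_lsc \<Omega> p F" and convex_F: "L2_W0_convex \<Omega> p F"
begin

text \<open>\<open>real_of_ereal\<close> sends infinity to 0, so \<open>\<phi>\<close> carries
  meaning on \<open>D\<close> only, where \<open>F_eq\<close> recovers \<open>F\<close>.\<close>

definition \<phi> :: "('a, 'b) L2 \<Rightarrow> real" where "\<phi> u = real_of_ereal (F (rep_L2 u))"

abbreviation D :: "('a, 'b) L2 set" where "D \<equiv> dom_F \<Omega> p F"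

lemma D_iff: "u \<in> D \<longleftrightarrow> u \<in> L2_on \<Omega> \<and> rep_L2 u \<in> W01p \<Omega> p \<and> F (rep_L2 u) < \<infinity>"
  by (simp add: dom_F_def)

lemma F_eq: "u \<in> D \<Longrightarrow> F (rep_L2 u) = ereal (\<phi> u)"
proof -
  assume "u \<in> D"
  then have "F (rep_L2 u) \<noteq> - \<infinity>" "F (rep_L2 u) < \<infinity>"
    using functional unfolding D_iff W0_functional_def by blast+
  then show ?thesis by (cases "F (rep_L2 u)") (simp_all add: \<phi>_def)
qed

lemma F_cong:
  "v \<in> W01p \<Omega> p \<Longrightarrow> w \<in> W01p \<Omega> p \<Longrightarrow> AE x\<in>\<Omega> in lebesgue. v x = w x \<Longrightarrow> F v = F w"
  using functional unfolding W0_functional_def by blast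

lemma rep_Lp2: "rep_L2 (u :: ('a, 'b) L2) \<in> Lp \<Omega> 2"
  by (rule L2_convergence_on(1)[OF sets_\<Omega> tendsto_const])

text \<open>The representative of 0 vanishes only almost everywhere, so the assumption on
  \<open>F (\<lambda>x. 0)\<close> is carried over by the invariance of \<open>F\<close> under
  changes on null sets. \<open>convex_combination\<close> treats sums in the same way.\<close>

lemma zero_D: "0 \<in> D"
proof -
  have eq: "AE x\<in>\<Omega> in lebesgue. (0::'b) = rep_L2 0 x"
    using rep_zero_L2[where ?'a = 'a and ?'b = 'b] by eventually_elim simp
  have w: "rep_L2 (0 :: ('a, 'b) L2) \<in> W01p \<Omega> p" by (rule W01p_cong_AE[OF W01p_zero eq])
  have "F (\<lambda>x. 0) = F (rep_L2 0)" by (rule F_cong[OF W01p_zero w eq])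
  then show ?thesis using w F0 subspace_0[OF subspace_L2_on] by (simp add: D_iff)
qed

lemma convex_combination:
  assumes u: "u \<in> D" and v: "v \<in> D" and c: "0 < c" "c < 1"
  shows "(1 - c) *\<^sub>R u + c *\<^sub>R v \<in> D" "\<phi> ((1 - c) *\<^sub>R u + c *\<^sub>R v) \<le> (1 - c) * \<phi> u + c * \<phi> v"
proof -
  let ?w = "(1 - c) *\<^sub>R u + c *\<^sub>R v" and ?f = "\<lambda>x. (1 - c) *\<^sub>R rep_L2 u x + c *\<^sub>R rep_L2 v x"
  have eq: "AE x\<in>\<Omega> in lebesgue. ?f x = rep_L2 ?w x"
    using rep_add_L2[of "(1 - c) *\<^sub>R u" "c *\<^sub>R v"] rep_scaleR_L2[of "1 - c" u] rep_scaleR_L2[of c v]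
    by eventually_elim simp
  have f: "?f \<in> W01p \<Omega> p" using u v by (intro W01p_add W01p_scaleR) (auto simp: D_iff)
  have w: "rep_L2 ?w \<in> W01p \<Omega> p" by (rule W01p_cong_AE[OF f eq])
  have "F (rep_L2 ?w) = F ?f" by (rule F_cong[OF f w eq, symmetric])
  also have "\<dots> \<le> ereal (1 - c) * F (rep_L2 u) + ereal c * F (rep_L2 v)"
    using convex_F u v c rep_Lp2 by (auto simp: L2_W0_convex_def D_iff)
  also have "\<dots> = ereal ((1 - c) * \<phi> u + c * \<phi> v)" using F_eq[OF u] F_eq[OF v] by simp
  finally have le: "F (rep_L2 ?w) \<le> ereal ((1 - c) * \<phi> u + c * \<phi> v)" .
  have "?w \<in> L2_on \<Omega>" using u v by (intro subspace_add subspace_scale subspace_L2_on) (auto simp: D_iff)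
  then show wD: "?w \<in> D" using w le by (auto simp: D_iff intro: le_less_trans)
  show "\<phi> ?w \<le> (1 - c) * \<phi> u + c * \<phi> v" using le F_eq[OF wD] by simp
qed

text \<open>Coercivity bounds the Sobolev energy on the convex sublevel set \<open>C\<close>. So
  \<open>u\<close> is a limit in the Sobolev norm of elements \<open>v n\<close> of
  \<open>C\<close>, which may differ from the given \<open>w k\<close>, and to these the assumed
  lower semicontinuity applies.\<close>

lemma sublevel_closed:
  assumes w: "\<And>k. w k \<in> D" and M: "\<And>k. \<phi> (w k) \<le> M" and lim: "w \<longlonglongrightarrow> u"
  shows "u \<in> D \<and> \<phi> u \<le> M"
proof -
  define C where "C = {v \<in> D. \<phi> v \<le> M}"
  have conv: "convex C"
  proof (rule convexI)
    fix x y :: "('a, 'b) L2" and a b :: real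
    assume xy: "x \<in> C" "y \<in> C" and ab: "0 \<le> a" "0 \<le> b" "a + b = 1"
    consider "b = 0" | "b = 1" | "0 < b" "b < 1" using ab by linarith
    then show "a *\<^sub>R x + b *\<^sub>R y \<in> C"
    proof cases
      case 3
      have a: "a = 1 - b" using ab by simp
      note cc = convex_combination[of x y b, OF _ _ 3]
      have "\<phi> ((1 - b) *\<^sub>R x + b *\<^sub>R y) \<le> (1 - b) * \<phi> x + b * \<phi> y" using cc(2) xy by (simp add: C_def)
      also have "\<dots> \<le> (1 - b) * M + b * M" using xy 3 by (intro add_mono mult_left_mono) (auto simp: C_def)
      also have "\<dots> = M" by (simp add: algebra_simps)
      finally show ?thesis using cc(1) xy unfolding a by (simp add: C_def)
    qed (use ab xy in auto)
  qed
  have W: "rep_L2 v \<in> W01p \<Omega> p" if "v \<in> C" for v using that by (simp add: C_def D_iff)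
  \<comment> \<open>The level \<open>M + 1\<close> contradicts \<open>\<phi> v \<le> M\<close>, so
    on \<open>C\<close> the norm is strictly below \<open>R\<close>.\<close>
  obtain R where R: "\<And>v. v \<in> W01p \<Omega> p \<Longrightarrow> W1p_norm \<Omega> p v \<ge> R \<Longrightarrow> F v \<ge> ereal (M + 1)"
    using coercive unfolding W0_coercive_def by blast
  have bound: "W1p_energy \<Omega> p (rep_L2 v) \<le> \<bar>R\<bar> powr p" if v: "v \<in> C" for v
  proof -
    have "F (rep_L2 v) < ereal (M + 1)" using v F_eq[of v] by (auto simp: C_def)
    then have "W1p_norm \<Omega> p (rep_L2 v) < R" using R[OF W[OF v]] by (meson leD leI)
    then have "W1p_energy \<Omega> p (rep_L2 v) powr (1 / p) \<le> \<bar>R\<bar>" by (simp add: W1p_norm_energy)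
    then have "(W1p_energy \<Omega> p (rep_L2 v) powr (1 / p)) powr p \<le> \<bar>R\<bar> powr p"
      using p_gt_1 by (intro powr_mono2) auto
    then show ?thesis using p_gt_1 W1p_energy_nonneg[of \<Omega> p "rep_L2 v"] by (simp add: powr_powr)
  qed
  have "u \<in> closure C" unfolding closure_sequential using w M lim by (intro exI[of _ w]) (simp add: C_def)
  from closure_convex_energy_bounded[OF p_gt_1 conv W bound this]
  obtain v where v: "\<And>n::nat. v n \<in> C" "rep_L2 u \<in> W01p \<Omega> p"
    "(\<lambda>n. W1p_energy \<Omega> p (\<lambda>x. rep_L2 (v n) x - rep_L2 u x)) \<longlonglongrightarrow> 0" by blast
  have "F (rep_L2 u) \<le> liminf (\<lambda>n. F (rep_L2 (v n)))"
    using lsc_F v W W1p_norm_tendsto_0_iff[of p \<Omega> "\<lambda>n x. rep_L2 (v n) x - rep_L2 u x"] p_gt_1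
    by (auto simp: W0_lsc_def)
  also have "\<dots> \<le> ereal M"
  proof (rule Liminf_le)
    have "F (rep_L2 (v n)) \<le> ereal M" for n using v(1)[of n] F_eq[of "v n"] by (simp add: C_def)
    then show "\<forall>\<^sub>F n in sequentially. F (rep_L2 (v n)) \<le> ereal M" by simp
  qed simp
  finally have le: "F (rep_L2 u) \<le> ereal M" .
  have "u \<in> L2_on \<Omega>"
    by (rule closed_sequentially[OF closed_L2_on[OF sets_\<Omega>] _ lim]) (use w in \<open>simp add: D_iff\<close>)
  then have uD: "u \<in> D" using v(2) le by (auto simp: D_iff intro: le_less_trans)
  then show ?thesis using le F_eq[OF uD] by simp
qed

sublocale convex_functional "L2_on \<Omega>" D \<phi>
proof
  show "subspace (L2_on \<Omega> :: ('a, 'b) L2 set)" by (rule subspace_L2_on)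
  show "closed (L2_on \<Omega> :: ('a, 'b) L2 set)" by (rule closed_L2_on[OF sets_\<Omega>])
  show "D \<subseteq> L2_on \<Omega>" by (auto simp: D_iff)
  show "D \<noteq> {}" using zero_D by blast
qed (rule convex_combination sublevel_closed; assumption)+

lemma subdiff_eq: "u \<in> D \<Longrightarrow> subdiff \<Omega> p F u = sub u"
  unfolding subdiff_def sub_def using F_eq by auto

lemma dom_subdiff_eq: "dom_subdiff \<Omega> p F = domA"
  unfolding dom_subdiff_def domA_def using subdiff_eq by auto

lemma is_arg_min_A0:
  assumes u: "u \<in> domA"
  shows "is_arg_min norm (\<lambda>z. z \<in> subdiff \<Omega> p F u) z \<longleftrightarrow> z = A0 u"
proof
  assume "is_arg_min norm (\<lambda>z. z \<in> subdiff \<Omega> p F u) z"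
  then have "z \<in> sub u" "norm z \<le> norm (A0 u)"
    using A0(2)[OF u] unfolding is_arg_min_linorder subdiff_eq[OF domA_D[OF u]] by auto
  then show "z = A0 u" by (rule A0_unique[OF u])
next
  assume "z = A0 u"
  then show "is_arg_min norm (\<lambda>z. z \<in> subdiff \<Omega> p F u) z"
    unfolding is_arg_min_linorder subdiff_eq[OF domA_D[OF u]] using A0(2,3)[OF u] by auto
qed

lemma min_section_eq: "u \<in> domA \<Longrightarrow> min_section \<Omega> p F u = A0 u"
proof -
  assume u: "u \<in> domA"
  have "is_arg_min norm (\<lambda>z. z \<in> subdiff \<Omega> p F u) = (\<lambda>z. z = A0 u)"
    by (rule ext) (rule is_arg_min_A0[OF u])
  then show ?thesis unfolding min_section_def arg_min_def by simp
qed

lemma subdiff_properties: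
  assumes "w \<in> dom_subdiff \<Omega> p F"
  shows "closed (subdiff \<Omega> p F w)" "convex (subdiff \<Omega> p F w)"
    "\<exists>!z. is_arg_min norm (\<lambda>z. z \<in> subdiff \<Omega> p F w) z"
proof -
  have w: "w \<in> domA" using assms by (simp add: dom_subdiff_eq)
  then show "closed (subdiff \<Omega> p F w)" "convex (subdiff \<Omega> p F w)"
    by (simp_all add: subdiff_eq[OF domA_D] closed_sub convex_sub)
  show "\<exists>!z. is_arg_min norm (\<lambda>z. z \<in> subdiff \<Omega> p F w) z"
    unfolding is_arg_min_A0[OF w] by simp
qed

section \<open>The gradient flow\<close>

lemma Linf_AE_bound:
  fixes f :: "real \<Rightarrow> 'c::{banach, second_countable_topology}"
  assumes "f \<in> Linf S" "S \<in> sets lebesgue"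
  obtains L where "0 \<le> L" "AE t\<in>S in lebesgue. norm (f t) \<le> L"
proof -
  have "Linf_norm S f < \<infinity>" using assms(1) by (simp add: Linf_def)
  then obtain L where L: "Linf_norm S f \<le> ereal L" by (cases "Linf_norm S f") auto
  have "AE t in lebesgue_on S. ereal (norm (f t)) \<le> Linf_norm S f"
    unfolding Linf_norm_def by (rule esssup_AE)
  then have "AE t\<in>S in lebesgue. ereal (norm (f t)) \<le> Linf_norm S f"
    using assms(2) by (simp add: AE_restrict_space_iff)
  then have "AE t\<in>S in lebesgue. norm (f t) \<le> \<bar>L\<bar>"
  proof eventually_elim
    case (elim t)
    show ?case
    proof
      assume "t \<in> S"
      with elim L have "ereal (norm (f t)) \<le> ereal L" by (meson order_trans)
      then show "norm (f t) \<le> \<bar>L\<bar>" by simp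
    qed
  qed
  then show thesis using that[of "\<bar>L\<bar>"] by simp
qed

text \<open>The difference \<open>w\<close> of two solutions is Lipschitz away from 0, by the bounds
  on the weak derivatives. The increment of its squared norm over \<open>[a, b]\<close> is the
  integral of its derivative against \<open>w a + w b\<close>. Replacing both values by
  \<open>w x\<close> costs an error quadratic in \<open>b - a\<close>, and the remaining term is
  nonpositive by monotonicity of the subdifferential.\<close>

lemma solution_unique:
  assumes u: "is_solution \<Omega> p F u0 u" and v: "is_solution \<Omega> p F u0 v" and t: "0 \<le> t"
  shows "v t = u t"
proof -
  let ?gu = "time_deriv u" and ?gv = "time_deriv v"
  have cu: "continuous_on {0..} u" and cv: "continuous_on {0..} v" using u v by (auto simp: is_solution_def)
  have wu: "is_weak_deriv {0<..} 1 u ?gu" and wv: "is_weak_deriv {0<..} 1 v ?gv"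
    using u v weak_deriv_is_weak_deriv by (auto simp: is_solution_def)
  have cu': "continuous_on {0<..} u" and cv': "continuous_on {0<..} v"
    by (rule continuous_on_subset[OF cu], force) (rule continuous_on_subset[OF cv], force)
  have du: "\<And>t. t > 0 \<Longrightarrow> u t \<in> D" and dv: "\<And>t. t > 0 \<Longrightarrow> v t \<in> D"
    using u v by (auto simp: is_solution_def dom_subdiff_def)
  define w where "w t = u t - v t" for t
  have mono: "AE t\<in>{0<..} in lebesgue. (?gu t - ?gv t) \<bullet> w t \<le> 0"
  proof -
    have "AE t\<in>{0<..} in lebesgue. - ?gu t \<in> subdiff \<Omega> p F (u t)" "AE t\<in>{0<..} in lebesgue. - ?gv t \<in> subdiff \<Omega> p F (v t)"
      using u v by (auto simp: is_solution_def)
    then show ?thesis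
    proof eventually_elim
      case (elim t)
      show ?case
      proof
        assume t: "t \<in> {0<..}"
        then have "0 \<le> (- ?gu t - - ?gv t) \<bullet> (u t - v t)"
          using elim du[of t] dv[of t] by (intro sub_monotone) (auto simp: subdiff_eq)
        then show "(?gu t - ?gv t) \<bullet> w t \<le> 0" by (simp add: w_def inner_diff_left)
      qed
    qed
  qed
  have dec: "norm (w t) \<le> norm (w s)" if st: "0 < s" "s \<le> t" for s t
  proof -
    have lin: "?gu \<in> Linf {s/2<..}" "?gv \<in> Linf {s/2<..}" using u v st by (auto simp: is_solution_def)
    obtain L1 where L1: "0 \<le> L1" "AE t\<in>{s/2<..} in lebesgue. norm (?gu t) \<le> L1" using Linf_AE_bound[OF lin(1)] by auto
    obtain L2 where L2: "0 \<le> L2" "AE t\<in>{s/2<..} in lebesgue. norm (?gv t) \<le> L2" using Linf_AE_bound[OF lin(2)] by auto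
    define B where "B = L1 + L2"
    have B: "0 \<le> B" "AE t\<in>{s/2<..} in lebesgue. norm (?gu t - ?gv t) \<le> B"
    proof -
      show "0 \<le> B" using L1 L2 by (simp add: B_def)
      show "AE t\<in>{s/2<..} in lebesgue. norm (?gu t - ?gv t) \<le> B"
        using L1(2) L2(2)
      proof eventually_elim
        case (elim t)
        then show ?case unfolding B_def using norm_triangle_ineq4[of "?gu t" "?gv t"] by (auto intro: order_trans add_mono)
      qed
    qed
    have int: "set_integrable lebesgue {a<..<b} (\<lambda>x. ?gu x - ?gv x)" "w b - w a = (LINT x:{a<..<b}|lebesgue. ?gu x - ?gv x)"
      if "0 < a" "a < b" for a b
    proof -
      note iu = weak_deriv_integral[OF cu' wu that] and iv = weak_deriv_integral[OF cv' wv that]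
      show "set_integrable lebesgue {a<..<b} (\<lambda>x. ?gu x - ?gv x)" by (rule set_integral_diff(1)[OF iu(1) iv(1)])
      show "w b - w a = (LINT x:{a<..<b}|lebesgue. ?gu x - ?gv x)"
        unfolding set_integral_diff(2)[OF iu(1) iv(1)] iu(2)[symmetric] iv(2)[symmetric] by (simp add: w_def)
    qed
    have const: "set_integrable lebesgue {a<..<b} (\<lambda>_. c)" "(LINT x:{a<..<b}|lebesgue. c) = (b - a) * c" if "a < b" for a b c :: real
      using that by (auto simp: set_integrable_def set_lebesgue_integral_def)
    have lip: "norm (w b - w a) \<le> B * (b - a)" if ab: "s \<le> a" "a \<le> b" for a b
    proof (cases "a = b")
      case False
      then have ab': "0 < a" "a < b" using ab st by auto
      have "norm (w b - w a) \<le> (LINT x:{a<..<b}|lebesgue. norm (?gu x - ?gv x))"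
        unfolding int(2)[OF ab'] by (rule set_integral_norm_bound[OF int(1)[OF ab']])
      also have "\<dots> \<le> (LINT x:{a<..<b}|lebesgue. B)"
      proof (rule set_integral_mono_AE[OF set_integrable_norm[OF int(1)[OF ab']] const(1)[OF ab'(2)]])
        show "AE x\<in>{a<..<b} in lebesgue. norm (?gu x - ?gv x) \<le> B" using B(2) by eventually_elim (use ab st in auto)
      qed
      also have "\<dots> = B * (b - a)" using const(2)[OF ab'(2)] by simp
      finally show ?thesis .
    qed simp
    have "(norm (w t))\<^sup>2 \<le> (norm (w s))\<^sup>2"
    \<comment> \<open>With this linear \<open>G\<close> the increment over \<open>[a, b]\<close> is
      allowed to be as large as \<open>2 * B * B * (b - a)\<^sup>2\<close>.\<close>
    proof (rule le_if_increments_le[OF st(2), where G = "\<lambda>t. - (2 * B * B) * t"])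
      fix a b assume ab: "s \<le> a" "a < b" "b \<le> t"
      have ab': "0 < a" "a < b" using ab st by auto
      have "(norm (w b))\<^sup>2 - (norm (w a))\<^sup>2 = (w b - w a) \<bullet> (w b + w a)"
        by (simp add: power2_norm_eq_inner algebra_simps inner_commute)
      also have "\<dots> = (LINT x:{a<..<b}|lebesgue. (?gu x - ?gv x) \<bullet> (w b + w a))"
        unfolding int(2)[OF ab'] set_lebesgue_integral_def using int(1)[OF ab']
        by (subst integral_inner_left[symmetric]) (auto simp: set_integrable_def)
      also have "\<dots> \<le> (LINT x:{a<..<b}|lebesgue. 2 * B * (B * (b - a)))"
      proof (rule set_integral_mono_AE[OF _ const(1)[OF ab'(2)]])
        have "integrable lebesgue (\<lambda>x. (indicator {a<..<b} x *\<^sub>R (?gu x - ?gv x)) \<bullet> (w b + w a))"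
          using int(1)[OF ab'] by (intro integrable_inner_left) (simp add: set_integrable_def)
        then show "set_integrable lebesgue {a<..<b} (\<lambda>x. (?gu x - ?gv x) \<bullet> (w b + w a))" by (simp add: set_integrable_def)
        show "AE x\<in>{a<..<b} in lebesgue. (?gu x - ?gv x) \<bullet> (w b + w a) \<le> 2 * B * (B * (b - a))"
          using B(2) mono
        proof eventually_elim
          case (elim x)
          show ?case
          proof
            assume x: "x \<in> {a<..<b}"
            let ?z = "?gu x - ?gv x"
            have z: "norm ?z \<le> B" "?z \<bullet> w x \<le> 0" using elim x ab st by auto
            have "norm (w b - w x) \<le> B * (b - x)" "norm (w x - w a) \<le> B * (x - a)" using lip[of x b] lip[of a x] x ab by auto
            moreover have "B * (b - x) \<le> B * (b - a)" "B * (x - a) \<le> B * (b - a)" using x B(1) by (auto intro!: mult_left_mono)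
            ultimately have n: "norm (w b - w x) \<le> B * (b - a)" "norm (w a - w x) \<le> B * (b - a)"
              by (auto simp: norm_minus_commute)
            have "?z \<bullet> (w b - w x) \<le> B * (B * (b - a))" "?z \<bullet> (w a - w x) \<le> B * (B * (b - a))"
              using norm_cauchy_schwarz[of ?z "w b - w x"] norm_cauchy_schwarz[of ?z "w a - w x"]
                mult_mono[OF z(1) n(1) B(1) norm_ge_zero] mult_mono[OF z(1) n(2) B(1) norm_ge_zero] by linarith+
            \<comment> \<open>The first two terms are of order \<open>b - a\<close> by the Lipschitz
              bound, the last one is nonpositive by \<open>mono\<close>.\<close>
            moreover have "?z \<bullet> (w b + w a) = ?z \<bullet> (w b - w x) + ?z \<bullet> (w a - w x) + 2 * (?z \<bullet> w x)"
              by (simp add: inner_add_right inner_diff_right)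
            ultimately show "?z \<bullet> (w b + w a) \<le> 2 * B * (B * (b - a))" using z(2) by simp
          qed
        qed
      qed
      also have "\<dots> = (b - a) * (2 * B * (B * (b - a)))" by (rule const(2)[OF ab'(2)])
      also have "\<dots> = (b - a) * (- (2 * B * B) * a - - (2 * B * B) * b)" by (simp add: algebra_simps)
      finally show "(norm (w b))\<^sup>2 - (norm (w a))\<^sup>2 \<le> (b - a) * (- (2 * B * B) * a - - (2 * B * B) * b)" .
    qed
    then show ?thesis by (simp add: power2_le_iff_abs_le)
  qed
  have "w t = 0"
  proof (cases "t = 0")
    case True
    then show ?thesis using u v by (simp add: w_def is_solution_def)
  next
    case False
    then have t: "0 < t" using t by simp
    let ?r = "\<lambda>n. t * inverse (real (Suc n))"
    have r: "0 < ?r n" "?r n \<le> t" for n using t by (auto simp: field_simps)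
    have rl: "?r \<longlonglongrightarrow> 0" using tendsto_mult[OF tendsto_const LIMSEQ_inverse_real_of_nat, of t] by simp
    have cw: "continuous_on {0..} w" unfolding w_def by (intro continuous_intros cu cv)
    have "(\<lambda>n. w (?r n)) \<longlonglongrightarrow> w 0"
      by (rule continuous_on_tendsto_compose[OF cw rl]) (use r(1) in \<open>auto simp: less_imp_le\<close>)
    then have "(\<lambda>n. norm (w (?r n))) \<longlonglongrightarrow> norm (w 0)" by (rule tendsto_norm)
    then have "norm (w t) \<le> norm (w 0)"
      by (rule LIMSEQ_le_const) (use dec[OF r] in auto)
    also have "w 0 = 0" using u v by (simp add: w_def is_solution_def)
    finally show ?thesis by simp
  qed
  then show ?thesis by (simp add: w_def)
qed

section \<open>Flows of the evolution inequality are solutions\<close>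

text \<open>The right derivative \<open>- A0 (u t)\<close> exists at every \<open>t > 0\<close>; it
  is therefore a weak derivative, and the chosen \<open>time_deriv\<close> agrees with it almost
  everywhere.\<close>

lemma evi_time_deriv:
  assumes u: "evi u"
  shows "is_weak_deriv {0<..} 1 u (\<lambda>t. - A0 (u t))" "AE t\<in>{0<..} in lebesgue. - A0 (u t) = time_deriv u t"
    "set_borel_measurable lebesgue {0<..} (\<lambda>t. A0 (u t))"
proof -
  let ?h = "\<lambda>n. inverse (real (Suc n))"
  have lip: "\<exists>L. \<forall>s\<in>{\<delta>..M}. \<forall>t\<in>{\<delta>..M}. norm (u t - u s) \<le> L * \<bar>t - s\<bar>" if "\<delta> > 0" for \<delta> M
    using evi_lipschitz[OF u less_imp_le[OF that] evi_domA[OF u that]]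
    by (intro exI[of _ "norm (A0 (u \<delta>))"] ballI) auto
  have d: "(\<lambda>n. (1 / ?h n) *\<^sub>R (u (t + ?h n) - u t)) \<longlonglongrightarrow> - A0 (u t)" if "t > 0" for t
    by (rule evi_right_derivative[OF u less_imp_le[OF that] evi_domA[OF u that] LIMSEQ_inverse_real_of_nat]) simp
  note * = is_weak_deriv_right_derivative[of "{0<..}", OF open_greaterThan subset_refl lip d]
  show w: "is_weak_deriv {0<..} 1 u (\<lambda>t. - A0 (u t))" by (rule *(1))
  have "AE t\<in>{0<..} in lebesgue. time_deriv u t = - A0 (u t)"
    by (rule weak_deriv_AE[OF _ _ w]) auto
  then show "AE t\<in>{0<..} in lebesgue. - A0 (u t) = time_deriv u t" by eventually_elim auto
  have "set_borel_measurable lebesgue {0<..} (\<lambda>t. - A0 (u t))" by (rule *(3))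
  then show "set_borel_measurable lebesgue {0<..} (\<lambda>t. A0 (u t))" by (simp add: set_borel_measurable_def)
qed

text \<open>The norm of \<open>A0 (u t)\<close> does not increase in time. The case
  \<open>a = 0\<close> is included for initial values in \<open>domA\<close>.\<close>

lemma evi_Linf:
  assumes u: "evi u" and a: "0 \<le> a" "u a \<in> domA"
  shows "Linf_norm {a<..} (time_deriv u) \<le> ereal (norm (A0 (u a)))" "time_deriv u \<in> Linf {a<..}"
proof -
  have m: "set_borel_measurable lebesgue {a<..} (time_deriv u)"
  proof -
    have "set_borel_measurable lebesgue {0<..} (\<lambda>t. - A0 (u t))"
      using evi_time_deriv(3)[OF u] by (simp add: set_borel_measurable_def)
    from set_borel_measurable_cong_AE[OF this evi_time_deriv(2)[OF u]]
    show ?thesis by (rule set_borel_measurable_subset) (use a in auto)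
  qed
  have m': "time_deriv u \<in> borel_measurable (lebesgue_on {a<..})"
    using m by (simp add: set_borel_measurable_def borel_measurable_restrict_space_iff)
  have "AE t\<in>{a<..} in lebesgue. ereal (norm (time_deriv u t)) \<le> ereal (norm (A0 (u a)))"
    using evi_time_deriv(2)[OF u]
  proof eventually_elim
    case (elim t)
    show ?case
    proof
      assume t: "t \<in> {a<..}"
      then have "time_deriv u t = - A0 (u t)" using elim a by auto
      then show "ereal (norm (time_deriv u t)) \<le> ereal (norm (A0 (u a)))"
        using evi_A0_antimono(2)[OF u a(1) _ a(2), of t] t by simp
    qed
  qed
  then have "AE t in lebesgue_on {a<..}. ereal (norm (time_deriv u t)) \<le> ereal (norm (A0 (u a)))"
    by (simp add: AE_restrict_space_iff)
  then show le: "Linf_norm {a<..} (time_deriv u) \<le> ereal (norm (A0 (u a)))"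
    unfolding Linf_norm_def using m' by (intro esssup_I) auto
  then show "time_deriv u \<in> Linf {a<..}" using m by (auto simp: Linf_def intro: le_less_trans)
qed

lemma evi_is_solution:
  assumes u: "evi u" and u0: "u 0 = u0" "u0 \<in> closure D"
  shows "is_solution \<Omega> p F u0 u"
  unfolding is_solution_def
proof (intro conjI allI impI)
  show "continuous_on {0..} u" by (rule evi_cont[OF u])
  have "closure D \<subseteq> L2_on \<Omega>" using D_subset closed_X by (rule closure_minimal)
  then show "u t \<in> L2_on \<Omega>" if "0 \<le> t" for t
    using that evi_D[OF u, of t] D_subset u0 by (cases "t = 0") auto
  show "\<exists>g. is_weak_deriv {0<..} 1 u g" using evi_time_deriv(1)[OF u] by blast
  show "time_deriv u \<in> Linf {\<delta><..}" if "0 < \<delta>" for \<delta>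
    using evi_Linf(2)[OF u less_imp_le[OF that] evi_domA[OF u that]] .
  show "u t \<in> dom_subdiff \<Omega> p F" if "0 < t" for t
    unfolding dom_subdiff_eq using evi_domA[OF u that] .
  show "AE t\<in>{0<..} in lebesgue. - time_deriv u t \<in> subdiff \<Omega> p F (u t)"
    using evi_time_deriv(2)[OF u]
  proof eventually_elim
    case (elim t)
    show ?case
    proof
      assume t: "t \<in> {0<..}"
      then have "- time_deriv u t = A0 (u t)" using elim by (metis minus_minus)
      then show "- time_deriv u t \<in> subdiff \<Omega> p F (u t)"
        using t A0(2)[OF evi_domA[OF u, of t]] subdiff_eq[OF evi_D[OF u, of t]] by simp
    qed
  qed
  show "u 0 = u0" by (rule u0)
qed

end

section \<open>Integrability of the energy and its derivative\<close>

text \<open>Fatou's lemma along intervals that exhaust \<open>(0, T)\<close>, with uniformly bounded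
  integrals.\<close>

lemma set_integrable_Ioo_exhaustion:
  fixes g :: "real \<Rightarrow> real"
  assumes T: "0 < T" and m: "set_borel_measurable lebesgue {0<..<T} g"
    and nn: "\<And>t. 0 < t \<Longrightarrow> t < T \<Longrightarrow> 0 \<le> g t"
    and i: "\<And>\<delta>. 0 < \<delta> \<Longrightarrow> \<delta> < T \<Longrightarrow> set_integrable lebesgue {\<delta><..<T} g"
    and B: "\<And>\<delta>. 0 < \<delta> \<Longrightarrow> \<delta> < T \<Longrightarrow> (LINT t:{\<delta><..<T}|lebesgue. g t) \<le> B"
  shows "set_integrable lebesgue {0<..<T} g"
proof -
  \<comment> \<open>Two successors, so that already \<open>r 0\<close> is less than
    \<open>T\<close>.\<close>
  define r where "r n = T * inverse (real (Suc (Suc n)))" for n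
  have r: "0 < r n" "r n < T" for n using T by (auto simp: r_def field_simps intro!: add_pos_nonneg)
  have rl: "r \<longlonglongrightarrow> 0"
    using tendsto_mult[OF tendsto_const LIMSEQ_Suc[OF LIMSEQ_inverse_real_of_nat], of T] by (simp add: r_def[abs_def])
  let ?f = "\<lambda>n t. indicator {r n<..<T} t *\<^sub>R g t" and ?G = "\<lambda>t. indicator {0<..<T} t *\<^sub>R g t"
  have fi: "integrable lebesgue (?f n)" for n using i[OF r] by (simp add: set_integrable_def)
  have fn: "0 \<le> ?f n t" for n t using nn[of t] r(1)[of n] by (auto simp: indicator_def)
  have lim: "(\<lambda>n. ?f n t) \<longlonglongrightarrow> ?G t" for t
  proof (cases "0 < t \<and> t < T")
    case True
    then have "\<forall>\<^sub>F n in sequentially. r n < t" by (intro order_tendstoD(2)[OF rl]) simp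
    then have "\<forall>\<^sub>F n in sequentially. ?f n t = ?G t" by eventually_elim (use True in auto)
    then show ?thesis by (rule tendsto_eventually)
  next
    case False
    then have "?f n t = ?G t" for n using r(1)[of n] by (auto simp: indicator_def)
    then show ?thesis by (simp only: tendsto_const)
  qed
  have "(\<integral>\<^sup>+t. ennreal (?G t) \<partial>lebesgue) = (\<integral>\<^sup>+t. liminf (\<lambda>n. ennreal (?f n t)) \<partial>lebesgue)"
    by (intro nn_integral_cong lim_imp_Liminf[symmetric] tendsto_ennrealI lim) simp
  also have "\<dots> \<le> liminf (\<lambda>n. \<integral>\<^sup>+t. ennreal (?f n t) \<partial>lebesgue)"
    using fi by (intro nn_integral_liminf) auto
  also have "\<dots> \<le> ennreal B"
  proof (rule Liminf_le)
    have "(\<integral>\<^sup>+t. ennreal (?f n t) \<partial>lebesgue) \<le> ennreal B" for n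
      using nn_integral_eq_integral[OF fi, of n] fn[of n] B[OF r, of n]
      by (simp add: set_lebesgue_integral_def ennreal_leI)
    then show "\<forall>\<^sub>F n in sequentially. (\<integral>\<^sup>+t. ennreal (?f n t) \<partial>lebesgue) \<le> ennreal B" by simp
  qed simp
  finally have "(\<integral>\<^sup>+t. ennreal (?G t) \<partial>lebesgue) < \<infinity>" by (rule le_less_trans) simp
  moreover have "0 \<le> ?G t" for t using nn[of t] by (auto simp: indicator_def)
  ultimately show ?thesis unfolding set_integrable_def
    using m by (intro integrableI_nonneg) (auto simp: set_borel_measurable_def)
qed

context sobolev_functional
begin

lemma evi_phi_weak_deriv:
  assumes u: "evi u" and S: "open S" "S \<subseteq> {0<..}"
  shows "is_weak_deriv S 1 (\<lambda>t. \<phi> (u t)) (\<lambda>t. - (norm (A0 (u t)))\<^sup>2)" "continuous_on {0<..} (\<lambda>t. \<phi> (u t))"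
proof -
  let ?h = "\<lambda>n. inverse (real (Suc n))"
  have lip: "\<exists>L. \<forall>s\<in>{\<delta>..M}. \<forall>t\<in>{\<delta>..M}. norm (\<phi> (u t) - \<phi> (u s)) \<le> L * \<bar>t - s\<bar>" if "\<delta> > 0" for \<delta> M
    using evi_phi_lipschitz[OF u less_imp_le[OF that] evi_domA[OF u that]]
    by (intro exI[of _ "(norm (A0 (u \<delta>)))\<^sup>2"] ballI) auto
  have d: "(\<lambda>n. (1 / ?h n) *\<^sub>R (\<phi> (u (t + ?h n)) - \<phi> (u t))) \<longlonglongrightarrow> - (norm (A0 (u t)))\<^sup>2" if "t > 0" for t
  proof -
    have "(\<lambda>n. (\<phi> (u (t + ?h n)) - \<phi> (u t)) / ?h n) \<longlonglongrightarrow> - (norm (A0 (u t)))\<^sup>2"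
      by (rule evi_phi_right_derivative[OF u less_imp_le[OF that] evi_domA[OF u that] LIMSEQ_inverse_real_of_nat]) simp
    moreover have "(1 / ?h n) *\<^sub>R (\<phi> (u (t + ?h n)) - \<phi> (u t)) = (\<phi> (u (t + ?h n)) - \<phi> (u t)) / ?h n" for n
      by (simp only: real_scaleR_def times_divide_eq_left mult_1)
    ultimately show ?thesis by (simp only:)
  qed
  note * = is_weak_deriv_right_derivative[OF S lip d]
  show "is_weak_deriv S 1 (\<lambda>t. \<phi> (u t)) (\<lambda>t. - (norm (A0 (u t)))\<^sup>2)" by (rule *(1))
  show "continuous_on {0<..} (\<lambda>t. \<phi> (u t))" by (rule *(2))
qed

lemma evi_bounded:
  assumes u: "evi u"
  obtains B where "0 \<le> B" "\<And>t. 0 \<le> t \<Longrightarrow> t \<le> T \<Longrightarrow> norm (u t) \<le> B"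
proof -
  have "compact (u ` {0..T})"
    by (intro compact_continuous_image continuous_on_subset[OF evi_cont[OF u]]) auto
  then obtain B where "\<forall>x\<in>u ` {0..T}. norm x \<le> B" using compact_imp_bounded bounded_iff by blast
  then have "norm (u t) \<le> \<bar>B\<bar>" if "0 \<le> t" "t \<le> T" for t
    using that by (meson abs_ge_self atLeastAtMost_iff imageI order_trans)
  then show thesis by (rule that[OF abs_ge_zero])
qed

text \<open>Exhibits \<open>- (A0 (u t) \<bullet> u t)\<close> as the derivative of a function that
  stays bounded near time 0. This primitive makes the energy estimate in \<open>evi_phi_Lp\<close>
  uniform there.\<close>

lemma evi_norm_weak_deriv:
  assumes u: "evi u"
  shows "is_weak_deriv {0<..} 1 (\<lambda>t. (norm (u t))\<^sup>2 / 2) (\<lambda>t. - (A0 (u t) \<bullet> u t))"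
    "continuous_on {0<..} (\<lambda>t. (norm (u t))\<^sup>2 / 2)"
proof -
  let ?h = "\<lambda>n. inverse (real (Suc n))" and ?\<Theta> = "\<lambda>t. (norm (u t))\<^sup>2 / 2"
  have diff: "?\<Theta> t - ?\<Theta> s = (u t - u s) \<bullet> ((1/2) *\<^sub>R (u t + u s))" for s t
    using half_square_diff[of "u t" 0 "u s"] by simp
  have lip: "\<exists>L. \<forall>s\<in>{\<delta>..M}. \<forall>t\<in>{\<delta>..M}. norm (?\<Theta> t - ?\<Theta> s) \<le> L * \<bar>t - s\<bar>" if \<delta>: "\<delta> > 0" for \<delta> M
  proof -
    obtain B where B: "0 \<le> B" "\<And>t. 0 \<le> t \<Longrightarrow> t \<le> M \<Longrightarrow> norm (u t) \<le> B" using evi_bounded[OF u] by metis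
    have "norm (?\<Theta> t - ?\<Theta> s) \<le> (norm (A0 (u \<delta>)) * B) * \<bar>t - s\<bar>" if "s \<in> {\<delta>..M}" "t \<in> {\<delta>..M}" for s t
    proof -
      have "norm (u t - u s) \<le> norm (A0 (u \<delta>)) * \<bar>t - s\<bar>"
        using evi_lipschitz[OF u less_imp_le[OF \<delta>] evi_domA[OF u \<delta>]] that by auto
      moreover have "norm ((1/2) *\<^sub>R (u t + u s)) \<le> B"
      proof -
        have "norm (u t + u s) \<le> norm (u t) + norm (u s)" by (rule norm_triangle_ineq)
        also have "\<dots> \<le> B + B" using B(2)[of t] B(2)[of s] that \<delta> by (intro add_mono) auto
        finally show ?thesis by simp
      qed
      ultimately have "norm (u t - u s) * norm ((1/2) *\<^sub>R (u t + u s)) \<le> (norm (A0 (u \<delta>)) * \<bar>t - s\<bar>) * B"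
        by (intro mult_mono) auto
      then show ?thesis unfolding diff
        using Cauchy_Schwarz_ineq2[of "u t - u s" "(1/2) *\<^sub>R (u t + u s)"] by (simp add: mult_ac)
    qed
    then show ?thesis by blast
  qed
  have d: "(\<lambda>n. (1 / ?h n) *\<^sub>R (?\<Theta> (t + ?h n) - ?\<Theta> t)) \<longlonglongrightarrow> - (A0 (u t) \<bullet> u t)" if t: "t > 0" for t
  proof -
    have 1: "(\<lambda>n. (1 / ?h n) *\<^sub>R (u (t + ?h n) - u t)) \<longlonglongrightarrow> - A0 (u t)"
      by (rule evi_right_derivative[OF u less_imp_le[OF t] evi_domA[OF u t] LIMSEQ_inverse_real_of_nat]) simp
    have "(\<lambda>n. t + ?h n) \<longlonglongrightarrow> t + 0" by (intro tendsto_add tendsto_const LIMSEQ_inverse_real_of_nat)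
    then have 2: "(\<lambda>n. u (t + ?h n)) \<longlonglongrightarrow> u t"
      using t by (intro continuous_on_tendsto_compose[OF evi_cont[OF u]]) (auto intro!: always_eventually add_nonneg_nonneg)
    have "(\<lambda>n. ((1 / ?h n) *\<^sub>R (u (t + ?h n) - u t)) \<bullet> ((1/2) *\<^sub>R (u (t + ?h n) + u t))) \<longlonglongrightarrow> (- A0 (u t)) \<bullet> ((1/2) *\<^sub>R (u t + u t))"
      by (intro tendsto_intros 1 2)
    moreover have "(1/2) *\<^sub>R (u t + u t) = u t" by (simp add: scaleR_2[symmetric])
    ultimately show ?thesis unfolding diff inner_scaleR_left by (simp only: real_scaleR_def inner_minus_left)
  qed
  note * = is_weak_deriv_right_derivative[of "{0<..}", OF open_greaterThan subset_refl lip d]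
  show "is_weak_deriv {0<..} 1 ?\<Theta> (\<lambda>t. - (A0 (u t) \<bullet> u t))" by (rule *(1))
  show "continuous_on {0<..} ?\<Theta>" by (rule *(2))
qed

lemma Lp_1_I: "set_integrable lebesgue S f \<Longrightarrow> f \<in> Lp S 1" for f :: "real \<Rightarrow> real"
  unfolding Lp_def using set_integrable_measurable[of lebesgue S f] set_integrable_norm[of lebesgue S f] by simp

text \<open>The subgradient inequality tested with 0 gives
  \<open>\<phi> (u t) \<le> \<phi> 0 + A0 (u t) \<bullet> u t\<close>, and the last term is minus
  the derivative of half the squared norm. So the integrals over \<open>(\<delta>, T)\<close> are
  bounded uniformly in \<open>\<delta>\<close>, even if the initial energy is infinite.\<close>

lemma evi_phi_Lp:
  assumes u: "evi u" and T: "0 < T"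
  shows "(\<lambda>t. \<phi> (u t)) \<in> Lp {0<..<T} 1"
proof (rule Lp_1_I)
  obtain B where B: "0 \<le> B" "\<And>t. 0 \<le> t \<Longrightarrow> t \<le> T \<Longrightarrow> norm (u t) \<le> B" using evi_bounded[OF u] by metis
  obtain r where r: "r > 0" "\<And>w. w \<in> D \<Longrightarrow> \<phi> w \<ge> \<phi> 0 - 1 - norm (w - 0) / r" using affine_lower_bound[OF zero_D] by blast
  \<comment> \<open>By the affine lower bound at 0 this makes \<open>\<phi> (u t) + c\<close>
    nonnegative up to time \<open>T\<close>; \<open>\<phi> 0 + c\<close> is nonnegative as
    well.\<close>
  define c where "c = \<bar>\<phi> 0\<bar> + 1 + B / r"
  have c: "0 \<le> \<phi> (u t) + c" if "0 < t" "t < T" for t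
  proof -
    have "norm (u t) / r \<le> B / r" using B(2)[of t] that r(1) by (intro divide_right_mono) auto
    then show ?thesis using r(2)[OF evi_D[OF u that(1)]] by (simp add: c_def)
  qed
  note w = evi_phi_weak_deriv[OF u open_greaterThan subset_refl]
  have loc: "set_integrable lebesgue {\<delta><..<T} (\<lambda>t. \<phi> (u t))" if \<delta>: "0 < \<delta>" for \<delta>
  proof -
    have "compact {\<delta>..T}" "{\<delta>..T} \<subseteq> {0<..}" using \<delta> by auto
    then have "set_integrable lebesgue {\<delta>..T} (\<lambda>t. \<phi> (u t))"
      using w(1) unfolding is_weak_deriv_def locally_integrable_def by blast
    then show ?thesis by (rule set_integrable_subset) auto
  qed
  have const: "set_integrable lebesgue {a<..<b} (\<lambda>_. k)" "a < b \<Longrightarrow> (LINT x:{a<..<b}|lebesgue. k) = (b - a) * k" for a b k :: real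
    by (auto simp: set_integrable_def set_lebesgue_integral_def lmeasurable_iff_integrable[symmetric])
  have "set_integrable lebesgue {0<..<T} (\<lambda>t. \<phi> (u t) + c)"
  proof (rule set_integrable_Ioo_exhaustion[OF T _ c])
    have "(\<lambda>t. indicator {0<..<T} t *\<^sub>R (\<phi> (u t) + c)) \<in> borel_measurable borel"
      by (rule borel_measurable_continuous_on_indicator) (auto intro!: continuous_intros continuous_on_subset[OF w(2)])
    then show "set_borel_measurable lebesgue {0<..<T} (\<lambda>t. \<phi> (u t) + c)"
      unfolding set_borel_measurable_def by (intro measurable_completion) simp
    fix \<delta> assume \<delta>: "0 < \<delta>" "\<delta> < T"
    show si: "set_integrable lebesgue {\<delta><..<T} (\<lambda>t. \<phi> (u t) + c)" by (intro set_integral_add loc const \<delta>)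
    note \<Theta> = weak_deriv_integral[OF evi_norm_weak_deriv(2)[OF u] evi_norm_weak_deriv(1)[OF u] \<delta>]
    have "(LINT t:{\<delta><..<T}|lebesgue. \<phi> (u t) + c) \<le> (LINT t:{\<delta><..<T}|lebesgue. (\<phi> 0 + c) - - (A0 (u t) \<bullet> u t))"
    proof (rule set_integral_mono[OF si set_integral_diff(1)[OF const(1) \<Theta>(1)]])
      fix t assume t: "t \<in> {\<delta><..<T}"
      then have t0: "0 < t" using \<delta> by auto
      have "\<phi> 0 \<ge> \<phi> (u t) + A0 (u t) \<bullet> (0 - u t)" by (rule subD[OF A0(2)[OF evi_domA[OF u t0]] zero_D])
      then show "\<phi> (u t) + c \<le> (\<phi> 0 + c) - - (A0 (u t) \<bullet> u t)" by simp
    qed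
    also have "\<dots> = (T - \<delta>) * (\<phi> 0 + c) - ((norm (u T))\<^sup>2 / 2 - (norm (u \<delta>))\<^sup>2 / 2)"
      unfolding set_integral_diff(2)[OF const(1) \<Theta>(1)] \<Theta>(2) const(2)[OF \<delta>(2)] ..
    also have "\<dots> \<le> T * (\<phi> 0 + c) + B\<^sup>2 / 2"
    proof -
      have "0 \<le> B / r" using B(1) r(1) by simp
      then have "0 \<le> \<phi> 0 + c" using abs_ge_minus_self[of "\<phi> 0"] by (simp add: c_def)
      then have "(T - \<delta>) * (\<phi> 0 + c) \<le> T * (\<phi> 0 + c)" using \<delta> by (intro mult_right_mono) auto
      moreover have "(norm (u \<delta>))\<^sup>2 \<le> B\<^sup>2" using B(2)[of \<delta>] \<delta> by (intro power_mono) auto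
      moreover have "0 \<le> (norm (u T))\<^sup>2" by simp
      ultimately show ?thesis by argo
    qed
    finally show "(LINT t:{\<delta><..<T}|lebesgue. \<phi> (u t) + c) \<le> T * (\<phi> 0 + c) + B\<^sup>2 / 2" .
  qed
  from set_integral_diff(1)[OF this const(1)[of 0 T c]]
  show "set_integrable lebesgue {0<..<T} (\<lambda>t. \<phi> (u t))" by simp
qed

text \<open>The energy identity: the integral over \<open>(\<delta>, T)\<close> is the energy drop
  from \<open>\<delta>\<close> to \<open>T\<close>, which is at most the drop from time 0, finite by
  assumption on \<open>u 0\<close>.\<close>

lemma evi_A0_square_integrable:
  assumes u: "evi u" and u0: "u 0 \<in> D" and T: "0 < T"
  shows "set_integrable lebesgue {0<..<T} (\<lambda>t. (norm (A0 (u t)))\<^sup>2)"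
proof (rule set_integrable_Ioo_exhaustion[OF T])
  have "set_borel_measurable lebesgue {0<..<T} (\<lambda>t. A0 (u t))"
    by (rule set_borel_measurable_subset[OF evi_time_deriv(3)[OF u]]) auto
  then have "(\<lambda>t. (norm (indicator {0<..<T} t *\<^sub>R A0 (u t)))\<^sup>2) \<in> borel_measurable lebesgue"
    unfolding set_borel_measurable_def by measurable
  moreover have "(\<lambda>t. (norm (indicator {0<..<T} t *\<^sub>R A0 (u t)))\<^sup>2) = (\<lambda>t. indicator {0<..<T} t *\<^sub>R (norm (A0 (u t)))\<^sup>2)"
    by (auto simp: fun_eq_iff indicator_def)
  ultimately show "set_borel_measurable lebesgue {0<..<T} (\<lambda>t. (norm (A0 (u t)))\<^sup>2)"
    unfolding set_borel_measurable_def by simp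
  fix \<delta> assume \<delta>: "0 < \<delta>" "\<delta> < T"
  note w = weak_deriv_integral[OF evi_phi_weak_deriv(2)[OF u open_greaterThan subset_refl] evi_phi_weak_deriv(1)[OF u open_greaterThan subset_refl] \<delta>]
  have "set_integrable lebesgue {\<delta><..<T} (\<lambda>t. - 1 * (- (norm (A0 (u t)))\<^sup>2))"
    by (intro set_integrable_mult_right w(1))
  then show i: "set_integrable lebesgue {\<delta><..<T} (\<lambda>t. (norm (A0 (u t)))\<^sup>2)" by simp
  have "(LINT t:{\<delta><..<T}|lebesgue. (norm (A0 (u t)))\<^sup>2) = - (LINT t:{\<delta><..<T}|lebesgue. - (norm (A0 (u t)))\<^sup>2)"
    by (simp add: set_lebesgue_integral_def)
  also have "\<dots> = \<phi> (u \<delta>) - \<phi> (u T)" unfolding w(2)[symmetric] by simp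
  also have "\<dots> \<le> \<phi> (u 0) - \<phi> (u T)" using evi_phi_decrease(2)[OF u order_refl _ u0, of \<delta>] \<delta> by simp
  finally show "(LINT t:{\<delta><..<T}|lebesgue. (norm (A0 (u t)))\<^sup>2) \<le> \<phi> (u 0) - \<phi> (u T)" .
qed simp

lemma evi_energy_regularity:
  assumes u: "evi u" and u0: "u 0 \<in> D" and T: "0 < T"
  shows "time_deriv u \<in> Lp {0<..<T} 2" "(\<lambda>t. \<phi> (u t)) \<in> W1p {0<..<T} 1"
proof -
  note sq = evi_A0_square_integrable[OF u u0 T]
  have ae: "AE t\<in>{0<..<T} in lebesgue. - A0 (u t) = time_deriv u t"
    using evi_time_deriv(2)[OF u] by eventually_elim auto
  have m: "set_borel_measurable lebesgue {0<..<T} (\<lambda>t. - A0 (u t))"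
  proof -
    have "set_borel_measurable lebesgue {0<..<T} (\<lambda>t. A0 (u t))"
      by (rule set_borel_measurable_subset[OF evi_time_deriv(3)[OF u]]) auto
    then show ?thesis by (simp add: set_borel_measurable_def)
  qed
  have "set_integrable lebesgue {0<..<T} (\<lambda>t. norm (time_deriv u t) powr 2)"
    by (rule set_integrable_cong_AE'[OF sq]) (use ae in \<open>eventually_elim, metis norm_minus_cancel norm_powr_2\<close>)
  then show "time_deriv u \<in> Lp {0<..<T} 2"
    unfolding Lp_def using set_borel_measurable_cong_AE[OF m ae] by blast
  have "set_integrable lebesgue {0<..<T} (\<lambda>t. - 1 * (norm (A0 (u t)))\<^sup>2)"
    by (intro set_integrable_mult_right sq)
  then have "(\<lambda>t. - (norm (A0 (u t)))\<^sup>2) \<in> Lp {0<..<T} 1" by (intro Lp_1_I) simp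
  moreover have "is_weak_deriv {0<..<T} 1 (\<lambda>t. \<phi> (u t)) (\<lambda>t. - (norm (A0 (u t)))\<^sup>2)"
    by (rule evi_phi_weak_deriv(1)[OF u]) auto
  ultimately show "(\<lambda>t. \<phi> (u t)) \<in> W1p {0<..<T} 1"
    unfolding W1p_def using evi_phi_Lp[OF u T] by auto
qed

end

theorem theorem1p2:
  fixes \<Omega> :: "(real ^ 'n) set"
    and p :: real
    and F :: "(real ^ 'n \<Rightarrow> real ^ 'm) \<Rightarrow> ereal"
    and u0 :: "(real ^ 'n, real ^ 'm) L2"
  assumes "open \<Omega>" and "connected \<Omega>" and "\<Omega> \<noteq> {}" and "bounded \<Omega>"
    and "1 < p"
    and "W0_functional \<Omega> p F"
    and "F (\<lambda>x. 0) < \<infinity>"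
    and "W0_coercive \<Omega> p F"
    and "W0_lsc \<Omega> p F"
    and "L2_W0_convex \<Omega> p F"
    and "u0 \<in> closure (dom_F \<Omega> p F)"
  shows "(\<forall>w\<in>dom_subdiff \<Omega> p F. closed (subdiff \<Omega> p F w) \<and> convex (subdiff \<Omega> p F w) \<and>
            (\<exists>!z. is_arg_min norm (\<lambda>z. z \<in> subdiff \<Omega> p F w) z)) \<and>
    (\<exists>u. is_solution \<Omega> p F u0 u \<and>
       (\<forall>v. is_solution \<Omega> p F u0 v \<longrightarrow> (\<forall>t\<ge>0. v t = u t)) \<and>
       (\<forall>T>0. (\<lambda>t. real_of_ereal (F (rep_L2 (u t)))) \<in> Lp {0<..<T} 1) \<and>
       ((\<forall>t>0. \<bar>F (rep_L2 (u t))\<bar> \<noteq> \<infinity>) \<and>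
          antimono_on {0<..} (\<lambda>t. real_of_ereal (F (rep_L2 (u t))))) \<and>
       (\<forall>\<delta>>0. Linf_norm {\<delta><..} (time_deriv u) \<le> ereal (norm (min_section \<Omega> p F (u \<delta>)))) \<and>
       (AE t\<in>{0<..} in lebesgue. - time_deriv u t = min_section \<Omega> p F (u t)) \<and>
       (u0 \<in> dom_F \<Omega> p F \<longrightarrow>
          (\<forall>T>0. time_deriv u \<in> Lp {0<..<T} 2 \<and>
             (\<lambda>t. real_of_ereal (F (rep_L2 (u t)))) \<in> W1p {0<..<T} 1)) \<and>
       (u0 \<in> dom_subdiff \<Omega> p F \<longrightarrow> time_deriv u \<in> Linf {0<..}))"
proof -
  interpret sobolev_functional \<Omega> p F
    by unfold_locales (use assms in \<open>simp_all add: less_imp_le\<close>)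
  obtain u where u: "evi u" "u 0 = u0" using evi_exists[OF assms(11)] by blast
  note sol = evi_is_solution[OF u assms(11)]
  have "is_solution \<Omega> p F u0 u \<and>
       (\<forall>v. is_solution \<Omega> p F u0 v \<longrightarrow> (\<forall>t\<ge>0. v t = u t)) \<and>
       (\<forall>T>0. (\<lambda>t. \<phi> (u t)) \<in> Lp {0<..<T} 1) \<and>
       ((\<forall>t>0. \<bar>F (rep_L2 (u t))\<bar> \<noteq> \<infinity>) \<and> antimono_on {0<..} (\<lambda>t. \<phi> (u t))) \<and>
       (\<forall>\<delta>>0. Linf_norm {\<delta><..} (time_deriv u) \<le> ereal (norm (min_section \<Omega> p F (u \<delta>)))) \<and>
       (AE t\<in>{0<..} in lebesgue. - time_deriv u t = min_section \<Omega> p F (u t)) \<and>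
       (u0 \<in> dom_F \<Omega> p F \<longrightarrow>
          (\<forall>T>0. time_deriv u \<in> Lp {0<..<T} 2 \<and> (\<lambda>t. \<phi> (u t)) \<in> W1p {0<..<T} 1)) \<and>
       (u0 \<in> dom_subdiff \<Omega> p F \<longrightarrow> time_deriv u \<in> Linf {0<..})"
  proof (intro conjI allI impI)
    show "is_solution \<Omega> p F u0 u" by (rule sol)
    show "v t = u t" if "is_solution \<Omega> p F u0 v" "0 \<le> t" for v t
      by (rule solution_unique[OF sol that])
    show "(\<lambda>t. \<phi> (u t)) \<in> Lp {0<..<T} 1" if "0 < T" for T by (rule evi_phi_Lp[OF u(1) that])
    show "\<bar>F (rep_L2 (u t))\<bar> \<noteq> \<infinity>" if "0 < t" for t using F_eq[OF evi_D[OF u(1) that]] by simp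
    show "antimono_on {0<..} (\<lambda>t. \<phi> (u t))"
      by (rule monotone_onI) (use evi_phi_decrease(2)[OF u(1)] evi_D[OF u(1)] in auto)
    show "Linf_norm {\<delta><..} (time_deriv u) \<le> ereal (norm (min_section \<Omega> p F (u \<delta>)))" if "0 < \<delta>" for \<delta>
      using evi_Linf(1)[OF u(1) less_imp_le[OF that] evi_domA[OF u(1) that]] min_section_eq[OF evi_domA[OF u(1) that]] by simp
    show "AE t\<in>{0<..} in lebesgue. - time_deriv u t = min_section \<Omega> p F (u t)"
      using evi_time_deriv(2)[OF u(1)]
    proof eventually_elim
      case (elim t)
      show ?case
      proof
        assume t: "t \<in> {0<..}"
        then have "- time_deriv u t = A0 (u t)" using elim by (metis minus_minus)
        then show "- time_deriv u t = min_section \<Omega> p F (u t)"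
          using min_section_eq[OF evi_domA[OF u(1), of t]] t by simp
      qed
    qed
    show "time_deriv u \<in> Lp {0<..<T} 2" "(\<lambda>t. \<phi> (u t)) \<in> W1p {0<..<T} 1" if "u0 \<in> dom_F \<Omega> p F" "0 < T" for T
      using evi_energy_regularity[OF u(1) _ that(2)] that(1) u(2) by auto
    show "time_deriv u \<in> Linf {0<..}" if "u0 \<in> dom_subdiff \<Omega> p F"
      using evi_Linf(2)[OF u(1) order_refl] that u(2) by (simp add: dom_subdiff_eq)
  qed
  then show ?thesis unfolding \<phi>_def by (intro conjI ballI subdiff_properties) (assumption+, rule exI)
qed

end
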